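(* Let $\mathcal{F}:\mathcal{P}(\mathbb{R}^d)\to\mathbb{R}$ be an energy functional with smooth first variation, and suppose there is a constant $C_{\mathcal{F}}>0$ such that for any two push-forward maps $T,\widetilde T:\mathbb{R}^d\to\mathbb{R}^d$, $$\int \left|\nabla_X \frac{\delta}{\delta\rho}\mathcal{F}(T_{\sharp}\varrho(\cdot),\cdot)\circ T(z)-\nabla_X \frac{\delta}{\delta\rho}\mathcal{F}(\widetilde T_{\sharp}\varrho(\cdot),\cdot)\circ \widetilde T(z)\right|^2 d\lambda(z)\le C_{\mathcal{F}}\int |T(z)-\widetilde T(z)|^2\,d\lambda(z).$$ Let $\theta(t)$ be the solution of the parameterized Wasserstein gradient flow $$\dot\theta=-\widehat G(\theta)^{\dagger}\nabla_\theta F(\theta)$$ with initial value $\theta(0)$, and let $\rho(t,\cdot)$ be the solution of the Wasserstein gradient flow $$\frac{\partial\rho}{\partial t}=-\mathrm{grad}_W\mathcal{F}(\rho)=\nabla\cdot\Big(\rho\,\nabla\frac{\delta\mathcal{F}}{\delta\rho}\Big),\qquad \rho(0,\cdot)=\rho_0 .$$ Then the Wasserstein-2 distance between $\rho_{\theta(t)}=T_{\theta(t)\sharp}\varrho$ and $\rho(t,\cdot)$ satisfies $$W_2^2(\rho_{\theta(t)}(\cdot),\rho(t,\cdot))\le e^{(1+2C_{\mathcal{F}})t}\,\epsilon_{\rho(0)}+\frac{2\delta_0}{1+2C_{\mathcal{F}}}\left(e^{(1+2C_{\mathcal{F}})t}-1\right),$$ where $\epsilon_{\rho(0)}=W_2^2(\rho_{\theta(0)},\rho_0)$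 is the initial approximation error and $\delta_0$ is the projection error.
   Context: Throughout the state space is $\mathbb{R}^d$, and $\mathcal{P}(\mathbb{R}^d)$ is the set of probability densities $\rho$ on $\mathbb{R}^d$ with $\int |x|^2\rho(x)\,dx<\infty$. The Wasserstein-2 distance is $W_2(\rho_1,\rho_2)=\big(\inf_{\pi\in\Pi(\rho_1,\rho_2)}\iint|x-y|^2\,d\pi(x,y)\big)^{1/2}$, where $\Pi(\rho_1,\rho_2)$ is the set of couplings with marginals $\rho_1,\rho_2$. For a smooth functional $\mathcal{F}$ on $\mathcal{P}(\mathbb{R}^d)$, $\frac{\delta}{\delta\rho}\mathcal{F}(\rho,x)$ denotes its first variation (in the $L^2$ sense) at $\rho$ evaluated at the point $x$, and $\nabla_X$ (also written $\nabla$) is the gradient in $x$. The expression $\nabla_X\frac{\delta}{\delta\rho}\mathcal{F}(T_\sharp\varrho(\cdot),\cdot)\circ T(z)$ means the $x$-gradient of the first variation at the density $T_\sharp\varrho$, evaluated at $x=T(z)$. The Wasserstein gradient flow is associated with the particle dynamics $\dot{\boldsymbol X}=-\nabla_X\frac{\delta}{\delta\rho}\mathcal{F}(\rho,\boldsymbol X)$, $\rho(t,\cdot)$ being the density of $\boldsymbol X(t)$: the density of a solution of this dynamics solves the flow. Reference measure: $\lambda$ is a fixed probability measure on $\mathbb{R}^d$, absolutely continuous with respect to Lebesgue measure, with density $\varrho$. A push-forward map is a map $T:\mathbb{R}^d\to\mathbb{R}^d$ inducing the density $T_\sharp\varrho$ given by $\int_E T_\sharp\varrho\,dx=\lambda(T^{-1}(E))$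 for measurable $E$. Parameterization: $\Theta\subset\mathbb{R}^n$ is the parameter space; for each $\theta\in\Theta$, $T_\theta:\mathbb{R}^d\to\mathbb{R}^d$ is a push-forward map, with $(\theta,z)\mapsto T_\theta(z)$ of class $C^1$; $\rho_\theta=T_{\theta\sharp}\varrho\in\mathcal{P}(\mathbb{R}^d)$; $\partial_\theta T_\theta(z)\in\mathbb{R}^{d\times n}$ is the Jacobian in $\theta$. Define $$\widehat G(\theta)=\int\partial_\theta T_\theta(z)^\top\partial_\theta T_\theta(z)\,d\lambda(z)\in\mathbb{R}^{n\times n},$$ with Moore–Penrose pseudoinverse $\widehat G(\theta)^\dagger$, and $F(\theta)=\mathcal{F}(\rho_\theta)$, whose gradient is given by $$\nabla_\theta F(\theta)=\int\partial_\theta T_\theta(z)^\top\,\nabla_X\frac{\delta}{\delta\rho}\mathcal{F}(T_{\theta\sharp}\varrho(\cdot),\cdot)\circ T_\theta(z)\,d\lambda(z).$$ Projection error (here the cotangent space of $\Theta$ at $\theta$ is identified with $\mathbb{R}^n$): $$\delta_0=\sup_{\theta\in\Theta}\min_{\xi\in\mathbb{R}^n}\int\left|\nabla\frac{\delta}{\delta\rho}\mathcal{F}(T_{\theta\sharp}\varrho(\cdot),\cdot)\circ T_\theta(z)-\partial_\theta T_\theta(z)\,\xi\right|^2d\lambda(z).$$ *)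

theory Defs
  imports "HOL-Probability.Probability"
begin

(* Elements of P(R^d) are encoded as the measures rho(x) dx, so that densities agreeing
   almost everywhere are identified; the push-forward density of T is then the measure
   "distr lam borel T". *)
definition prob_densities :: "(real^'d) measure set" where
  "prob_densities = {density lborel (\<lambda>x. ennreal (r x)) | r.
     r \<in> borel_measurable borel \<and> (\<forall>x. 0 \<le> r x) \<and>
     (\<integral>\<^sup>+x. ennreal (r x) \<partial>lborel) = 1 \<and>
     (\<integral>\<^sup>+x. ennreal ((norm x)\<^sup>2 * r x) \<partial>lborel) < \<infinity>}"

definition couplings ::
  "(real^'d) measure \<Rightarrow> (real^'d) measure \<Rightarrow> ((real^'d) \<times> (real^'d)) measure set" where
  "couplings \<mu> \<nu> = {\<pi>. sets \<pi> = sets borel \<and> distr \<pi> borel fst = \<mu> \<and> distr \<pi> borel snd = \<nu>}"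

(* The infimum is finite on prob_densities, where the conversion to real loses nothing. *)
definition W2 :: "(real^'d) measure \<Rightarrow> (real^'d) measure \<Rightarrow> real" where
  "W2 \<mu> \<nu> = sqrt (enn2real (INF \<pi>\<in>couplings \<mu> \<nu>. \<integral>\<^sup>+p. ennreal ((norm (fst p - snd p))\<^sup>2) \<partial>\<pi>))"

definition push_forward_map :: "(real^'d) measure \<Rightarrow> (real^'d \<Rightarrow> real^'d) \<Rightarrow> bool" where
  "push_forward_map lam T \<longleftrightarrow> T \<in> lam \<rightarrow>\<^sub>M borel \<and> distr lam borel T \<in> prob_densities"

definition nabla :: "(real^'d \<Rightarrow> real) \<Rightarrow> real^'d \<Rightarrow> real^'d" where
  "nabla f x = (THE g. GDERIV f x :> g)"

definition C1 :: "(real^'d \<Rightarrow> real) \<Rightarrow> bool" where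
  "C1 f \<longleftrightarrow> (\<forall>x. f differentiable (at x)) \<and> continuous_on UNIV (nabla f)"

(* U rho is the L^2 first variation of F at rho: the derivative of F(rho + e h) at e = 0 is
   the L^2 pairing of U rho with h, for compactly supported square-integrable h. The derivative
   is taken along those e for which rho + e h is still in P(R^d), so it is one-sided where
   rho vanishes, and nothing is required of directions h that leave P(R^d) at once. *)
definition first_variation ::
  "((real^'d) measure \<Rightarrow> real) \<Rightarrow> ((real^'d) measure \<Rightarrow> real^'d \<Rightarrow> real) \<Rightarrow> bool" where
  "first_variation F U \<longleftrightarrow>
    (\<forall>r h. r \<in> borel_measurable borel \<and> (\<forall>x. 0 \<le> r x) \<and>
        density lborel (\<lambda>x. ennreal (r x)) \<in> prob_densities \<and>
        h \<in> borel_measurable borel \<and> bounded {x. h x \<noteq> 0} \<and> integrable lborel (\<lambda>x. (h x)\<^sup>2) \<longrightarrow>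
      ((\<lambda>e. F (density lborel (\<lambda>x. ennreal (r x + e * h x))))
        has_real_derivative (\<integral>x. U (density lborel (\<lambda>x. ennreal (r x))) x * h x \<partial>lborel))
       (at 0 within {e. (AE x in lborel. 0 \<le> r x + e * h x) \<and>
                        density lborel (\<lambda>x. ennreal (r x + e * h x)) \<in> prob_densities}))"

(* (theta, z) |-> T theta z is C^1 on Theta x R^d, with J the Jacobian in theta. *)
definition C1_family ::
  "(real^'n) set \<Rightarrow> (real^'n \<Rightarrow> real^'d \<Rightarrow> real^'d) \<Rightarrow> (real^'n \<Rightarrow> real^'d \<Rightarrow> real^'n^'d) \<Rightarrow> bool" where
  "C1_family Theta T J \<longleftrightarrow> (\<exists>K :: real^'n \<Rightarrow> real^'d \<Rightarrow> real^'d^'d.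
     (\<forall>\<theta>\<in>Theta. \<forall>z. ((\<lambda>(\<eta>, y). T \<eta> y) has_derivative (\<lambda>(h, k). J \<theta> z *v h + K \<theta> z *v k))
        (at (\<theta>, z) within Theta \<times> UNIV)) \<and>
     continuous_on (Theta \<times> UNIV) (\<lambda>(\<theta>, z). J \<theta> z) \<and>
     continuous_on (Theta \<times> UNIV) (\<lambda>(\<theta>, z). K \<theta> z))"

definition pseudoinverse :: "real^'n^'m \<Rightarrow> real^'m^'n" where
  "pseudoinverse A = (THE B. A ** B ** A = A \<and> B ** A ** B = B \<and>
     transpose (A ** B) = A ** B \<and> transpose (B ** A) = B ** A)"

definition Ghat ::
  "(real^'d) measure \<Rightarrow> (real^'n \<Rightarrow> real^'d \<Rightarrow> real^'n^'d) \<Rightarrow> real^'n \<Rightarrow> real^'n^'n" where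
  "Ghat lam J \<theta> = (\<integral>z. transpose (J \<theta> z) ** J \<theta> z \<partial>lam)"

(* The minimum over xi is written as an infimum, which is attained (projection onto a
   finite-dimensional subspace). The value may be infinite. *)
definition projection_error ::
  "(real^'d) measure \<Rightarrow> ((real^'d) measure \<Rightarrow> real^'d \<Rightarrow> real) \<Rightarrow> (real^'n) set \<Rightarrow>
   (real^'n \<Rightarrow> real^'d \<Rightarrow> real^'d) \<Rightarrow> (real^'n \<Rightarrow> real^'d \<Rightarrow> real^'n^'d) \<Rightarrow> ennreal" where
  "projection_error lam U Theta T J =
    (SUP \<theta>\<in>Theta. INF \<xi>. \<integral>\<^sup>+z. ennreal
       ((norm (nabla (U (distr lam borel (T \<theta>))) (T \<theta> z) - J \<theta> z *v \<xi>))\<^sup>2) \<partial>lam)"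

(* Weak (distributional) solution on [0, tau] of d/dt rho = div (rho grad (U rho)),
   rho(0) = rho0: a W2-continuous curve in P(R^d) satisfying the equation tested against
   compactly supported C^1 functions; the sign comes from the integration by parts in x. *)
definition wasserstein_gradient_flow ::
  "((real^'d) measure \<Rightarrow> real^'d \<Rightarrow> real) \<Rightarrow> real \<Rightarrow> (real^'d) measure \<Rightarrow>
   (real \<Rightarrow> (real^'d) measure) \<Rightarrow> bool" where
  "wasserstein_gradient_flow U \<tau> \<rho>0 \<rho> \<longleftrightarrow>
     \<rho> 0 = \<rho>0 \<and>
     (\<forall>t\<in>{0..\<tau>}. \<rho> t \<in> prob_densities) \<and>
     (\<forall>t\<in>{0..\<tau>}. ((\<lambda>s. W2 (\<rho> s) (\<rho> t)) \<longlongrightarrow> 0) (at t within {0..\<tau>})) \<and>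
     (\<forall>\<phi>. C1 \<phi> \<and> bounded {x. \<phi> x \<noteq> 0} \<longrightarrow>
       (\<forall>t\<in>{0..\<tau>}. ((\<lambda>s. \<integral>x. \<phi> x \<partial>\<rho> s) has_real_derivative
          - (\<integral>x. nabla \<phi> x \<bullet> nabla (U (\<rho> t)) x \<partial>\<rho> t)) (at t within {0..\<tau>})))"

end

theory Submission
  imports Defs
begin

text \<open>
  Let \<open>e(t)\<close> be the squared distance in \<open>L\<^sup>2(lam)\<close> between \<open>T (\<theta> t)\<close> and a map \<open>X t\<close> that
  pushes \<open>lam\<close> forward to \<open>\<rho> t\<close>. Two maps on the reference space form a coupling, so
  \<open>W2\<^sup>2 \<le> e(t)\<close>. If \<open>X t\<close> moves along the velocity \<open>v (\<rho> t) = - \<nabla> (U (\<rho> t))\<close>, the time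
  derivative of \<open>T (\<theta> t) - X t\<close> is the difference of two terms. The first is what remains
  of the gradient of the first variation along \<open>T (\<theta> t)\<close> after subtracting its least-squares
  approximation by the columns of \<open>J\<close>: the pseudoinverse in the parameterized flow solves the
  normal equations, so the squared norm of this residual is at most \<open>\<delta>\<close>, the projection error
  (\<open>least_squares_residual\<close>, \<open>parameterized_velocity_residual\<close>). The second is the
  difference of the gradients along the two maps, bounded by \<open>C e\<close> by hypothesis. Hence the
  derivative has squared norm at most \<open>2 C e + 2 \<delta>\<close>, and \<open>2 a b \<le> a\<^sup>2 + b\<^sup>2\<close> gives
  \<open>e' \<le> (1 + 2 C) e + 2 \<delta>\<close>. Gronwall's inequality, with \<open>X 0\<close> chosen almost optimal for the
  initial measures, is the claim. Three points of this outline need work.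

  A weak solution is given as a curve of measures, and trajectories have to be found for it. The
  hypothesis on \<open>C\<close> compares gradients along maps only in mean, but comparing a map with the
  same map after an exchange of two small sets shows that \<open>v \<mu>\<close> is Lipschitz with constant
  \<open>sqrt C\<close> on the support of \<open>\<mu>\<close> (\<open>v_lipschitz_on_support\<close>). The
  McShane extension gives a field on the whole space that is Lipschitz in space and Borel in time
  and space, with a flow by Picard iteration. That this flow transports \<open>\<rho> 0\<close> to \<open>\<rho> t\<close>
  (\<open>lagrangian_representation\<close>) is shown by testing: Euler steps along mollified time averages
  of the field are close to the flow, and pulling a test function back by such a step changes its
  integral as the weak equation predicts, up to an error of smaller order than the step
  (\<open>averaged_field\<close>, \<open>transport_one_step\<close>, \<open>flow_pushforward_test\<close>).

  The distance \<open>W2\<close> is an infimum over couplings, while the argument runs with maps defined on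
  one reference space. As \<open>lam\<close> charges no hyperplane, quantile transport
  realises every law on a Euclidean space as an image of \<open>lam\<close>, and if it also respects the cells
  of a fine partition it replaces a coupling by maps at an arbitrarily small additional cost
  (\<open>transport_map_with_labels\<close>, \<open>near_optimal_map\<close>).

  Finally, the bound on the derivative at a given time is in terms of \<open>e\<close> at that time, and \<open>e\<close>
  is only known to be finite and lower semicontinuous. By a Baire category argument it is bounded
  (\<open>locally_bounded_everywhere\<close>), after which a discrete version of Gronwall's inequality
  applies (\<open>square_integrable_curve\<close>).
\<close>

section \<open>The Moore--Penrose pseudoinverse of a symmetric matrix\<close>

text \<open>
  Penrose's argument: both candidates give the same products \<open>A ** B\<close> and \<open>B ** A\<close>, and
  \<open>B\<close> is recovered from these as \<open>B ** A ** B\<close>.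
\<close>
lemma pseudoinverse_unique:
  fixes A :: "real^'n^'m" and B B' :: "real^'m^'n"
  assumes "A ** B ** A = A" "B ** A ** B = B" "transpose (A ** B) = A ** B" "transpose (B ** A) = B ** A"
    and "A ** B' ** A = A" "B' ** A ** B' = B'" "transpose (A ** B') = A ** B'" "transpose (B' ** A) = B' ** A"
  shows "B = B'"
proof -
  have ab: "A ** B = A ** B'"
  proof -
    have "A ** B = transpose (A ** B' ** A ** B)"
      using assms(3,5) by simp
    also have "\<dots> = transpose ((A ** B') ** (A ** B))" by (simp add: matrix_mul_assoc)
    also have "\<dots> = (A ** B) ** (A ** B')"
      using assms(3,7) by (simp add: matrix_transpose_mul)
    also have "\<dots> = A ** B'" using assms(1) by (simp add: matrix_mul_assoc)
    finally show ?thesis .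
  qed
  have ba: "B ** A = B' ** A"
  proof -
    have "B ** A = transpose (B ** (A ** B' ** A))"
      using assms(4,5) by simp
    also have "\<dots> = transpose ((B ** A) ** (B' ** A))" by (simp add: matrix_mul_assoc)
    also have "\<dots> = (B' ** A) ** (B ** A)"
      using assms(4,8) by (simp add: matrix_transpose_mul)
    also have "\<dots> = B' ** (A ** B ** A)" by (simp add: matrix_mul_assoc)
    also have "\<dots> = B' ** A" using assms(1) by simp
    finally show ?thesis .
  qed
  have "B = (B ** A) ** B" using assms(2) by simp
  also have "\<dots> = B' ** (A ** B)" by (simp add: ba matrix_mul_assoc)
  also have "\<dots> = B' ** A ** B'" by (simp add: ab matrix_mul_assoc)
  finally show ?thesis using assms(6) by simp
qed

lemma matrix_diff_ldistrib: "A ** (B - C) = A ** B - A ** (C :: real^'k^'n)" for A :: "real^'n^'m"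
  by (vector matrix_matrix_mult_def sum_subtractf algebra_simps)

lemma matrix_diff_rdistrib: "(A - B) ** C = A ** C - B ** (C :: real^'k^'n)" for A :: "real^'n^'m"
  by (vector matrix_matrix_mult_def sum_subtractf algebra_simps)

lemma matrix_add_rdistrib': "(A + B) ** C = A ** C + B ** (C :: real^'k^'n)" for A :: "real^'n^'m"
  by (vector matrix_matrix_mult_def sum.distrib algebra_simps)

lemma transpose_diff: "transpose (A - B) = transpose A - transpose B" for A :: "real^'n^'m"
  by (vector transpose_def)

text \<open>
  The definite description in \<open>pseudoinverse\<close> needs a witness. A symmetric \<open>G\<close> maps the
  orthogonal complement of its kernel into itself, so adding the orthogonal projection \<open>P\<close> onto
  the kernel makes it invertible; the inverse of \<open>G + P\<close> minus \<open>P\<close> satisfies Penrose's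
  conditions.
\<close>
lemma pseudoinverse_symmetric:
  fixes G :: "real^'n^'n"
  assumes sym: "transpose G = G"
  shows "G ** pseudoinverse G ** G = G"
proof -
  define K where "K = {x. G *v x = 0}"
  have sub: "subspace K"
    unfolding K_def by (rule linear_subspace_kernel) (simp add: matrix_vector_mul_linear)
  obtain S where S: "S \<subseteq> K" "pairwise orthogonal S" "\<And>x. x \<in> S \<Longrightarrow> norm x = 1"
      "independent S" "span S = K"
    using orthonormal_basis_subspace[OF sub] by metis
  have finS: "finite S" using S(4) independent_bound_general by blast
  define p where "p x = (\<Sum>b\<in>S. (b \<bullet> x) *\<^sub>R b)" for x
  have linp: "linear p"
    unfolding p_def
    by (intro linearI)
       (simp_all add: inner_add_right scaleR_add_left sum.distrib scaleR_sum_right)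
  define P where "P = matrix p"
  have Pv: "P *v x = p x" for x unfolding P_def using linp by (simp add: matrix_works)
  have pK: "p x \<in> K" for x
    unfolding p_def using S sub by (intro subspace_sum) (auto intro: subspace_scale)
  have psym: "p x \<bullet> y = x \<bullet> p y" for x y
    unfolding p_def inner_sum_left inner_sum_right
    by (intro sum.cong) (auto simp: inner_commute)
  have pS: "p b = b" if b: "b \<in> S" for b
  proof -
    have "p b = (\<Sum>c\<in>S. if c = b then b else 0)"
      unfolding p_def
    proof (intro sum.cong refl)
      fix c assume c: "c \<in> S"
      show "(c \<bullet> b) *\<^sub>R c = (if c = b then b else 0)"
      proof (cases "c = b")
        case True
        have "b \<bullet> b = 1" using S(3)[OF b] by (simp add: norm_eq_1)
        then show ?thesis using True by simp
      next
        case False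
        then have "c \<bullet> b = 0" using S(2) b c by (auto simp: pairwise_def orthogonal_def)
        then show ?thesis using False by simp
      qed
    qed
    then show ?thesis using finS b by simp
  qed
  have pid: "p x = x" if "x \<in> K" for x
  proof -
    have "x \<in> span S" using that S by simp
    then show ?thesis
      by (induction rule: span_induct_alt)
         (auto simp: linear_0[OF linp] linear_add[OF linp] linear_scale[OF linp] pS)
  qed
  have Gsym: "(G *v x) \<bullet> y = x \<bullet> (G *v y)" for x y
    using dot_lmul_matrix[of x G y] sym by (metis transpose_matrix_vector)
  have PT: "transpose P = P"
  proof -
    have "transpose P *v x = P *v x" for x
    proof -
      have "(transpose P *v x) \<bullet> y = (P *v x) \<bullet> y" for y
        using psym[of x y] Pv dot_lmul_matrix[of x P y] by simp
      then show ?thesis by (metis vector_eq_rdot)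
    qed
    then show ?thesis by (simp add: matrix_eq)
  qed
  have GP: "G ** P = 0"
    using pK by (simp add: matrix_eq Pv K_def flip: matrix_vector_mul_assoc)
  have PG: "P ** G = 0"
  proof -
    have "P ** G = transpose (G ** P)" using sym PT by (simp add: matrix_transpose_mul)
    then show ?thesis using GP by (simp add: transpose_def vec_eq_iff)
  qed
  have PP: "P ** P = P"
    using pK pid by (simp add: matrix_eq Pv flip: matrix_vector_mul_assoc)
  define H where "H = G + P"
  have "x = 0" if "H *v x = 0" for x
  proof -
    have 1: "G *v x = - p x"
      using that by (simp add: H_def matrix_vector_mult_add_rdistrib Pv eq_neg_iff_add_eq_0)
    have "(G *v x) \<bullet> p x = 0"
      using Gsym[of x "p x"] pK[of x] by (simp add: K_def)
    then have "p x = 0" using 1 by simp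
    then have "x \<in> K" using 1 by (simp add: K_def)
    then show ?thesis using pid \<open>p x = 0\<close> by simp
  qed
  then obtain Hi where Hi: "Hi ** H = mat 1"
    using matrix_left_invertible_ker by blast
  then have Hi': "H ** Hi = mat 1" using matrix_left_right_inverse by blast
  have HP: "H ** P = P" "P ** H = P"
    by (simp_all add: H_def matrix_add_ldistrib matrix_add_rdistrib' GP PG PP)
  have HiP: "Hi ** P = P" "P ** Hi = P"
    using HP Hi Hi' by (metis matrix_mul_assoc matrix_mul_lid, metis matrix_mul_assoc matrix_mul_rid)
  define B where "B = Hi - P"
  have GB: "G ** B = mat 1 - P" "B ** G = mat 1 - P"
  proof -
    have G: "G = H - P" by (simp add: H_def)
    show "G ** B = mat 1 - P"
      unfolding B_def by (subst G) (simp add: matrix_diff_ldistrib matrix_diff_rdistrib Hi' HP HiP PP)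
    show "B ** G = mat 1 - P"
      unfolding B_def by (subst G) (simp add: matrix_diff_ldistrib matrix_diff_rdistrib Hi HP HiP PP)
  qed
  have mp: "G ** B ** G = G \<and> B ** G ** B = B \<and> transpose (G ** B) = G ** B \<and> transpose (B ** G) = B ** G"
    unfolding GB
    by (auto simp: B_def matrix_diff_ldistrib matrix_diff_rdistrib PG HiP PP transpose_mat PT
        transpose_diff)
  have "pseudoinverse G = B"
    unfolding pseudoinverse_def by (rule the_equality) (use mp pseudoinverse_unique in blast)+
  then show ?thesis using mp by simp
qed

text \<open>
  The hypothesis on \<open>b\<close> says that it is orthogonal to the kernel of \<open>G\<close>, that is, that it
  lies in the range of \<open>G\<close>.
\<close>
lemma pseudoinverse_solves:
  fixes G :: "real^'n^'n"
  assumes sym: "transpose G = G" and b: "\<And>x. G *v x = 0 \<Longrightarrow> b \<bullet> x = 0"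
  shows "G *v (pseudoinverse G *v b) = b"
proof -
  let ?B = "pseudoinverse G"
  note mp = pseudoinverse_symmetric[OF sym]
  define c where "c = transpose ?B *v b"
  have Gsym: "(G *v x) \<bullet> y = x \<bullet> (G *v y)" for x y
    using dot_lmul_matrix[of x G y] sym by (metis transpose_matrix_vector)
  have "b = G *v c"
  proof -
    have "b \<bullet> w = (G *v c) \<bullet> w" for w
    proof -
      have "G *v (w - ?B *v (G *v w)) = 0"
        using mp by (simp add: matrix_vector_mult_diff_distrib matrix_vector_mul_assoc matrix_mul_assoc)
      then have "b \<bullet> w = b \<bullet> (?B *v (G *v w))"
        using b by (force simp: inner_diff_right)
      also have "\<dots> = c \<bullet> (G *v w)"
        unfolding c_def by (metis dot_lmul_matrix transpose_matrix_vector)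
      finally show ?thesis using Gsym by simp
    qed
    then show ?thesis by (metis vector_eq_rdot)
  qed
  then show ?thesis using mp by (simp add: matrix_vector_mul_assoc matrix_mul_assoc)
qed

section \<open>Elementary inequalities\<close>

lemma young_sq:
  fixes a b c :: real
  assumes "0 < c" shows "(a + b)\<^sup>2 \<le> (1 + c) * a\<^sup>2 + (1 + 1/c) * b\<^sup>2"
proof -
  have "0 \<le> (c * a - b)\<^sup>2 / c" using assms by simp
  also have "\<dots> = c * a\<^sup>2 + b\<^sup>2 / c - 2 * a * b"
    using assms by (simp add: power2_eq_square field_simps)
  finally show ?thesis by (simp add: power2_sum algebra_simps)
qed

lemma norm_add_sq_le: "(norm (x + y))\<^sup>2 \<le> 2 * (norm x)\<^sup>2 + 2 * (norm y)\<^sup>2"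
proof -
  have "(norm (x + y))\<^sup>2 \<le> (norm x + norm y)\<^sup>2" by (intro power_mono norm_triangle_ineq) auto
  also have "\<dots> \<le> 2 * (norm x)\<^sup>2 + 2 * (norm y)\<^sup>2" using young_sq[of 1 "norm x" "norm y"] by simp
  finally show ?thesis .
qed

section \<open>Least squares\<close>

text \<open>
  The normal equations \<open>G *v \<eta> = b\<close> are solvable: if \<open>G *v x = 0\<close> then \<open>J z *v x\<close>
  vanishes almost everywhere, so \<open>b \<bullet> x = 0\<close>. The residual at their solution is orthogonal to
  all \<open>J z *v x\<close>, and Pythagoras' theorem compares it with the residual at \<open>\<xi>\<close>. A finite
  error at the one vector \<open>\<xi>\<^sub>0\<close> makes \<open>v\<close> square-integrable, since the columns of \<open>J\<close> are.
\<close>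
lemma least_squares_residual:
  fixes J :: "'a \<Rightarrow> real^'n^'d" and v :: "'a \<Rightarrow> real^'d"
  assumes J[measurable]: "J \<in> borel_measurable M" and v[measurable]: "v \<in> borel_measurable M"
    and GI: "integrable M (\<lambda>z. transpose (J z) ** J z)"
    and fin: "(\<integral>\<^sup>+z. ennreal ((norm (v z - J z *v \<xi>\<^sub>0))\<^sup>2) \<partial>M) < \<infinity>"
  defines "G \<equiv> (\<integral>z. transpose (J z) ** J z \<partial>M)"
    and "b \<equiv> (\<integral>z. transpose (J z) *v v z \<partial>M)"
  shows "(\<integral>\<^sup>+z. ennreal ((norm (v z - J z *v (pseudoinverse G *v b)))\<^sup>2) \<partial>M)
      \<le> (\<integral>\<^sup>+z. ennreal ((norm (v z - J z *v \<xi>))\<^sup>2) \<partial>M)"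
proof -
  have Jm[measurable]: "(\<lambda>z. J z *v x) \<in> borel_measurable M" for x
    by (intro borel_measurable_continuous_on[OF _ J]
          linear_continuous_on linear_conv_bounded_linear[THEN iffD1])
       (auto intro!: linearI simp: matrix_vector_mult_add_rdistrib scaleR_matrix_vector_assoc)
  have bl: "bounded_linear (\<lambda>A. x \<bullet> (A *v y))" for x y :: "real^'n"
    by (intro linear_conv_bounded_linear[THEN iffD1])
       (auto intro!: linearI simp: matrix_vector_mult_add_rdistrib inner_add_right
             simp flip: scaleR_matrix_vector_assoc)
  have JJ: "(J z *v x) \<bullet> (J z *v y) = x \<bullet> ((transpose (J z) ** J z) *v y)" for x y z
    by (simp flip: matrix_vector_mul_assoc add: dot_lmul_matrix)
       (metis dot_lmul_matrix transpose_matrix_vector transpose_transpose)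
  have intJJ: "integrable M (\<lambda>z. (J z *v x) \<bullet> (J z *v y))" for x y
    unfolding JJ by (rule integrable_bounded_linear[OF bl GI])
  have intG: "(\<integral>z. (J z *v x) \<bullet> (J z *v y) \<partial>M) = x \<bullet> (G *v y)" for x y
    unfolding JJ G_def by (rule integral_bounded_linear[OF bl GI])
  have intJ2: "integrable M (\<lambda>z. (norm (J z *v x))\<^sup>2)" for x
    using intJJ[of x x] by (simp add: power2_norm_eq_inner)
  have int0: "integrable M (\<lambda>z. (norm (v z - J z *v \<xi>\<^sub>0))\<^sup>2)"
    by (rule integrableI_bounded) (use fin in auto)
  have intv: "integrable M (\<lambda>z. (norm (v z - J z *v x))\<^sup>2)" for x
  proof (rule Bochner_Integration.integrable_bound)
    show "integrable M (\<lambda>z. 2 * (norm (v z - J z *v \<xi>\<^sub>0))\<^sup>2 + 2 * (norm (J z *v (\<xi>\<^sub>0 - x)))\<^sup>2)"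
      using int0 intJ2 by auto
    show "AE z in M. norm ((norm (v z - J z *v x))\<^sup>2)
        \<le> norm (2 * (norm (v z - J z *v \<xi>\<^sub>0))\<^sup>2 + 2 * (norm (J z *v (\<xi>\<^sub>0 - x)))\<^sup>2)"
    proof (intro AE_I2)
      fix z
      let ?p = "v z - J z *v \<xi>\<^sub>0" and ?q = "J z *v (\<xi>\<^sub>0 - x)"
      have e: "v z - J z *v x = ?p + ?q" by (simp add: matrix_vector_mult_diff_distrib)
      show "norm ((norm (v z - J z *v x))\<^sup>2) \<le> norm (2 * (norm ?p)\<^sup>2 + 2 * (norm ?q)\<^sup>2)"
        unfolding e using norm_add_sq_le[of ?p ?q] by simp
    qed
  qed measurable
  have intv2: "integrable M (\<lambda>z. (norm (v z))\<^sup>2)" using intv[of 0] by simp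
  have intvJ: "integrable M (\<lambda>z. v z \<bullet> (J z *v x))" for x
  proof (rule Bochner_Integration.integrable_bound)
    show "integrable M (\<lambda>z. (norm (v z))\<^sup>2 + (norm (J z *v x))\<^sup>2)" using intv2 intJ2 by auto
    show "AE z in M. norm (v z \<bullet> (J z *v x)) \<le> norm ((norm (v z))\<^sup>2 + (norm (J z *v x))\<^sup>2)"
    proof (intro AE_I2)
      fix z
      have "norm (v z \<bullet> (J z *v x)) \<le> norm (v z) * norm (J z *v x)"
        using Cauchy_Schwarz_ineq2 by simp
      also have "\<dots> \<le> (norm (v z))\<^sup>2 + (norm (J z *v x))\<^sup>2"
        using sum_squares_bound[of "norm (v z)" "norm (J z *v x)"]
          mult_nonneg_nonneg[OF norm_ge_zero norm_ge_zero, of "v z" "J z *v x"] by linarith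
      finally show "norm (v z \<bullet> (J z *v x)) \<le> norm ((norm (v z))\<^sup>2 + (norm (J z *v x))\<^sup>2)" by simp
    qed
  qed measurable
  have JT: "(transpose (J z) *v v z) \<bullet> x = v z \<bullet> (J z *v x)" for z x
    by (metis dot_lmul_matrix transpose_matrix_vector)
  have intb: "integrable M (\<lambda>z. transpose (J z) *v v z)"
  proof (rule Bochner_Integration.integrable_bound)
    show "integrable M (\<lambda>z. \<Sum>k\<in>UNIV. \<bar>v z \<bullet> (J z *v axis k 1)\<bar>)"
      using intvJ by auto
    have "(\<lambda>z. (transpose (J z) *v v z) \<bullet> i) \<in> borel_measurable M" for i
      by (subst JT) measurable
    then show "(\<lambda>z. transpose (J z) *v v z) \<in> borel_measurable M"
      using borel_measurable_euclidean_space by blast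
    show "AE z in M. norm (transpose (J z) *v v z) \<le> norm (\<Sum>k\<in>UNIV. \<bar>v z \<bullet> (J z *v axis k 1)\<bar>)"
    proof (intro AE_I2)
      fix z
      have "norm (transpose (J z) *v v z) \<le> (\<Sum>k\<in>UNIV. \<bar>(transpose (J z) *v v z) $ k\<bar>)"
        by (rule norm_le_l1_cart)
      also have "\<dots> = (\<Sum>k\<in>UNIV. \<bar>v z \<bullet> (J z *v axis k 1)\<bar>)"
        by (simp add: JT[symmetric] inner_axis del: transpose_matrix_vector)
      finally show "norm (transpose (J z) *v v z) \<le> norm (\<Sum>k\<in>UNIV. \<bar>v z \<bullet> (J z *v axis k 1)\<bar>)"
        by simp
    qed
  qed
  have bx: "b \<bullet> x = (\<integral>z. v z \<bullet> (J z *v x) \<partial>M)" for x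
    unfolding b_def JT[symmetric]
    using integral_bounded_linear[OF bounded_linear_inner_left intb, of x] by simp
  have symG: "transpose G = G"
  proof -
    have "G $ j $ i = axis j 1 \<bullet> (G *v axis i 1)" for i j
      by (simp add: matrix_vector_mult_basis column_def inner_axis')
    also have "axis j 1 \<bullet> (G *v axis i 1) = axis i 1 \<bullet> (G *v axis j 1)" for i j
      unfolding intG[symmetric] by (simp add: inner_commute)
    finally have "G $ j $ i = G $ i $ j" for i j
      by (simp add: matrix_vector_mult_basis column_def inner_axis')
    then show ?thesis by (simp add: vec_eq_iff transpose_def)
  qed
  define \<eta> where "\<eta> = pseudoinverse G *v b"
  have G\<eta>: "G *v \<eta> = b"
    unfolding \<eta>_def
  proof (rule pseudoinverse_solves[OF symG])
    fix x assume "G *v x = 0"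
    then have "(\<integral>z. (norm (J z *v x))\<^sup>2 \<partial>M) = 0"
      using intG[of x x] by (simp add: power2_norm_eq_inner)
    then have "AE z in M. (norm (J z *v x))\<^sup>2 = 0"
      using integral_nonneg_eq_0_iff_AE[OF intJ2] by simp
    then have "AE z in M. v z \<bullet> (J z *v x) = 0" by eventually_elim simp
    then show "b \<bullet> x = 0" unfolding bx by (rule integral_eq_zero_AE)
  qed
  have cross: "(\<integral>z. (v z - J z *v \<eta>) \<bullet> (J z *v x) \<partial>M) = 0" for x
  proof -
    have "(\<integral>z. (v z - J z *v \<eta>) \<bullet> (J z *v x) \<partial>M) = b \<bullet> x - \<eta> \<bullet> (G *v x)"
      unfolding bx intG[symmetric] inner_diff_left
      by (rule Bochner_Integration.integral_diff[OF intvJ intJJ])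
    also have "\<eta> \<bullet> (G *v x) = b \<bullet> x"
      unfolding G\<eta>[symmetric] using symG by (metis dot_lmul_matrix transpose_matrix_vector)
    finally show ?thesis by simp
  qed
  have intc: "integrable M (\<lambda>z. (v z - J z *v \<eta>) \<bullet> (J z *v x))" for x
    unfolding inner_diff_left using intvJ intJJ by auto
  have "(\<integral>z. (norm (v z - J z *v \<eta>))\<^sup>2 \<partial>M) \<le> (\<integral>z. (norm (v z - J z *v \<xi>))\<^sup>2 \<partial>M)"
  proof -
    let ?x = "\<eta> - \<xi>"
    have e: "(norm (v z - J z *v \<xi>))\<^sup>2
        = (norm (v z - J z *v \<eta>))\<^sup>2 + 2 * ((v z - J z *v \<eta>) \<bullet> (J z *v ?x)) + (norm (J z *v ?x))\<^sup>2" for z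
    proof -
      have "v z - J z *v \<xi> = (v z - J z *v \<eta>) + J z *v ?x"
        by (simp add: matrix_vector_mult_diff_distrib)
      then show ?thesis
        by (simp only: power2_norm_eq_inner inner_add_left inner_add_right) (simp add: inner_commute)
    qed
    have "(\<integral>z. (norm (v z - J z *v \<xi>))\<^sup>2 \<partial>M) = (\<integral>z. (norm (v z - J z *v \<eta>))\<^sup>2 \<partial>M)
        + 2 * (\<integral>z. (v z - J z *v \<eta>) \<bullet> (J z *v ?x) \<partial>M) + (\<integral>z. (norm (J z *v ?x))\<^sup>2 \<partial>M)"
      unfolding e using intv intc intJ2 by simp
    then show ?thesis using cross by simp
  qed
  then show ?thesis
    unfolding \<eta>_def[symmetric]
    using nn_integral_eq_integral[OF intv] by (simp add: ennreal_leI)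
qed

section \<open>Transport maps from an absolutely continuous law\<close>

text \<open>
  Ternary expansions with digits 0 and 2 are used because, unlike binary ones, they determine
  the bit sequence.
\<close>
definition cantor_code :: "(nat \<Rightarrow> bool) \<Rightarrow> real" where
  "cantor_code b = (\<Sum>n. of_bool (b n) * (2 / 3 ^ Suc n))"

lemma summable_cantor: "summable (\<lambda>n. of_bool (b n) * (2 / 3 ^ Suc n) :: real)"
proof (rule summable_comparison_test')
  show "summable (\<lambda>n. (2/3) * (1/3) ^ n :: real)"
    by (intro summable_mult summable_geometric) simp
  show "norm (of_bool (b n) * (2 / 3 ^ Suc n) :: real) \<le> (2/3) * (1/3::real) ^ n" for n
    by (auto simp: power_one_over field_simps)
qed

lemma cantor_code_bounds: "0 \<le> cantor_code b" "cantor_code b \<le> 1"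
proof -
  show "0 \<le> cantor_code b" unfolding cantor_code_def
    by (intro suminf_nonneg summable_cantor) auto
  have "cantor_code b \<le> (\<Sum>n. (2/3) * (1/3) ^ n :: real)"
    unfolding cantor_code_def
    by (intro suminf_le summable_cantor summable_mult summable_geometric)
       (auto simp: power_one_over field_simps)
  also have "\<dots> = 1" by (subst suminf_mult) (auto simp: suminf_geometric summable_geometric)
  finally show "cantor_code b \<le> 1" .
qed

lemma cantor_code_rec:
  "cantor_code b = of_bool (b 0) * (2/3) + cantor_code (\<lambda>n. b (Suc n)) / 3"
proof -
  have "cantor_code b = of_bool (b 0) * (2 / 3 ^ Suc 0) + (\<Sum>n. of_bool (b (Suc n)) * (2 / 3 ^ Suc (Suc n)))"
    unfolding cantor_code_def by (subst suminf_split_head[OF summable_cantor]) simp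
  also have "(\<Sum>n. of_bool (b (Suc n)) * (2 / 3 ^ Suc (Suc n)) :: real)
      = (\<Sum>n. of_bool (b (Suc n)) * (2 / 3 ^ Suc n) / 3)"
    by (intro suminf_cong) simp
  also have "\<dots> = cantor_code (\<lambda>n. b (Suc n)) / 3"
    unfolding cantor_code_def using suminf_divide[OF summable_cantor, of "\<lambda>n. b (Suc n)" 3] by simp
  finally show ?thesis by simp
qed

text \<open>
  The ternary shift. The threshold separates codes with leading digit 0, at most \<open>1/3\<close>, from
  those with leading digit 2, at least \<open>2/3\<close>.
\<close>
primrec cantor_shift :: "nat \<Rightarrow> real \<Rightarrow> real" where
  "cantor_shift 0 r = r"
| "cantor_shift (Suc n) r = 3 * cantor_shift n r - (if cantor_shift n r \<ge> 1/2 then 2 else 0)"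

lemma cantor_shift_code: "cantor_shift n (cantor_code b) = cantor_code (\<lambda>k. b (n + k))"
proof (induction n)
  case (Suc n)
  have *: "cantor_code (\<lambda>k. b (n + k)) = of_bool (b n) * (2/3) + cantor_code (\<lambda>k. b (Suc n + k)) / 3"
    using cantor_code_rec[of "\<lambda>k. b (n + k)"] by simp
  show ?case
    using cantor_code_bounds[of "\<lambda>k. b (Suc n + k)"]
    by (simp only: cantor_shift.simps Suc *) (cases "b n"; simp)
qed simp

lemma cantor_digit: "cantor_shift n (cantor_code b) \<ge> 1/2 \<longleftrightarrow> b n"
proof -
  have *: "cantor_code (\<lambda>k. b (n + k)) = of_bool (b n) * (2/3) + cantor_code (\<lambda>k. b (Suc n + k)) / 3"
    using cantor_code_rec[of "\<lambda>k. b (n + k)"] by simp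
  show ?thesis
    unfolding cantor_shift_code *
    using cantor_code_bounds[of "\<lambda>k. b (Suc n + k)"] by (cases "b n"; simp)
qed

lemma measurable_cantor_shift[measurable]: "cantor_shift n \<in> borel_measurable borel"
proof (induction n)
  case 0
  then show ?case by (simp add: cantor_shift.simps(1)[abs_def])
next
  case (Suc n)
  note [measurable] = Suc
  show ?case by (simp add: cantor_shift.simps(2)[abs_def])
qed

text \<open>
  A point is determined by the pairs of a coordinate and a rational number below that
  coordinate. Enumerating all pairs turns the point into a bit sequence, hence into a real number,
  and each coordinate is recovered as a supremum of rational numbers, which is a Borel operation.
  This reduces transport between laws on Euclidean spaces to transport on the line.
\<close>
lemma borel_real_embedding:
  obtains enc :: "'b::euclidean_space \<Rightarrow> real" and dec :: "real \<Rightarrow> 'b"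
  where "enc \<in> borel_measurable borel" "dec \<in> borel_measurable borel"
    "\<And>y. dec (enc y) = y" "\<And>y. 0 \<le> enc y" "\<And>y. enc y \<le> 1"
proof -
  define D where "D = (Basis :: 'b set) \<times> (\<rat> :: real set)"
  have D: "countable D" "D \<noteq> {}"
    unfolding D_def by (intro countable_SIGMA countable_finite countable_rat finite_Basis) (auto intro: Rats_0)
  define b where "b n = fst (from_nat_into D n)" for n
  define q where "q n = snd (from_nat_into D n)" for n
  have surj: "\<exists>n. b n = i \<and> q n = r" if "i \<in> Basis" "r \<in> \<rat>" for i r
  proof -
    have "(i, r) \<in> D" using that by (simp add: D_def)
    then obtain n where "from_nat_into D n = (i, r)" using from_nat_into_surj[OF D(1)] by blast
    then show ?thesis unfolding b_def q_def by (intro exI[of _ n]) simp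
  qed
  define enc where "enc y = cantor_code (\<lambda>n. q n < y \<bullet> b n)" for y :: 'b
  define dc where "dc i r = real_of_ereal (SUP n. if b n = i \<and> cantor_shift n r \<ge> 1/2 then ereal (q n) else -\<infinity>)"
    for i r
  define dec where "dec r = (\<Sum>i\<in>Basis. dc i r *\<^sub>R i)" for r
  have [measurable]: "dc i \<in> borel_measurable borel" for i
    unfolding dc_def[abs_def] by measurable
  have m1: "enc \<in> borel_measurable borel"
    unfolding enc_def[abs_def] cantor_code_def by measurable
  have m2: "dec \<in> borel_measurable borel"
    unfolding dec_def[abs_def] by measurable
  have dc: "dc i (enc y) = y \<bullet> i" if i: "i \<in> Basis" for i y
  proof -
    have "(SUP n. if b n = i \<and> cantor_shift n (enc y) \<ge> 1/2 then ereal (q n) else -\<infinity>) = ereal (y \<bullet> i)"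
      unfolding enc_def cantor_digit
    proof (rule SUP_eqI)
      show "(if b n = i \<and> q n < y \<bullet> b n then ereal (q n) else - \<infinity>) \<le> ereal (y \<bullet> i)" for n
        by auto
    next
      fix u assume u: "\<And>n. n \<in> UNIV \<Longrightarrow> (if b n = i \<and> q n < y \<bullet> b n then ereal (q n) else - \<infinity>) \<le> u"
      show "ereal (y \<bullet> i) \<le> u"
      proof (rule ccontr)
        assume "\<not> ereal (y \<bullet> i) \<le> u"
        then obtain r where r: "u < ereal r" "r < y \<bullet> i"
          using ereal_dense2[of u "ereal (y \<bullet> i)"] by (auto simp: not_le)
        obtain s where s: "s \<in> \<rat>" "r < s" "s < y \<bullet> i" using Rats_dense_in_real[OF r(2)] by blast
        obtain n where n: "b n = i" "q n = s" using surj[OF i s(1)] by blast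
        have "ereal s \<le> u" using u[of n] n s by simp
        moreover have "u < ereal s" using r(1) s(2) by (meson ereal_less(3) less_trans ereal_less_eq(3) less_ereal.simps(1))
        ultimately show False by simp
      qed
    qed
    then show ?thesis unfolding dc_def by simp
  qed
  show ?thesis
  proof (rule that[of enc dec])
    show "dec (enc y) = y" for y
      unfolding dec_def by (simp add: dc euclidean_representation)
  qed (auto simp: m1 m2 enc_def cantor_code_bounds)
qed

text \<open>
  The distribution function attains every value in the open unit interval by continuity. So the
  set on which it is at most \<open>u\<close> contains a half-line of measure \<open>u\<close> and is contained in half-lines
  of measure arbitrarily close to \<open>u\<close>.
\<close>
lemma (in real_distribution) cdf_transform_uniform:
  assumes cont: "\<And>x. isCont (cdf M) x" and u: "0 \<le> u" "u < 1"
  shows "measure M {x. cdf M x \<le> u} = u"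
proof -
  have mono: "cdf M x \<le> cdf M y" if "x \<le> y" for x y using cdf_nondecreasing that .
  have [measurable]: "cdf M \<in> borel_measurable borel"
    by (rule borel_measurable_mono) (auto simp: mono_def mono)
  have ivt: "\<exists>c. cdf M c = w" if w: "0 < w" "w < 1" for w
  proof -
    obtain a where a: "cdf M a < w"
      using order_tendstoD(2)[OF cdf_lim_at_bot w(1)] by (auto simp: eventually_at_bot_linorder)
    obtain b where b: "w < cdf M b"
      using order_tendstoD(1)[OF cdf_lim_at_top_prob w(2)] by (auto simp: eventually_at_top_linorder)
    have "a \<le> b" using a b mono[of b a] by linarith
    then show ?thesis
      using IVT[of "cdf M" a w b] a b cont by auto
  qed
  have le: "measure M {x. cdf M x \<le> u} \<le> w" if uw: "u < w" "w < 1" for w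
  proof -
    obtain c where c: "cdf M c = w" using ivt[of w] le_less_trans[OF u(1) uw(1)] uw(2) by blast
    have "{x. cdf M x \<le> u} \<subseteq> {..c}"
    proof
      fix x assume "x \<in> {x. cdf M x \<le> u}"
      then have "cdf M x < cdf M c" using c uw by simp
      then show "x \<in> {..c}" using mono[of c x] by (cases "x \<le> c") auto
    qed
    then have "measure M {x. cdf M x \<le> u} \<le> measure M {..c}"
      by (intro finite_measure_mono) auto
    then show ?thesis using c by (simp add: cdf_def)
  qed
  have "measure M {x. cdf M x \<le> u} \<le> u"
    by (rule dense_ge_bounded[OF u(2)]) (use le in auto)
  moreover have "u \<le> measure M {x. cdf M x \<le> u}"
  proof (cases "u = 0")
    case False
    then obtain c where c: "cdf M c = u" using ivt[of u] u by force
    have "{..c} \<subseteq> {x. cdf M x \<le> u}" using mono c by auto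
    then have "measure M {..c} \<le> measure M {x. cdf M x \<le> u}"
      by (intro finite_measure_mono) auto
    then show ?thesis using c by (simp add: cdf_def)
  qed simp
  ultimately show ?thesis by simp
qed

text \<open>
  The exceptional points lie on countably many hyperplanes, one for each value of the label
  \<open>J\<close>, and these are Lebesgue null sets.
\<close>
lemma continuous_law_coordinate:
  fixes M :: "(real^'d) measure" and J :: "real^'d \<Rightarrow> nat"
  assumes "absolutely_continuous lborel M" and sM: "sets M = sets borel"
    and inj: "inj \<sigma>"
  shows "AE x in M. real (J x) + \<sigma> (x $ i) \<noteq> c"
proof -
  have "\<exists>a. \<forall>x :: real^'d. \<sigma> (x $ i) = c - real j \<longrightarrow> x $ i = a" for j
    using inj by (metis injD)
  then obtain a where a: "\<And>j x. \<sigma> ((x :: real^'d) $ i) = c - real j \<Longrightarrow> x $ i = a j" by metis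
  have null: "AE x in M. x $ i \<noteq> a j" for j
  proof -
    have "negligible {x :: real^'d. x $ i = a j}" using negligible_standard_hyperplane[of "axis i 1 :: real^'d" "a j"]
      by (simp add: inner_axis axis_in_Basis_iff)
    moreover have "{x :: real^'d. x $ i = a j} \<in> sets borel"
      by measurable
    ultimately have "{x :: real^'d. x $ i = a j} \<in> null_sets lborel"
      by (simp add: negligible_iff_null_sets null_sets_completion_iff)
    then have "{x :: real^'d. x $ i = a j} \<in> null_sets M"
      using assms(1) by (auto simp: absolutely_continuous_def)
    then show ?thesis by (auto dest!: AE_not_in)
  qed
  have "AE x in M. \<forall>j. x $ i \<noteq> a j" using null by (simp add: AE_all_countable)
  then show ?thesis
    by eventually_elim (use a in \<open>auto simp: algebra_simps eq_diff_eq\<close>)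
qed

text \<open>
  Quantile transport that respects labels. Encode \<open>x\<close> and \<open>y\<close> as real numbers in the unit
  interval that starts at their label. The encoded law of \<open>M\<close> has no atoms, so its distribution
  function followed by the quantile function of the encoded law of \<open>P\<close> carries the one to the
  other. This map is monotone and both encoded laws have the same mass below each integer, so it
  does not change the integer part. With constant labels this yields the existence of transport
  maps; with the cells of a fine partition it approximates couplings by maps
  (\<open>near_optimal_map\<close>), and with sets of equal mass it exchanges them
  (\<open>v_lipschitz_on_support\<close>).
\<close>
theorem transport_map_with_labels:
  fixes M :: "(real^'d) measure" and P :: "'b::euclidean_space measure"
    and J :: "real^'d \<Rightarrow> nat" and K :: "'b \<Rightarrow> nat"
  assumes M: "prob_space M" "sets M = sets borel" "absolutely_continuous lborel M"
    and P: "prob_space P" "sets P = sets borel"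
    and J[measurable]: "J \<in> borel \<rightarrow>\<^sub>M count_space UNIV" and K[measurable]: "K \<in> borel \<rightarrow>\<^sub>M count_space UNIV"
    and law: "\<And>j. measure M {x. J x < j} = measure P {y. K y < j}"
  obtains R where "R \<in> borel \<rightarrow>\<^sub>M borel" "distr M borel R = P" "AE x in M. K (R x) = J x"
proof -
  interpret M: prob_space M by fact
  interpret P: prob_space P by fact
  have [simp]: "space M = UNIV" "space P = UNIV"
    using sets_eq_imp_space_eq[OF M(2)] sets_eq_imp_space_eq[OF P(2)] by auto
  have [measurable_cong]: "sets M = sets borel" "sets P = sets borel" by fact+
  obtain enc :: "'b \<Rightarrow> real" and dec where enc[measurable]: "enc \<in> borel_measurable borel"
    and dec0[measurable]: "dec \<in> borel_measurable borel"
    and encdec: "\<And>y. dec (enc y) = y" and enc01: "\<And>y. 0 \<le> enc y" "\<And>y. enc y \<le> 1"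
    by (rule borel_real_embedding) blast
  obtain i0 :: 'd where True by simp
  \<comment> \<open>Any injective Borel map of the line into the open unit interval would do.\<close>
  define \<sigma> where "\<sigma> t = 1/2 + arctan t / pi" for t :: real
  have \<sigma>: "0 < \<sigma> t" "\<sigma> t < 1" for t
    using arctan_bounded[of t] by (auto simp: \<sigma>_def field_simps)
  have inj: "inj \<sigma>" by (auto simp: \<sigma>_def inj_def arctan_eq_iff)
  have [measurable]: "\<sigma> \<in> borel_measurable borel"
    unfolding \<sigma>_def[abs_def] by measurable
  define h where "h x = real (J x) + \<sigma> (x $ i0)" for x
  \<comment> \<open>The code of \<open>y\<close> lies between \<open>K y + 1/4\<close> and \<open>K y + 3/4\<close>, away from the
    integers, so that its label is its integer part.\<close>
  define g where "g y = real (K y) + (1/4 + enc y / 2)" for y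
  have [measurable]: "h \<in> borel_measurable borel" "g \<in> borel_measurable borel"
    unfolding h_def[abs_def] g_def[abs_def] by measurable
  define M1 where "M1 = distr M borel h"
  define P1 where "P1 = distr P borel g"
  interpret M1: cdf_distribution M1
    unfolding M1_def cdf_distribution_def by (rule M.real_distribution_distr) measurable
  interpret P1: cdf_distribution P1
    unfolding P1_def cdf_distribution_def by (rule P.real_distribution_distr) measurable
  have cdfM: "M1.C r = measure M {x. h x \<le> r}" for r
    unfolding M1_def cdf_def by (subst measure_distr) (auto simp: vimage_def)
  have cdfP: "P1.C r = measure P {y. g y \<le> r}" for r
    unfolding P1_def cdf_def by (subst measure_distr) (auto simp: vimage_def)
  have cont: "isCont M1.C r" for r
  proof -
    have "AE x in M. h x \<noteq> r"
      unfolding h_def by (rule continuous_law_coordinate[OF M(3,2) inj])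
    then have "measure M {x. h x = r} = 0"
      by (subst M.prob_eq_0) auto
    then show ?thesis
      unfolding M1.isCont_cdf by (simp add: M1_def measure_distr vimage_def)
  qed
  have unif: "measure M {x. M1.C (h x) \<le> u} = u" if "0 \<le> u" "u < 1" for u
  proof -
    have "measure M1 {r. M1.C r \<le> u} = measure M {x. M1.C (h x) \<le> u}"
    proof -
      have "{r. M1.C r \<le> u} \<in> sets borel" by measurable
      then show ?thesis by (subst (1) M1_def, subst measure_distr) (auto simp: vimage_def)
    qed
    then show ?thesis using M1.cdf_transform_uniform[OF cont that] by simp
  qed
  have unif1: "measure M {x. M1.C (h x) \<le> u} = u" if "0 \<le> u" "u \<le> 1" for u
  proof (cases "u = 1")
    case True
    have "{x. M1.C (h x) \<le> u} = UNIV" using True M1.cdf_bounded_prob by auto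
    then show ?thesis using True M.prob_space by simp
  qed (use that unif in auto)
  have noatom: "AE x in M. M1.C (h x) \<noteq> u" for u
  proof (cases "0 \<le> u \<and> u \<le> 1")
    case True
    have "measure M {x. M1.C (h x) = u} \<le> 0"
    proof (cases "u = 0")
      case True
      have "measure M {x. M1.C (h x) = u} \<le> measure M {x. M1.C (h x) \<le> 0}"
        using True by (intro M.finite_measure_mono) auto
      then show ?thesis using unif1[of 0] by simp
    next
      case False
      show ?thesis
      proof (rule field_le_epsilon)
        fix e :: real assume e: "0 < e"
        define w where "w = max 0 (u - e)"
        have w: "0 \<le> w" "w \<le> 1" "w < u" "u \<le> w + e" using True False e by (auto simp: w_def)
        have "measure M {x. M1.C (h x) = u} + measure M {x. M1.C (h x) \<le> w}
            = measure M ({x. M1.C (h x) = u} \<union> {x. M1.C (h x) \<le> w})"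
          using w by (intro M.finite_measure_Union[symmetric]) auto
        also have "\<dots> \<le> measure M {x. M1.C (h x) \<le> u}"
          using w by (intro M.finite_measure_mono) auto
        finally show "measure M {x. M1.C (h x) = u} \<le> 0 + e"
          using unif1[of u] unif1[of w] w True by simp
      qed
    qed
    then have "measure M {x. M1.C (h x) = u} = 0" using measure_nonneg[of M] by (meson antisym)
    then show ?thesis by (subst (asm) M.prob_eq_0) auto
  next
    case False
    then show ?thesis
      using M1.cdf_nonneg M1.cdf_bounded_prob by (intro AE_I2) auto
  qed
  define r where "r x = P1.I (M1.C (h x))" for x
  \<comment> \<open>The quantile function is only meaningful on the open unit interval; the value 0 outside
    concerns a null set.\<close>
  define r' where "r' x = (if M1.C (h x) \<in> {0<..<1} then r x else 0)" for x
  define dec' where "dec' s = dec ((s - of_int \<lfloor>s\<rfloor> - 1/4) * 2)" for s :: real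
  have [measurable]: "dec' \<in> borel_measurable borel" unfolding dec'_def[abs_def] by measurable
  have r'm[measurable]: "r' \<in> borel_measurable borel"
  proof -
    have "(\<lambda>w. if w \<in> {0<..<1} then P1.I w else 0) \<in> borel_measurable borel"
      by (subst measurable_If_restrict_space_iff) (auto simp: P1.measurable_CI[unfolded greaterThanLessThan_def greaterThan_def lessThan_def Int_def mem_Collect_eq])
    from measurable_compose[OF _ this, of "\<lambda>x. M1.C (h x)" borel]
    show ?thesis unfolding r'_def[abs_def] r_def by simp
  qed
  have gbd: "real (K y) < g y" "g y \<le> real (K y) + 3/4" for y
    using enc01[of y] by (auto simp: g_def)
  have fl: "\<lfloor>g y\<rfloor> = int (K y)" for y
    using gbd[of y] by (intro floor_unique) auto
  have dg: "dec' (g y) = y" for y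
    unfolding dec'_def fl by (simp add: g_def encdec)
  have in01: "AE x in M. M1.C (h x) \<in> {0<..<1}"
    using noatom[of 0] noatom[of 1]
    by eventually_elim (use M1.cdf_nonneg M1.cdf_bounded_prob in \<open>auto simp: less_le\<close>)
  have distr_r: "distr M borel r' = P1"
  proof (rule cdf_unique)
    show "real_distribution (distr M borel r')"
      by (rule M.real_distribution_distr) measurable
    show "real_distribution P1" ..
    show "cdf (distr M borel r') = P1.C"
    proof
      fix s
      have "cdf (distr M borel r') s = measure M {x. r' x \<le> s}"
        unfolding cdf_def by (subst measure_distr) (auto simp: vimage_def)
      also have "\<dots> = measure M {x. M1.C (h x) \<le> P1.C s}"
      proof (rule M.finite_measure_eq_AE)
        show "AE x in M. (x \<in> {x. r' x \<le> s}) = (x \<in> {x. M1.C (h x) \<le> P1.C s})"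
          using in01
        proof eventually_elim
          case (elim x)
          then have "r' x = P1.I (M1.C (h x))" by (simp only: r'_def r_def if_True)
          moreover have "M1.C (h x) \<le> P1.C s \<longleftrightarrow> P1.I (M1.C (h x)) \<le> s"
            using elim by (intro P1.pseudoinverse) auto
          ultimately show ?case by (simp only: mem_Collect_eq)
        qed
        show "{x. r' x \<le> s} \<in> sets M" by measurable
        show "{x. M1.C (h x) \<le> P1.C s} \<in> sets M" by measurable
      qed
      also have "\<dots> = P1.C s"
        by (rule unif1) (auto simp: P1.cdf_nonneg P1.cdf_bounded_prob)
      finally show "cdf (distr M borel r') s = P1.C s" .
    qed
  qed
  have lab1: "AE x in M. g (dec' (r' x)) = r' x"
  proof -
    have "AE s in P1. g (dec' s) = s"
      unfolding P1_def by (subst AE_distr_iff) (auto simp: dg)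
    then show ?thesis
      unfolding distr_r[symmetric] by (subst (asm) AE_distr_iff) auto
  qed
  have FJ: "M1.C (real j) = measure M {x. J x < j}" for j
  proof -
    have "h x \<le> real j \<longleftrightarrow> J x < j" for x
    proof
      assume "h x \<le> real j"
      then have "real (J x) < real j" using \<sigma>[of "x $ i0"] by (simp add: h_def)
      then show "J x < j" by simp
    next
      assume "J x < j"
      then have "real (J x) + 1 \<le> real j" by simp
      then show "h x \<le> real j" using \<sigma>[of "x $ i0"] by (simp add: h_def)
    qed
    then show ?thesis by (simp add: cdfM)
  qed
  have GJ: "P1.C s = measure P {y. K y < j}" if "real j \<le> s + 1/4" "s \<le> real j" for j s
  proof -
    have "g y \<le> s \<longleftrightarrow> K y < j" for y
    proof
      assume "g y \<le> s"
      then have "real (K y) < real j" using gbd[of y] that by linarith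
      then show "K y < j" by simp
    next
      assume "K y < j"
      then have "real (K y) + 1 \<le> real j" by simp
      then show "g y \<le> s" using gbd[of y] that by linarith
    qed
    then show ?thesis by (simp add: cdfP)
  qed
  have lab2: "AE x in M. \<lfloor>r' x\<rfloor> = int (J x)"
  proof -
    have "AE x in M. \<forall>j. M1.C (h x) \<noteq> M1.C (real j)"
      using noatom by (simp add: AE_all_countable)
    with in01 show ?thesis
    proof eventually_elim
      case (elim x)
      let ?w = "M1.C (h x)" and ?j = "J x"
      have hb: "real ?j \<le> h x" "h x \<le> real (Suc ?j)" using \<sigma>[of "x $ i0"] by (auto simp: h_def)
      have w: "0 < ?w" "?w < 1" using elim by auto
      have "M1.C (real ?j) < ?w"
        using M1.cdf_nondecreasing[OF hb(1)] elim(2)[rule_format, of ?j] by simp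
      then have "P1.C (real ?j) < ?w" using GJ[of ?j "real ?j"] FJ law by simp
      then have 1: "real ?j < r x"
        using P1.pseudoinverse[OF w, of "real ?j"] by (simp add: r_def not_le[symmetric])
      have "?w \<le> M1.C (real (Suc ?j))" using M1.cdf_nondecreasing[OF hb(2)] .
      then have "?w \<le> P1.C (real ?j + 3/4)" using GJ[of "Suc ?j" "real ?j + 3/4"] unfolding FJ law by simp
      then have 2: "r x \<le> real ?j + 3/4"
        using P1.pseudoinverse[OF w, of "real ?j + 3/4"] by (simp add: r_def)
      show ?case using 1 2 elim(1) by (intro floor_unique) (auto simp: r'_def)
    qed
  qed
  show ?thesis
  proof (rule that[of "\<lambda>x. dec' (r' x)"])
    show "(\<lambda>x. dec' (r' x)) \<in> borel \<rightarrow>\<^sub>M borel" by measurable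
    have "distr M borel (\<lambda>x. dec' (r' x)) = distr (distr M borel r') borel dec'"
      by (subst distr_distr) (auto simp: comp_def)
    also have "\<dots> = distr P borel (\<lambda>y. dec' (g y))"
      unfolding distr_r P1_def by (subst distr_distr) (auto simp: comp_def)
    also have "\<dots> = P"
      by (simp add: dg distr_id2 P(2))
    finally show "distr M borel (\<lambda>x. dec' (r' x)) = P" .
    show "AE x in M. K (dec' (r' x)) = J x"
      using lab1 lab2 by eventually_elim (metis fl of_nat_eq_iff)
  qed
qed

section \<open>The Wasserstein distance through maps\<close>

lemma prob_densities_facts:
  assumes "\<mu> \<in> prob_densities"
  shows "prob_space \<mu>" "sets \<mu> = sets borel" "absolutely_continuous lborel \<mu>"
    "(\<integral>\<^sup>+x. ennreal ((norm x)\<^sup>2) \<partial>\<mu>) < \<infinity>"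
proof -
  obtain r where r: "\<mu> = density lborel (\<lambda>x. ennreal (r x))" and [measurable]: "r \<in> borel_measurable borel"
    and pos: "\<And>x. 0 \<le> r x" and one: "(\<integral>\<^sup>+x. ennreal (r x) \<partial>lborel) = 1"
    and mom: "(\<integral>\<^sup>+x. ennreal ((norm x)\<^sup>2 * r x) \<partial>lborel) < \<infinity>"
    using assms unfolding prob_densities_def by blast
  show "prob_space \<mu>" by (rule prob_spaceI) (simp add: r emeasure_density one)
  show "sets \<mu> = sets borel" by (simp add: r)
  show "absolutely_continuous lborel \<mu>" unfolding r by (intro absolutely_continuousI_density) simp
  have "(\<integral>\<^sup>+x. ennreal ((norm x)\<^sup>2) \<partial>\<mu>) = (\<integral>\<^sup>+x. ennreal (r x) * ennreal ((norm x)\<^sup>2) \<partial>lborel)"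
    unfolding r by (subst nn_integral_density) auto
  also have "\<dots> = (\<integral>\<^sup>+x. ennreal ((norm x)\<^sup>2 * r x) \<partial>lborel)"
    by (intro nn_integral_cong) (simp add: ennreal_mult[symmetric] pos mult.commute)
  finally show "(\<integral>\<^sup>+x. ennreal ((norm x)\<^sup>2) \<partial>\<mu>) < \<infinity>" using mom by simp
qed

text \<open>
  The label of a point is the index of the first nearby point of a dense sequence.
\<close>
lemma small_cells:
  assumes "0 < \<delta>"
  obtains J :: "'a::{second_countable_topology, metric_space} \<Rightarrow> nat"
  where "J \<in> borel \<rightarrow>\<^sub>M count_space UNIV" "\<And>x y. J x = J y \<Longrightarrow> dist x y \<le> \<delta>"
proof -
  obtain D :: "'a set" where D: "countable D" "\<And>X. open X \<Longrightarrow> X \<noteq> {} \<Longrightarrow> \<exists>d\<in>D. d \<in> X"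
    by (rule countable_dense_setE) blast
  have "D \<noteq> {}" using D(2)[of UNIV] by auto
  define d where "d n = from_nat_into D n" for n
  define J where "J x = (LEAST n. dist x (d n) < \<delta> / 2)" for x
  have ex: "\<exists>n. dist x (d n) < \<delta> / 2" for x
  proof -
    have "\<exists>y\<in>D. y \<in> ball x (\<delta>/2)" using D(2)[of "ball x (\<delta>/2)"] assms by auto
    then obtain y where "y \<in> D" "dist x y < \<delta>/2" by auto
    then show ?thesis using from_nat_into_surj[OF D(1)] by (metis d_def)
  qed
  have J: "dist x (d (J x)) < \<delta> / 2" for x unfolding J_def by (rule LeastI_ex[OF ex])
  show ?thesis
  proof (rule that[of J])
    show "J \<in> borel \<rightarrow>\<^sub>M count_space UNIV" unfolding J_def[abs_def] by measurable
    fix x y assume "J x = J y"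
    then have "dist x (d (J x)) < \<delta> / 2" "dist y (d (J x)) < \<delta> / 2" using J[of x] J[of y] by auto
    then show "dist x y \<le> \<delta>" using dist_triangle2[of x y "d (J x)"] by simp
  qed
qed

text \<open>
  The mass of the part of \<open>A\<close> below a hyperplane varies continuously with the hyperplane, so
  the intermediate value theorem applies.
\<close>
lemma subset_of_given_measure:
  fixes M :: "(real^'d) measure"
  assumes M: "prob_space M" "sets M = sets borel" "absolutely_continuous lborel M"
    and A: "A \<in> sets borel" and m: "0 \<le> m" "m \<le> measure M A"
  obtains E where "E \<in> sets borel" "E \<subseteq> A" "measure M E = m"
proof -
  interpret M: prob_space M by fact
  have [measurable_cong]: "sets M = sets borel" by fact
  have [simp]: "space M = UNIV" using sets_eq_imp_space_eq[OF M(2)] by auto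
  have [measurable]: "A \<in> sets borel" by fact
  obtain i :: 'd where True by simp
  define N where "N = distr (restrict_space M A) borel (\<lambda>x. x $ i)"
  have fin: "finite_measure (restrict_space M A)"
    using M(2) A by (intro finite_measure_restrict_space M.finite_measure_axioms) auto
  have N: "measure N B = measure M {x\<in>A. x $ i \<in> B}" if "B \<in> sets borel" for B
  proof -
    have "measure N B = measure (restrict_space M A) ((\<lambda>x. x $ i) -` B \<inter> space (restrict_space M A))"
      unfolding N_def using that by (intro measure_distr measurable_restrict_space1) auto
    also have "\<dots> = measure M {x\<in>A. x $ i \<in> B}"
      using that A M(2) by (subst measure_restrict_space) (auto simp: space_restrict_space intro!: arg_cong[where f="measure M"])
    finally show ?thesis .
  qed
  interpret N: finite_borel_measure N
    unfolding finite_borel_measure_def finite_borel_measure_axioms_def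
    by (auto simp: N_def intro!: finite_measure.finite_measure_distr[OF fin] measurable_restrict_space1)
  have cont: "isCont (cdf N) c" for c
  proof -
    have "AE x in M. real ((\<lambda>_. 0) x) + x $ i \<noteq> c"
      by (rule continuous_law_coordinate[OF M(3,2), of "\<lambda>x. x"]) auto
    then have "AE x in M. x \<notin> {x\<in>A. x $ i \<in> {c}}" by eventually_elim auto
    then have "measure M {x\<in>A. x $ i \<in> {c}} = 0" by (subst M.prob_eq_0) auto
    then show ?thesis unfolding N.isCont_cdf by (simp add: N)
  qed
  have cdf: "cdf N c = measure M {x\<in>A. x $ i \<le> c}" for c
    unfolding cdf_def by (simp add: N)
  consider "m = 0" | "m = measure M A" | "0 < m" "m < measure M A" using m by linarith
  then show ?thesis
  proof cases
    case 1 then show ?thesis by (intro that[of "{}"]) auto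
  next
    case 2 then show ?thesis by (intro that[of A]) (auto simp: A)
  next
    case 3
    have tot: "measure N (space N) = measure M A"
      using N[of UNIV] by (simp add: N_def)
    obtain a where a: "cdf N a < m"
      using order_tendstoD(2)[OF N.cdf_lim_at_bot 3(1)] by (auto simp: eventually_at_bot_linorder)
    obtain b where b: "m < cdf N b"
      using order_tendstoD(1)[OF N.cdf_lim_at_top, of m] 3(2) by (auto simp: tot eventually_at_top_linorder)
    have "a \<le> b" using a b N.cdf_nondecreasing[of b a] by linarith
    then obtain c where "cdf N c = m"
      using IVT[of "cdf N" a m b] a b cont by auto
    then show ?thesis by (intro that[of "{x\<in>A. x $ i \<le> c}"]) (auto simp: cdf)
  qed
qed

text \<open>
  The squared distance before the conversion to a real number, which sends \<open>\<infinity>\<close> to 0.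
\<close>
definition W2_cost :: "(real^'d) measure \<Rightarrow> (real^'d) measure \<Rightarrow> ennreal" where
  "W2_cost \<mu> \<nu> = (INF \<pi>\<in>couplings \<mu> \<nu>. \<integral>\<^sup>+p. ennreal ((norm (fst p - snd p))\<^sup>2) \<partial>\<pi>)"

lemma W2_sq: "W2_cost \<mu> \<nu> < \<infinity> \<Longrightarrow> ennreal ((W2 \<mu> \<nu>)\<^sup>2) = W2_cost \<mu> \<nu>"
  unfolding W2_def W2_cost_def[symmetric] by (simp add: less_top)

locale reference_measure =
  fixes lam :: "(real^'d) measure"
  assumes prob_lam: "prob_space lam" and sets_lam[measurable_cong]: "sets lam = sets borel"
    and ac_lam: "absolutely_continuous lborel lam"
begin

sublocale prob_space lam by (rule prob_lam)

lemma space_lam[simp]: "space lam = UNIV" using sets_eq_imp_space_eq[OF sets_lam] by simp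

lemma transport_map_exists:
  fixes \<nu> :: "'b::euclidean_space measure"
  assumes "prob_space \<nu>" "sets \<nu> = sets borel"
  obtains S where "S \<in> borel \<rightarrow>\<^sub>M borel" "distr lam borel S = \<nu>"
proof -
  interpret \<nu>: prob_space \<nu> by fact
  have "space \<nu> = UNIV" using sets_eq_imp_space_eq[OF assms(2)] by simp
  then have "measure lam {x. (\<lambda>_. 0) x < j} = measure \<nu> {y. (\<lambda>_. 0) y < j}" for j :: nat
    using prob_space \<nu>.prob_space by auto
  from transport_map_with_labels[OF prob_lam sets_lam ac_lam assms _ _ this]
  show ?thesis using that by (metis measurable_const UNIV_I space_count_space)
qed

lemma second_moment_map:
  assumes [measurable]: "S \<in> borel \<rightarrow>\<^sub>M borel" and "distr lam borel S \<in> prob_densities"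
  shows "(\<integral>\<^sup>+z. ennreal ((norm (S z))\<^sup>2) \<partial>lam) < \<infinity>"
proof -
  have "(\<integral>\<^sup>+z. ennreal ((norm (S z))\<^sup>2) \<partial>lam) = (\<integral>\<^sup>+x. ennreal ((norm x)\<^sup>2) \<partial>distr lam borel S)"
    by (subst nn_integral_distr) auto
  then show ?thesis using prob_densities_facts(4)[OF assms(2)] by simp
qed

text \<open>
  The joint law of the two maps is a coupling.
\<close>
lemma W2_cost_maps:
  fixes S S' :: "real^'d \<Rightarrow> real^'d"
  assumes [measurable]: "S \<in> borel \<rightarrow>\<^sub>M borel" "S' \<in> borel \<rightarrow>\<^sub>M borel"
  shows "W2_cost (distr lam borel S) (distr lam borel S') \<le> (\<integral>\<^sup>+z. ennreal ((norm (S z - S' z))\<^sup>2) \<partial>lam)"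
proof -
  let ?\<pi> = "distr lam borel (\<lambda>z. (S z, S' z))"
  have [measurable]: "(\<lambda>z. (S z, S' z)) \<in> borel \<rightarrow>\<^sub>M borel"
    unfolding borel_prod[symmetric] by measurable
  have f[measurable]: "fst \<in> borel \<rightarrow>\<^sub>M (borel :: (real^'d) measure)" "snd \<in> borel \<rightarrow>\<^sub>M (borel :: (real^'d) measure)"
    by (intro borel_measurable_continuous_onI continuous_intros)+
  have "distr ?\<pi> borel fst = distr lam borel S"
    by (subst distr_distr) (auto simp: comp_def f)
  moreover have "distr ?\<pi> borel snd = distr lam borel S'"
    by (subst distr_distr) (auto simp: comp_def f)
  ultimately have "?\<pi> \<in> couplings (distr lam borel S) (distr lam borel S')"
    by (simp add: couplings_def)
  then have "W2_cost (distr lam borel S) (distr lam borel S')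
      \<le> (\<integral>\<^sup>+p. ennreal ((norm (fst p - snd p))\<^sup>2) \<partial>?\<pi>)"
    unfolding W2_cost_def by (rule INF_lower)
  also have "\<dots> = (\<integral>\<^sup>+z. ennreal ((norm (S z - S' z))\<^sup>2) \<partial>lam)"
    by (subst nn_integral_distr) auto
  finally show ?thesis .
qed

lemma maps_sq_finite:
  assumes [measurable]: "S \<in> borel \<rightarrow>\<^sub>M borel" "S' \<in> borel \<rightarrow>\<^sub>M borel"
    and "distr lam borel S \<in> prob_densities" "distr lam borel S' \<in> prob_densities"
  shows "(\<integral>\<^sup>+z. ennreal ((norm (S z - S' z))\<^sup>2) \<partial>lam) < \<infinity>"
proof -
  have "(\<integral>\<^sup>+z. ennreal ((norm (S z - S' z))\<^sup>2) \<partial>lam)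
      \<le> (\<integral>\<^sup>+z. 2 * ennreal ((norm (S z))\<^sup>2) + 2 * ennreal ((norm (S' z))\<^sup>2) \<partial>lam)"
  proof (intro nn_integral_mono)
    fix z
    have "ennreal ((norm (S z - S' z))\<^sup>2) \<le> ennreal (2 * (norm (S z))\<^sup>2 + 2 * (norm (S' z))\<^sup>2)"
      using norm_add_sq_le[of "S z" "- S' z"] by (intro ennreal_leI) simp
    then show "ennreal ((norm (S z - S' z))\<^sup>2) \<le> 2 * ennreal ((norm (S z))\<^sup>2) + 2 * ennreal ((norm (S' z))\<^sup>2)"
      by (simp add: ennreal_plus ennreal_mult)
  qed
  also have "\<dots> = 2 * (\<integral>\<^sup>+z. ennreal ((norm (S z))\<^sup>2) \<partial>lam) + 2 * (\<integral>\<^sup>+z. ennreal ((norm (S' z))\<^sup>2) \<partial>lam)"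
    by (simp add: nn_integral_add nn_integral_cmult)
  also have "\<dots> < \<infinity>"
    using second_moment_map[OF assms(1,3)] second_moment_map[OF assms(2,4)]
    by (simp add: ennreal_mult_less_top)
  finally show ?thesis .
qed

lemma W2_cost_finite:
  fixes \<mu> \<nu> :: "(real^'d) measure"
  assumes "\<mu> \<in> prob_densities" "\<nu> \<in> prob_densities"
  shows "W2_cost \<mu> \<nu> < \<infinity>"
proof -
  obtain S S' where S: "S \<in> borel \<rightarrow>\<^sub>M borel" "distr lam borel S = \<mu>" "S' \<in> borel \<rightarrow>\<^sub>M borel" "distr lam borel S' = \<nu>"
    using transport_map_exists prob_densities_facts(1,2)[OF assms(1)] prob_densities_facts(1,2)[OF assms(2)] by metis
  show ?thesis
    using W2_cost_maps[OF S(1,3)] maps_sq_finite[OF S(1,3)] S assms by (simp add: order_le_less_trans)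
qed

lemma W2_le_maps:
  fixes S S' :: "real^'d \<Rightarrow> real^'d"
  assumes "S \<in> borel \<rightarrow>\<^sub>M borel" "S' \<in> borel \<rightarrow>\<^sub>M borel" "distr lam borel S = \<mu>" "distr lam borel S' = \<nu>"
    and "\<mu> \<in> prob_densities" "\<nu> \<in> prob_densities"
  shows "ennreal ((W2 \<mu> \<nu>)\<^sup>2) \<le> (\<integral>\<^sup>+z. ennreal ((norm (S z - S' z))\<^sup>2) \<partial>lam)"
  using W2_cost_maps[OF assms(1,2)] W2_sq[OF W2_cost_finite[OF assms(5,6)]] assms(3,4) by simp

text \<open>
  A near-optimal coupling \<open>\<pi>\<close> is itself the image of \<open>\<mu>\<close> under a map \<open>R\<close> into pairs. If
  \<open>R\<close> takes a point \<open>x\<close> to a pair whose first component lies in the same small cell as \<open>x\<close>,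
  the distance from \<open>x\<close> to the second component of \<open>R x\<close> is nearly that between the two
  components, so \<open>snd \<circ> R \<circ> S\<close> has nearly the cost of \<open>\<pi>\<close>.
\<close>
lemma near_optimal_map:
  fixes S :: "real^'d \<Rightarrow> real^'d"
  assumes S[measurable]: "S \<in> borel \<rightarrow>\<^sub>M borel" "distr lam borel S = \<mu>"
    and P: "\<mu> \<in> prob_densities" "\<nu> \<in> prob_densities" and e: "0 < e"
  obtains S' where "S' \<in> borel \<rightarrow>\<^sub>M borel" "distr lam borel S' = \<nu>"
    "(\<integral>\<^sup>+z. ennreal ((norm (S z - S' z))\<^sup>2) \<partial>lam) \<le> ennreal ((W2 \<mu> \<nu>)\<^sup>2 + e)"
proof -
  let ?w = "(W2 \<mu> \<nu>)\<^sup>2"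
  have f[measurable]: "fst \<in> borel \<rightarrow>\<^sub>M (borel :: (real^'d) measure)" "snd \<in> borel \<rightarrow>\<^sub>M (borel :: (real^'d) measure)"
    by (intro borel_measurable_continuous_onI continuous_intros)+
  have w: "W2_cost \<mu> \<nu> = ennreal ?w" using W2_sq[OF W2_cost_finite[OF P]] by simp
  have "W2_cost \<mu> \<nu> < ennreal (?w + e/2)" unfolding w using e by (intro ennreal_lessI add_nonneg_pos) auto
  then obtain \<pi> where \<pi>: "\<pi> \<in> couplings \<mu> \<nu>"
    and c: "(\<integral>\<^sup>+p. ennreal ((norm (fst p - snd p))\<^sup>2) \<partial>\<pi>) < ennreal (?w + e/2)"
    unfolding W2_cost_def by (auto simp: INF_less_iff)
  have s\<pi>[measurable_cong]: "sets \<pi> = sets borel" and m1: "distr \<pi> borel fst = \<mu>" and m2: "distr \<pi> borel snd = \<nu>"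
    using \<pi> by (auto simp: couplings_def)
  have f\<pi>: "fst \<in> \<pi> \<rightarrow>\<^sub>M (borel :: (real^'d) measure)" "snd \<in> \<pi> \<rightarrow>\<^sub>M (borel :: (real^'d) measure)"
    using f by (simp_all add: measurable_cong_sets[OF s\<pi> refl])
  have sp: "space \<pi> = UNIV" using sets_eq_imp_space_eq[OF s\<pi>] by simp
  interpret \<mu>: prob_space \<mu> using prob_densities_facts[OF P(1)] by simp
  have s\<mu>[measurable_cong]: "sets \<mu> = sets borel" using prob_densities_facts[OF P(1)] by simp
  have p\<pi>: "prob_space \<pi>"
  proof (rule prob_spaceI)
    have "emeasure \<pi> (space \<pi>) = emeasure (distr \<pi> borel fst) UNIV"
      by (subst emeasure_distr) (auto simp: sp f\<pi>)
    then show "emeasure \<pi> (space \<pi>) = 1"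
      unfolding m1 using \<mu>.emeasure_space_1 sets_eq_imp_space_eq[OF s\<mu>] by simp
  qed
  \<comment> \<open>Weight in Young's inequality and size of the cells: enlarging the cost of \<open>\<pi>\<close> by the
    factor \<open>1 + a\<close> and moving points within their cells each add at most \<open>e/4\<close>.\<close>
  define a where "a = e / (4 * (?w + e/2 + 1))"
  have a: "0 < a" using e by (simp add: a_def add_nonneg_pos)
  have ac: "a * (?w + e/2) \<le> e/4"
  proof -
    have "a * (?w + e/2) \<le> a * (?w + e/2 + 1)" using a by (intro mult_left_mono) auto
    also have "\<dots> = e/4"
    proof -
      have "?w + e/2 + 1 > 0" using e by (simp add: add_nonneg_pos)
      then show ?thesis by (simp add: a_def field_simps)
    qed
    finally show ?thesis .
  qed
  define q where "q = 1 + 1/a"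
  define \<delta> where "\<delta> = sqrt (e / (4 * q))"
  have \<delta>: "0 < \<delta>" "(1 + 1/a) * \<delta>\<^sup>2 = e/4"
  proof -
    have "0 < q" using a by (simp add: q_def add_pos_pos)
    then show "0 < \<delta>" "(1 + 1/a) * \<delta>\<^sup>2 = e/4"
      unfolding q_def[symmetric] using e by (simp_all add: \<delta>_def)
  qed
  obtain J :: "real^'d \<Rightarrow> nat" where J[measurable]: "J \<in> borel \<rightarrow>\<^sub>M count_space UNIV"
    and Jd: "\<And>x y. J x = J y \<Longrightarrow> dist x y \<le> \<delta>" using small_cells[OF \<delta>(1)] by blast
  have law: "measure \<mu> {x. J x < j} = measure \<pi> {p. (J \<circ> fst) p < j}" for j
  proof -
    have "measure \<mu> {x. J x < j} = measure (distr \<pi> borel fst) {x. J x < j}" by (simp add: m1)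
    also have "\<dots> = measure \<pi> {p. (J \<circ> fst) p < j}"
      by (subst measure_distr) (auto simp: sp vimage_def f\<pi>)
    finally show ?thesis .
  qed
  obtain R where R[measurable]: "R \<in> borel \<rightarrow>\<^sub>M borel" and dR: "distr \<mu> borel R = \<pi>"
    and lab: "AE x in \<mu>. (J \<circ> fst) (R x) = J x"
    by (rule transport_map_with_labels[OF \<mu>.prob_space_axioms s\<mu> prob_densities_facts(3)[OF P(1)] p\<pi> s\<pi> J _ law])
       (auto simp: comp_def)
  have Sm[measurable]: "S \<in> lam \<rightarrow>\<^sub>M borel" by measurable
  show ?thesis
  proof (rule that[of "\<lambda>z. snd (R (S z))"])
    show "(\<lambda>z. snd (R (S z))) \<in> borel \<rightarrow>\<^sub>M borel" by measurable
    have "distr lam borel (\<lambda>z. snd (R (S z))) = distr (distr (distr lam borel S) borel R) borel snd"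
      by (subst distr_distr, measurable, subst distr_distr) (auto simp: comp_def)
    then show "distr lam borel (\<lambda>z. snd (R (S z))) = \<nu>" by (simp add: S dR m2)
    have "(\<integral>\<^sup>+z. ennreal ((norm (S z - snd (R (S z))))\<^sup>2) \<partial>lam)
        = (\<integral>\<^sup>+x. ennreal ((norm (x - snd (R x)))\<^sup>2) \<partial>\<mu>)"
      unfolding S(2)[symmetric] by (subst nn_integral_distr) auto
    also have "\<dots> \<le> (\<integral>\<^sup>+x. ennreal ((1 + 1/a) * \<delta>\<^sup>2) + ennreal (1 + a) * ennreal ((norm (fst (R x) - snd (R x)))\<^sup>2) \<partial>\<mu>)"
    proof (rule nn_integral_mono_AE)
      show "AE x in \<mu>. ennreal ((norm (x - snd (R x)))\<^sup>2)
          \<le> ennreal ((1 + 1/a) * \<delta>\<^sup>2) + ennreal (1 + a) * ennreal ((norm (fst (R x) - snd (R x)))\<^sup>2)"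
        using lab
      proof eventually_elim
        case (elim x)
        then have d: "norm (x - fst (R x)) \<le> \<delta>" using Jd[of x "fst (R x)"] by (simp add: dist_norm)
        have "norm (x - snd (R x)) \<le> norm (x - fst (R x)) + norm (fst (R x) - snd (R x))"
          using norm_triangle_ineq[of "x - fst (R x)" "fst (R x) - snd (R x)"] by simp
        then have "norm (x - snd (R x)) \<le> norm (fst (R x) - snd (R x)) + \<delta>" using d by simp
        then have "(norm (x - snd (R x)))\<^sup>2 \<le> (norm (fst (R x) - snd (R x)) + \<delta>)\<^sup>2" by (intro power_mono) auto
        also have "\<dots> \<le> (1 + a) * (norm (fst (R x) - snd (R x)))\<^sup>2 + (1 + 1/a) * \<delta>\<^sup>2" by (rule young_sq[OF a])
        finally have "ennreal ((norm (x - snd (R x)))\<^sup>2)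
            \<le> ennreal ((1 + 1/a) * \<delta>\<^sup>2 + (1 + a) * (norm (fst (R x) - snd (R x)))\<^sup>2)"
          by (intro ennreal_leI) simp
        then show ?case using a by (simp add: ennreal_plus ennreal_mult)
      qed
    qed
    also have "\<dots> = ennreal (e/4) + ennreal (1 + a) * (\<integral>\<^sup>+x. ennreal ((norm (fst (R x) - snd (R x)))\<^sup>2) \<partial>\<mu>)"
      unfolding \<delta> by (subst nn_integral_add) (auto simp: nn_integral_cmult \<mu>.emeasure_space_1)
    also have "(\<integral>\<^sup>+x. ennreal ((norm (fst (R x) - snd (R x)))\<^sup>2) \<partial>\<mu>) = (\<integral>\<^sup>+p. ennreal ((norm (fst p - snd p))\<^sup>2) \<partial>\<pi>)"
      unfolding dR[symmetric] by (subst nn_integral_distr) auto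
    also have "ennreal (e/4) + ennreal (1 + a) * \<dots> \<le> ennreal (e/4) + ennreal (1 + a) * ennreal (?w + e/2)"
      using c by (intro add_left_mono mult_left_mono) auto
    also have "\<dots> = ennreal (e/4 + (1 + a) * (?w + e/2))"
      using e a by (subst ennreal_mult[symmetric]) (auto simp: ennreal_plus)
    also have "\<dots> \<le> ennreal (?w + e)"
    proof (intro ennreal_leI)
      have "(1 + a) * (?w + e/2) = ?w + e/2 + a * (?w + e/2)" by (simp add: algebra_simps)
      then show "e/4 + (1 + a) * (?w + e/2) \<le> ?w + e" using ac e by linarith
    qed
    finally show "(\<integral>\<^sup>+z. ennreal ((norm (S z - snd (R (S z))))\<^sup>2) \<partial>lam) \<le> ennreal (?w + e)" .
  qed
qed

end

section \<open>Lipschitz continuity of the velocity field\<close>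

definition support :: "'a::metric_space measure \<Rightarrow> 'a set" where
  "support \<mu> = {x. \<forall>r>0. 0 < measure \<mu> (ball x r)}"

text \<open>
  By Lindeloef's theorem countably many null balls cover the complement of the support.
\<close>
lemma AE_in_support:
  fixes \<mu> :: "'a::{second_countable_topology, metric_space} measure"
  assumes "finite_measure \<mu>" "sets \<mu> = sets borel"
  shows "AE x in \<mu>. x \<in> support \<mu>"
proof -
  interpret finite_measure \<mu> by fact
  define F where "F = {ball x r | x r. 0 < r \<and> measure \<mu> (ball x r) = 0}"
  obtain F' where F': "F' \<subseteq> F" "countable F'" "\<Union>F' = \<Union>F"
    by (rule Lindelof[of F]) (auto simp: F_def)
  have "(\<Union>A\<in>F'. A) \<in> null_sets \<mu>"
  proof (rule null_sets_UN'[OF F'(2)])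
    fix A assume "A \<in> F'"
    then obtain x r where "A = ball x r" "measure \<mu> (ball x r) = 0" using F'(1) by (auto simp: F_def)
    moreover have "ball x r \<in> sets \<mu>" for x r by (simp add: assms(2))
    ultimately show "A \<in> null_sets \<mu>" by (intro null_setsI) (simp_all add: emeasure_eq_measure)
  qed
  then have "AE x in \<mu>. x \<notin> \<Union>F" using F'(3) AE_not_in by force
  then show ?thesis
  proof eventually_elim
    case (elim x)
    show ?case unfolding support_def
    proof (safe, rule ccontr)
      fix r :: real assume r: "0 < r" "\<not> 0 < measure \<mu> (ball x r)"
      then have "measure \<mu> (ball x r) = 0" using measure_nonneg[of \<mu> "ball x r"] by linarith
      then have "ball x r \<in> F" using r by (auto simp: F_def)
      then show False using elim r(1) by force
    qed
  qed
qed

text \<open>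
  McShane's formula, the largest extension of \<open>f\<close> from \<open>S\<close> with Lipschitz constant \<open>L\<close>.
\<close>
definition mcshane :: "real \<Rightarrow> 'a::metric_space set \<Rightarrow> ('a \<Rightarrow> real) \<Rightarrow> 'a \<Rightarrow> real" where
  "mcshane L S f x = (INF y\<in>S. f y + L * dist x y)"

context
  fixes L :: real and S :: "'a::metric_space set" and f :: "'a \<Rightarrow> real"
  assumes L: "0 \<le> L" and ne: "S \<noteq> {}"
    and lip: "\<And>x y. x \<in> S \<Longrightarrow> y \<in> S \<Longrightarrow> \<bar>f x - f y\<bar> \<le> L * dist x y"
begin

lemma mcshane_bdd: "bdd_below ((\<lambda>y. f y + L * dist x y) ` S)"
proof -
  obtain y0 where y0: "y0 \<in> S" using ne by auto
  show ?thesis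
  proof (rule bdd_belowI2[of _ "f y0 - L * dist x y0"])
    fix y assume y: "y \<in> S"
    have "L * dist y0 y \<le> L * dist x y0 + L * dist x y"
      using L dist_triangle3[of y0 y x] by (simp flip: distrib_left add: mult_left_mono)
    then show "f y0 - L * dist x y0 \<le> f y + L * dist x y" using lip[OF y0 y] by linarith
  qed
qed

lemma mcshane_le: "y \<in> S \<Longrightarrow> mcshane L S f x \<le> f y + L * dist x y"
  unfolding mcshane_def by (rule cINF_lower[OF mcshane_bdd])

lemma mcshane_extends: "x \<in> S \<Longrightarrow> mcshane L S f x = f x"
proof (rule antisym)
  assume x: "x \<in> S"
  show "mcshane L S f x \<le> f x" using mcshane_le[OF x, of x] by simp
  show "f x \<le> mcshane L S f x"
    unfolding mcshane_def
  proof (rule cINF_greatest[OF ne])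
    fix y assume "y \<in> S" then show "f x \<le> f y + L * dist x y" using lip[OF x, of y] by linarith
  qed
qed

lemma mcshane_lipschitz: "\<bar>mcshane L S f x - mcshane L S f x'\<bar> \<le> L * dist x x'"
proof -
  have *: "mcshane L S f x - L * dist x x' \<le> mcshane L S f x'" for x x'
  proof -
    have "mcshane L S f x - L * dist x x' \<le> (INF y\<in>S. f y + L * dist x' y)"
    proof (rule cINF_greatest[OF ne])
      fix y assume y: "y \<in> S"
      have "L * dist x y \<le> L * dist x x' + L * dist x' y"
        using L dist_triangle[of x y x'] by (simp flip: distrib_left add: mult_left_mono)
      then show "mcshane L S f x - L * dist x x' \<le> f y + L * dist x' y" using mcshane_le[OF y, of x] by linarith
    qed
    then show ?thesis by (simp add: mcshane_def)
  qed
  show ?thesis using *[of x x'] *[of x' x] by (simp add: abs_le_iff dist_commute)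
qed

end

locale lipschitz_velocity = reference_measure lam for lam :: "(real^'d) measure" +
  fixes v :: "(real^'d) measure \<Rightarrow> real^'d \<Rightarrow> real^'d" and C :: real
  assumes v_cont: "\<And>\<mu>. \<mu> \<in> prob_densities \<Longrightarrow> continuous_on UNIV (v \<mu>)"
    and C_pos: "0 < C"
    and v_lip: "\<And>S S'. S \<in> borel \<rightarrow>\<^sub>M borel \<Longrightarrow> S' \<in> borel \<rightarrow>\<^sub>M borel \<Longrightarrow>
        distr lam borel S \<in> prob_densities \<Longrightarrow> distr lam borel S' \<in> prob_densities \<Longrightarrow>
        (\<integral>\<^sup>+z. ennreal ((norm (v (distr lam borel S) (S z) - v (distr lam borel S') (S' z)))\<^sup>2) \<partial>lam)
        \<le> ennreal C * (\<integral>\<^sup>+z. ennreal ((norm (S z - S' z))\<^sup>2) \<partial>lam)"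
begin

lemma v_measurable: "\<mu> \<in> prob_densities \<Longrightarrow> v \<mu> \<in> borel_measurable borel"
  by (rule borel_measurable_continuous_onI[OF v_cont])

lemma near_optimal_pair:
  assumes "\<mu> \<in> prob_densities" "\<nu> \<in> prob_densities" "0 < e"
  obtains S S' where "S \<in> borel \<rightarrow>\<^sub>M borel" "S' \<in> borel \<rightarrow>\<^sub>M borel"
    "distr lam borel S = \<mu>" "distr lam borel S' = \<nu>"
    "(\<integral>\<^sup>+z. ennreal ((norm (S z - S' z))\<^sup>2) \<partial>lam) \<le> ennreal ((W2 \<mu> \<nu>)\<^sup>2 + e)"
    "(\<integral>\<^sup>+z. ennreal ((norm (v \<mu> (S z) - v \<nu> (S' z)))\<^sup>2) \<partial>lam) \<le> ennreal (C * ((W2 \<mu> \<nu>)\<^sup>2 + e))"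
proof -
  obtain S where S: "S \<in> borel \<rightarrow>\<^sub>M borel" "distr lam borel S = \<mu>"
    by (rule transport_map_exists[OF prob_densities_facts(1,2)[OF assms(1)]])
  obtain S' where S': "S' \<in> borel \<rightarrow>\<^sub>M borel" "distr lam borel S' = \<nu>"
    and c: "(\<integral>\<^sup>+z. ennreal ((norm (S z - S' z))\<^sup>2) \<partial>lam) \<le> ennreal ((W2 \<mu> \<nu>)\<^sup>2 + e)"
    by (rule near_optimal_map[OF S assms])
  have "(\<integral>\<^sup>+z. ennreal ((norm (v \<mu> (S z) - v \<nu> (S' z)))\<^sup>2) \<partial>lam)
      \<le> ennreal C * (\<integral>\<^sup>+z. ennreal ((norm (S z - S' z))\<^sup>2) \<partial>lam)"
    using v_lip[OF S(1) S'(1)] assms S(2) S'(2) by simp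
  also have "\<dots> \<le> ennreal C * ennreal ((W2 \<mu> \<nu>)\<^sup>2 + e)" using c by (intro mult_left_mono) auto
  also have "\<dots> = ennreal (C * ((W2 \<mu> \<nu>)\<^sup>2 + e))" using C_pos assms(3) by (simp add: ennreal_mult)
  finally show ?thesis using that S S' c by blast
qed

text \<open>
  Suppose that the bound fails at \<open>(x, y)\<close>. By continuity it fails on a product of two balls,
  which have positive mass and contain sets \<open>E1\<close> and \<open>E2\<close> of equal positive mass. A
  map \<open>\<phi>\<close> that exchanges these sets and fixes all other points preserves \<open>\<mu>\<close>, so \<open>S\<close> and
  \<open>\<phi> \<circ> S\<close> have the same law \<open>\<mu>\<close>. For this pair \<open>v_lip\<close> is an integrated form of the bound,
  contradicted by its strict failure on \<open>E1\<close> and \<open>E2\<close> and the equality elsewhere.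
\<close>
lemma v_lipschitz_on_support:
  assumes \<mu>: "\<mu> \<in> prob_densities" and x: "x \<in> support \<mu>" and y: "y \<in> support \<mu>"
  shows "norm (v \<mu> x - v \<mu> y) \<le> sqrt C * dist x y"
proof (rule ccontr)
  assume not: "\<not> norm (v \<mu> x - v \<mu> y) \<le> sqrt C * dist x y"
  note pd = prob_densities_facts[OF \<mu>]
  interpret \<mu>: prob_space \<mu> by (rule pd)
  have [measurable_cong]: "sets \<mu> = sets borel" by (rule pd)
  have sp: "space \<mu> = UNIV" using sets_eq_imp_space_eq[OF pd(2)] by simp
  have vm[measurable]: "v \<mu> \<in> borel_measurable borel" using v_measurable[OF \<mu>] .
  define Q where "Q = {p :: (real^'d) \<times> (real^'d). C * (dist (fst p) (snd p))\<^sup>2 < (norm (v \<mu> (fst p) - v \<mu> (snd p)))\<^sup>2}"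
  have sq: "(sqrt C * dist a b)\<^sup>2 = C * (dist a b)\<^sup>2" for a b :: "real^'d"
    using C_pos by (simp add: power_mult_distrib)
  have Q: "(a, b) \<in> Q \<longleftrightarrow> sqrt C * dist a b < norm (v \<mu> a - v \<mu> b)" for a b
  proof -
    have "(a, b) \<in> Q \<longleftrightarrow> (sqrt C * dist a b)\<^sup>2 < (norm (v \<mu> a - v \<mu> b))\<^sup>2" by (simp add: Q_def sq)
    also have "\<dots> \<longleftrightarrow> sqrt C * dist a b < norm (v \<mu> a - v \<mu> b)"
      using C_pos by (metis linorder_not_less mult_nonneg_nonneg norm_ge_zero power_mono power_strict_mono pos2 real_sqrt_ge_zero less_imp_le zero_le_dist)
    finally show ?thesis .
  qed
  have "open Q"
    unfolding Q_def
    by (intro open_Collect_less continuous_intros continuous_on_compose2[OF v_cont[OF \<mu>]]) auto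
  moreover have "(x, y) \<in> Q" using not by (simp add: Q)
  ultimately obtain A B where AB: "open A" "open B" "x \<in> A" "y \<in> B" "A \<times> B \<subseteq> Q"
    by (auto elim!: open_prod_elim)
  obtain r where r: "0 < r" "ball x r \<subseteq> A" "ball y r \<subseteq> B"
  proof -
    obtain r1 where "0 < r1" "ball x r1 \<subseteq> A" using AB open_contains_ball by blast
    moreover obtain r2 where "0 < r2" "ball y r2 \<subseteq> B" using AB open_contains_ball by blast
    ultimately show ?thesis by (intro that[of "min r1 r2"]) auto
  qed
  define m where "m = min (measure \<mu> (ball x r)) (measure \<mu> (ball y r))"
  have m: "0 < m" using x y r(1) by (simp add: m_def support_def)
  obtain E1 where E1[measurable]: "E1 \<in> sets borel" and E1': "E1 \<subseteq> ball x r" "measure \<mu> E1 = m"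
    using subset_of_given_measure[OF pd(1-3), of "ball x r" m] m by (auto simp: m_def)
  obtain E2 where E2[measurable]: "E2 \<in> sets borel" and E2': "E2 \<subseteq> ball y r" "measure \<mu> E2 = m"
    using subset_of_given_measure[OF pd(1-3), of "ball y r" m] m by (auto simp: m_def)
  have EQ: "E1 \<times> E2 \<subseteq> Q" using AB(5) r E1'(1) E2'(1) by blast
  have diag: "(a, a) \<notin> Q" for a by (simp add: Q)
  have disj: "E1 \<inter> E2 = {}" using EQ diag by blast
  have Qsym: "(a, b) \<in> Q \<Longrightarrow> (b, a) \<in> Q" for a b
    by (simp add: Q dist_commute norm_minus_commute)
  \<comment> \<open>The two labels are exchanged on \<open>E1\<close> and \<open>E2\<close>, so transport from one labelling to
    the other takes \<open>E1\<close> to \<open>E2\<close> and conversely.\<close>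
  define J :: "real^'d \<Rightarrow> nat" where "J a = (if a \<in> E1 then 1 else if a \<in> E2 then 2 else 0)" for a
  define K :: "real^'d \<Rightarrow> nat" where "K a = (if a \<in> E1 then 2 else if a \<in> E2 then 1 else 0)" for a
  have law: "measure \<mu> {a. J a < j} = measure \<mu> {a. K a < j}" for j
  proof -
    consider "j = 0" | "j = 1" | "j = 2" | "2 < j" by linarith
    then show ?thesis
    proof cases
      case 3
      have "{a. J a < 2} = UNIV - E2" "{a. K a < 2} = UNIV - E1"
        using disj by (auto simp: J_def K_def)
      then show ?thesis
        using 3 E1' E2' \<mu>.prob_compl[of E1] \<mu>.prob_compl[of E2] by (simp add: sp)
    qed (auto simp: J_def K_def intro!: arg_cong[where f="measure \<mu>"])
  qed
  obtain R where R[measurable]: "R \<in> borel \<rightarrow>\<^sub>M borel" and dR: "distr \<mu> borel R = \<mu>"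
    and lab: "AE a in \<mu>. K (R a) = J a"
    by (rule transport_map_with_labels[OF pd(1-3) pd(1,2) _ _ law]) (auto simp: J_def[abs_def] K_def[abs_def])
  define \<phi> where "\<phi> a = (if a \<in> E1 \<union> E2 then R a else a)" for a
  have [measurable]: "\<phi> \<in> borel \<rightarrow>\<^sub>M borel" unfolding \<phi>_def[abs_def] by measurable
  have RE: "AE a in \<mu>. (a \<in> E1 \<longleftrightarrow> R a \<in> E2) \<and> (a \<in> E2 \<longleftrightarrow> R a \<in> E1)"
    using lab by eventually_elim (use disj in \<open>auto simp: J_def K_def split: if_splits\<close>)
  have d\<phi>: "distr \<mu> borel \<phi> = \<mu>"
  proof (rule measure_eqI)
    fix A assume "A \<in> sets (distr \<mu> borel \<phi>)"
    then have A[measurable]: "A \<in> sets borel" by simp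
    have "emeasure (distr \<mu> borel \<phi>) A = emeasure \<mu> {a. \<phi> a \<in> A}"
      by (subst emeasure_distr) (auto simp: sp vimage_def)
    also have "\<dots> = emeasure \<mu> ({a. R a \<in> A \<inter> (E1 \<union> E2)} \<union> (A - (E1 \<union> E2)))"
      by (rule emeasure_eq_AE) (use RE in \<open>auto simp: \<phi>_def\<close>)
    also have "\<dots> = emeasure \<mu> ({a. R a \<in> A \<inter> (E1 \<union> E2)}) + emeasure \<mu> (A - (E1 \<union> E2))"
    proof -
      have "emeasure \<mu> ({a. R a \<in> A \<inter> (E1 \<union> E2)} \<union> (A - (E1 \<union> E2)))
          = emeasure \<mu> (({a. R a \<in> A \<inter> (E1 \<union> E2)} \<inter> (E1 \<union> E2)) \<union> (A - (E1 \<union> E2)))"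
        by (rule emeasure_eq_AE) (use RE in auto)
      also have "\<dots> = emeasure \<mu> ({a. R a \<in> A \<inter> (E1 \<union> E2)} \<inter> (E1 \<union> E2)) + emeasure \<mu> (A - (E1 \<union> E2))"
        by (rule plus_emeasure[symmetric]) auto
      also have "emeasure \<mu> ({a. R a \<in> A \<inter> (E1 \<union> E2)} \<inter> (E1 \<union> E2)) = emeasure \<mu> {a. R a \<in> A \<inter> (E1 \<union> E2)}"
        by (rule emeasure_eq_AE) (use RE in auto)
      finally show ?thesis .
    qed
    also have "emeasure \<mu> ({a. R a \<in> A \<inter> (E1 \<union> E2)}) = emeasure (distr \<mu> borel R) (A \<inter> (E1 \<union> E2))"
      by (subst emeasure_distr) (auto simp: sp vimage_def)
    also have "\<dots> = emeasure \<mu> (A \<inter> (E1 \<union> E2))" by (simp add: dR)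
    also have "\<dots> + emeasure \<mu> (A - (E1 \<union> E2)) = emeasure \<mu> A"
      by (subst plus_emeasure) (auto intro!: arg_cong[where f="emeasure \<mu>"])
    finally show "emeasure (distr \<mu> borel \<phi>) A = emeasure \<mu> A" .
  qed (simp add: pd)
  obtain S where S[measurable]: "S \<in> borel \<rightarrow>\<^sub>M borel" and dS: "distr lam borel S = \<mu>"
    by (rule transport_map_exists[OF pd(1,2)])
  have dS': "distr lam borel (\<lambda>z. \<phi> (S z)) = \<mu>"
  proof -
    have "distr lam borel (\<lambda>z. \<phi> (S z)) = distr (distr lam borel S) borel \<phi>"
      by (subst distr_distr) (auto simp: comp_def)
    then show ?thesis by (simp add: dS d\<phi>)
  qed
  let ?f = "\<lambda>a. ennreal (C * (dist a (\<phi> a))\<^sup>2)" and ?g = "\<lambda>a. ennreal ((norm (v \<mu> a - v \<mu> (\<phi> a)))\<^sup>2)"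
  have le: "(\<integral>\<^sup>+a. ?g a \<partial>\<mu>) \<le> (\<integral>\<^sup>+a. ?f a \<partial>\<mu>)"
  proof -
    have "(\<integral>\<^sup>+a. ?g a \<partial>\<mu>) = (\<integral>\<^sup>+z. ?g (S z) \<partial>lam)"
      by (subst dS[symmetric], subst nn_integral_distr) auto
    also have "\<dots> \<le> ennreal C * (\<integral>\<^sup>+z. ennreal ((norm (S z - \<phi> (S z)))\<^sup>2) \<partial>lam)"
      using v_lip[of S "\<lambda>z. \<phi> (S z)"] \<mu> by (simp add: dS dS')
    also have "\<dots> = (\<integral>\<^sup>+z. ?f (S z) \<partial>lam)"
      using C_pos by (subst nn_integral_cmult[symmetric]) (auto simp: ennreal_mult dist_norm)
    also have "\<dots> = (\<integral>\<^sup>+a. ?f a \<partial>\<mu>)"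
      using nn_integral_distr[of S lam borel ?f] by (simp add: dS)
    finally show ?thesis .
  qed
  have fin: "(\<integral>\<^sup>+a. ?f a \<partial>\<mu>) \<noteq> \<infinity>"
  proof -
    have "(\<integral>\<^sup>+a. ?f a \<partial>\<mu>) = ennreal C * (\<integral>\<^sup>+z. ennreal ((norm (S z - \<phi> (S z)))\<^sup>2) \<partial>lam)"
      using C_pos
      by (subst dS[symmetric], subst nn_integral_distr)
         (auto simp: ennreal_mult dist_norm nn_integral_cmult)
    also have "\<dots> < \<infinity>"
      using maps_sq_finite[of S "\<lambda>z. \<phi> (S z)"] \<mu> by (simp add: dS dS' ennreal_mult_less_top)
    finally show ?thesis by simp
  qed
  have strict: "AE a in \<mu>. a \<in> E1 \<longrightarrow> ?f a < ?g a"
    using RE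
  proof eventually_elim
    case (elim a)
    show ?case
    proof
      assume a: "a \<in> E1"
      then have "(a, \<phi> a) \<in> Q" using elim EQ by (auto simp: \<phi>_def)
      then have "C * (dist a (\<phi> a))\<^sup>2 < (norm (v \<mu> a - v \<mu> (\<phi> a)))\<^sup>2" by (simp add: Q_def)
      moreover have "0 \<le> C * (dist a (\<phi> a))\<^sup>2" using C_pos by simp
      ultimately show "?f a < ?g a" by (intro ennreal_lessI) linarith+
    qed
  qed
  have "(\<integral>\<^sup>+a. ?f a \<partial>\<mu>) < (\<integral>\<^sup>+a. ?g a \<partial>\<mu>)"
  proof (rule nn_integral_less)
    show "AE a in \<mu>. ?f a \<le> ?g a"
      using RE
    proof eventually_elim
      case (elim a)
      show ?case
      proof (cases "a \<in> E1 \<union> E2")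
        case True
        then have "(a, \<phi> a) \<in> Q" using elim EQ Qsym by (auto simp: \<phi>_def)
        then show ?thesis unfolding Q_def by (intro ennreal_leI) simp
      qed (simp add: \<phi>_def)
    qed
    show "\<not> (AE a in \<mu>. ?g a \<le> ?f a)"
    proof
      assume "AE a in \<mu>. ?g a \<le> ?f a"
      then have "AE a in \<mu>. a \<notin> E1" using strict by eventually_elim auto
      then have "measure \<mu> E1 = 0" by (subst \<mu>.prob_eq_0) auto
      then show False using m E1' by simp
    qed
  qed (use fin in auto)
  then show False using le by simp
qed

text \<open>
  The velocity is controlled on the support only. McShane's extension applies to its components,
  which costs the factor \<open>CARD('d)\<close> in the Lipschitz constant.
\<close>
definition ext :: "(real^'d) measure \<Rightarrow> real^'d \<Rightarrow> real^'d" where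
  "ext \<mu> x = (\<chi> i. mcshane (sqrt C) (support \<mu>) (\<lambda>y. v \<mu> y $ i) x)"

definition lipC :: real where "lipC = real CARD('d) * sqrt C"

lemma lipC_pos: "0 < lipC" using C_pos by (simp add: lipC_def)

lemma
  assumes \<mu>: "\<mu> \<in> prob_densities"
  shows support_nonempty: "support \<mu> \<noteq> {}"
    and v_component_lip: "\<And>x y. x \<in> support \<mu> \<Longrightarrow> y \<in> support \<mu> \<Longrightarrow> \<bar>v \<mu> x $ i - v \<mu> y $ i\<bar> \<le> sqrt C * dist x y"
    and AE_support: "AE x in \<mu>. x \<in> support \<mu>"
proof -
  interpret \<mu>: prob_space \<mu> by (rule prob_densities_facts[OF \<mu>])
  show *: "AE x in \<mu>. x \<in> support \<mu>"
    by (rule AE_in_support) (auto simp: \<mu>.finite_measure_axioms prob_densities_facts[OF \<mu>])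
  show "support \<mu> \<noteq> {}"
  proof
    assume "support \<mu> = {}"
    then have "AE x in \<mu>. False" using * by simp
    then show False by simp
  qed
  show "\<bar>v \<mu> x $ i - v \<mu> y $ i\<bar> \<le> sqrt C * dist x y" if "x \<in> support \<mu>" "y \<in> support \<mu>" for x y
    using order_trans[OF component_le_norm_cart[of "v \<mu> x - v \<mu> y" i] v_lipschitz_on_support[OF \<mu> that]]
    unfolding vector_minus_component .
qed

lemma ext_eq:
  assumes \<mu>: "\<mu> \<in> prob_densities" and x: "x \<in> support \<mu>"
  shows "ext \<mu> x = v \<mu> x"
proof -
  have "mcshane (sqrt C) (support \<mu>) (\<lambda>y. v \<mu> y $ i) x = v \<mu> x $ i" for i
    by (rule mcshane_extends[OF _ support_nonempty[OF \<mu>] v_component_lip[OF \<mu>] x]) (use C_pos in auto)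
  then show ?thesis unfolding ext_def vec_eq_iff vec_lambda_beta by blast
qed

lemma ext_AE:
  assumes \<mu>: "\<mu> \<in> prob_densities"
  shows "AE x in \<mu>. ext \<mu> x = v \<mu> x"
proof -
  have "AE x in \<mu>. x \<in> support \<mu>" by (rule AE_support[OF \<mu>])
  then show ?thesis by eventually_elim (rule ext_eq[OF \<mu>])
qed

lemma ext_lipschitz:
  assumes \<mu>: "\<mu> \<in> prob_densities"
  shows "norm (ext \<mu> x - ext \<mu> y) \<le> lipC * norm (x - y)"
proof -
  have "norm (ext \<mu> x - ext \<mu> y) \<le> (\<Sum>i\<in>UNIV. \<bar>(ext \<mu> x - ext \<mu> y) $ i\<bar>)" by (rule norm_le_l1_cart)
  also have "\<dots> \<le> (\<Sum>i\<in>(UNIV :: 'd set). sqrt C * dist x y)"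
  proof (rule sum_mono)
    fix i
    have "\<bar>mcshane (sqrt C) (support \<mu>) (\<lambda>y. v \<mu> y $ i) x - mcshane (sqrt C) (support \<mu>) (\<lambda>y. v \<mu> y $ i) y\<bar>
        \<le> sqrt C * dist x y"
      by (rule mcshane_lipschitz[OF _ support_nonempty[OF \<mu>] v_component_lip[OF \<mu>]]) (use C_pos in auto)
    then show "\<bar>(ext \<mu> x - ext \<mu> y) $ i\<bar> \<le> sqrt C * dist x y" by (simp add: ext_def)
  qed
  finally show ?thesis by (simp add: lipC_def dist_norm)
qed

lemma ext_continuous: "\<mu> \<in> prob_densities \<Longrightarrow> continuous_on UNIV (ext \<mu>)"
proof (rule continuous_onI)
  fix x :: "real^'d" and e :: real assume \<mu>: "\<mu> \<in> prob_densities" and e: "0 < e"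
  show "\<exists>d>0. \<forall>x'\<in>UNIV. dist x' x < d \<longrightarrow> dist (ext \<mu> x') (ext \<mu> x) \<le> e"
  proof (intro exI[of _ "e / lipC"] conjI ballI impI)
    fix x' assume "dist x' x < e / lipC"
    then have "lipC * norm (x' - x) \<le> e" using lipC_pos by (simp add: dist_norm field_simps)
    then show "dist (ext \<mu> x') (ext \<mu> x) \<le> e" using ext_lipschitz[OF \<mu>, of x' x] by (simp add: dist_norm)
  qed (use e lipC_pos in simp)
qed

text \<open>
  Couple \<open>\<mu>\<close> and \<open>\<nu>\<close> by maps \<open>S\<close> and \<open>S'\<close> of nearly optimal cost. Since
  \<open>ext \<mu> (S z) = v \<mu> (S z)\<close> almost everywhere, the difference at \<open>S' z\<close> splits into an increment
  of the Lipschitz map \<open>ext \<mu>\<close> and the variation of the velocity along the two maps. The cost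
  controls both.
\<close>
lemma ext_L2:
  assumes \<mu>: "\<mu> \<in> prob_densities" and \<nu>: "\<nu> \<in> prob_densities"
  shows "(\<integral>\<^sup>+x. ennreal ((norm (ext \<mu> x - v \<nu> x))\<^sup>2) \<partial>\<nu>) \<le> ennreal ((2 * lipC\<^sup>2 + 2 * C) * (W2 \<mu> \<nu>)\<^sup>2)"
proof (rule ennreal_le_epsilon)
  fix e :: real assume e: "0 < e"
  let ?k = "2 * lipC\<^sup>2 + 2 * C"
  have k: "0 < ?k" using C_pos lipC_pos by (simp add: add_pos_pos)
  have [measurable]: "ext \<mu> \<in> borel_measurable borel" using ext_continuous[OF \<mu>] by (rule borel_measurable_continuous_onI)
  have [measurable]: "v \<mu> \<in> borel_measurable borel" "v \<nu> \<in> borel_measurable borel" using v_measurable \<mu> \<nu> by auto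
  define e' where "e' = e / ?k"
  have e': "0 < e'" "?k * e' = e" using k e by (auto simp: e'_def)
  obtain S S' where S[measurable]: "S \<in> borel \<rightarrow>\<^sub>M borel" "S' \<in> borel \<rightarrow>\<^sub>M borel"
    and d: "distr lam borel S = \<mu>" "distr lam borel S' = \<nu>"
    and c: "(\<integral>\<^sup>+z. ennreal ((norm (S z - S' z))\<^sup>2) \<partial>lam) \<le> ennreal ((W2 \<mu> \<nu>)\<^sup>2 + e')"
    "(\<integral>\<^sup>+z. ennreal ((norm (v \<mu> (S z) - v \<nu> (S' z)))\<^sup>2) \<partial>lam) \<le> ennreal (C * ((W2 \<mu> \<nu>)\<^sup>2 + e'))"
    by (rule near_optimal_pair[OF \<mu> \<nu> e'(1)])
  have AE: "AE z in lam. ext \<mu> (S z) = v \<mu> (S z)"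
  proof -
    have *: "AE x in distr lam borel S. ext \<mu> x = v \<mu> x" unfolding d(1) by (rule ext_AE[OF \<mu>])
    show ?thesis by (rule AE_distrD[OF _ *]) measurable
  qed
  have "(\<integral>\<^sup>+x. ennreal ((norm (ext \<mu> x - v \<nu> x))\<^sup>2) \<partial>\<nu>)
      = (\<integral>\<^sup>+z. ennreal ((norm (ext \<mu> (S' z) - v \<nu> (S' z)))\<^sup>2) \<partial>lam)"
    by (subst d(2)[symmetric], subst nn_integral_distr) auto
  also have "\<dots> \<le> (\<integral>\<^sup>+z. ennreal (2 * lipC\<^sup>2) * ennreal ((norm (S z - S' z))\<^sup>2)
      + 2 * ennreal ((norm (v \<mu> (S z) - v \<nu> (S' z)))\<^sup>2) \<partial>lam)"
  proof (rule nn_integral_mono_AE)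
    show "AE z in lam. ennreal ((norm (ext \<mu> (S' z) - v \<nu> (S' z)))\<^sup>2)
        \<le> ennreal (2 * lipC\<^sup>2) * ennreal ((norm (S z - S' z))\<^sup>2)
          + 2 * ennreal ((norm (v \<mu> (S z) - v \<nu> (S' z)))\<^sup>2)"
      using AE
    proof eventually_elim
      case (elim z)
      have "norm (ext \<mu> (S' z) - ext \<mu> (S z)) \<le> lipC * norm (S z - S' z)"
        using ext_lipschitz[OF \<mu>, of "S' z" "S z"] by (simp add: norm_minus_commute)
      then have "(norm (ext \<mu> (S' z) - ext \<mu> (S z)))\<^sup>2 \<le> lipC\<^sup>2 * (norm (S z - S' z))\<^sup>2"
        by (metis power_mono norm_ge_zero power_mult_distrib)
      then have "(norm (ext \<mu> (S' z) - v \<nu> (S' z)))\<^sup>2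
          \<le> 2 * lipC\<^sup>2 * (norm (S z - S' z))\<^sup>2 + 2 * (norm (v \<mu> (S z) - v \<nu> (S' z)))\<^sup>2"
        using norm_add_sq_le[of "ext \<mu> (S' z) - ext \<mu> (S z)" "v \<mu> (S z) - v \<nu> (S' z)"] elim by simp
      then have "ennreal ((norm (ext \<mu> (S' z) - v \<nu> (S' z)))\<^sup>2)
          \<le> ennreal (2 * lipC\<^sup>2 * (norm (S z - S' z))\<^sup>2 + 2 * (norm (v \<mu> (S z) - v \<nu> (S' z)))\<^sup>2)"
        by (rule ennreal_leI)
      then show ?case by (simp add: ennreal_plus ennreal_mult)
    qed
  qed
  also have "\<dots> = ennreal (2 * lipC\<^sup>2) * (\<integral>\<^sup>+z. ennreal ((norm (S z - S' z))\<^sup>2) \<partial>lam)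
      + 2 * (\<integral>\<^sup>+z. ennreal ((norm (v \<mu> (S z) - v \<nu> (S' z)))\<^sup>2) \<partial>lam)"
    by (simp add: nn_integral_add nn_integral_cmult)
  also have "\<dots> \<le> ennreal (2 * lipC\<^sup>2) * ennreal ((W2 \<mu> \<nu>)\<^sup>2 + e') + 2 * ennreal (C * ((W2 \<mu> \<nu>)\<^sup>2 + e'))"
    using c by (intro add_mono mult_left_mono) auto
  also have "\<dots> = ennreal (2 * lipC\<^sup>2 * ((W2 \<mu> \<nu>)\<^sup>2 + e') + 2 * (C * ((W2 \<mu> \<nu>)\<^sup>2 + e')))"
    using e'(1) C_pos by (simp add: ennreal_plus ennreal_mult)
  also have "2 * lipC\<^sup>2 * ((W2 \<mu> \<nu>)\<^sup>2 + e') + 2 * (C * ((W2 \<mu> \<nu>)\<^sup>2 + e')) = ?k * (W2 \<mu> \<nu>)\<^sup>2 + ?k * e'"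
    by (simp add: algebra_simps)
  also have "ennreal (?k * (W2 \<mu> \<nu>)\<^sup>2 + ?k * e') = ennreal (?k * (W2 \<mu> \<nu>)\<^sup>2) + ennreal e"
    unfolding e'(2) using k e by (intro ennreal_plus) auto
  finally show "(\<integral>\<^sup>+x. ennreal ((norm (ext \<mu> x - v \<nu> x))\<^sup>2) \<partial>\<nu>) \<le> ennreal (?k * (W2 \<mu> \<nu>)\<^sup>2) + ennreal e" .
qed

text \<open>
  The infimum that defines the extension at \<open>x\<close> is nearly attained at some \<open>y\<close> in the support
  of \<open>\<mu>\<close>. If \<open>\<nu>\<close> is close to \<open>\<mu>\<close>, Markov's inequality for maps of nearly optimal cost finds a
  \<open>z\<close> such that \<open>S z\<close> is close to \<open>y\<close>, \<open>S' z\<close> lies in the support of \<open>\<nu>\<close> close to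
  \<open>S z\<close>, and the velocities there are close. Then \<open>S' z\<close> is nearly as good a competitor in the
  infimum for \<open>\<nu>\<close>. Semicontinuity of this kind makes the velocity a Borel function of time and
  space (\<open>V_measurable\<close>).
\<close>
lemma ext_upper_semicontinuous:
  assumes \<mu>: "\<mu> \<in> prob_densities" and lt: "ext \<mu> x $ i < c"
  obtains \<delta> where "0 < \<delta>"
    "\<And>\<nu> x'. \<nu> \<in> prob_densities \<Longrightarrow> W2 \<mu> \<nu> < \<delta> \<Longrightarrow> dist x x' < \<delta> \<Longrightarrow> ext \<nu> x' $ i < c"
proof -
  let ?L = "sqrt C"
  have L: "0 \<le> ?L" using C_pos by simp
  note pd = prob_densities_facts[OF \<mu>]
  have [measurable]: "v \<mu> \<in> borel_measurable borel" using v_measurable \<mu> by auto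
  have "(INF y\<in>support \<mu>. v \<mu> y $ i + ?L * dist x y) < c"
    using lt by (simp add: ext_def mcshane_def)
  then obtain y where y: "y \<in> support \<mu>" "v \<mu> y $ i + ?L * dist x y < c"
    using cINF_less_iff[OF support_nonempty[OF \<mu>] mcshane_bdd[OF L support_nonempty[OF \<mu>] v_component_lip[OF \<mu>]]]
    by blast
  define \<gamma> where "\<gamma> = c - (v \<mu> y $ i + ?L * dist x y)"
  have \<gamma>: "0 < \<gamma>" using y by (simp add: \<gamma>_def)
  obtain r0 where r0: "0 < r0" "\<And>a. dist a y < r0 \<Longrightarrow> dist (v \<mu> a) (v \<mu> y) < \<gamma>/4"
    using v_cont[OF \<mu>, unfolded continuous_on_iff, rule_format, of y "\<gamma>/4"] \<gamma> by auto
  define q where "q = ?L + 1"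
  have q: "0 < q" using C_pos by (simp add: q_def add_pos_pos)
  define r where "r = min r0 (\<gamma> / (8 * q))"
  have r: "0 < r" "r \<le> r0"
  proof -
    have "0 < \<gamma> / (8 * q)" using \<gamma> q by simp
    then show "0 < r" "r \<le> r0" using r0(1) unfolding r_def by auto
  qed
  have Lr: "?L * r \<le> \<gamma>/8"
  proof -
    have "?L * r \<le> q * r" using r by (intro mult_right_mono) (auto simp: q_def)
    also have "\<dots> \<le> q * (\<gamma> / (8 * q))" using q by (intro mult_left_mono) (auto simp: r_def)
    also have "\<dots> = \<gamma>/8" using q by simp
    finally show ?thesis .
  qed
  define m where "m = measure \<mu> (ball y r)"
  have m: "0 < m" using y r by (simp add: m_def support_def)
  \<comment> \<open>Markov's inequality bounds by \<open>\<delta>\<^sup>2 * Q\<close> the mass of the \<open>z\<close> at which the maps are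
    \<open>r\<close> apart or the velocities \<open>\<gamma>/4\<close> apart; \<open>\<delta>\<close> makes this less than \<open>m\<close>.\<close>
  define Q where "Q = 2 / r\<^sup>2 + 32 * C / \<gamma>\<^sup>2"
  have Q: "0 < Q" using r C_pos \<gamma> by (simp add: Q_def add_pos_pos)
  define \<delta> where "\<delta> = min r (sqrt (m / (2 * Q)))"
  have \<delta>: "0 < \<delta>" "\<delta> \<le> r" using r m Q by (auto simp: \<delta>_def)
  have \<delta>Q: "\<delta>\<^sup>2 * Q < m"
  proof -
    have "\<delta>\<^sup>2 \<le> (sqrt (m / (2 * Q)))\<^sup>2" using \<delta> by (intro power_mono) (auto simp: \<delta>_def)
    also have "\<dots> = m / (2 * Q)" using m Q by simp
    finally have "\<delta>\<^sup>2 * Q \<le> m / 2" using Q by (simp add: field_simps)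
    then show ?thesis using m by simp
  qed
  show ?thesis
  proof (rule that[OF \<delta>(1)])
    fix \<nu> x' assume \<nu>: "\<nu> \<in> prob_densities" and w: "W2 \<mu> \<nu> < \<delta>" and xx': "dist x x' < \<delta>"
    have [measurable]: "v \<nu> \<in> borel_measurable borel" using v_measurable \<nu> by auto
    have w0: "0 \<le> W2 \<mu> \<nu>" by (simp add: W2_def)
    have w2: "(W2 \<mu> \<nu>)\<^sup>2 + \<delta>\<^sup>2 \<le> 2 * \<delta>\<^sup>2" using w w0 by (simp add: power_mono)
    obtain S S' where S[measurable]: "S \<in> borel \<rightarrow>\<^sub>M borel" "S' \<in> borel \<rightarrow>\<^sub>M borel"
      and d: "distr lam borel S = \<mu>" "distr lam borel S' = \<nu>"
      and c1: "(\<integral>\<^sup>+z. ennreal ((norm (S z - S' z))\<^sup>2) \<partial>lam) \<le> ennreal ((W2 \<mu> \<nu>)\<^sup>2 + \<delta>\<^sup>2)"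
      and c2: "(\<integral>\<^sup>+z. ennreal ((norm (v \<mu> (S z) - v \<nu> (S' z)))\<^sup>2) \<partial>lam) \<le> ennreal (C * ((W2 \<mu> \<nu>)\<^sup>2 + \<delta>\<^sup>2))"
      by (rule near_optimal_pair[OF \<mu> \<nu>, of "\<delta>\<^sup>2"]) (use \<delta> in auto)
    have AE: "AE z in lam. S' z \<in> support \<nu>"
    proof -
      have "AE a in \<nu>. a \<in> support \<nu>" by (rule AE_support[OF \<nu>])
      then show ?thesis
        unfolding d(2)[symmetric] by (rule AE_distrD[rotated]) measurable
    qed
    have "\<exists>z. S z \<in> ball y r \<and> S' z \<in> support \<nu> \<and> norm (S z - S' z) < r \<and> norm (v \<mu> (S z) - v \<nu> (S' z)) < \<gamma>/4"
    proof (rule ccontr)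
      assume neg: "\<not> ?thesis"
      define A where "A = S -` ball y r"
      have Am: "A \<in> sets lam" using measurable_sets[OF S(1), of "ball y r"] by (simp add: A_def sets_lam)
      have "ennreal m = emeasure (distr lam borel S) (ball y r)"
        unfolding d(1) m_def using pd(1) by (simp add: prob_space.finite_measure finite_measure.emeasure_eq_measure)
      also have "\<dots> = emeasure lam A"
        unfolding A_def by (subst emeasure_distr) auto
      also have "\<dots> = (\<integral>\<^sup>+z. indicator A z \<partial>lam)" using Am by simp
      also have "\<dots> \<le> (\<integral>\<^sup>+z. ennreal (1/r\<^sup>2) * ennreal ((norm (S z - S' z))\<^sup>2)
          + ennreal (16/\<gamma>\<^sup>2) * ennreal ((norm (v \<mu> (S z) - v \<nu> (S' z)))\<^sup>2) \<partial>lam)"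
      proof (rule nn_integral_mono_AE)
        show "AE z in lam. indicator A z \<le> ennreal (1/r\<^sup>2) * ennreal ((norm (S z - S' z))\<^sup>2)
          + ennreal (16/\<gamma>\<^sup>2) * ennreal ((norm (v \<mu> (S z) - v \<nu> (S' z)))\<^sup>2)"
          using AE
        proof eventually_elim
          case (elim z)
          show ?case
          proof (cases "S z \<in> ball y r")
            case True
            let ?a = "norm (S z - S' z)" and ?b = "norm (v \<mu> (S z) - v \<nu> (S' z))"
            have "r \<le> ?a \<or> \<gamma>/4 \<le> ?b" using neg True elim by force
            then have "1 \<le> (1/r\<^sup>2) * ?a\<^sup>2 + (16/\<gamma>\<^sup>2) * ?b\<^sup>2"
            proof
              assume "r \<le> ?a"
              then have "1 \<le> (1/r\<^sup>2) * ?a\<^sup>2" using r by (simp add: power_mono)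
              then show ?thesis by (simp add: add_increasing2)
            next
              assume "\<gamma>/4 \<le> ?b"
              then have "(\<gamma>/4)\<^sup>2 \<le> ?b\<^sup>2" using \<gamma> by (intro power_mono) auto
              then have "1 \<le> (16/\<gamma>\<^sup>2) * ?b\<^sup>2" using \<gamma> by (simp add: power_divide field_simps)
              then show ?thesis by (simp add: add_increasing)
            qed
            then have "ennreal 1 \<le> ennreal ((1/r\<^sup>2) * ?a\<^sup>2 + (16/\<gamma>\<^sup>2) * ?b\<^sup>2)" by (rule ennreal_leI)
            also have "\<dots> = ennreal (1/r\<^sup>2) * ennreal (?a\<^sup>2) + ennreal (16/\<gamma>\<^sup>2) * ennreal (?b\<^sup>2)"
              using r \<gamma> by (subst ennreal_plus) (auto simp: ennreal_mult[symmetric])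
            finally show ?thesis using True by (simp add: A_def)
          qed (simp add: A_def)
        qed
      qed
      also have "\<dots> = ennreal (1/r\<^sup>2) * (\<integral>\<^sup>+z. ennreal ((norm (S z - S' z))\<^sup>2) \<partial>lam)
          + ennreal (16/\<gamma>\<^sup>2) * (\<integral>\<^sup>+z. ennreal ((norm (v \<mu> (S z) - v \<nu> (S' z)))\<^sup>2) \<partial>lam)"
        by (simp add: nn_integral_add nn_integral_cmult)
      also have "\<dots> \<le> ennreal (1/r\<^sup>2) * ennreal (2 * \<delta>\<^sup>2) + ennreal (16/\<gamma>\<^sup>2) * ennreal (C * (2 * \<delta>\<^sup>2))"
        using w2 C_pos
        by (intro add_mono mult_left_mono order_trans[OF c1] order_trans[OF c2] ennreal_leI) auto
      also have "\<dots> = ennreal ((1/r\<^sup>2) * (2 * \<delta>\<^sup>2) + (16/\<gamma>\<^sup>2) * (C * (2 * \<delta>\<^sup>2)))"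
        using C_pos by (simp add: ennreal_mult[symmetric] ennreal_plus[symmetric] del: ennreal_plus)
      also have "(1/r\<^sup>2) * (2 * \<delta>\<^sup>2) + (16/\<gamma>\<^sup>2) * (C * (2 * \<delta>\<^sup>2)) = \<delta>\<^sup>2 * Q"
        by (simp add: Q_def algebra_simps)
      finally have "m \<le> \<delta>\<^sup>2 * Q" using Q by (simp add: ennreal_le_iff)
      then show False using \<delta>Q by simp
    qed
    then obtain z where z: "S z \<in> ball y r" "S' z \<in> support \<nu>" "norm (S z - S' z) < r"
      "norm (v \<mu> (S z) - v \<nu> (S' z)) < \<gamma>/4" by blast
    have "ext \<nu> x' $ i \<le> v \<nu> (S' z) $ i + ?L * dist x' (S' z)"
      unfolding ext_def
      using mcshane_le[OF L support_nonempty[OF \<nu>] v_component_lip[OF \<nu>] z(2)] by simp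
    moreover have "v \<nu> (S' z) $ i \<le> v \<mu> y $ i + \<gamma>/2"
    proof -
      have "\<bar>v \<nu> (S' z) $ i - v \<mu> (S z) $ i\<bar> < \<gamma>/4"
        using component_le_norm_cart[of "v \<mu> (S z) - v \<nu> (S' z)" i] z(4) by (simp add: abs_minus_commute)
      moreover have "\<bar>v \<mu> (S z) $ i - v \<mu> y $ i\<bar> < \<gamma>/4"
        using component_le_norm_cart[of "v \<mu> (S z) - v \<mu> y" i] r0(2)[of "S z"] z(1) r
        by (simp add: dist_norm dist_commute) (simp add: norm_minus_commute)
      ultimately show ?thesis by linarith
    qed
    moreover have "?L * dist x' (S' z) \<le> ?L * dist x y + 3 * (?L * r)"
    proof -
      have "dist x' (S' z) \<le> dist x x' + dist x y + dist y (S z) + dist (S z) (S' z)"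
        using dist_triangle[of x' "S' z" x] dist_triangle[of x "S' z" y] dist_triangle[of y "S' z" "S z"]
        by (simp add: dist_commute)
      also have "\<dots> \<le> dist x y + 3 * r"
      proof -
        have "dist (S z) (S' z) < r" "dist y (S z) < r" using z(1,3) by (simp_all add: dist_norm)
        then show ?thesis using xx' \<delta> by linarith
      qed
      finally have "?L * dist x' (S' z) \<le> ?L * (dist x y + 3 * r)" using L by (intro mult_left_mono)
      then show ?thesis by (simp add: algebra_simps)
    qed
    moreover have "v \<mu> y $ i + ?L * dist x y = c - \<gamma>" by (simp add: \<gamma>_def)
    ultimately show "ext \<nu> x' $ i < c" using Lr \<gamma> by linarith
  qed
qed

end

section \<open>The velocity along a curve of measures\<close>

lemma locally_bounded_imp_bounded:
  fixes f :: "'a::metric_space \<Rightarrow> real"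
  assumes S: "compact S"
    and loc: "\<And>t. t \<in> S \<Longrightarrow> \<exists>d>0. \<exists>B. \<forall>s\<in>S. dist s t < d \<longrightarrow> f s \<le> B"
  shows "\<exists>B. \<forall>s\<in>S. f s \<le> B"
proof -
  obtain d B where d: "\<And>t. t \<in> S \<Longrightarrow> 0 < d t" and B: "\<And>t s. t \<in> S \<Longrightarrow> s \<in> S \<Longrightarrow> dist s t < d t \<Longrightarrow> f s \<le> B t"
    using loc by metis
  obtain T where T: "T \<subseteq> S" "finite T" "S \<subseteq> (\<Union>t\<in>T. ball t (d t))"
    by (rule compactE_image[OF S, of S "\<lambda>t. ball t (d t)"]) (use d in auto)
  show ?thesis
  proof (intro exI[of _ "Max (insert 0 (B ` T))"] ballI)
    fix s assume s: "s \<in> S"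
    then obtain t where "t \<in> T" "dist s t < d t" using T(3) by (force simp: dist_commute)
    then have "f s \<le> B t" "B t \<in> B ` T" using B s T(1) by auto
    then show "f s \<le> Max (insert 0 (B ` T))" using T(2) by (meson Max_ge finite_imageI finite_insert insertCI order_trans)
  qed
qed

lemma compact_support_bounded:
  fixes g :: "'a::euclidean_space \<Rightarrow> real"
  assumes g: "continuous_on UNIV g" and R: "bounded {x. g x \<noteq> 0}"
  obtains B where "\<And>x. \<bar>g x\<bar> \<le> B"
proof -
  obtain R where R: "\<And>x. g x \<noteq> 0 \<Longrightarrow> norm x \<le> R" using R by (auto simp: bounded_iff)
  have "compact (g ` cball 0 R)"
    using continuous_on_subset[OF g] by (intro compact_continuous_image) auto
  then have "bounded (g ` cball 0 R)" by (rule compact_imp_bounded)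
  then obtain B0 where B0: "\<forall>y\<in>g ` cball 0 R. norm y \<le> B0" unfolding bounded_iff by blast
  show ?thesis
  proof (rule that[of "max 0 B0"])
    fix x show "\<bar>g x\<bar> \<le> max 0 B0"
      using B0 R[of x] by (cases "g x = 0") (auto simp: le_max_iff_disj)
  qed
qed

lemma measurable_vecI:
  fixes f :: "'a \<Rightarrow> real^'n"
  assumes "\<And>i. (\<lambda>x. f x $ i) \<in> borel_measurable M"
  shows "f \<in> borel_measurable M"
proof -
  have "(\<lambda>x. f x \<bullet> b) \<in> borel_measurable M" if b: "b \<in> Basis" for b
  proof -
    obtain i where "b = axis i 1" using b by (auto simp: Basis_vec_def)
    then show ?thesis using assms[of i] by (simp add: inner_axis)
  qed
  then show ?thesis using borel_measurable_euclidean_space by blast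
qed

context reference_measure
begin

lemma W2_sym_le:
  fixes \<mu> \<nu> :: "(real^'d) measure"
  assumes \<mu>: "\<mu> \<in> prob_densities" and \<nu>: "\<nu> \<in> prob_densities"
  shows "(W2 \<nu> \<mu>)\<^sup>2 \<le> (W2 \<mu> \<nu>)\<^sup>2"
proof (rule field_le_epsilon)
  fix e :: real assume e: "0 < e"
  obtain S where S: "S \<in> borel \<rightarrow>\<^sub>M borel" "distr lam borel S = \<mu>"
    by (rule transport_map_exists[OF prob_densities_facts(1,2)[OF \<mu>]])
  obtain S' where S': "S' \<in> borel \<rightarrow>\<^sub>M borel" "distr lam borel S' = \<nu>"
    and c: "(\<integral>\<^sup>+z. ennreal ((norm (S z - S' z))\<^sup>2) \<partial>lam) \<le> ennreal ((W2 \<mu> \<nu>)\<^sup>2 + e)"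
    by (rule near_optimal_map[OF S \<mu> \<nu> e])
  have "ennreal ((W2 \<nu> \<mu>)\<^sup>2) \<le> (\<integral>\<^sup>+z. ennreal ((norm (S' z - S z))\<^sup>2) \<partial>lam)"
    by (rule W2_le_maps[OF S'(1) S(1) S'(2) S(2) \<nu> \<mu>])
  also have "\<dots> \<le> ennreal ((W2 \<mu> \<nu>)\<^sup>2 + e)" using c by (simp add: norm_minus_commute)
  finally show "(W2 \<nu> \<mu>)\<^sup>2 \<le> (W2 \<mu> \<nu>)\<^sup>2 + e" using e by (subst (asm) ennreal_le_iff) auto
qed

lemma W2_sym:
  fixes \<mu> \<nu> :: "(real^'d) measure"
  assumes \<mu>: "\<mu> \<in> prob_densities" and \<nu>: "\<nu> \<in> prob_densities"
  shows "W2 \<nu> \<mu> = W2 \<mu> \<nu>"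
proof -
  have "(W2 \<nu> \<mu>)\<^sup>2 = (W2 \<mu> \<nu>)\<^sup>2" using W2_sym_le[OF \<mu> \<nu>] W2_sym_le[OF \<nu> \<mu>] by simp
  moreover have "0 \<le> W2 \<nu> \<mu>" "0 \<le> W2 \<mu> \<nu>" by (simp_all add: W2_def)
  ultimately show ?thesis by (simp add: power2_eq_iff_nonneg)
qed

text \<open>
  A substitute for the triangle inequality, obtained from two maps of nearly optimal cost that
  start from one representation of \<open>\<kappa>\<close>, and from \<open>(a + b)\<^sup>2 \<le> 2 a\<^sup>2 + 2 b\<^sup>2\<close>.
\<close>
lemma W2_quasi_triangle:
  fixes \<mu> \<nu> \<kappa> :: "(real^'d) measure"
  assumes \<mu>: "\<mu> \<in> prob_densities" and \<nu>: "\<nu> \<in> prob_densities" and \<kappa>: "\<kappa> \<in> prob_densities"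
  shows "(W2 \<mu> \<nu>)\<^sup>2 \<le> 2 * (W2 \<mu> \<kappa>)\<^sup>2 + 2 * (W2 \<nu> \<kappa>)\<^sup>2"
proof (rule field_le_epsilon)
  fix e :: real assume e: "0 < e"
  then have e4: "0 < e/4" by simp
  obtain S where S: "S \<in> borel \<rightarrow>\<^sub>M borel" "distr lam borel S = \<kappa>"
    by (rule transport_map_exists[OF prob_densities_facts(1,2)[OF \<kappa>]])
  obtain S1 where S1: "S1 \<in> borel \<rightarrow>\<^sub>M borel" "distr lam borel S1 = \<mu>"
    and c1: "(\<integral>\<^sup>+z. ennreal ((norm (S z - S1 z))\<^sup>2) \<partial>lam) \<le> ennreal ((W2 \<kappa> \<mu>)\<^sup>2 + e/4)"
    by (rule near_optimal_map[OF S \<kappa> \<mu> e4])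
  obtain S2 where S2: "S2 \<in> borel \<rightarrow>\<^sub>M borel" "distr lam borel S2 = \<nu>"
    and c2: "(\<integral>\<^sup>+z. ennreal ((norm (S z - S2 z))\<^sup>2) \<partial>lam) \<le> ennreal ((W2 \<kappa> \<nu>)\<^sup>2 + e/4)"
    by (rule near_optimal_map[OF S \<kappa> \<nu> e4])
  note [measurable] = S(1) S1(1) S2(1)
  have "ennreal ((W2 \<mu> \<nu>)\<^sup>2) \<le> (\<integral>\<^sup>+z. ennreal ((norm (S1 z - S2 z))\<^sup>2) \<partial>lam)"
    by (rule W2_le_maps[OF S1(1) S2(1) S1(2) S2(2) \<mu> \<nu>])
  also have "\<dots> \<le> (\<integral>\<^sup>+z. 2 * ennreal ((norm (S z - S1 z))\<^sup>2) + 2 * ennreal ((norm (S z - S2 z))\<^sup>2) \<partial>lam)"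
  proof (intro nn_integral_mono)
    fix z
    have "(norm (S1 z - S2 z))\<^sup>2 \<le> 2 * (norm (S z - S1 z))\<^sup>2 + 2 * (norm (S z - S2 z))\<^sup>2"
      using norm_add_sq_le[of "S1 z - S z" "S z - S2 z"] by (simp add: norm_minus_commute)
    then have "ennreal ((norm (S1 z - S2 z))\<^sup>2) \<le> ennreal (2 * (norm (S z - S1 z))\<^sup>2 + 2 * (norm (S z - S2 z))\<^sup>2)"
      by (rule ennreal_leI)
    then show "ennreal ((norm (S1 z - S2 z))\<^sup>2) \<le> 2 * ennreal ((norm (S z - S1 z))\<^sup>2) + 2 * ennreal ((norm (S z - S2 z))\<^sup>2)"
      by (simp add: ennreal_plus ennreal_mult)
  qed
  also have "\<dots> = 2 * (\<integral>\<^sup>+z. ennreal ((norm (S z - S1 z))\<^sup>2) \<partial>lam) + 2 * (\<integral>\<^sup>+z. ennreal ((norm (S z - S2 z))\<^sup>2) \<partial>lam)"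
    by (simp add: nn_integral_add nn_integral_cmult)
  also have "\<dots> \<le> 2 * ennreal ((W2 \<kappa> \<mu>)\<^sup>2 + e/4) + 2 * ennreal ((W2 \<kappa> \<nu>)\<^sup>2 + e/4)"
    using c1 c2 by (intro add_mono mult_left_mono) auto
  also have "\<dots> = ennreal (2 * ((W2 \<kappa> \<mu>)\<^sup>2 + e/4) + 2 * ((W2 \<kappa> \<nu>)\<^sup>2 + e/4))"
  proof -
    have "2 * ennreal a = ennreal (2 * a)" if "0 \<le> a" for a using that by (simp add: ennreal_mult)
    then show ?thesis using e by (simp add: ennreal_plus[symmetric] del: ennreal_plus)
  qed
  finally have "(W2 \<mu> \<nu>)\<^sup>2 \<le> 2 * ((W2 \<kappa> \<mu>)\<^sup>2 + e/4) + 2 * ((W2 \<kappa> \<nu>)\<^sup>2 + e/4)"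
    using e by (subst (asm) ennreal_le_iff) auto
  then show "(W2 \<mu> \<nu>)\<^sup>2 \<le> 2 * (W2 \<mu> \<kappa>)\<^sup>2 + 2 * (W2 \<nu> \<kappa>)\<^sup>2 + e"
    unfolding W2_sym[OF \<mu> \<kappa>] W2_sym[OF \<nu> \<kappa>] by simp
qed

end

text \<open>
  A weak solution of the continuity equation with velocity \<open>v (\<rho> t)\<close>, continuous in \<open>W2\<close>.
\<close>
locale continuity_equation = lipschitz_velocity lam v C
  for lam :: "(real^'d) measure" and v :: "(real^'d) measure \<Rightarrow> real^'d \<Rightarrow> real^'d" and C :: real +
  fixes \<tau> :: real and \<rho> :: "real \<Rightarrow> (real^'d) measure"
  assumes \<tau>: "0 \<le> \<tau>"
    and \<rho>_P: "\<And>t. t \<in> {0..\<tau>} \<Longrightarrow> \<rho> t \<in> prob_densities"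
    and \<rho>_cont: "\<And>t. t \<in> {0..\<tau>} \<Longrightarrow> ((\<lambda>s. W2 (\<rho> s) (\<rho> t)) \<longlongrightarrow> 0) (at t within {0..\<tau>})"
    and \<rho>_weak: "\<And>\<phi> t. C1 \<phi> \<Longrightarrow> bounded {x. \<phi> x \<noteq> 0} \<Longrightarrow> t \<in> {0..\<tau>} \<Longrightarrow>
        ((\<lambda>s. \<integral>x. \<phi> x \<partial>\<rho> s) has_real_derivative (\<integral>x. nabla \<phi> x \<bullet> v (\<rho> t) x \<partial>\<rho> t)) (at t within {0..\<tau>})"
begin

text \<open>
  Freezing time outside \<open>{0..\<tau>}\<close> defines the velocity for all real times.
\<close>
definition clamp_time :: "real \<Rightarrow> real" where "clamp_time s = max 0 (min \<tau> s)"

lemma clamp_time_in: "clamp_time s \<in> {0..\<tau>}" and clamp_time_id: "s \<in> {0..\<tau>} \<Longrightarrow> clamp_time s = s"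
  and clamp_time_dist: "\<bar>clamp_time s - clamp_time t\<bar> \<le> \<bar>s - t\<bar>"
  using \<tau> by (auto simp: clamp_time_def)

definition V :: "real \<Rightarrow> real^'d \<Rightarrow> real^'d" where "V s = ext (\<rho> (clamp_time s))"

lemma W2_continuous:
  assumes "t \<in> {0..\<tau>}" "0 < e"
  obtains d where "0 < d" "\<And>s. s \<in> {0..\<tau>} \<Longrightarrow> \<bar>s - t\<bar> < d \<Longrightarrow> W2 (\<rho> s) (\<rho> t) < e"
proof -
  have "eventually (\<lambda>s. W2 (\<rho> s) (\<rho> t) < e) (at t within {0..\<tau>})"
    using order_tendstoD(2)[OF \<rho>_cont[OF assms(1)] assms(2)] .
  then obtain d where d: "0 < d" "\<And>s. s \<in> {0..\<tau>} \<Longrightarrow> s \<noteq> t \<Longrightarrow> \<bar>s - t\<bar> < d \<Longrightarrow> W2 (\<rho> s) (\<rho> t) < e"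
    unfolding eventually_at by (auto simp: dist_real_def)
  have "W2 (\<rho> t) (\<rho> t) < e"
  proof -
    obtain S where S: "S \<in> borel \<rightarrow>\<^sub>M borel" "distr lam borel S = \<rho> t"
      by (rule transport_map_exists[OF prob_densities_facts(1,2)[OF \<rho>_P[OF assms(1)]]])
    have "(W2 (\<rho> t) (\<rho> t))\<^sup>2 \<le> 0"
      using W2_le_maps[OF S(1) S(1) S(2) S(2) \<rho>_P \<rho>_P] assms(1) by simp
    then show ?thesis using assms(2) by simp
  qed
  then show ?thesis using d by (intro that[of d]) auto
qed

lemma V_lipschitz: "norm (V s x - V s y) \<le> lipC * norm (x - y)"
  unfolding V_def by (rule ext_lipschitz[OF \<rho>_P[OF clamp_time_in]])

lemma V_AE: "s \<in> {0..\<tau>} \<Longrightarrow> AE x in \<rho> s. V s x = v (\<rho> s) x"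
  unfolding V_def by (simp add: clamp_time_id ext_AE[OF \<rho>_P])

text \<open>
  Each component is upper semicontinuous in time and space, as the curve is continuous in
  \<open>W2\<close>.
\<close>
lemma V_measurable: "(\<lambda>p. V (fst p) (snd p)) \<in> borel_measurable borel"
proof (intro measurable_vecI borel_measurableI_less)
  fix i c
  have "open {p. V (fst p) (snd p) $ i < c}"
  proof (subst open_prod_def, safe)
    fix s x assume "V (fst (s, x)) (snd (s, x)) $ i < c"
    then have "ext (\<rho> (clamp_time s)) x $ i < c" by (simp add: V_def)
    then obtain \<delta> where \<delta>: "0 < \<delta>" "\<And>\<nu> x'. \<nu> \<in> prob_densities \<Longrightarrow> W2 (\<rho> (clamp_time s)) \<nu> < \<delta> \<Longrightarrow> dist x x' < \<delta> \<Longrightarrow> ext \<nu> x' $ i < c"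
      by (rule ext_upper_semicontinuous[OF \<rho>_P[OF clamp_time_in]]) blast
    obtain d where d: "0 < d" "\<And>r. r \<in> {0..\<tau>} \<Longrightarrow> \<bar>r - clamp_time s\<bar> < d \<Longrightarrow> W2 (\<rho> r) (\<rho> (clamp_time s)) < \<delta>"
      by (rule W2_continuous[OF clamp_time_in \<delta>(1)]) blast
    show "\<exists>A B. open A \<and> open B \<and> (s, x) \<in> A \<times> B \<and> A \<times> B \<subseteq> {p. V (fst p) (snd p) $ i < c}"
    proof (intro exI[of _ "ball s d"] exI[of _ "ball x \<delta>"] conjI subsetI)
      fix p assume p: "p \<in> ball s d \<times> ball x \<delta>"
      let ?r = "clamp_time (fst p)"
      have "\<bar>?r - clamp_time s\<bar> < d"
        using clamp_time_dist[of "fst p" s] p by (auto simp: dist_real_def)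
      then have "W2 (\<rho> ?r) (\<rho> (clamp_time s)) < \<delta>" using d(2) clamp_time_in by blast
      then have "W2 (\<rho> (clamp_time s)) (\<rho> ?r) < \<delta>" using W2_sym \<rho>_P clamp_time_in by metis
      then show "p \<in> {p. V (fst p) (snd p) $ i < c}"
        using \<delta>(2)[OF \<rho>_P[OF clamp_time_in]] p by (auto simp: V_def)
    qed (use d \<delta> in auto)
  qed
  then show "{p \<in> space borel. V (fst p) (snd p) $ i < c} \<in> sets borel" by simp
qed

lemma W2_uniformly_continuous:
  assumes "0 < e"
  obtains d where "0 < d" "\<And>r s. r \<in> {0..\<tau>} \<Longrightarrow> s \<in> {0..\<tau>} \<Longrightarrow> \<bar>r - s\<bar> < d \<Longrightarrow> (W2 (\<rho> r) (\<rho> s))\<^sup>2 < e"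
proof -
  let ?I = "{0..\<tau>}"
  have "\<exists>d>0. \<forall>s\<in>?I. \<bar>s - t\<bar> < d \<longrightarrow> W2 (\<rho> s) (\<rho> t) < sqrt (e/4)" if t: "t \<in> ?I" for t
    by (rule W2_continuous[OF t, of "sqrt (e/4)"]) (use assms in auto)
  then obtain d where d: "\<And>t. t \<in> ?I \<Longrightarrow> 0 < d t"
    "\<And>t s. t \<in> ?I \<Longrightarrow> s \<in> ?I \<Longrightarrow> \<bar>s - t\<bar> < d t \<Longrightarrow> W2 (\<rho> s) (\<rho> t) < sqrt (e/4)" by metis
  obtain \<delta> where \<delta>: "0 < \<delta>" "\<And>T. T \<subseteq> ?I \<Longrightarrow> diameter T < \<delta> \<Longrightarrow> \<exists>B\<in>(\<lambda>t. ball t (d t)) ` ?I. T \<subseteq> B"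
  proof (rule Lebesgue_number_lemma[of ?I "(\<lambda>t. ball t (d t)) ` ?I"])
    show "(\<lambda>t. ball t (d t)) ` ?I \<noteq> {}" using \<tau> by simp
    show "?I \<subseteq> \<Union> ((\<lambda>t. ball t (d t)) ` ?I)" using d(1) by (meson UN_I centre_in_ball subsetI)
  qed auto
  show ?thesis
  proof (rule that[OF \<delta>(1)])
    fix r s assume rs: "r \<in> ?I" "s \<in> ?I" "\<bar>r - s\<bar> < \<delta>"
    have "diameter {r, s} \<le> \<bar>r - s\<bar>"
      by (rule diameter_le) auto
    then obtain t where t: "t \<in> ?I" "{r, s} \<subseteq> ball t (d t)" using \<delta>(2)[of "{r, s}"] rs by auto
    have W: "(W2 (\<rho> u) (\<rho> t))\<^sup>2 < e/4" if "u \<in> {r, s}" for u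
    proof -
      have "W2 (\<rho> u) (\<rho> t) < sqrt (e/4)" using d(2)[of t u] t that rs by (auto simp: dist_real_def abs_minus_commute)
      then have "(W2 (\<rho> u) (\<rho> t))\<^sup>2 < (sqrt (e/4))\<^sup>2" by (intro power_strict_mono) (auto simp: W2_def)
      then show ?thesis using assms by simp
    qed
    have "(W2 (\<rho> r) (\<rho> s))\<^sup>2 \<le> 2 * (W2 (\<rho> r) (\<rho> t))\<^sup>2 + 2 * (W2 (\<rho> s) (\<rho> t))\<^sup>2"
      by (rule W2_quasi_triangle) (use rs t \<rho>_P in auto)
    then show "(W2 (\<rho> r) (\<rho> s))\<^sup>2 < e" using W[of r] W[of s] by simp
  qed
qed

lemma W2_bounded: obtains B where "0 \<le> B" "\<And>s. s \<in> {0..\<tau>} \<Longrightarrow> (W2 (\<rho> s) (\<rho> 0))\<^sup>2 \<le> B"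
proof -
  have "\<exists>B. \<forall>s\<in>{0..\<tau>}. (W2 (\<rho> s) (\<rho> 0))\<^sup>2 \<le> B"
  proof (rule locally_bounded_imp_bounded[where f="\<lambda>s. (W2 (\<rho> s) (\<rho> 0))\<^sup>2"])
    fix t assume t: "t \<in> {0..\<tau>}"
    obtain d where d: "0 < d" "\<And>s. s \<in> {0..\<tau>} \<Longrightarrow> \<bar>s - t\<bar> < d \<Longrightarrow> W2 (\<rho> s) (\<rho> t) < 1"
      by (rule W2_continuous[OF t, of 1]) auto
    have "\<forall>s\<in>{0..\<tau>}. dist s t < d \<longrightarrow> (W2 (\<rho> s) (\<rho> 0))\<^sup>2 \<le> 2 + 2 * (W2 (\<rho> 0) (\<rho> t))\<^sup>2"
    proof (intro ballI impI)
      fix s assume s: "s \<in> {0..\<tau>}" "dist s t < d"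
      have "(W2 (\<rho> s) (\<rho> 0))\<^sup>2 \<le> 2 * (W2 (\<rho> s) (\<rho> t))\<^sup>2 + 2 * (W2 (\<rho> 0) (\<rho> t))\<^sup>2"
        by (rule W2_quasi_triangle) (use s t \<tau> \<rho>_P in auto)
      moreover have "(W2 (\<rho> s) (\<rho> t))\<^sup>2 \<le> 1"
        using d(2)[of s] s by (intro power_le_one) (auto simp: dist_real_def W2_def)
      ultimately show "(W2 (\<rho> s) (\<rho> 0))\<^sup>2 \<le> 2 + 2 * (W2 (\<rho> 0) (\<rho> t))\<^sup>2" by simp
    qed
    then show "\<exists>d>0. \<exists>B. \<forall>s\<in>{0..\<tau>}. dist s t < d \<longrightarrow> (W2 (\<rho> s) (\<rho> 0))\<^sup>2 \<le> B"
      using d(1) by blast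
  qed simp
  then obtain B where B: "\<forall>s\<in>{0..\<tau>}. (W2 (\<rho> s) (\<rho> 0))\<^sup>2 \<le> B" by blast
  then show ?thesis by (intro that[of "max 0 B"]) (auto simp: le_max_iff_disj)
qed

text \<open>
  The curve stays at bounded distance from \<open>\<rho> 0\<close>, which bounds its second moments. For the
  field at the origin, go from \<open>V 0 0\<close> to \<open>V s 0\<close> through the points \<open>S z\<close> and \<open>S' z\<close> of two
  maps of nearly optimal cost, at which the velocities at the times \<open>0\<close> and \<open>s\<close> are comparable in
  mean, and average over \<open>z\<close>.
\<close>
lemma uniform_bounds:
  obtains M where "0 \<le> M" "\<And>s. s \<in> {0..\<tau>} \<Longrightarrow> (\<integral>\<^sup>+x. ennreal ((norm x)\<^sup>2) \<partial>\<rho> s) \<le> ennreal M"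
    "\<And>s. norm (V s 0) \<le> M"
proof -
  have z: "0 \<in> {0..\<tau>}" using \<tau> by simp
  note P0 = \<rho>_P[OF z]
  obtain B where B: "0 \<le> B" "\<And>s. s \<in> {0..\<tau>} \<Longrightarrow> (W2 (\<rho> s) (\<rho> 0))\<^sup>2 \<le> B" by (rule W2_bounded) blast
  obtain S where S[measurable]: "S \<in> borel \<rightarrow>\<^sub>M borel" and dS: "distr lam borel S = \<rho> 0"
    by (rule transport_map_exists[OF prob_densities_facts(1,2)[OF P0]])
  have vm[measurable]: "v (\<rho> s) \<in> borel_measurable borel" if "s \<in> {0..\<tau>}" for s
    using v_measurable[OF \<rho>_P[OF that]] .
  obtain m where m: "0 \<le> m" "(\<integral>\<^sup>+z. ennreal ((norm (S z))\<^sup>2) \<partial>lam) = ennreal m"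
    using second_moment_map[OF S] P0 dS by (cases "(\<integral>\<^sup>+z. ennreal ((norm (S z))\<^sup>2) \<partial>lam)") auto
  define b where "b = 2 * m + 2 * (B + 1)"
  have b: "0 \<le> b" using m B by (simp add: b_def)
  define a where "a = 2 * (2 * lipC\<^sup>2 * b + 2 * (C * (B + 1))) + 2 * (2 * lipC\<^sup>2 * m + 2 * (norm (V 0 0))\<^sup>2)"
  have a: "0 \<le> a" using b B(1) C_pos m lipC_pos by (simp add: a_def)
  have pair: "\<exists>S'. S' \<in> borel \<rightarrow>\<^sub>M borel \<and> distr lam borel S' = \<rho> s \<and>
      (\<integral>\<^sup>+z. ennreal ((norm (S z - S' z))\<^sup>2) \<partial>lam) \<le> ennreal (B + 1)" if s: "s \<in> {0..\<tau>}" for s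
  proof -
    obtain S' where S': "S' \<in> borel \<rightarrow>\<^sub>M borel" "distr lam borel S' = \<rho> s"
      and c: "(\<integral>\<^sup>+z. ennreal ((norm (S z - S' z))\<^sup>2) \<partial>lam) \<le> ennreal ((W2 (\<rho> 0) (\<rho> s))\<^sup>2 + 1)"
      by (rule near_optimal_map[OF S dS P0 \<rho>_P[OF s], of 1]) auto
    have "ennreal ((W2 (\<rho> 0) (\<rho> s))\<^sup>2 + 1) \<le> ennreal (B + 1)"
      using B(2)[OF s] W2_sym[OF P0 \<rho>_P[OF s]] by (intro ennreal_leI) simp
    then show ?thesis using S' c order_trans by blast
  qed
  have mom: "(\<integral>\<^sup>+x. ennreal ((norm x)\<^sup>2) \<partial>\<rho> s) \<le> ennreal b" if s: "s \<in> {0..\<tau>}" for s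
  proof -
    obtain S' where [measurable]: "S' \<in> borel \<rightarrow>\<^sub>M borel" and d: "distr lam borel S' = \<rho> s"
      and c: "(\<integral>\<^sup>+z. ennreal ((norm (S z - S' z))\<^sup>2) \<partial>lam) \<le> ennreal (B + 1)" using pair[OF s] by blast
    have "(\<integral>\<^sup>+x. ennreal ((norm x)\<^sup>2) \<partial>\<rho> s) = (\<integral>\<^sup>+z. ennreal ((norm (S' z))\<^sup>2) \<partial>lam)"
      by (subst d[symmetric], subst nn_integral_distr) auto
    also have "\<dots> \<le> (\<integral>\<^sup>+z. 2 * ennreal ((norm (S z))\<^sup>2) + 2 * ennreal ((norm (S z - S' z))\<^sup>2) \<partial>lam)"
    proof (intro nn_integral_mono)
      fix z
      have "ennreal ((norm (S' z))\<^sup>2) \<le> ennreal (2 * (norm (S z))\<^sup>2 + 2 * (norm (S z - S' z))\<^sup>2)"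
        using norm_add_sq_le[of "S z" "S' z - S z"] by (intro ennreal_leI) (simp add: norm_minus_commute)
      then show "ennreal ((norm (S' z))\<^sup>2) \<le> 2 * ennreal ((norm (S z))\<^sup>2) + 2 * ennreal ((norm (S z - S' z))\<^sup>2)"
        by (simp add: ennreal_plus ennreal_mult)
    qed
    also have "\<dots> = 2 * ennreal m + 2 * (\<integral>\<^sup>+z. ennreal ((norm (S z - S' z))\<^sup>2) \<partial>lam)"
      by (simp add: nn_integral_add nn_integral_cmult m)
    also have "\<dots> \<le> 2 * ennreal m + 2 * ennreal (B + 1)"
      using c by (intro add_left_mono mult_left_mono) auto
    also have "\<dots> = ennreal b" using m B by (simp add: b_def ennreal_plus ennreal_mult)
    finally show ?thesis .
  qed
  have V0: "(norm (V s 0))\<^sup>2 \<le> a" if s: "s \<in> {0..\<tau>}" for s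
  proof -
    obtain S' where [measurable]: "S' \<in> borel \<rightarrow>\<^sub>M borel" and d: "distr lam borel S' = \<rho> s"
      and c: "(\<integral>\<^sup>+z. ennreal ((norm (S z - S' z))\<^sup>2) \<partial>lam) \<le> ennreal (B + 1)" using pair[OF s] by blast
    note [measurable] = vm[OF s] vm[OF z]
    have AE1: "AE z in lam. V 0 (S z) = v (\<rho> 0) (S z)"
    proof -
      have *: "AE x in distr lam borel S. V 0 x = v (\<rho> 0) x" unfolding dS by (rule V_AE[OF z])
      show ?thesis by (rule AE_distrD[OF _ *]) measurable
    qed
    have AE2: "AE z in lam. V s (S' z) = v (\<rho> s) (S' z)"
    proof -
      have *: "AE x in distr lam borel S'. V s x = v (\<rho> s) x" unfolding d by (rule V_AE[OF s])
      show ?thesis by (rule AE_distrD[OF _ *]) measurable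
    qed
    have "ennreal ((norm (V s 0))\<^sup>2) = (\<integral>\<^sup>+z. ennreal ((norm (V s 0))\<^sup>2) \<partial>lam)"
      by (simp add: emeasure_space_1[unfolded space_lam])
    also have "\<dots> \<le> (\<integral>\<^sup>+z. ennreal (4 * lipC\<^sup>2) * ennreal ((norm (S' z))\<^sup>2)
        + 4 * ennreal ((norm (v (\<rho> 0) (S z) - v (\<rho> s) (S' z)))\<^sup>2)
        + ennreal (4 * lipC\<^sup>2) * ennreal ((norm (S z))\<^sup>2) + ennreal (4 * (norm (V 0 0))\<^sup>2) \<partial>lam)"
    proof (rule nn_integral_mono_AE)
      show "AE z in lam. ennreal ((norm (V s 0))\<^sup>2) \<le> ennreal (4 * lipC\<^sup>2) * ennreal ((norm (S' z))\<^sup>2)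
        + 4 * ennreal ((norm (v (\<rho> 0) (S z) - v (\<rho> s) (S' z)))\<^sup>2)
        + ennreal (4 * lipC\<^sup>2) * ennreal ((norm (S z))\<^sup>2) + ennreal (4 * (norm (V 0 0))\<^sup>2)"
        using AE1 AE2
      proof eventually_elim
        case (elim z)
        let ?p = "V s 0 - V s (S' z)" and ?q = "v (\<rho> s) (S' z) - v (\<rho> 0) (S z)"
          and ?r = "V 0 (S z) - V 0 0"
        have p: "(norm ?p)\<^sup>2 \<le> lipC\<^sup>2 * (norm (S' z))\<^sup>2"
          using power_mono[OF V_lipschitz[of s 0 "S' z"] norm_ge_zero, of 2] by (simp add: power_mult_distrib)
        have r: "(norm ?r)\<^sup>2 \<le> lipC\<^sup>2 * (norm (S z))\<^sup>2"
          using power_mono[OF V_lipschitz[of 0 "S z" 0] norm_ge_zero, of 2] by (simp add: power_mult_distrib)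
        have e: "V s 0 = (?p + ?q) + (?r + V 0 0)" using elim by simp
        have "(norm (V s 0))\<^sup>2 \<le> 2 * (norm (?p + ?q))\<^sup>2 + 2 * (norm (?r + V 0 0))\<^sup>2"
          by (subst e) (rule norm_add_sq_le)
        also have "\<dots> \<le> 2 * (2 * (norm ?p)\<^sup>2 + 2 * (norm ?q)\<^sup>2) + 2 * (2 * (norm ?r)\<^sup>2 + 2 * (norm (V 0 0))\<^sup>2)"
          by (intro add_mono mult_left_mono norm_add_sq_le) auto
        also have "\<dots> \<le> 4 * lipC\<^sup>2 * (norm (S' z))\<^sup>2 + 4 * (norm (v (\<rho> 0) (S z) - v (\<rho> s) (S' z)))\<^sup>2
            + 4 * lipC\<^sup>2 * (norm (S z))\<^sup>2 + 4 * (norm (V 0 0))\<^sup>2"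
          using p r by (simp add: norm_minus_commute algebra_simps)
        finally have "ennreal ((norm (V s 0))\<^sup>2) \<le> ennreal (4 * lipC\<^sup>2 * (norm (S' z))\<^sup>2 + 4 * (norm (v (\<rho> 0) (S z) - v (\<rho> s) (S' z)))\<^sup>2
            + 4 * lipC\<^sup>2 * (norm (S z))\<^sup>2 + 4 * (norm (V 0 0))\<^sup>2)" by (rule ennreal_leI)
        then show ?case by (simp add: ennreal_plus ennreal_mult)
      qed
    qed
    also have "\<dots> = ennreal (4 * lipC\<^sup>2) * (\<integral>\<^sup>+x. ennreal ((norm x)\<^sup>2) \<partial>\<rho> s)
        + 4 * (\<integral>\<^sup>+z. ennreal ((norm (v (\<rho> 0) (S z) - v (\<rho> s) (S' z)))\<^sup>2) \<partial>lam)
        + ennreal (4 * lipC\<^sup>2) * ennreal m + ennreal (4 * (norm (V 0 0))\<^sup>2)"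
    proof -
      have "(\<integral>\<^sup>+x. ennreal ((norm x)\<^sup>2) \<partial>\<rho> s) = (\<integral>\<^sup>+z. ennreal ((norm (S' z))\<^sup>2) \<partial>lam)"
        by (subst d[symmetric], subst nn_integral_distr) auto
      then show ?thesis by (simp add: nn_integral_add nn_integral_cmult m emeasure_space_1[unfolded space_lam])
    qed
    also have "\<dots> \<le> ennreal (4 * lipC\<^sup>2) * ennreal b + 4 * (ennreal C * ennreal (B + 1))
        + ennreal (4 * lipC\<^sup>2) * ennreal m + ennreal (4 * (norm (V 0 0))\<^sup>2)"
    proof (intro add_mono mult_left_mono order_refl mom[OF s])
      have "(\<integral>\<^sup>+z. ennreal ((norm (v (\<rho> 0) (S z) - v (\<rho> s) (S' z)))\<^sup>2) \<partial>lam)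
          \<le> ennreal C * (\<integral>\<^sup>+z. ennreal ((norm (S z - S' z))\<^sup>2) \<partial>lam)"
        using v_lip[of S S'] \<rho>_P[OF s] P0 by (simp add: d dS)
      also have "\<dots> \<le> ennreal C * ennreal (B + 1)" using c by (intro mult_left_mono) auto
      finally show "(\<integral>\<^sup>+z. ennreal ((norm (v (\<rho> 0) (S z) - v (\<rho> s) (S' z)))\<^sup>2) \<partial>lam) \<le> ennreal C * ennreal (B + 1)" .
    qed auto
    also have "\<dots> = ennreal a"
    proof -
      have "a = 4 * lipC\<^sup>2 * b + 4 * (C * (B + 1)) + 4 * lipC\<^sup>2 * m + 4 * (norm (V 0 0))\<^sup>2"
        by (simp add: a_def algebra_simps)
      then show ?thesis using b B(1) C_pos m(1) by (simp add: ennreal_plus ennreal_mult)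
    qed
    finally show ?thesis using a by (simp add: ennreal_le_iff)
  qed
  define M where "M = max b (sqrt a)"
  show ?thesis
  proof (rule that[of M])
    show "0 \<le> M" using b by (simp add: M_def)
    show "(\<integral>\<^sup>+x. ennreal ((norm x)\<^sup>2) \<partial>\<rho> s) \<le> ennreal M" if "s \<in> {0..\<tau>}" for s
      using mom[OF that] by (rule order_trans) (simp add: M_def ennreal_leI)
    show "norm (V s 0) \<le> M" for s
    proof -
      have "norm (V s 0) \<le> sqrt a"
        using V0[OF clamp_time_in[of s]] by (intro real_le_rsqrt) (simp add: V_def clamp_time_id[OF clamp_time_in])
      then show ?thesis by (simp add: M_def)
    qed
  qed
qed

text \<open>
  Where maps with the laws \<open>\<rho> s\<close> and \<open>\<rho> t\<close> are close to each other, uniform continuity of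
  \<open>g\<close> makes the difference small; the remaining mass is bounded by the cost, as in Markov's
  inequality.
\<close>
lemma weak_continuity:
  fixes g :: "real^'d \<Rightarrow> real"
  assumes g: "continuous_on UNIV g" "bounded {x. g x \<noteq> 0}" and t: "t \<in> {0..\<tau>}"
  shows "((\<lambda>s. \<integral>x. g x \<partial>\<rho> s) \<longlongrightarrow> (\<integral>x. g x \<partial>\<rho> t)) (at t within {0..\<tau>})"
proof -
  obtain R where R: "\<And>x. g x \<noteq> 0 \<Longrightarrow> norm x \<le> R" using g(2) by (auto simp: bounded_iff)
  have [measurable]: "g \<in> borel_measurable borel" using g(1) by (rule borel_measurable_continuous_onI)
  obtain B0 where B0: "\<And>x. \<bar>g x\<bar> \<le> B0" using compact_support_bounded[OF g] by blast
  define B where "B = max 1 B0"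
  have B: "0 < B" "\<And>x. \<bar>g x\<bar> \<le> B" using B0 by (auto simp: B_def le_max_iff_disj)
  have uc: "\<exists>d>0. \<forall>x y. dist x y < d \<longrightarrow> \<bar>g x - g y\<bar> < e" if e: "0 < e" for e
  proof -
    have "uniformly_continuous_on (cball 0 (R + 1)) g"
      using continuous_on_subset[OF g(1)] by (intro compact_uniformly_continuous) auto
    then obtain d where d: "0 < d" "\<And>x y. x \<in> cball 0 (R + 1) \<Longrightarrow> y \<in> cball 0 (R + 1) \<Longrightarrow> dist y x < d \<Longrightarrow> dist (g y) (g x) < e"
      unfolding uniformly_continuous_on_def using e by meson
    show ?thesis
    proof (intro exI[of _ "min d 1"] conjI allI impI)
      fix x y :: "real^'d" assume xy: "dist x y < min d 1"
      show "\<bar>g x - g y\<bar> < e"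
      proof (cases "g x = 0 \<and> g y = 0")
        case False
        then have "norm x \<le> R \<or> norm y \<le> R" using R by blast
        then have "x \<in> cball 0 (R + 1)" "y \<in> cball 0 (R + 1)"
          using xy norm_triangle_ineq2[of x y] norm_triangle_ineq2[of y x] by (auto simp: dist_norm norm_minus_commute)
        then show ?thesis using d(2)[of x y] xy by (simp add: dist_real_def dist_commute)
      qed (use e in simp)
    qed (use d in simp)
  qed
  show ?thesis
  proof (rule tendstoI)
    fix e :: real assume e: "0 < e"
    obtain d where d: "0 < d" "\<And>x y. dist x y < d \<Longrightarrow> \<bar>g x - g y\<bar> < e/2" using uc[of "e/2"] e by auto
    define q where "q = 2 * B / d\<^sup>2"
    have q: "0 < q" using B d by (simp add: q_def)
    define e' where "e' = sqrt (e / (8 * q))"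
    have e': "0 < e'" "q * (e'\<^sup>2 + e'\<^sup>2) = e / 4" using q e by (simp_all add: e'_def)
    obtain \<delta> where \<delta>: "0 < \<delta>" "\<And>s. s \<in> {0..\<tau>} \<Longrightarrow> \<bar>s - t\<bar> < \<delta> \<Longrightarrow> W2 (\<rho> s) (\<rho> t) < e'"
      by (rule W2_continuous[OF t e'(1)]) blast
    have "dist (\<integral>x. g x \<partial>\<rho> s) (\<integral>x. g x \<partial>\<rho> t) < e" if s: "s \<in> {0..\<tau>}" "\<bar>s - t\<bar> < \<delta>" for s
    proof -
      have "0 < e'\<^sup>2" using e' by simp
      then obtain S S' where S[measurable]: "S \<in> borel \<rightarrow>\<^sub>M borel" "S' \<in> borel \<rightarrow>\<^sub>M borel"
        and dd: "distr lam borel S = \<rho> s" "distr lam borel S' = \<rho> t"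
        and c: "(\<integral>\<^sup>+z. ennreal ((norm (S z - S' z))\<^sup>2) \<partial>lam) \<le> ennreal ((W2 (\<rho> s) (\<rho> t))\<^sup>2 + e'\<^sup>2)"
        by (rule near_optimal_pair[OF \<rho>_P[OF s(1)] \<rho>_P[OF t]]) blast
      have w: "(W2 (\<rho> s) (\<rho> t))\<^sup>2 \<le> e'\<^sup>2"
        using \<delta>(2)[OF s] by (intro power_mono) (auto simp: W2_def)
      have int: "integrable lam (\<lambda>z. g (S z))" "integrable lam (\<lambda>z. g (S' z))"
        by (rule integrable_const_bound[where B=B]; use B in auto)+
      have "(\<integral>x. g x \<partial>\<rho> s) = (\<integral>z. g (S z) \<partial>lam)"
        by (subst dd(1)[symmetric], subst integral_distr) auto
      moreover have "(\<integral>x. g x \<partial>\<rho> t) = (\<integral>z. g (S' z) \<partial>lam)"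
        by (subst dd(2)[symmetric], subst integral_distr) auto
      ultimately have "dist (\<integral>x. g x \<partial>\<rho> s) (\<integral>x. g x \<partial>\<rho> t) = norm (\<integral>z. g (S z) - g (S' z) \<partial>lam)"
        using int by (simp add: dist_norm)
      also have "ennreal \<dots> \<le> (\<integral>\<^sup>+z. norm (g (S z) - g (S' z)) \<partial>lam)"
        by (rule integral_norm_bound_ennreal) (use int in auto)
      also have "\<dots> \<le> (\<integral>\<^sup>+z. ennreal (e/2) + ennreal q * ennreal ((norm (S z - S' z))\<^sup>2) \<partial>lam)"
      proof (intro nn_integral_mono)
        fix z
        have "norm (g (S z) - g (S' z)) \<le> e/2 + q * (norm (S z - S' z))\<^sup>2"
        proof (cases "dist (S z) (S' z) < d")
          case True
          have "0 \<le> q * (norm (S z - S' z))\<^sup>2" using q by simp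
          then show ?thesis using d(2)[OF True] by simp
        next
          case False
          then have "d\<^sup>2 \<le> (norm (S z - S' z))\<^sup>2" using d(1) by (intro power_mono) (auto simp: dist_norm)
          then have "q * d\<^sup>2 \<le> q * (norm (S z - S' z))\<^sup>2" using q by simp
          moreover have "q * d\<^sup>2 = 2 * B" using d(1) by (simp add: q_def)
          moreover have "\<bar>g (S z) - g (S' z)\<bar> \<le> 2 * B" using B(2)[of "S z"] B(2)[of "S' z"] by linarith
          ultimately show ?thesis using e by simp
        qed
        then have "ennreal (norm (g (S z) - g (S' z))) \<le> ennreal (e/2 + q * (norm (S z - S' z))\<^sup>2)" by (rule ennreal_leI)
        then show "ennreal (norm (g (S z) - g (S' z))) \<le> ennreal (e/2) + ennreal q * ennreal ((norm (S z - S' z))\<^sup>2)"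
          using e q by (simp add: ennreal_plus ennreal_mult)
      qed
      also have "\<dots> = ennreal (e/2) + ennreal q * (\<integral>\<^sup>+z. ennreal ((norm (S z - S' z))\<^sup>2) \<partial>lam)"
        by (simp add: nn_integral_add nn_integral_cmult emeasure_space_1[unfolded space_lam])
      also have "\<dots> \<le> ennreal (e/2) + ennreal q * ennreal (e'\<^sup>2 + e'\<^sup>2)"
        using w by (intro add_left_mono mult_left_mono order_trans[OF c] ennreal_leI) auto
      also have "\<dots> = ennreal (e/2 + e/4)"
        using e q e'(2) by (simp add: ennreal_mult[symmetric] ennreal_plus[symmetric] del: ennreal_plus)
      finally show ?thesis using e by (simp add: ennreal_le_iff)
    qed
    then show "eventually (\<lambda>s. dist (\<integral>x. g x \<partial>\<rho> s) (\<integral>x. g x \<partial>\<rho> t) < e) (at t within {0..\<tau>})"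
      unfolding eventually_at using \<delta>(1) by (metis dist_real_def)
  qed
qed

end

section \<open>Flows of Lipschitz vector fields\<close>

lemma has_integral_exp_mult:
  fixes c :: real
  assumes "c \<noteq> 0" "0 \<le> t"
  shows "((\<lambda>s. exp (c * s)) has_integral (exp (c * t) - 1) / c) {0..t}"
proof -
  have "((\<lambda>s. exp (c * s)) has_integral (exp (c * t) / c - exp (c * 0) / c)) {0..t}"
    using assms
    by (intro fundamental_theorem_of_calculus)
       (auto intro!: derivative_eq_intros simp: has_real_derivative_iff_has_vector_derivative[symmetric])
  then show ?thesis by (simp add: diff_divide_distrib)
qed

lemma has_integral_norm_le:
  fixes f :: "real \<Rightarrow> 'a::euclidean_space"
  assumes I: "(f has_integral I) {a..b}" and "a \<le> b" and B: "\<And>s. s \<in> {a..b} \<Longrightarrow> norm (f s) \<le> B"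
  shows "norm I \<le> B * (b - a)"
proof -
  have "norm (integral {a..b} f) \<le> integral {a..b} (\<lambda>s. B)"
    using I B by (intro integral_norm_bound_integral integrable_const_ivl) (auto simp: has_integral_integrable)
  then show ?thesis using I assms(2) by (simp add: integral_unique mult.commute)
qed

lemma geometric_steps_converge:
  fixes f :: "nat \<Rightarrow> 'a::banach"
  assumes step: "\<And>n. norm (f (Suc n) - f n) \<le> c / 2 ^ n"
  shows "convergent f" and "norm (lim f - f n) \<le> 2 * c / 2 ^ n"
proof -
  have c: "0 \<le> c" using order_trans[OF norm_ge_zero step[of 0]] by simp
  have *: "norm (f (n + k) - f n) \<le> 2 * c / 2 ^ n - 2 * c / 2 ^ (n + k)" for n k
  proof (induction k)
    case (Suc k)
    have "norm (f (n + Suc k) - f n) \<le> norm (f (Suc (n + k)) - f (n + k)) + norm (f (n + k) - f n)"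
      using norm_triangle_ineq[of "f (Suc (n + k)) - f (n + k)" "f (n + k) - f n"] by simp
    also have "\<dots> \<le> c / 2 ^ (n + k) + (2 * c / 2 ^ n - 2 * c / 2 ^ (n + k))"
      by (intro add_mono step Suc)
    also have "\<dots> = 2 * c / 2 ^ n - 2 * c / 2 ^ (n + Suc k)" by (simp add: field_simps)
    finally show ?case .
  qed simp
  have **: "norm (f m - f n) \<le> 2 * c / 2 ^ n" if "n \<le> m" for m n
  proof -
    have "norm (f (n + (m - n)) - f n) \<le> 2 * c / 2 ^ n - 2 * c / 2 ^ (n + (m - n))" by (rule *)
    then show ?thesis using that c by (simp add: order_trans[of _ "2 * c / 2 ^ n - 2 * c / 2 ^ m"])
  qed
  have lim0: "(\<lambda>n. 2 * c / 2 ^ n) \<longlonglongrightarrow> 0"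
  proof -
    have "(\<lambda>n. (1/2 :: real) ^ n) \<longlonglongrightarrow> 0" by (rule LIMSEQ_power_zero) simp
    then have "(\<lambda>n. 2 * c * (1/2) ^ n) \<longlonglongrightarrow> 0" by (rule tendsto_mult_right_zero)
    moreover have "2 * c * (1/2) ^ n = 2 * c / 2 ^ n" for n
      by (simp add: power_one_over field_simps)
    ultimately show ?thesis by (simp only:)
  qed
  have "Cauchy f"
  proof (rule metric_CauchyI)
    fix e :: real assume "0 < e"
    then obtain N where N: "\<And>n. n \<ge> N \<Longrightarrow> 2 * c / 2 ^ n < e / 2"
      using order_tendstoD(2)[OF lim0, of "e/2"] by (auto simp: eventually_sequentially)
    have "dist (f m) (f n) < e" if "m \<ge> N" "n \<ge> N" for m n
    proof -
      have "dist (f m) (f N) < e/2" "dist (f n) (f N) < e/2"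
        using **[OF that(1)] **[OF that(2)] N[of N] by (simp_all add: dist_norm)
      then show ?thesis using dist_triangle2[of "f m" "f n" "f N"] by simp
    qed
    then show "\<exists>M. \<forall>m\<ge>M. \<forall>n\<ge>M. dist (f m) (f n) < e" by blast
  qed
  then show conv: "convergent f" by (rule Cauchy_convergent)
  then have "(\<lambda>m. norm (f m - f n)) \<longlonglongrightarrow> norm (lim f - f n)"
    by (intro tendsto_intros) (simp add: convergent_LIMSEQ_iff)
  then show "norm (lim f - f n) \<le> 2 * c / 2 ^ n"
    by (rule LIMSEQ_le_const2) (use ** in auto)
qed

text \<open>
  Dependence on time is only measurable, so trajectories are solutions of the integral
  equation.
\<close>
locale lipschitz_field =
  fixes V :: "real \<Rightarrow> 'a::euclidean_space \<Rightarrow> 'a" and K M \<tau> :: real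
  assumes V_meas: "(\<lambda>p. V (fst p) (snd p)) \<in> borel_measurable borel"
    and V_lip: "\<And>s x y. norm (V s x - V s y) \<le> K * norm (x - y)"
    and V_zero: "\<And>s. norm (V s 0) \<le> M"
    and K_pos: "0 < K" and \<tau>_nonneg: "0 \<le> \<tau>"
begin

lemma M_nonneg: "0 \<le> M" using order_trans[OF norm_ge_zero V_zero] .

lemma V_growth: "norm (V s x) \<le> M + K * norm x"
  using norm_triangle_ineq[of "V s 0" "V s x - V s 0"] V_zero[of s] V_lip[of s x 0] by simp

lemma V_along_curve_integrable:
  assumes c: "continuous_on {0..\<tau>} c" and t: "{a..b} \<subseteq> {0..\<tau>}"
  shows "(\<lambda>s. V s (c s)) integrable_on {a..b}"
proof -
  define c' where "c' s = c (max 0 (min \<tau> s))" for s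
  have cc: "continuous_on UNIV c'"
    unfolding c'_def using \<tau>_nonneg
    by (intro continuous_on_compose2[OF c] continuous_intros) auto
  have [measurable]: "c' \<in> borel_measurable borel" by (rule borel_measurable_continuous_onI[OF cc])
  have m: "(\<lambda>s. V s (c' s)) \<in> borel_measurable borel"
  proof -
    have "(\<lambda>s. (s, c' s)) \<in> borel \<rightarrow>\<^sub>M borel" unfolding borel_prod[symmetric] by measurable
    from measurable_compose[OF this V_meas] show ?thesis by simp
  qed
  obtain B where B: "\<And>s. s \<in> {0..\<tau>} \<Longrightarrow> norm (c s) \<le> B"
  proof -
    have "bounded (c ` {0..\<tau>})" using c by (intro compact_imp_bounded compact_continuous_image) auto
    then obtain B where "\<forall>y\<in>c ` {0..\<tau>}. norm y \<le> B" unfolding bounded_iff by blast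
    then show ?thesis using that[of B] by blast
  qed
  have "(\<lambda>s. V s (c' s)) integrable_on {a..b}"
  proof (rule measurable_bounded_by_integrable_imp_integrable)
    show "(\<lambda>s. V s (c' s)) \<in> borel_measurable (lebesgue_on {a..b})"
      by (intro measurable_restrict_space1 measurable_completion) (use m in simp)
    show "(\<lambda>s. M + K * B) integrable_on {a..b}" by (rule integrable_const_ivl)
    fix s assume s: "s \<in> {a..b}"
    then have "c' s = c s" using t by (auto simp: c'_def)
    then have "norm (c' s) \<le> B" using B s t by auto
    then have "K * norm (c' s) \<le> K * B" using K_pos by simp
    then show "norm (V s (c' s)) \<le> M + K * B" using V_growth[of s "c' s"] by linarith
  qed auto
  then show ?thesis
    by (rule integrable_eq) (use t in \<open>auto simp: c'_def\<close>)
qed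

primrec picard :: "nat \<Rightarrow> real \<Rightarrow> 'a \<Rightarrow> 'a" where
  "picard 0 t x = x"
| "picard (Suc n) t x = x + integral {0..t} (\<lambda>s. V s (picard n s x))"

lemma picard_continuous: "continuous_on {0..\<tau>} (\<lambda>t. picard n t x)"
proof (induction n)
  case (Suc n)
  show ?case
    unfolding picard.simps
    by (intro continuous_intros indefinite_integral_continuous_1 V_along_curve_integrable[OF Suc]) auto
qed simp

lemma integral_diff_le:
  assumes c: "continuous_on {0..\<tau>} c" and c': "continuous_on {0..\<tau>} c'" and t: "t \<in> {0..\<tau>}"
    and g: "(g has_integral I) {0..t}" and le: "\<And>s. s \<in> {0..t} \<Longrightarrow> K * norm (c s - c' s) \<le> g s"
  shows "norm (integral {0..t} (\<lambda>s. V s (c s)) - integral {0..t} (\<lambda>s. V s (c' s))) \<le> I"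
proof -
  have i: "(\<lambda>s. V s (c s)) integrable_on {0..t}" "(\<lambda>s. V s (c' s)) integrable_on {0..t}"
    using t by (auto intro!: V_along_curve_integrable c c')
  have "integral {0..t} (\<lambda>s. V s (c s)) - integral {0..t} (\<lambda>s. V s (c' s))
      = integral {0..t} (\<lambda>s. V s (c s) - V s (c' s))"
    by (rule integral_diff[OF i, symmetric])
  also have "norm \<dots> \<le> integral {0..t} g"
  proof (intro integral_norm_bound_integral integrable_diff i)
    show "g integrable_on {0..t}" using g by (rule has_integral_integrable)
    show "norm (V s (c s) - V s (c' s)) \<le> g s" if "s \<in> {0..t}" for s
      using V_lip[of s "c s" "c' s"] le[OF that] by linarith
  qed
  finally show ?thesis using g by (simp add: integral_unique)
qed

definition picard_bound :: "'a \<Rightarrow> real" where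
  "picard_bound x = (M + K * norm x) / (2 * K) * exp (2 * K * \<tau>)"

text \<open>
  In the norm weighted by \<open>exp (- 2 * K * t)\<close> the Picard operator is a contraction with
  factor \<open>1/2\<close> on the whole time interval.
\<close>
lemma picard_step:
  assumes t: "t \<in> {0..\<tau>}"
  shows "norm (picard (Suc n) t x - picard n t x) \<le> (M + K * norm x) / (2 * K) * exp (2 * K * t) / 2 ^ n"
  using t
proof (induction n arbitrary: t)
  case 0
  let ?A = "M + K * norm x"
  have A: "0 \<le> ?A" using M_nonneg K_pos by simp
  have "norm (integral {0..t} (\<lambda>s. V s x)) \<le> integral {0..t} (\<lambda>s. ?A)"
    by (intro integral_norm_bound_integral V_growth V_along_curve_integrable integrable_const_ivl) (use 0 in auto)
  also have "\<dots> = ?A * t" using 0 by simp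
  also have "\<dots> \<le> ?A * (exp (2 * K * t) / (2 * K))"
  proof (rule mult_left_mono[OF _ A])
    have "2 * K * t \<le> exp (2 * K * t)" using exp_ge_add_one_self[of "2 * K * t"] by linarith
    then show "t \<le> exp (2 * K * t) / (2 * K)" using K_pos by (simp add: field_simps)
  qed
  finally show ?case by simp
next
  case (Suc n)
  let ?A = "(M + K * norm x) / (2 * K)"
  have A: "0 \<le> ?A" using M_nonneg K_pos by simp
  have e: "((\<lambda>s. K * ?A / 2 ^ n * exp ((2 * K) * s)) has_integral K * ?A / 2 ^ n * ((exp ((2 * K) * t) - 1) / (2 * K))) {0..t}"
    by (intro has_integral_mult_right has_integral_exp_mult) (use Suc K_pos in auto)
  have "norm (picard (Suc (Suc n)) t x - picard (Suc n) t x)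
      = norm (integral {0..t} (\<lambda>s. V s (picard (Suc n) s x)) - integral {0..t} (\<lambda>s. V s (picard n s x)))"
    by (simp only: picard.simps(2)[of "Suc n"] picard.simps(2)[of n t]) simp
  also have "\<dots> \<le> K * ?A / 2 ^ n * ((exp ((2 * K) * t) - 1) / (2 * K))"
  proof (rule integral_diff_le[OF picard_continuous picard_continuous Suc.prems e])
    fix s assume "s \<in> {0..t}"
    then have "norm (picard (Suc n) s x - picard n s x) \<le> ?A * exp (2 * K * s) / 2 ^ n"
      using Suc by auto
    then have "K * norm (picard (Suc n) s x - picard n s x) \<le> K * (?A * exp (2 * K * s) / 2 ^ n)"
      using K_pos by (intro mult_left_mono) auto
    moreover have "K * (?A * exp (2 * K * s) / 2 ^ n) = K * ?A / 2 ^ n * exp (2 * K * s)"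
      by (simp only: times_divide_eq_left times_divide_eq_right mult.assoc)
    ultimately show "K * norm (picard (Suc n) s x - picard n s x) \<le> K * ?A / 2 ^ n * exp (2 * K * s)"
      by (simp only:)
  qed
  also have "\<dots> = ?A / 2 ^ Suc n * (exp (2 * K * t) - 1)" using K_pos by (simp add: field_simps)
  also have "\<dots> \<le> ?A / 2 ^ Suc n * exp (2 * K * t)"
    by (rule mult_left_mono[OF _ divide_nonneg_pos[OF A]]) auto
  finally show ?case by simp
qed

lemma picard_lipschitz:
  assumes "t \<in> {0..\<tau>}"
  shows "norm (picard n t x - picard n t y) \<le> norm (x - y) * exp (K * t)"
  using assms
proof (induction n arbitrary: t)
  case 0
  then have "norm (x - y) * 1 \<le> norm (x - y) * exp (K * t)" using K_pos by (intro mult_left_mono) auto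
  then show ?case by simp
next
  case (Suc n)
  have e: "((\<lambda>s. K * norm (x - y) * exp (K * s)) has_integral K * norm (x - y) * ((exp (K * t) - 1) / K)) {0..t}"
    by (intro has_integral_mult_right has_integral_exp_mult) (use Suc K_pos in auto)
  have "norm (picard (Suc n) t x - picard (Suc n) t y)
     \<le> norm (x - y) + norm (integral {0..t} (\<lambda>s. V s (picard n s x)) - integral {0..t} (\<lambda>s. V s (picard n s y)))"
    using norm_triangle_ineq[of "x - y" "integral {0..t} (\<lambda>s. V s (picard n s x)) - integral {0..t} (\<lambda>s. V s (picard n s y))"]
    by (simp add: algebra_simps)
  also have "\<dots> \<le> norm (x - y) + K * norm (x - y) * ((exp (K * t) - 1) / K)"
  proof (intro add_left_mono integral_diff_le[OF picard_continuous picard_continuous Suc.prems e])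
    fix s assume "s \<in> {0..t}"
    then have "norm (picard n s x - picard n s y) \<le> norm (x - y) * exp (K * s)" using Suc by auto
    then show "K * norm (picard n s x - picard n s y) \<le> K * norm (x - y) * exp (K * s)"
      using K_pos by (simp add: mult.assoc)
  qed
  also have "\<dots> = norm (x - y) * exp (K * t)" using K_pos by (simp add: field_simps)
  finally show ?case .
qed

definition flow :: "real \<Rightarrow> 'a \<Rightarrow> 'a" where "flow t x = lim (\<lambda>n. picard n t x)"

lemma
  assumes t: "t \<in> {0..\<tau>}"
  shows picard_converges: "(\<lambda>n. picard n t x) \<longlonglongrightarrow> flow t x"
    and picard_error: "norm (flow t x - picard n t x) \<le> 2 * picard_bound x / 2 ^ n"
proof -
  have s: "norm (picard (Suc n) t x - picard n t x) \<le> picard_bound x / 2 ^ n" for n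
  proof -
    have "0 \<le> (M + K * norm x) / (2 * K)" using M_nonneg K_pos by simp
    then have "(M + K * norm x) / (2 * K) * exp (2 * K * t) \<le> picard_bound x"
      unfolding picard_bound_def using t K_pos by (intro mult_left_mono) auto
    then show ?thesis using picard_step[OF t, of n x] by (meson divide_right_mono order_trans zero_le_numeral zero_le_power)
  qed
  note g = geometric_steps_converge[of "\<lambda>n. picard n t x", OF s]
  show "(\<lambda>n. picard n t x) \<longlonglongrightarrow> flow t x" using g(1) unfolding flow_def by (simp add: convergent_LIMSEQ_iff)
  show "norm (flow t x - picard n t x) \<le> 2 * picard_bound x / 2 ^ n" using g(2) unfolding flow_def .
qed

lemma flow_lipschitz: "t \<in> {0..\<tau>} \<Longrightarrow> norm (flow t x - flow t y) \<le> norm (x - y) * exp (K * t)"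
  by (rule LIMSEQ_le_const2[OF tendsto_norm[OF tendsto_diff[OF picard_converges picard_converges]]])
     (use picard_lipschitz in blast)+

lemma error_lim: "(\<lambda>n. b * (2 * picard_bound x / 2 ^ n)) \<longlonglongrightarrow> 0"
proof -
  have "(\<lambda>n. (1/2 :: real) ^ n) \<longlonglongrightarrow> 0" by (rule LIMSEQ_power_zero) simp
  then have "(\<lambda>n. b * (2 * picard_bound x) * (1/2) ^ n) \<longlonglongrightarrow> 0" by (rule tendsto_mult_right_zero)
  moreover have "b * (2 * picard_bound x) * (1/2) ^ n = b * (2 * picard_bound x / 2 ^ n)" for n
    by (simp add: power_one_over field_simps)
  ultimately show ?thesis by (simp only:)
qed

lemma flow_continuous: "continuous_on {0..\<tau>} (\<lambda>t. flow t x)"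
proof (rule uniform_limit_theorem[where F=sequentially])
  show "\<forall>\<^sub>F n in sequentially. continuous_on {0..\<tau>} (\<lambda>t. picard n t x)" by (simp add: picard_continuous)
  show "uniform_limit {0..\<tau>} (\<lambda>n t. picard n t x) (\<lambda>t. flow t x) sequentially"
  proof (rule uniform_limitI)
    fix e :: real assume "0 < e"
    then have "\<forall>\<^sub>F n in sequentially. 1 * (2 * picard_bound x / 2 ^ n) < e"
      by (rule order_tendstoD(2)[OF error_lim])
    then show "\<forall>\<^sub>F n in sequentially. \<forall>t\<in>{0..\<tau>}. dist (picard n t x) (flow t x) < e"
    proof eventually_elim
      case (elim n)
      show ?case
      proof
        fix t assume "t \<in> {0..\<tau>}"
        from picard_error[OF this, of x n] elim show "dist (picard n t x) (flow t x) < e"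
          unfolding dist_norm norm_minus_commute[of "picard n t x"] by linarith
      qed
    qed
  qed
qed simp

lemma flow_equation:
  assumes t: "t \<in> {0..\<tau>}"
  shows "flow t x = x + integral {0..t} (\<lambda>s. V s (flow s x))"
proof -
  have "(\<lambda>n. norm (integral {0..t} (\<lambda>s. V s (picard n s x)) - integral {0..t} (\<lambda>s. V s (flow s x)))) \<longlonglongrightarrow> 0"
  proof (rule tendsto_sandwich[OF _ _ tendsto_const error_lim[of "t * K" x]])
    show "\<forall>\<^sub>F n in sequentially. norm (integral {0..t} (\<lambda>s. V s (picard n s x)) - integral {0..t} (\<lambda>s. V s (flow s x)))
        \<le> t * K * (2 * picard_bound x / 2 ^ n)"
    proof (intro always_eventually allI integral_diff_le[OF picard_continuous flow_continuous t])
      fix n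
      show "((\<lambda>s. K * (2 * picard_bound x / 2 ^ n)) has_integral t * K * (2 * picard_bound x / 2 ^ n)) {0..t}"
        using has_integral_const_real[of "K * (2 * picard_bound x / 2 ^ n)" 0 t] t by (simp add: mult.assoc)
      fix s assume "s \<in> {0..t}"
      then have "norm (flow s x - picard n s x) \<le> 2 * picard_bound x / 2 ^ n" using t by (intro picard_error) auto
      then show "K * norm (picard n s x - flow s x) \<le> K * (2 * picard_bound x / 2 ^ n)"
        using K_pos by (intro mult_left_mono) (auto simp: norm_minus_commute)
    qed
  qed auto
  then have "(\<lambda>n. integral {0..t} (\<lambda>s. V s (picard n s x))) \<longlonglongrightarrow> integral {0..t} (\<lambda>s. V s (flow s x))"
    by (simp add: LIM_zero_iff tendsto_norm_zero_iff)
  then have "(\<lambda>n. picard (Suc n) t x) \<longlonglongrightarrow> x + integral {0..t} (\<lambda>s. V s (flow s x))"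
    by (auto intro!: tendsto_intros)
  moreover have "(\<lambda>n. picard (Suc n) t x) \<longlonglongrightarrow> flow t x"
    using picard_converges[OF t] by (rule LIMSEQ_Suc)
  ultimately show ?thesis using LIMSEQ_unique by blast
qed

lemma flow_increment:
  assumes "0 \<le> a" "a \<le> b" "b \<le> \<tau>"
  shows "((\<lambda>s. V s (flow s x)) has_integral (flow b x - flow a x)) {a..b}"
proof -
  have i: "(\<lambda>s. V s (flow s x)) integrable_on {a'..b'}" if "{a'..b'} \<subseteq> {0..\<tau>}" for a' b'
    by (rule V_along_curve_integrable[OF flow_continuous that])
  have "integral {0..a} (\<lambda>s. V s (flow s x)) + integral {a..b} (\<lambda>s. V s (flow s x)) = integral {0..b} (\<lambda>s. V s (flow s x))"
    using assms by (intro Henstock_Kurzweil_Integration.integral_combine i) auto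
  then have "flow b x - flow a x = integral {a..b} (\<lambda>s. V s (flow s x))"
    using flow_equation[of a x] flow_equation[of b x] assms by (simp add: algebra_simps)
  then show ?thesis using i[of a b] assms by (auto simp: has_integral_integral[symmetric] has_integral_iff)
qed

lemma flow_bound: obtains R where "0 \<le> R" "\<And>t x. t \<in> {0..\<tau>} \<Longrightarrow> norm (flow t x) \<le> R + exp (K * \<tau>) * norm x"
proof -
  have "bounded ((\<lambda>t. flow t 0) ` {0..\<tau>})"
    by (intro compact_imp_bounded compact_continuous_image flow_continuous) auto
  then obtain B where B: "\<forall>y\<in>(\<lambda>t. flow t 0) ` {0..\<tau>}. norm y \<le> B" unfolding bounded_iff by blast
  show ?thesis
  proof (rule that[of "max 0 B"])
    fix t x assume t: "t \<in> {0..\<tau>}"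
    have "norm (flow t x) \<le> norm (flow t 0) + norm (flow t x - flow t 0)"
      using norm_triangle_ineq[of "flow t 0" "flow t x - flow t 0"] by simp
    moreover have "norm (flow t x - flow t 0) \<le> norm x * exp (K * t)" using flow_lipschitz[OF t, of x 0] by simp
    moreover have "norm x * exp (K * t) \<le> norm x * exp (K * \<tau>)" using t K_pos by (intro mult_left_mono) auto
    moreover have "norm (flow t 0) \<le> B" using B t by blast
    ultimately show "norm (flow t x) \<le> max 0 B + exp (K * \<tau>) * norm x"
      unfolding mult.commute[of "exp (K * \<tau>)"] by linarith
  qed simp
qed

lemma flow_measurable:
  "(\<lambda>p. flow (max 0 (min \<tau> (fst p))) (snd p)) \<in> borel_measurable borel"
proof (rule borel_measurable_continuous_onI)
  let ?c = "\<lambda>s. max 0 (min \<tau> s)"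
  show "continuous_on UNIV (\<lambda>p. flow (?c (fst p)) (snd p))"
    unfolding continuous_on_iff
  proof (intro ballI allI impI)
    fix p :: "real \<times> 'a" and e :: real assume e: "0 < e"
    obtain s x where p: "p = (s, x)" by force
    define E where "E = exp (K * \<tau>)"
    have E: "0 < E" by (simp add: E_def)
    have cc: "continuous_on UNIV (\<lambda>s. flow (?c s) x)"
      using \<tau>_nonneg by (intro continuous_on_compose2[OF flow_continuous] continuous_intros) auto
    obtain d where d: "0 < d" "\<And>r. dist r s < d \<Longrightarrow> dist (flow (?c r) x) (flow (?c s) x) < e/2"
      using cc[unfolded continuous_on_iff, rule_format, of s "e/2"] e by auto
    show "\<exists>d>0. \<forall>q\<in>UNIV. dist q p < d \<longrightarrow> dist (flow (?c (fst q)) (snd q)) (flow (?c (fst p)) (snd p)) < e"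
    proof (intro exI[of _ "min d (e / (2 * E))"] conjI ballI impI)
      fix q assume q: "dist q p < min d (e / (2 * E))"
      have "dist (fst q) s < d" using q dist_fst_le[of q p] by (simp add: p)
      then have 1: "dist (flow (?c (fst q)) x) (flow (?c s) x) < e/2" by (rule d)
      have tt: "?c (fst q) \<in> {0..\<tau>}" using \<tau>_nonneg by auto
      have "dist (snd q) x < e / (2 * E)" using q dist_snd_le[of q p] by (simp add: p)
      then have "norm (snd q - x) * E < e/2" using E by (simp add: dist_norm field_simps)
      moreover have "norm (flow (?c (fst q)) (snd q) - flow (?c (fst q)) x) \<le> norm (snd q - x) * exp (K * ?c (fst q))"
        by (rule flow_lipschitz[OF tt])
      moreover have "norm (snd q - x) * exp (K * ?c (fst q)) \<le> norm (snd q - x) * E"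
        unfolding E_def using tt K_pos by (intro mult_left_mono) auto
      ultimately have 2: "dist (flow (?c (fst q)) (snd q)) (flow (?c (fst q)) x) < e/2" by (simp add: dist_norm)
      show "dist (flow (?c (fst q)) (snd q)) (flow (?c (fst p)) (snd p)) < e"
        using dist_triangle[of "flow (?c (fst q)) (snd q)" "flow (?c s) x" "flow (?c (fst q)) x"] 1 2 by (simp add: p)
    qed (use d e E in auto)
  qed
qed

text \<open>
  Here \<open>w\<close> is the increment of any one-step scheme that approximates the integral of the field
  frozen at the current position \<open>y\<close>. The last term is the error of freezing: the trajectory moves
  by at most \<open>(b - a) * (M + K * R)\<close> during the step.
\<close>
lemma euler_step_error:
  assumes ab: "0 \<le> a" "a \<le> b" "b \<le> \<tau>"
    and w: "norm (w - integral {a..b} (\<lambda>s. V s y)) \<le> (b - a) * \<epsilon>"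
    and R: "\<And>s. s \<in> {0..\<tau>} \<Longrightarrow> norm (flow s x) \<le> R"
  shows "norm (y + w - flow b x) \<le> (1 + K * (b - a)) * norm (y - flow a x)
      + (b - a) * (\<epsilon> + K * ((b - a) * (M + K * R)))"
proof -
  let ?G = "M + K * R"
  have ii: "(\<lambda>s. V s y) integrable_on {a..b}"
    using ab by (intro V_along_curve_integrable) auto
  have near: "norm (flow a x - flow s x) \<le> (b - a) * ?G" if s: "s \<in> {a..b}" for s
  proof -
    have h: "((\<lambda>r. V r (flow r x)) has_integral (flow s x - flow a x)) {a..s}"
      by (rule flow_increment) (use ab s in auto)
    have "norm (flow s x - flow a x) \<le> ?G * (s - a)"
    proof (rule has_integral_norm_le[OF h])
      show "a \<le> s" using s by simp
      fix r assume "r \<in> {a..s}"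
      then have "norm (flow r x) \<le> R" using ab s by (intro R) auto
      then have "K * norm (flow r x) \<le> K * R" using K_pos by simp
      then show "norm (V r (flow r x)) \<le> ?G" using V_growth[of r "flow r x"] by linarith
    qed
    also have "\<dots> \<le> ?G * (b - a)"
    proof -
      have "0 \<le> R" using order_trans[OF norm_ge_zero R[of a]] ab by simp
      then have "0 \<le> ?G" using M_nonneg K_pos by simp
      then show ?thesis using s by (intro mult_left_mono) auto
    qed
    finally show ?thesis by (simp add: norm_minus_commute mult.commute)
  qed
  have h: "((\<lambda>s. V s y - V s (flow s x)) has_integral (integral {a..b} (\<lambda>s. V s y) - (flow b x - flow a x))) {a..b}"
    by (intro has_integral_diff flow_increment ab integrable_integral ii)
  have "norm (integral {a..b} (\<lambda>s. V s y) - (flow b x - flow a x))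
      \<le> K * (norm (y - flow a x) + (b - a) * ?G) * (b - a)"
  proof (rule has_integral_norm_le[OF h ab(2)])
    fix s assume s: "s \<in> {a..b}"
    have "norm (y - flow s x) \<le> norm (y - flow a x) + norm (flow a x - flow s x)"
      using norm_triangle_ineq[of "y - flow a x" "flow a x - flow s x"] by simp
    also have "\<dots> \<le> norm (y - flow a x) + (b - a) * ?G" using near[OF s] by simp
    finally have "K * norm (y - flow s x) \<le> K * (norm (y - flow a x) + (b - a) * ?G)" using K_pos by simp
    then show "norm (V s y - V s (flow s x)) \<le> K * (norm (y - flow a x) + (b - a) * ?G)"
      using V_lip[of s y "flow s x"] by linarith
  qed
  then have 1: "norm (integral {a..b} (\<lambda>s. V s y) - (flow b x - flow a x))
      \<le> K * (norm (y - flow a x) + (b - a) * ?G) * (b - a)" .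
  have e: "y + w - flow b x = (y - flow a x) + (w - integral {a..b} (\<lambda>s. V s y))
      + (integral {a..b} (\<lambda>s. V s y) - (flow b x - flow a x))" by simp
  have "norm (y + w - flow b x) \<le> norm (y - flow a x) + norm (w - integral {a..b} (\<lambda>s. V s y))
      + norm (integral {a..b} (\<lambda>s. V s y) - (flow b x - flow a x))"
    unfolding e by (intro norm_triangle_le add_right_mono norm_triangle_ineq)
  also have "\<dots> \<le> norm (y - flow a x) + (b - a) * \<epsilon> + K * (norm (y - flow a x) + (b - a) * ?G) * (b - a)"
    using 1 w by linarith
  also have "\<dots> = (1 + K * (b - a)) * norm (y - flow a x) + (b - a) * (\<epsilon> + K * ((b - a) * ?G))"
    by (simp add: algebra_simps)
  finally show ?thesis .
qed

end

section \<open>Mollification of Lipschitz maps\<close>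

text \<open>
  Continuity of \<open>f'\<close> in each direction separately is continuity of the derivative, the dimension
  being finite.
\<close>
definition C1_map :: "('a::euclidean_space \<Rightarrow> 'b::euclidean_space) \<Rightarrow> ('a \<Rightarrow> 'a \<Rightarrow> 'b) \<Rightarrow> bool" where
  "C1_map f f' \<longleftrightarrow> (\<forall>x. (f has_derivative f' x) (at x)) \<and> (\<forall>h. continuous_on UNIV (\<lambda>x. f' x h))"

lemma C1_map_continuous: "C1_map f f' \<Longrightarrow> continuous_on UNIV f"
  unfolding C1_map_def by (intro continuous_at_imp_continuous_on ballI) (metis has_derivative_continuous)

lemma C1_map_linear: "C1_map f f' \<Longrightarrow> linear (f' x)"
  unfolding C1_map_def by (metis has_derivative_linear)

lemma C1_map_derivative_continuous:
  assumes f: "C1_map f f'" and g: "continuous_on S g" and h: "continuous_on S h"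
  shows "continuous_on S (\<lambda>z. f' (g z) (h z))"
proof -
  have "f' (g z) (h z) = (\<Sum>b\<in>Basis. (h z \<bullet> b) *\<^sub>R f' (g z) b)" for z
  proof -
    have "f' (g z) (h z) = f' (g z) (\<Sum>b\<in>Basis. (h z \<bullet> b) *\<^sub>R b)" by (simp add: euclidean_representation)
    also have "\<dots> = (\<Sum>b\<in>Basis. (h z \<bullet> b) *\<^sub>R f' (g z) b)"
      using C1_map_linear[OF f, of "g z"] by (simp add: linear_sum linear_scale)
    finally show ?thesis .
  qed
  moreover have "continuous_on S (\<lambda>z. \<Sum>b\<in>Basis. (h z \<bullet> b) *\<^sub>R f' (g z) b)"
    using f by (intro continuous_intros h continuous_on_compose2[OF _ g, of UNIV]) (auto simp: C1_map_def)
  ultimately show ?thesis by simp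
qed

lemma C1_map_compose:
  assumes f: "C1_map f f'" and g: "C1_map g g'"
  shows "C1_map (\<lambda>x. f (g x)) (\<lambda>x h. f' (g x) (g' x h))"
  unfolding C1_map_def
proof (intro conjI allI)
  fix x
  have "(g has_derivative g' x) (at x)" "(f has_derivative f' (g x)) (at (g x))"
    using f g by (auto simp: C1_map_def)
  then show "((\<lambda>x. f (g x)) has_derivative (\<lambda>h. f' (g x) (g' x h))) (at x)"
    by (rule has_derivative_compose)
  show "continuous_on UNIV (\<lambda>x. f' (g x) (g' x h))" for h
    by (rule C1_map_derivative_continuous[OF f C1_map_continuous[OF g]]) (use g in \<open>auto simp: C1_map_def\<close>)
qed

lemma C1_map_step:
  assumes W: "C1_map W W'"
  shows "C1_map (\<lambda>x. x + c *\<^sub>R W x) (\<lambda>x h. h + c *\<^sub>R W' x h)"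
  using W unfolding C1_map_def
  by (auto intro!: derivative_eq_intros continuous_intros)

lemma lipschitz_derivative_bound:
  assumes f: "(f has_derivative D) (at x)" and L: "\<And>y. norm (f y - f x) \<le> L * norm (y - x)"
  shows "norm (D h) \<le> L * norm h"
proof -
  interpret bounded_linear D using f by (rule has_derivative_bounded_linear)
  have *: "norm (D h) \<le> (L + e) * norm h" if e: "0 < e" for e
  proof (cases "h = 0")
    case False
    obtain d where d: "0 < d" "\<And>y. norm (y - x) < d \<Longrightarrow> norm (f y - f x - D (y - x)) \<le> e * norm (y - x)"
      using f e unfolding has_derivative_at_alt by blast
    define t where "t = d / (2 * norm h)"
    have t: "0 < t" "norm (t *\<^sub>R h) < d" using d False by (auto simp: t_def)
    have "norm (D (t *\<^sub>R h)) \<le> norm (f (x + t *\<^sub>R h) - f x) + norm (f (x + t *\<^sub>R h) - f x - D (t *\<^sub>R h))"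
      using norm_triangle_ineq4[of "f (x + t *\<^sub>R h) - f x" "f (x + t *\<^sub>R h) - f x - D (t *\<^sub>R h)"] by simp
    also have "\<dots> \<le> L * norm (t *\<^sub>R h) + e * norm (t *\<^sub>R h)"
      using L[of "x + t *\<^sub>R h"] d(2)[of "x + t *\<^sub>R h"] t by (intro add_mono) auto
    finally have "t * norm (D h) \<le> t * ((L + e) * norm h)"
      using t by (simp add: scaleR algebra_simps)
    then show ?thesis using t by simp
  qed (simp add: zero)
  show ?thesis
  proof (rule field_le_epsilon)
    fix e :: real assume e: "0 < e"
    have "norm (D h) \<le> (L + e / (norm h + 1)) * norm h"
      using e by (intro * divide_pos_pos) (auto simp: add_nonneg_pos)
    also have "\<dots> = L * norm h + e * (norm h / (norm h + 1))" by (simp add: algebra_simps)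
    also have "e * (norm h / (norm h + 1)) \<le> e * 1"
      using e by (intro mult_left_mono) (auto simp: divide_le_eq add_nonneg_pos)
    finally show "norm (D h) \<le> L * norm h + e" by simp
  qed
qed

lemma bochner_norm_bound:
  fixes f :: "'a \<Rightarrow> 'b::{banach, second_countable_topology}"
  assumes f: "integrable M f" and g: "integrable M g" and le: "\<And>x. norm (f x) \<le> g x"
  shows "norm (\<integral>x. f x \<partial>M) \<le> (\<integral>x. g x \<partial>M)"
proof -
  have "norm (\<integral>x. f x \<partial>M) \<le> (\<integral>x. norm (f x) \<partial>M)" by (rule integral_norm_bound)
  also have "\<dots> \<le> (\<integral>x. g x \<partial>M)" using f g le by (intro integral_mono) auto
  finally show ?thesis .
qed

context
  fixes f :: "'a::euclidean_space \<Rightarrow> 'b::euclidean_space" and L :: real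
  assumes lip: "\<And>x y. norm (f x - f y) \<le> L * norm (x - y)"
begin

lemma lip_continuous: "continuous_on UNIV f"
proof -
  have "(max 0 L)-lipschitz_on UNIV f"
  proof (rule lipschitz_onI)
    fix x y
    show "dist (f x) (f y) \<le> max 0 L * dist x y"
      using lip[of x y] mult_right_mono[of L "max 0 L" "norm (x - y)"] by (simp add: dist_norm)
  qed simp
  then show ?thesis by (rule lipschitz_on_continuous_on)
qed

lemma kernel_integrable:
  assumes q: "continuous_on UNIV q" and sq: "\<And>u. R < norm u \<Longrightarrow> q u = (0::real)"
  shows "integrable lborel (\<lambda>y. q (x - y) *\<^sub>R f y)" and "integrable lborel (\<lambda>z. q z *\<^sub>R f (x - z))"
    and "integrable lborel q"
    and "(\<integral>y. q (x - y) *\<^sub>R f y \<partial>lborel) = (\<integral>z. q z *\<^sub>R f (x - z) \<partial>lborel)"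
proof -
  note lc = lip_continuous
  have c1: "continuous_on S (\<lambda>y. q (x - y) *\<^sub>R f y)" and c2: "continuous_on S (\<lambda>z. q z *\<^sub>R f (x - z))" for S
    by (intro continuous_intros continuous_on_compose2[OF q] continuous_on_compose2[OF lc]; auto)+
  have "integrable lborel (\<lambda>y. indicator (cball x R) y *\<^sub>R (q (x - y) *\<^sub>R f y))"
    by (rule borel_integrable_compact[OF _ c1]) simp
  moreover have "indicator (cball x R) y *\<^sub>R (q (x - y) *\<^sub>R f y) = q (x - y) *\<^sub>R f y" for y
    using sq[of "x - y"] by (cases "norm (x - y) \<le> R") (auto simp: indicator_def dist_norm)
  ultimately show "integrable lborel (\<lambda>y. q (x - y) *\<^sub>R f y)" by (simp only:)
  have "integrable lborel (\<lambda>z. indicator (cball 0 R) z *\<^sub>R (q z *\<^sub>R f (x - z)))"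
    by (rule borel_integrable_compact[OF _ c2]) simp
  moreover have "indicator (cball 0 R) z *\<^sub>R (q z *\<^sub>R f (x - z)) = q z *\<^sub>R f (x - z)" for z
    using sq[of z] by (cases "norm z \<le> R") (auto simp: indicator_def)
  ultimately show "integrable lborel (\<lambda>z. q z *\<^sub>R f (x - z))" by (simp only:)
  have "integrable lborel (\<lambda>z. indicator (cball 0 R) z *\<^sub>R q z)"
    by (rule borel_integrable_compact) (auto intro: continuous_on_subset[OF q])
  moreover have "indicator (cball 0 R) z *\<^sub>R q z = q z" for z
    using sq[of z] by (cases "norm z \<le> R") (auto simp: indicator_def)
  ultimately show "integrable lborel q" by (simp only:)
  let ?F = "\<lambda>y. q (x - y) *\<^sub>R f y"
  have mF: "?F \<in> borel_measurable borel" using c1[of UNIV] by (rule borel_measurable_continuous_onI)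
  have "distr lborel borel (\<lambda>z. x - z) = (lborel :: 'a measure)"
    using lborel_affine[of "-1 :: real" x] by (simp add: density_1 one_ennreal_def[symmetric])
  then have "(\<integral>y. ?F y \<partial>lborel) = (\<integral>y. ?F y \<partial>distr lborel borel (\<lambda>z. x - z))" by simp
  also have "\<dots> = (\<integral>z. ?F (x - z) \<partial>lborel)" by (subst integral_distr) (use mF in auto)
  finally show "(\<integral>y. q (x - y) *\<^sub>R f y \<partial>lborel) = (\<integral>z. q z *\<^sub>R f (x - z) \<partial>lborel)" by simp
qed

lemma convolution_lipschitz:
  assumes q: "continuous_on UNIV q" and sq: "\<And>u. R < norm u \<Longrightarrow> q u = (0::real)"
  shows "norm ((\<integral>y. q (x - y) *\<^sub>R f y \<partial>lborel) - (\<integral>y. q (x' - y) *\<^sub>R f y \<partial>lborel))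
    \<le> (\<integral>z. \<bar>q z\<bar> \<partial>lborel) * L * norm (x - x')"
proof -
  note k = kernel_integrable[where R=R, OF q sq]
  have "(\<integral>y. q (x - y) *\<^sub>R f y \<partial>lborel) - (\<integral>y. q (x' - y) *\<^sub>R f y \<partial>lborel)
      = (\<integral>z. q z *\<^sub>R f (x - z) - q z *\<^sub>R f (x' - z) \<partial>lborel)"
    by (simp add: k)
  also have "norm \<dots> \<le> (\<integral>z. \<bar>q z\<bar> * (L * norm (x - x')) \<partial>lborel)"
  proof (rule bochner_norm_bound)
    show "integrable lborel (\<lambda>z. \<bar>q z\<bar> * (L * norm (x - x')))" using k(3) by auto
    show "integrable lborel (\<lambda>z. q z *\<^sub>R f (x - z) - q z *\<^sub>R f (x' - z))" using k(2) by auto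
    fix z
    have "norm (q z *\<^sub>R f (x - z) - q z *\<^sub>R f (x' - z)) = \<bar>q z\<bar> * norm (f (x - z) - f (x' - z))"
      by (simp flip: scaleR_diff_right)
    also have "\<dots> \<le> \<bar>q z\<bar> * (L * norm (x - x'))"
      using lip[of "x - z" "x' - z"] by (intro mult_left_mono) auto
    finally show "norm (q z *\<^sub>R f (x - z) - q z *\<^sub>R f (x' - z)) \<le> \<bar>q z\<bar> * (L * norm (x - x'))" .
  qed
  also have "\<dots> = (\<integral>z. \<bar>q z\<bar> \<partial>lborel) * L * norm (x - x')" by simp
  finally show ?thesis .
qed

text \<open>
  The derivative of the squared positive part is \<open>2 * max 0 s\<close>, which is Lipschitz.
\<close>
lemma square_part_taylor: "\<bar>(max 0 (s + t))\<^sup>2 - (max 0 s)\<^sup>2 - 2 * max 0 s * t\<bar> \<le> t\<^sup>2" for s t :: real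
proof -
  consider "0 \<le> s" "0 \<le> s + t" | "0 \<le> s" "s + t < 0" | "s < 0" "0 \<le> s + t" | "s < 0" "s + t < 0" by linarith
  then show ?thesis
  proof cases
    case 2
    have "s * (s + t) \<le> 0" using 2 by (intro mult_nonneg_nonpos) auto
    moreover have "s * t \<le> 0" using 2 by (intro mult_nonneg_nonpos) auto
    moreover have "0 \<le> t * t" "0 \<le> (s + t) * (s + t)" by auto
    ultimately show ?thesis using 2 by (simp add: power2_eq_square algebra_simps abs_le_iff)
  next
    case 3
    then have "(s + t)\<^sup>2 \<le> t\<^sup>2" by (intro power_mono) auto
    then show ?thesis using 3 by simp
  qed (auto simp: power2_eq_square algebra_simps)
qed

text \<open>
  Convolution with the normalised kernel \<open>(max 0 (\<epsilon>\<^sup>2 - (norm u)\<^sup>2))\<^sup>2\<close>. This kernel is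
  supported in the ball of radius \<open>\<epsilon>\<close> and its derivative is explicit and Lipschitz, so
  differentiating under the integral only takes the quadratic bound on its Taylor remainder.
\<close>
lemma mollify_lipschitz:
  assumes \<epsilon>: "0 < \<epsilon>"
  obtains g g' where "C1_map g g'" "\<And>x. norm (g x - f x) \<le> L * \<epsilon>"
    "\<And>x y. norm (g x - g y) \<le> L * norm (x - y)"
    "\<And>x. (\<And>y. norm (y - x) \<le> \<epsilon> \<Longrightarrow> f y = 0) \<Longrightarrow> g x = 0"
proof -
  define sp where "sp u = max 0 (\<epsilon>\<^sup>2 - (norm u)\<^sup>2)" for u :: 'a
  define k where "k u = (sp u)\<^sup>2" for u
  \<comment> \<open>The derivative of \<open>k\<close> at \<open>u\<close> in the direction \<open>h\<close>.\<close>
  define q where "q h u = - 4 * sp u * (u \<bullet> h)" for h u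
  have sp0: "sp u = 0" if "\<epsilon> \<le> norm u" for u
    using that \<epsilon> by (simp add: sp_def max_def power_mono)
  have spc: "continuous_on UNIV sp" unfolding sp_def by (intro continuous_intros)
  have kc: "continuous_on UNIV k" unfolding k_def by (intro continuous_intros spc)
  have qc: "continuous_on UNIV (q h)" for h unfolding q_def by (intro continuous_intros spc)
  have k0: "k u = 0" if "\<epsilon> < norm u" for u using sp0 that by (simp add: k_def)
  have q0: "q h u = 0" if "\<epsilon> < norm u" for u h using sp0 that by (simp add: q_def)
  note kk = kernel_integrable[where R=\<epsilon>, OF kc k0] and qq = kernel_integrable[where R=\<epsilon>, OF qc q0]
  define Z where "Z = (\<integral>z. k z \<partial>lborel)"
  have Z: "0 < Z"
  proof -
    have "0 \<le> Z" unfolding Z_def by (rule integral_nonneg_AE) (simp add: k_def)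
    moreover have "Z \<noteq> 0"
    proof
      assume "Z = 0"
      then have "AE z in lborel. k z = 0"
        unfolding Z_def using integral_nonneg_eq_0_iff_AE[OF kk(3)] by (simp add: k_def)
      then have "AE z in lborel. z \<notin> ball (0::'a) \<epsilon>"
      proof eventually_elim
        case (elim z)
        then have "sp z = 0" by (simp add: k_def)
        then have "\<epsilon>\<^sup>2 \<le> (norm z)\<^sup>2" by (simp add: sp_def max_def split: if_splits)
        then show ?case using \<epsilon> by (simp add: abs_le_square_iff[symmetric])
      qed
      then have "ball (0::'a) \<epsilon> \<in> null_sets lborel" by (subst AE_iff_null_sets) auto
      then have "negligible (ball (0::'a) \<epsilon>)" by (simp add: negligible_iff_null_sets null_sets_completionI)
      then show False using open_not_negligible[of "ball (0::'a) \<epsilon>"] \<epsilon> by auto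
    qed
    ultimately show ?thesis by simp
  qed
  define g where "g x = (\<integral>y. k (x - y) *\<^sub>R f y \<partial>lborel) /\<^sub>R Z" for x
  define g' where "g' x h = (\<integral>y. q h (x - y) *\<^sub>R f y \<partial>lborel) /\<^sub>R Z" for x h
  have taylor: "\<bar>k (u + h) - k u - q h u\<bar> \<le> ((2 * \<epsilon> + 3)\<^sup>2 + 2 * \<epsilon>\<^sup>2) * (norm h)\<^sup>2 * indicator (cball 0 (\<epsilon> + 1)) u"
    if h: "norm h \<le> 1" for u h
  proof (cases "norm u \<le> \<epsilon> + 1")
    case True
    define t where "t = - (2 * (u \<bullet> h) + (norm h)\<^sup>2)"
    define s where "s = \<epsilon>\<^sup>2 - (norm u)\<^sup>2"
    have st: "\<epsilon>\<^sup>2 - (norm (u + h))\<^sup>2 = s + t"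
      by (simp add: s_def t_def power2_norm_eq_inner inner_add_left inner_add_right inner_commute)
    have m: "0 \<le> max 0 s" "max 0 s \<le> \<epsilon>\<^sup>2" using \<epsilon> by (auto simp: s_def)
    have e: "k (u + h) - k u - q h u = ((max 0 (s + t))\<^sup>2 - (max 0 s)\<^sup>2 - 2 * max 0 s * t) - 2 * max 0 s * (norm h)\<^sup>2"
      unfolding k_def sp_def st q_def s_def[symmetric] by (simp add: t_def algebra_simps)
    have "\<bar>u \<bullet> h\<bar> \<le> (\<epsilon> + 1) * norm h"
      using Cauchy_Schwarz_ineq2[of u h] mult_right_mono[OF True norm_ge_zero[of h]] by linarith
    moreover have "(norm h)\<^sup>2 \<le> 1 * norm h"
      unfolding power2_eq_square using h by (intro mult_right_mono) auto
    ultimately have A1: "u \<bullet> h \<le> \<epsilon> * norm h + norm h" "- (u \<bullet> h) \<le> \<epsilon> * norm h + norm h" "(norm h)\<^sup>2 \<le> norm h"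
      by (simp_all add: distrib_right abs_le_iff)
    have A2: "0 \<le> (norm h)\<^sup>2" "0 \<le> norm h" by simp_all
    have "t \<le> 2 * (\<epsilon> * norm h) + 3 * norm h" "- t \<le> 2 * (\<epsilon> * norm h) + 3 * norm h"
      unfolding t_def using A1 A2 by linarith+
    then have "\<bar>t\<bar> \<le> (2 * \<epsilon> + 3) * norm h" by (simp add: distrib_right abs_le_iff)
    then have "\<bar>t\<bar>\<^sup>2 \<le> ((2 * \<epsilon> + 3) * norm h)\<^sup>2" by (intro power_mono) auto
    then have t2: "t\<^sup>2 \<le> (2 * \<epsilon> + 3)\<^sup>2 * (norm h)\<^sup>2" by (simp add: power_mult_distrib)
    have "\<bar>2 * max 0 s * (norm h)\<^sup>2\<bar> \<le> 2 * \<epsilon>\<^sup>2 * (norm h)\<^sup>2"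
      using m by (simp add: abs_mult mult_right_mono)
    then have "\<bar>k (u + h) - k u - q h u\<bar> \<le> t\<^sup>2 + 2 * \<epsilon>\<^sup>2 * (norm h)\<^sup>2"
      unfolding e using square_part_taylor[of s t] by linarith
    also have "\<dots> \<le> ((2 * \<epsilon> + 3)\<^sup>2 + 2 * \<epsilon>\<^sup>2) * (norm h)\<^sup>2" using t2 by (simp add: distrib_right)
    finally show ?thesis using True by simp
  next
    case False
    then have "\<epsilon> \<le> norm (u + h)" "\<epsilon> \<le> norm u"
      using h norm_triangle_ineq4[of "u + h" h] by auto
    then show ?thesis by (simp add: k_def q_def sp0)
  qed
  define A where "A = ((2 * \<epsilon> + 3)\<^sup>2 + 2 * \<epsilon>\<^sup>2)"
  have A: "0 \<le> A" by (simp add: A_def)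
  have deriv: "(g has_derivative g' x) (at x)" for x
  proof -
    define I where "I = (\<integral>y. indicator (cball x (\<epsilon> + 1)) y *\<^sub>R norm (f y) \<partial>lborel)"
    have Ii: "integrable lborel (\<lambda>y. indicator (cball x (\<epsilon> + 1)) y *\<^sub>R norm (f y))"
      by (rule borel_integrable_compact) (auto intro!: continuous_intros continuous_on_subset[OF lip_continuous])
    have I: "0 \<le> I" unfolding I_def by (rule integral_nonneg_AE) auto
    have quad: "norm (g (x + h) - g x - g' x h) \<le> A * I / Z * (norm h)\<^sup>2" if h: "norm h \<le> 1" for h
    proof -
      have "g (x + h) - g x - g' x h = (\<integral>y. (k (x + h - y) - k (x - y) - q h (x - y)) *\<^sub>R f y \<partial>lborel) /\<^sub>R Z"
        unfolding g_def g'_def using kk(1) qq(1)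
        by (simp add: scaleR_diff_left scaleR_diff_right[symmetric])
      also have "norm \<dots> = norm (\<integral>y. (k (x + h - y) - k (x - y) - q h (x - y)) *\<^sub>R f y \<partial>lborel) / Z"
        using Z by (simp add: divide_inverse mult.commute)
      also have "\<dots> \<le> (\<integral>y. A * (norm h)\<^sup>2 * (indicator (cball x (\<epsilon> + 1)) y *\<^sub>R norm (f y)) \<partial>lborel) / Z"
      proof (intro divide_right_mono bochner_norm_bound)
        show "integrable lborel (\<lambda>y. (k (x + h - y) - k (x - y) - q h (x - y)) *\<^sub>R f y)"
          using kk(1) qq(1) by (simp add: scaleR_diff_left)
        show "integrable lborel (\<lambda>y. A * (norm h)\<^sup>2 * (indicator (cball x (\<epsilon> + 1)) y *\<^sub>R norm (f y)))"
          using Ii by auto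
        fix y
        have "\<bar>k (x - y + h) - k (x - y) - q h (x - y)\<bar> \<le> A * (norm h)\<^sup>2 * indicator (cball 0 (\<epsilon> + 1)) (x - y)"
          unfolding A_def by (rule taylor[OF h])
        moreover have "x - y + h = x + h - y" by simp
        moreover have "indicator (cball 0 (\<epsilon> + 1)) (x - y) = (indicator (cball x (\<epsilon> + 1)) y :: real)"
          by (simp add: indicator_def dist_norm norm_minus_commute)
        ultimately have "\<bar>k (x + h - y) - k (x - y) - q h (x - y)\<bar> \<le> A * (norm h)\<^sup>2 * indicator (cball x (\<epsilon> + 1)) y" by metis
        then have "\<bar>k (x + h - y) - k (x - y) - q h (x - y)\<bar> * norm (f y) \<le> A * (norm h)\<^sup>2 * indicator (cball x (\<epsilon> + 1)) y * norm (f y)"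
          by (rule mult_right_mono) simp
        then show "norm ((k (x + h - y) - k (x - y) - q h (x - y)) *\<^sub>R f y) \<le> A * (norm h)\<^sup>2 * (indicator (cball x (\<epsilon> + 1)) y *\<^sub>R norm (f y))"
          by (simp add: mult.assoc)
      qed (use Z in auto)
      also have "\<dots> = A * I / Z * (norm h)\<^sup>2" by (simp add: I_def)
      finally show ?thesis .
    qed
    have lin: "linear (g' x)"
    proof (rule linearI)
      fix h1 h2 c
      have "q (h1 + h2) u *\<^sub>R f y = q h1 u *\<^sub>R f y + q h2 u *\<^sub>R f y" for u y
        by (simp add: q_def inner_add_right algebra_simps)
      then show "g' x (h1 + h2) = g' x h1 + g' x h2"
        unfolding g'_def using qq(1) by (simp add: scaleR_add_right)
      have "q (c *\<^sub>R h1) u *\<^sub>R f y = c *\<^sub>R (q h1 u *\<^sub>R f y)" for u y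
        by (simp add: q_def)
      then have "(\<integral>y. q (c *\<^sub>R h1) (x - y) *\<^sub>R f y \<partial>lborel) = (\<integral>y. c *\<^sub>R (q h1 (x - y) *\<^sub>R f y) \<partial>lborel)"
        by (simp only:)
      also have "\<dots> = c *\<^sub>R (\<integral>y. q h1 (x - y) *\<^sub>R f y \<partial>lborel)" by (rule integral_scaleR_right)
      finally show "g' x (c *\<^sub>R h1) = c *\<^sub>R g' x h1"
        unfolding g'_def by (simp add: mult.commute)
    qed
    show ?thesis
      unfolding has_derivative_at
    proof (intro conjI)
      show "bounded_linear (g' x)" using lin by (simp add: linear_conv_bounded_linear)
      show "(\<lambda>h. norm (g (x + h) - g x - g' x h) / norm h) \<midarrow>0\<rightarrow> 0"
      proof (rule Lim_null_comparison[where g="\<lambda>h. A * I / Z * norm h"])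
        show "\<forall>\<^sub>F h in at 0. norm (norm (g (x + h) - g x - g' x h) / norm h) \<le> A * I / Z * norm h"
          unfolding eventually_at
        proof (intro exI[of _ 1] conjI ballI impI)
          fix h :: 'a assume h: "h \<noteq> 0 \<and> dist h 0 < 1"
          then have "norm (g (x + h) - g x - g' x h) \<le> A * I / Z * (norm h)\<^sup>2" by (intro quad) auto
          then show "norm (norm (g (x + h) - g x - g' x h) / norm h) \<le> A * I / Z * norm h"
            using h by (simp add: divide_le_eq power2_eq_square mult.assoc)
        qed simp
        show "(\<lambda>h. A * I / Z * norm h) \<midarrow>0\<rightarrow> 0"
          by (rule tendsto_eq_intros refl | simp)+
      qed
    qed
  qed
  have cont: "continuous_on UNIV (\<lambda>x. g' x h)" for h
  proof -
    define B where "B = (\<integral>z. \<bar>q h z\<bar> \<partial>lborel) * L / Z"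
    have "(max 0 B)-lipschitz_on UNIV (\<lambda>x. g' x h)"
    proof (rule lipschitz_onI)
      fix x y
      have "dist (g' x h) (g' y h) = norm ((\<integral>z. q h (x - z) *\<^sub>R f z \<partial>lborel) - (\<integral>z. q h (y - z) *\<^sub>R f z \<partial>lborel)) / Z"
        unfolding g'_def dist_norm using Z
        by (simp flip: scaleR_diff_right add: divide_inverse mult.commute)
      also have "\<dots> \<le> (\<integral>z. \<bar>q h z\<bar> \<partial>lborel) * L * norm (x - y) / Z"
        using Z by (intro divide_right_mono convolution_lipschitz[where R=\<epsilon>, OF qc q0]) auto
      also have "\<dots> = B * dist x y" by (simp add: B_def dist_norm)
      also have "\<dots> \<le> max 0 B * dist x y" by (intro mult_right_mono) auto
      finally show "dist (g' x h) (g' y h) \<le> max 0 B * dist x y" .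
    qed simp
    then show ?thesis by (rule lipschitz_on_continuous_on)
  qed
  have "\<bar>k z\<bar> = k z" for z by (simp add: k_def)
  then have Zabs: "(\<integral>z. \<bar>k z\<bar> \<partial>lborel) = Z" unfolding Z_def by (simp only:)
  show ?thesis
  proof (rule that[of g g'])
    show "C1_map g g'" using deriv cont by (simp add: C1_map_def)
    show "norm (g x - g y) \<le> L * norm (x - y)" for x y
    proof -
      have "norm (g x - g y) = norm ((\<integral>z. k (x - z) *\<^sub>R f z \<partial>lborel) - (\<integral>z. k (y - z) *\<^sub>R f z \<partial>lborel)) / Z"
        unfolding g_def using Z by (simp flip: scaleR_diff_right add: divide_inverse mult.commute)
      also have "\<dots> \<le> Z * L * norm (x - y) / Z"
        using Z convolution_lipschitz[where R=\<epsilon>, OF kc k0, of x y] unfolding Zabs by (intro divide_right_mono) auto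
      finally show ?thesis using Z by simp
    qed
    show "norm (g x - f x) \<le> L * \<epsilon>" for x
    proof -
      have "g x - f x = (\<integral>z. k z *\<^sub>R f (x - z) \<partial>lborel) /\<^sub>R Z - (\<integral>z. k z *\<^sub>R f x \<partial>lborel) /\<^sub>R Z"
      proof -
        have "(\<integral>z. k z *\<^sub>R f x \<partial>lborel) = Z *\<^sub>R f x"
          unfolding Z_def by (rule integral_scaleR_left) (rule kk(3))
        then show ?thesis using Z kk(4)[of x] by (simp only: g_def) simp
      qed
      also have "\<dots> = (\<integral>z. k z *\<^sub>R f (x - z) - k z *\<^sub>R f x \<partial>lborel) /\<^sub>R Z"
        using kk(2,3) by (simp add: scaleR_diff_right)
      also have "norm \<dots> = norm (\<integral>z. k z *\<^sub>R f (x - z) - k z *\<^sub>R f x \<partial>lborel) / Z"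
        using Z by (simp add: divide_inverse mult.commute)
      also have "\<dots> \<le> (\<integral>z. k z * (L * \<epsilon>) \<partial>lborel) / Z"
      proof (intro divide_right_mono bochner_norm_bound)
        show "integrable lborel (\<lambda>z. k z *\<^sub>R f (x - z) - k z *\<^sub>R f x)" using kk(2,3) by auto
        show "integrable lborel (\<lambda>z. k z * (L * \<epsilon>))" using kk(3) by auto
        fix z
        have "norm (k z *\<^sub>R f (x - z) - k z *\<^sub>R f x) = k z * norm (f (x - z) - f x)"
          by (simp flip: scaleR_diff_right) (simp add: k_def)
        also have "\<dots> \<le> k z * (L * \<epsilon>)"
        proof (cases "norm z \<le> \<epsilon>")
          case True
          have "norm (f (x - z) - f x) \<le> L * norm z" using lip[of "x - z" x] by simp
          moreover have "0 \<le> L"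
          proof (rule ccontr)
            assume "\<not> 0 \<le> L"
            moreover obtain b :: 'a where "b \<in> Basis" using nonempty_Basis by blast
            ultimately show False using order_trans[OF norm_ge_zero lip[of b 0]] by simp
          qed
          ultimately have "norm (f (x - z) - f x) \<le> L * \<epsilon>" using True by (meson mult_left_mono order_trans)
          then show ?thesis by (intro mult_left_mono) (auto simp: k_def)
        next
          case False then show ?thesis using k0[of z] by simp
        qed
        finally show "norm (k z *\<^sub>R f (x - z) - k z *\<^sub>R f x) \<le> k z * (L * \<epsilon>)" .
      qed (use Z in auto)
      also have "\<dots> = L * \<epsilon>" using Z by (simp add: Z_def[symmetric])
      finally show ?thesis .
    qed
    show "g x = 0" if z: "\<And>y. norm (y - x) \<le> \<epsilon> \<Longrightarrow> f y = 0" for x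
    proof -
      have "k (x - y) *\<^sub>R f y = 0" for y
        using z[of y] k0[of "x - y"] by (cases "norm (y - x) \<le> \<epsilon>") (auto simp: norm_minus_commute)
      then have "(\<integral>y. k (x - y) *\<^sub>R f y \<partial>lborel) = 0" by (simp only: Bochner_Integration.integral_zero)
      then show ?thesis by (simp add: g_def)
    qed
  qed
qed

end

section \<open>Transport of test functions over one time step\<close>

lemma C1_map_imp_C1:
  fixes f :: "real^'d \<Rightarrow> real"
  assumes f: "C1_map f f'"
  shows "C1 f" and "nabla f x \<bullet> h = f' x h"
proof -
  define g where "g x = (\<Sum>b\<in>Basis. f' x b *\<^sub>R b)" for x
  have gh: "h \<bullet> g x = f' x h" for x h
  proof -
    have "f' x h = f' x (\<Sum>b\<in>Basis. (h \<bullet> b) *\<^sub>R b)" by (simp add: euclidean_representation)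
    also have "\<dots> = (\<Sum>b\<in>Basis. (h \<bullet> b) *\<^sub>R f' x b)"
      using C1_map_linear[OF f, of x] by (simp add: linear_sum linear_scale)
    finally show ?thesis by (simp add: g_def inner_sum_right mult.commute)
  qed
  have gd: "GDERIV f x :> g x" for x
    using f by (simp add: gderiv_def gh C1_map_def)
  have n: "nabla f x = g x" for x
    unfolding nabla_def
  proof (rule the_equality[where P="\<lambda>g. GDERIV f x :> g", OF gd])
    fix g2 assume "GDERIV f x :> g2"
    then have "(\<lambda>h. h \<bullet> g2) = (\<lambda>h. h \<bullet> g x)"
      using gd[of x] unfolding gderiv_def by (rule has_derivative_unique)
    then show "g2 = g x" by (metis vector_eq_ldot)
  qed
  show "nabla f x \<bullet> h = f' x h" by (simp add: n gh[symmetric] inner_commute)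
  have "continuous_on UNIV g"
    unfolding g_def using f by (intro continuous_intros) (auto simp: C1_map_def)
  moreover have "nabla f = g" using n by auto
  moreover have "f differentiable (at x)" for x
    using f unfolding C1_map_def differentiable_def by blast
  ultimately show "C1 f" by (simp add: C1_def)
qed

lemma derivative_zero_outside_support:
  fixes f :: "'a::euclidean_space \<Rightarrow> 'b::euclidean_space"
  assumes f: "C1_map f f'" and R: "\<And>x. f x \<noteq> 0 \<Longrightarrow> norm x \<le> R" and y: "R < norm y"
  shows "f' y h = 0"
proof -
  have "(f has_derivative f' y) (at y)" using f by (simp add: C1_map_def)
  moreover have "(f has_derivative (\<lambda>_. 0)) (at y)"
  proof (rule has_derivative_transform_within_open[of "\<lambda>_. 0" _ _ _ "{x. R < norm x}"])
    show "open {x::'a. R < norm x}" by (intro open_Collect_less continuous_intros)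
    show "0 = f x" if "x \<in> {x. R < norm x}" for x using R[of x] that by force
  qed (use y in auto)
  ultimately have "f' y = (\<lambda>_. 0)" by (rule has_derivative_unique)
  then show ?thesis by simp
qed

text \<open>
  The bound \<open>B\<close> on the derivative is part of the notion because it has to be followed through
  many compositions with Euler steps.
\<close>
definition test_map :: "real \<Rightarrow> (real^'d \<Rightarrow> real) \<Rightarrow> (real^'d \<Rightarrow> real^'d \<Rightarrow> real) \<Rightarrow> bool" where
  "test_map B f f' \<longleftrightarrow> C1_map f f' \<and> (\<forall>x h. \<bar>f' x h\<bar> \<le> B * norm h) \<and> bounded {x. f x \<noteq> 0}"

text \<open>
  A short Euler step does not bring distant points close to the origin, so composition with it
  preserves compactness of supports.
\<close>
lemma expanding_step:
  fixes W :: "'a::euclidean_space \<Rightarrow> 'a"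
  assumes W: "\<And>x y. norm (W x - W y) \<le> K * norm (x - y)" and c: "0 \<le> c" "c \<le> h" "h * K \<le> 1/2" and K: "0 \<le> K"
    and R: "norm (x + c *\<^sub>R W x) \<le> R"
  shows "norm x \<le> 2 * (R + h * norm (W 0))"
proof -
  have "norm (W x) \<le> norm (W 0) + K * norm x"
    using norm_triangle_ineq[of "W 0" "W x - W 0"] W[of x 0] by simp
  then have "c * norm (W x) \<le> h * (norm (W 0) + K * norm x)"
    using c by (intro mult_mono) auto
  also have "\<dots> = h * norm (W 0) + (h * K) * norm x" by (simp add: algebra_simps)
  also have "\<dots> \<le> h * norm (W 0) + 1/2 * norm x" using c by (intro add_left_mono mult_right_mono) auto
  finally have "c * norm (W x) \<le> h * norm (W 0) + norm x / 2" by simp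
  moreover have "norm x \<le> norm (x + c *\<^sub>R W x) + c * norm (W x)"
    using norm_triangle_ineq4[of "x + c *\<^sub>R W x" "c *\<^sub>R W x"] c by simp
  ultimately show ?thesis using R by simp
qed

lemma test_map_step:
  assumes f: "test_map B f f'" and W: "C1_map W W'"
    and Wl: "\<And>x y. norm (W x - W y) \<le> K * norm (x - y)" and h: "0 \<le> h" "h * K \<le> 1/2" and K: "0 \<le> K" and B: "0 \<le> B"
  shows "test_map (B * (1 + K * h)) (\<lambda>x. f (x + h *\<^sub>R W x)) (\<lambda>x k. f' (x + h *\<^sub>R W x) (k + h *\<^sub>R W' x k))"
  unfolding test_map_def
proof (intro conjI allI)
  show "C1_map (\<lambda>x. f (x + h *\<^sub>R W x)) (\<lambda>x k. f' (x + h *\<^sub>R W x) (k + h *\<^sub>R W' x k))"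
    using f by (intro C1_map_compose[OF _ C1_map_step[OF W]]) (simp add: test_map_def)
  fix x k
  have W': "norm (W' x k) \<le> K * norm k"
    by (rule lipschitz_derivative_bound[where f=W and x=x]) (use W Wl in \<open>auto simp: C1_map_def\<close>)
  have "\<bar>f' (x + h *\<^sub>R W x) (k + h *\<^sub>R W' x k)\<bar> \<le> B * norm (k + h *\<^sub>R W' x k)"
    using f by (simp add: test_map_def)
  also have "\<dots> \<le> B * (norm k + h * (K * norm k))"
  proof (rule mult_left_mono[OF _ B])
    have "norm (k + h *\<^sub>R W' x k) \<le> norm k + h * norm (W' x k)"
      using norm_triangle_ineq[of k "h *\<^sub>R W' x k"] h by simp
    also have "\<dots> \<le> norm k + h * (K * norm k)" using W' h by (intro add_left_mono mult_left_mono) auto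
    finally show "norm (k + h *\<^sub>R W' x k) \<le> norm k + h * (K * norm k)" .
  qed
  finally show "\<bar>f' (x + h *\<^sub>R W x) (k + h *\<^sub>R W' x k)\<bar> \<le> B * (1 + K * h) * norm k" by (simp add: algebra_simps)
next
  obtain R where R: "\<And>x. f x \<noteq> 0 \<Longrightarrow> norm x \<le> R" using f by (auto simp: test_map_def bounded_iff)
  show "bounded {x. f (x + h *\<^sub>R W x) \<noteq> 0}"
    unfolding bounded_iff
  proof (intro exI ballI)
    fix x assume "x \<in> {x. f (x + h *\<^sub>R W x) \<noteq> 0}"
    then show "norm x \<le> 2 * (R + h * norm (W 0))"
      using R by (intro expanding_step[OF Wl h(1) order_refl h(2) K]) auto
  qed
qed

context continuity_equation
begin

lemma \<rho>_prob: "s \<in> {0..\<tau>} \<Longrightarrow> prob_space (\<rho> s)" and \<rho>_sets: "s \<in> {0..\<tau>} \<Longrightarrow> sets (\<rho> s) = sets borel"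
  using prob_densities_facts[OF \<rho>_P] by auto

lemma compact_support_integrable:
  assumes g: "continuous_on UNIV g" "bounded {x. g x \<noteq> (0::real)}" and s: "s \<in> {0..\<tau>}"
  shows "integrable (\<rho> s) g"
proof -
  interpret R: prob_space "\<rho> s" using \<rho>_prob[OF s] .
  obtain B where B: "\<And>x. \<bar>g x\<bar> \<le> B" using compact_support_bounded[OF g] by blast
  have "g \<in> borel_measurable (\<rho> s)"
    using borel_measurable_continuous_onI[OF g(1)] measurable_cong_sets[OF \<rho>_sets[OF s] refl] by blast
  then show ?thesis by (intro R.integrable_const_bound[where B=B]) (use B in auto)
qed

text \<open>
  The rule for differentiating a pairing whose two arguments both move: the term with \<open>p\<close>
  comes from the test function, the term with \<open>\<psi>'\<close> from the weak equation for the fixed test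
  function \<open>\<psi> s0\<close>. As the measure in the first term also moves, weak continuity of the curve and
  uniformity of the derivative \<open>p\<close> in space enter.
\<close>
lemma moving_test_function:
  assumes ab: "0 \<le> a" "b \<le> \<tau>" and s0: "s0 \<in> {a..b}"
    and \<psi>0: "C1_map (\<psi> s0) \<psi>'"
    and \<psi>: "\<And>s. s \<in> {a..b} \<Longrightarrow> continuous_on UNIV (\<psi> s)" "\<And>s. s \<in> {a..b} \<Longrightarrow> bounded {x. \<psi> s x \<noteq> (0::real)}"
    and d: "\<And>s x. s \<in> {a..b} \<Longrightarrow> ((\<lambda>s. \<psi> s x) has_real_derivative p s x) (at s within {a..b})"
    and u: "\<And>\<eta>. 0 < \<eta> \<Longrightarrow> \<exists>\<delta>>0. \<forall>s\<in>{a..b}. \<bar>s - s0\<bar> < \<delta> \<longrightarrow> (\<forall>x. \<bar>p s x - p s0 x\<bar> \<le> \<eta>)"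
    and p: "continuous_on UNIV (p s0)" "bounded {x. p s0 x \<noteq> 0}"
  shows "((\<lambda>s. \<integral>x. \<psi> s x \<partial>\<rho> s) has_real_derivative
      (\<integral>x. p s0 x \<partial>\<rho> s0) + (\<integral>x. \<psi>' x (v (\<rho> s0) x) \<partial>\<rho> s0)) (at s0 within {a..b})"
proof -
  have sub: "{a..b} \<subseteq> {0..\<tau>}" using ab by auto
  have s0': "s0 \<in> {0..\<tau>}" using s0 sub by auto
  have "((\<lambda>s. \<integral>x. \<psi> s0 x \<partial>\<rho> s) has_real_derivative (\<integral>x. nabla (\<psi> s0) x \<bullet> v (\<rho> s0) x \<partial>\<rho> s0)) (at s0 within {0..\<tau>})"
    by (rule \<rho>_weak[OF C1_map_imp_C1(1)[OF \<psi>0] \<psi>(2)[OF s0] s0'])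
  then have B: "((\<lambda>s. ((\<integral>x. \<psi> s0 x \<partial>\<rho> s) - (\<integral>x. \<psi> s0 x \<partial>\<rho> s0)) / (s - s0)) \<longlongrightarrow> (\<integral>x. \<psi>' x (v (\<rho> s0) x) \<partial>\<rho> s0)) (at s0 within {a..b})"
    unfolding C1_map_imp_C1(2)[OF \<psi>0] has_field_derivative_iff by (rule tendsto_within_subset[OF _ sub])
  have P: "((\<lambda>s. \<integral>x. p s0 x \<partial>\<rho> s) \<longlongrightarrow> (\<integral>x. p s0 x \<partial>\<rho> s0)) (at s0 within {a..b})"
    by (rule tendsto_within_subset[OF weak_continuity[OF p s0'] sub])
  have A: "((\<lambda>s. ((\<integral>x. \<psi> s x \<partial>\<rho> s) - (\<integral>x. \<psi> s0 x \<partial>\<rho> s)) / (s - s0) - (\<integral>x. p s0 x \<partial>\<rho> s)) \<longlongrightarrow> 0) (at s0 within {a..b})"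
  proof (rule tendstoI)
    fix e :: real assume e: "0 < e"
    then obtain \<delta> where \<delta>: "0 < \<delta>" "\<And>s x. s \<in> {a..b} \<Longrightarrow> \<bar>s - s0\<bar> < \<delta> \<Longrightarrow> \<bar>p s x - p s0 x\<bar> \<le> e/2"
      using u[of "e/2"] by auto
    show "\<forall>\<^sub>F s in at s0 within {a..b}. dist (((\<integral>x. \<psi> s x \<partial>\<rho> s) - (\<integral>x. \<psi> s0 x \<partial>\<rho> s)) / (s - s0) - (\<integral>x. p s0 x \<partial>\<rho> s)) 0 < e"
      unfolding eventually_at
    proof (intro exI[of _ \<delta>] conjI ballI impI)
      fix s assume s: "s \<in> {a..b}" and "s \<noteq> s0 \<and> dist s s0 < \<delta>"
      then have ne: "s \<noteq> s0" and sd: "\<bar>s - s0\<bar> < \<delta>" by (auto simp: dist_real_def)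
      have s': "s \<in> {0..\<tau>}" using s sub by auto
      interpret R: prob_space "\<rho> s" by (rule \<rho>_prob[OF s'])
      have pt: "\<bar>(\<psi> s x - \<psi> s0 x) / (s - s0) - p s0 x\<bar> \<le> e/2" for x
      proof -
        let ?S = "{a..b} \<inter> {r. \<bar>r - s0\<bar> < \<delta>}"
        have conv: "convex ?S"
        proof -
          have "{r. \<bar>r - s0\<bar> < \<delta>} = ball s0 \<delta>" by (auto simp: dist_real_def)
          then show ?thesis by (simp add: convex_Int)
        qed
        have "norm ((\<psi> s x - s * p s0 x) - (\<psi> s0 x - s0 * p s0 x)) \<le> (e/2) * norm (s - s0)"
        proof (rule field_differentiable_bound[OF conv, where f="\<lambda>r. \<psi> r x - r * p s0 x" and f'="\<lambda>r. p r x - p s0 x"])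
          fix r assume r: "r \<in> ?S"
          show "((\<lambda>r. \<psi> r x - r * p s0 x) has_field_derivative p r x - p s0 x) (at r within ?S)"
            by (rule has_field_derivative_subset[of _ _ _ "{a..b}"])
               (use r d in \<open>auto intro!: derivative_eq_intros\<close>)
          show "norm (p r x - p s0 x) \<le> e/2" using \<delta>(2) r by simp
        qed (use s s0 sd \<delta> in auto)
        moreover have "(\<psi> s x - \<psi> s0 x) / (s - s0) - p s0 x = ((\<psi> s x - s * p s0 x) - (\<psi> s0 x - s0 * p s0 x)) / (s - s0)"
          using ne by (simp add: field_simps)
        ultimately show ?thesis using ne by (simp add: divide_le_eq)
      qed
      have i: "integrable (\<rho> s) (\<psi> s)" "integrable (\<rho> s) (\<psi> s0)" "integrable (\<rho> s) (p s0)"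
        using \<psi> p s s0 s' by (auto intro!: compact_support_integrable)
      have "((\<integral>x. \<psi> s x \<partial>\<rho> s) - (\<integral>x. \<psi> s0 x \<partial>\<rho> s)) / (s - s0) - (\<integral>x. p s0 x \<partial>\<rho> s)
          = (\<integral>x. (\<psi> s x - \<psi> s0 x) / (s - s0) - p s0 x \<partial>\<rho> s)"
        using i by simp
      also have "norm \<dots> \<le> (\<integral>x. e/2 \<partial>\<rho> s)"
        using i pt by (intro bochner_norm_bound) auto
      also have "\<dots> = e/2" using R.prob_space by simp
      finally show "dist (((\<integral>x. \<psi> s x \<partial>\<rho> s) - (\<integral>x. \<psi> s0 x \<partial>\<rho> s)) / (s - s0) - (\<integral>x. p s0 x \<partial>\<rho> s)) 0 < e"
        using e by (simp add: dist_norm)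
    qed (rule \<delta>)
  qed
  show ?thesis
    unfolding has_field_derivative_iff
  proof (rule Lim_transform_eventually)
    show "((\<lambda>s. (((\<integral>x. \<psi> s x \<partial>\<rho> s) - (\<integral>x. \<psi> s0 x \<partial>\<rho> s)) / (s - s0) - (\<integral>x. p s0 x \<partial>\<rho> s)) + (\<integral>x. p s0 x \<partial>\<rho> s)
        + ((\<integral>x. \<psi> s0 x \<partial>\<rho> s) - (\<integral>x. \<psi> s0 x \<partial>\<rho> s0)) / (s - s0)) \<longlongrightarrow>
        (\<integral>x. p s0 x \<partial>\<rho> s0) + (\<integral>x. \<psi>' x (v (\<rho> s0) x) \<partial>\<rho> s0)) (at s0 within {a..b})"
      using tendsto_add[OF tendsto_add[OF A P] B] by simp
    show "\<forall>\<^sub>F s in at s0 within {a..b}. (((\<integral>x. \<psi> s x \<partial>\<rho> s) - (\<integral>x. \<psi> s0 x \<partial>\<rho> s)) / (s - s0) - (\<integral>x. p s0 x \<partial>\<rho> s)) + (\<integral>x. p s0 x \<partial>\<rho> s)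
        + ((\<integral>x. \<psi> s0 x \<partial>\<rho> s) - (\<integral>x. \<psi> s0 x \<partial>\<rho> s0)) / (s - s0)
        = ((\<integral>x. \<psi> s x \<partial>\<rho> s) - (\<integral>x. \<psi> s0 x \<partial>\<rho> s0)) / (s - s0)"
      by (simp add: diff_divide_distrib)
  qed
qed

text \<open>
  The functions \<open>f (x + (b - s) *\<^sub>R W x)\<close> lead from the pull-back of \<open>f\<close> by the Euler step at
  \<open>s = a\<close> to \<open>f\<close> at \<open>s = b\<close>. The derivative of their integrals against \<open>\<rho> s\<close> is the
  integral of \<open>f'\<close> in the direction \<open>(V s x - W x) + (b - s) *\<^sub>R W' x (V s x)\<close>, which is small if
  \<open>W\<close> approximates the velocity and the step is short.
\<close>
lemma transport_one_step:
  assumes ab: "0 \<le> a" "a < b" "b \<le> \<tau>" and f: "test_map B f f'" and B: "0 \<le> B"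
    and W: "C1_map W W'" and Wl: "\<And>x y. norm (W x - W y) \<le> lipC * norm (x - y)"
    and small: "(b - a) * lipC \<le> 1/2"
    and Q: "\<And>s. s \<in> {a..b} \<Longrightarrow> (\<integral>\<^sup>+x. ennreal (norm (V s x - W x)) \<partial>\<rho> s) \<le> ennreal Q" "0 \<le> Q"
    and m: "\<And>s. s \<in> {a..b} \<Longrightarrow> (\<integral>\<^sup>+x. ennreal (norm (V s x)) \<partial>\<rho> s) \<le> ennreal m" "0 \<le> m"
  shows "\<bar>(\<integral>x. f x \<partial>\<rho> b) - (\<integral>x. f (x + (b - a) *\<^sub>R W x) \<partial>\<rho> a)\<bar> \<le> (b - a) * (B * (Q + (b - a) * lipC * m))"
proof -
  define E where "E s x = x + (b - s) *\<^sub>R W x" for s x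
  define p where "p s x = f' (E s x) (- W x)" for s x
  have fC: "C1_map f f'" and fB: "\<And>x h. \<bar>f' x h\<bar> \<le> B * norm h" and fs: "bounded {x. f x \<noteq> 0}"
    using f by (auto simp: test_map_def)
  have K: "0 \<le> lipC" using lipC_pos by simp
  have W'l: "norm (W' x k) \<le> lipC * norm k" for x k
    by (rule lipschitz_derivative_bound[where f=W and x=x]) (use W Wl in \<open>auto simp: C1_map_def\<close>)
  obtain R where R: "\<And>x. f x \<noteq> 0 \<Longrightarrow> norm x \<le> R" using fs by (auto simp: bounded_iff)
  define R' where "R' = 2 * (R + (b - a) * norm (W 0))"
  have far: "R < norm (E s x)" if "s \<in> {a..b}" "R' < norm x" for s x
  proof (rule ccontr)
    assume "\<not> R < norm (E s x)"
    then have "norm x \<le> R'"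
      unfolding R'_def E_def using that small K
      by (intro expanding_step[OF Wl, of "b - s" "b - a"]) auto
    then show False using that by simp
  qed
  have Wc: "continuous_on UNIV W" by (rule C1_map_continuous[OF W])
  have Ec: "continuous_on UNIV (\<lambda>z. E (fst z) (snd z))"
    unfolding E_def by (intro continuous_intros continuous_on_compose2[OF Wc]) auto
  have pc: "continuous_on UNIV (\<lambda>z. p (fst z) (snd z))"
    unfolding p_def
    by (rule C1_map_derivative_continuous[OF fC Ec]) (intro continuous_intros continuous_on_compose2[OF Wc]; simp)
  have pc1: "continuous_on UNIV (p s)" for s
    using continuous_on_compose2[OF pc, of UNIV "\<lambda>x. (s, x)"] by (simp add: continuous_intros)
  have p0: "p s x = 0" if "s \<in> {a..b}" "R' < norm x" for s x
    unfolding p_def by (rule derivative_zero_outside_support[OF fC R far[OF that]])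
  have f0: "f (E s x) = 0" if "s \<in> {a..b}" "R' < norm x" for s x
    using R[of "E s x"] far[OF that] by force
  have \<psi>C: "C1_map (\<lambda>x. f (E s x)) (\<lambda>x h. f' (E s x) (h + (b - s) *\<^sub>R W' x h))" for s
    unfolding E_def by (rule C1_map_compose[OF fC C1_map_step[OF W]])
  have unif: "\<exists>\<delta>>0. \<forall>s\<in>{a..b}. \<bar>s - s0\<bar> < \<delta> \<longrightarrow> (\<forall>x. \<bar>p s x - p s0 x\<bar> \<le> \<eta>)" if s0: "s0 \<in> {a..b}" and \<eta>: "0 < \<eta>" for s0 \<eta>
  proof -
    have "uniformly_continuous_on ({a..b} \<times> cball 0 R') (\<lambda>z. p (fst z) (snd z))"
      by (rule compact_uniformly_continuous) (auto intro: continuous_on_subset[OF pc] compact_Times)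
    then obtain \<delta> where \<delta>: "0 < \<delta>" "\<And>z z'. z \<in> {a..b} \<times> cball 0 R' \<Longrightarrow> z' \<in> {a..b} \<times> cball 0 R' \<Longrightarrow>
        dist z' z < \<delta> \<Longrightarrow> dist (p (fst z') (snd z')) (p (fst z) (snd z)) < \<eta>"
      unfolding uniformly_continuous_on_def using \<eta> by meson
    have "\<bar>p s x - p s0 x\<bar> \<le> \<eta>" if s: "s \<in> {a..b}" "\<bar>s - s0\<bar> < \<delta>" for s x
    proof (cases "norm x \<le> R'")
      case True
      have "dist (s, x) (s0, x) < \<delta>" using s by (simp add: dist_Pair_Pair dist_real_def)
      then have "dist (p (fst (s, x)) (snd (s, x))) (p (fst (s0, x)) (snd (s0, x))) < \<eta>"
        using True s s0 by (intro \<delta>(2)) auto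
      then show ?thesis by (simp add: dist_real_def)
    next
      case False then show ?thesis using p0[of s x] p0[of s0 x] s s0 \<eta> by simp
    qed
    then show ?thesis using \<delta>(1) by blast
  qed
  have sd: "((\<lambda>s. f (E s x)) has_real_derivative p s x) (at s within {a..b})" for s x
  proof -
    have 1: "((\<lambda>s. E s x) has_derivative (\<lambda>t. t *\<^sub>R (- W x))) (at s within {a..b})"
      unfolding E_def by (auto intro!: derivative_eq_intros)
    have 2: "(f has_derivative f' (E s x)) (at (E s x))" using fC by (simp add: C1_map_def)
    have 3: "((\<lambda>s. f (E s x)) has_derivative (\<lambda>t. f' (E s x) (t *\<^sub>R (- W x)))) (at s within {a..b})"
      by (rule has_derivative_compose[OF 1 2])
    have "(\<lambda>t. f' (E s x) (t *\<^sub>R (- W x))) = (*) (p s x)"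
    proof
      fix t show "f' (E s x) (t *\<^sub>R (- W x)) = p s x * t"
        unfolding p_def using linear_scale[OF C1_map_linear[OF fC, of "E s x"], of t "- W x"] by simp
    qed
    then show ?thesis using 3 by (simp add: has_field_derivative_def)
  qed
  define G' where "G' s = (\<integral>x. p s x \<partial>\<rho> s) + (\<integral>x. f' (E s x) (v (\<rho> s) x + (b - s) *\<^sub>R W' x (v (\<rho> s) x)) \<partial>\<rho> s)" for s
  have bs: "bounded {x. f (E s x) \<noteq> 0}" "bounded {x. p s x \<noteq> 0}" if "s \<in> {a..b}" for s
    unfolding bounded_iff using f0[OF that] p0[OF that] by (meson mem_Collect_eq not_le)+
  have G: "((\<lambda>s. \<integral>x. f (E s x) \<partial>\<rho> s) has_real_derivative G' s) (at s within {a..b})" if s: "s \<in> {a..b}" for s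
    unfolding G'_def
    by (rule moving_test_function[where \<psi>="\<lambda>s x. f (E s x)" and p=p, OF ab(1,3) s \<psi>C])
       (use bs sd unif[OF s] pc1 C1_map_continuous[OF \<psi>C] s in auto)
  have G'b: "norm (G' s) \<le> B * (Q + (b - a) * lipC * m)" if s: "s \<in> {a..b}" for s
  proof -
    have s': "s \<in> {0..\<tau>}" using s ab by auto
    interpret R: prob_space "\<rho> s" by (rule \<rho>_prob[OF s'])
    note [measurable_cong] = \<rho>_sets[OF s']
    have Vc: "continuous_on UNIV (V s)" unfolding V_def by (rule ext_continuous[OF \<rho>_P[OF clamp_time_in]])
    have [measurable]: "V s \<in> borel_measurable borel" "W \<in> borel_measurable borel"
      using Vc Wc by (auto intro: borel_measurable_continuous_onI)
    let ?q = "\<lambda>x. f' (E s x) (v (\<rho> s) x + (b - s) *\<^sub>R W' x (v (\<rho> s) x))"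
    have Es: "continuous_on UNIV (E s)"
      unfolding E_def by (intro continuous_intros Wc)
    have "continuous_on UNIV ?q"
      by (intro C1_map_derivative_continuous[OF fC Es] continuous_intros v_cont[OF \<rho>_P[OF s']]
          C1_map_derivative_continuous[OF W])
    then have qm[measurable]: "?q \<in> borel_measurable borel" by (rule borel_measurable_continuous_onI)
    have [measurable]: "p s \<in> borel_measurable borel" using pc1 by (rule borel_measurable_continuous_onI)
    have bs0: "0 \<le> b - s" "b - s \<le> b - a" using s by auto
    have step: "norm ((b - s) *\<^sub>R W' x y) \<le> (b - a) * lipC * norm y" for x y
    proof -
      have "norm ((b - s) *\<^sub>R W' x y) = (b - s) * norm (W' x y)" using bs0 by simp
      also have "\<dots> \<le> (b - a) * (lipC * norm y)" using bs0 W'l K by (intro mult_mono) auto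
      finally show ?thesis by (simp add: mult.assoc)
    qed
    have Vi: "integrable (\<rho> s) (\<lambda>x. norm (V s x))"
      by (rule integrableI_bounded) (use m(1)[OF s] in \<open>auto intro: le_less_trans\<close>)
    have qi: "integrable (\<rho> s) ?q"
    proof (rule Bochner_Integration.integrable_bound)
      show "integrable (\<rho> s) (\<lambda>x. B * (1 + (b - a) * lipC) * norm (V s x))" using Vi by auto
      show "AE x in \<rho> s. norm (?q x) \<le> norm (B * (1 + (b - a) * lipC) * norm (V s x))"
        using V_AE[OF s']
      proof eventually_elim
        case (elim x)
        have "norm (?q x) \<le> B * norm (V s x + (b - s) *\<^sub>R W' x (V s x))" using fB elim by simp
        also have "\<dots> \<le> B * (norm (V s x) + (b - a) * lipC * norm (V s x))"
          using norm_triangle_le[OF add_left_mono[OF step]] B by (intro mult_left_mono) auto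
        also have "\<dots> = B * (1 + (b - a) * lipC) * norm (V s x)" by (simp add: algebra_simps)
        also have "\<dots> \<le> norm \<dots>" by simp
        finally show ?case .
      qed
    qed measurable
    have pi: "integrable (\<rho> s) (p s)" by (rule compact_support_integrable[OF pc1 bs(2)[OF s] s'])
    have "G' s = (\<integral>x. p s x + ?q x \<partial>\<rho> s)" unfolding G'_def using pi qi by simp
    then have "ennreal (norm (G' s)) \<le> (\<integral>\<^sup>+x. ennreal (norm (p s x + ?q x)) \<partial>\<rho> s)"
      using integral_norm_bound_ennreal[of "\<rho> s" "\<lambda>x. p s x + ?q x"] pi qi by simp
    also have "\<dots> \<le> (\<integral>\<^sup>+x. ennreal B * (ennreal (norm (V s x - W x)) + ennreal ((b - a) * lipC) * ennreal (norm (V s x))) \<partial>\<rho> s)"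
    proof (rule nn_integral_mono_AE)
      show "AE x in \<rho> s. ennreal (norm (p s x + ?q x))
          \<le> ennreal B * (ennreal (norm (V s x - W x)) + ennreal ((b - a) * lipC) * ennreal (norm (V s x)))"
        using V_AE[OF s']
      proof eventually_elim
        case (elim x)
        have "p s x + ?q x = f' (E s x) ((V s x - W x) + (b - s) *\<^sub>R W' x (V s x))"
        proof -
          have "(V s x - W x) + (b - s) *\<^sub>R W' x (V s x) = - W x + (V s x + (b - s) *\<^sub>R W' x (V s x))" by simp
          then show ?thesis
            using linear_add[OF C1_map_linear[OF fC, of "E s x"], of "- W x" "V s x + (b - s) *\<^sub>R W' x (V s x)"] elim
            by (simp only: p_def)
        qed
        then have "norm (p s x + ?q x) \<le> B * norm ((V s x - W x) + (b - s) *\<^sub>R W' x (V s x))" using fB by simp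
        also have "\<dots> \<le> B * (norm (V s x - W x) + (b - a) * lipC * norm (V s x))"
          using norm_triangle_le[OF add_left_mono[OF step]] B by (intro mult_left_mono) auto
        finally have "ennreal (norm (p s x + ?q x)) \<le> ennreal (B * (norm (V s x - W x) + (b - a) * lipC * norm (V s x)))"
          by (rule ennreal_leI)
        then show ?case using B ab K by (simp add: ennreal_mult ennreal_plus)
      qed
    qed
    also have "\<dots> = ennreal B * ((\<integral>\<^sup>+x. ennreal (norm (V s x - W x)) \<partial>\<rho> s) + ennreal ((b - a) * lipC) * (\<integral>\<^sup>+x. ennreal (norm (V s x)) \<partial>\<rho> s))"
      by (simp add: nn_integral_add nn_integral_cmult)
    also have "\<dots> \<le> ennreal B * (ennreal Q + ennreal ((b - a) * lipC) * ennreal m)"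
      using Q(1)[OF s] m(1)[OF s] by (intro mult_left_mono add_mono) auto
    also have "\<dots> = ennreal (B * (Q + (b - a) * lipC * m))"
      using B Q(2) m(2) ab K by (simp add: ennreal_mult ennreal_plus)
    finally show ?thesis using B Q(2) m(2) ab K by (subst (asm) ennreal_le_iff) auto
  qed
  have "norm ((\<integral>x. f (E b x) \<partial>\<rho> b) - (\<integral>x. f (E a x) \<partial>\<rho> a)) \<le> B * (Q + (b - a) * lipC * m) * norm (b - a)"
    by (rule field_differentiable_bound[where S="{a..b}" and f="\<lambda>s. \<integral>x. f (E s x) \<partial>\<rho> s" and f'=G'])
       (use G G'b ab in auto)
  then show ?thesis using ab by (simp add: E_def mult.commute)
qed

end

section \<open>The flow transports the curve\<close>

lemma discrete_gronwall:
  fixes \<delta> :: "nat \<Rightarrow> real"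
  assumes "\<delta> 0 \<le> 0" and step: "\<And>k. k < N \<Longrightarrow> \<delta> (Suc k) \<le> (1 + K * h) * \<delta> k + h * c"
    and pos: "0 \<le> K" "0 \<le> h" "0 \<le> c" and "k \<le> N"
  shows "\<delta> k \<le> real k * h * exp (K * (real k * h)) * c"
  using \<open>k \<le> N\<close>
proof (induction k)
  case (Suc k)
  let ?e = "\<lambda>k. exp (K * (real k * h))"
  have e: "(1 + K * h) * ?e k \<le> ?e (Suc k)"
  proof -
    have "(1 + K * h) * ?e k \<le> exp (K * h) * ?e k"
      by (intro mult_right_mono) (simp_all add: exp_ge_add_one_self)
    also have "\<dots> = ?e (Suc k)" by (simp add: exp_add[symmetric] algebra_simps)
    finally show ?thesis .
  qed
  have e1: "1 \<le> ?e (Suc k)" using pos by simp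
  have "\<delta> (Suc k) \<le> (1 + K * h) * \<delta> k + h * c" using step Suc by simp
  also have "\<dots> \<le> (1 + K * h) * (real k * h * ?e k * c) + h * c"
    using Suc pos by (intro add_right_mono mult_left_mono) auto
  also have "\<dots> = real k * h * c * ((1 + K * h) * ?e k) + h * c * 1" by (simp add: algebra_simps)
  also have "\<dots> \<le> real k * h * c * ?e (Suc k) + h * c * ?e (Suc k)"
    using e e1 pos by (intro add_mono mult_left_mono) auto
  also have "\<dots> = real (Suc k) * h * ?e (Suc k) * c" by (simp add: algebra_simps)
  finally show ?case .
qed (use assms in simp)

context continuity_equation
begin

text \<open>
  A choice that turns the bounds of \<open>uniform_bounds\<close> into a constant, so that the flow of \<open>V\<close>
  becomes available in the whole context.
\<close>
definition Mb :: real where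
  "Mb = (SOME M. 0 \<le> M \<and> (\<forall>s\<in>{0..\<tau>}. (\<integral>\<^sup>+x. ennreal ((norm x)\<^sup>2) \<partial>\<rho> s) \<le> ennreal M) \<and> (\<forall>s. norm (V s 0) \<le> M))"

lemma Mb: "0 \<le> Mb" "\<And>s. s \<in> {0..\<tau>} \<Longrightarrow> (\<integral>\<^sup>+x. ennreal ((norm x)\<^sup>2) \<partial>\<rho> s) \<le> ennreal Mb" "\<And>s. norm (V s 0) \<le> Mb"
proof -
  have "\<exists>M. 0 \<le> M \<and> (\<forall>s\<in>{0..\<tau>}. (\<integral>\<^sup>+x. ennreal ((norm x)\<^sup>2) \<partial>\<rho> s) \<le> ennreal M) \<and> (\<forall>s. norm (V s 0) \<le> M)"
    using uniform_bounds by metis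
  from someI_ex[OF this, folded Mb_def]
  show "0 \<le> Mb" "\<And>s. s \<in> {0..\<tau>} \<Longrightarrow> (\<integral>\<^sup>+x. ennreal ((norm x)\<^sup>2) \<partial>\<rho> s) \<le> ennreal Mb" "\<And>s. norm (V s 0) \<le> Mb"
    by blast+
qed

sublocale F: lipschitz_field V lipC Mb \<tau>
  by unfold_locales (use V_measurable V_lipschitz Mb lipC_pos \<tau> in auto)

lemma V_pair_measurable:
  assumes [measurable]: "f \<in> M \<rightarrow>\<^sub>M borel" "g \<in> M \<rightarrow>\<^sub>M borel"
  shows "(\<lambda>z. V (f z) (g z)) \<in> borel_measurable M"
proof -
  have "(\<lambda>z. (f z, g z)) \<in> M \<rightarrow>\<^sub>M borel" unfolding borel_prod[symmetric] by measurable
  from measurable_compose[OF this V_measurable] show ?thesis by simp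
qed

lemma flow_measurable_at:
  assumes "t \<in> {0..\<tau>}"
  shows "F.flow t \<in> borel_measurable borel"
proof -
  have "(\<lambda>x. (t, x)) \<in> borel \<rightarrow>\<^sub>M (borel :: (real \<times> (real^'d)) measure)"
    unfolding borel_prod[symmetric] by measurable
  from measurable_compose[OF this F.flow_measurable] show ?thesis using assms by simp
qed

lemma first_moment:
  assumes s: "s \<in> {0..\<tau>}"
  shows "(\<integral>\<^sup>+x. ennreal (norm x) \<partial>\<rho> s) \<le> ennreal (1 + Mb)"
proof -
  interpret R: prob_space "\<rho> s" by (rule \<rho>_prob[OF s])
  note [measurable_cong] = \<rho>_sets[OF s]
  have "(\<integral>\<^sup>+x. ennreal (norm x) \<partial>\<rho> s) \<le> (\<integral>\<^sup>+x. 1 + ennreal ((norm x)\<^sup>2) \<partial>\<rho> s)"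
  proof (intro nn_integral_mono)
    fix x :: "real^'d"
    have "norm x \<le> 1 + (norm x)\<^sup>2"
    proof -
      have "2 * norm x \<le> (norm x)\<^sup>2 + 1" using sum_squares_bound[of "norm x" 1] by simp
      then show ?thesis using norm_ge_zero[of x] zero_le_power2[of "norm x"] by linarith
    qed
    then have "ennreal (norm x) \<le> ennreal (1 + (norm x)\<^sup>2)" by (rule ennreal_leI)
    then show "ennreal (norm x) \<le> 1 + ennreal ((norm x)\<^sup>2)" by (simp add: ennreal_plus)
  qed
  also have "\<dots> = 1 + (\<integral>\<^sup>+x. ennreal ((norm x)\<^sup>2) \<partial>\<rho> s)"
    using R.emeasure_space_1 by (simp add: nn_integral_add)
  also have "\<dots> \<le> 1 + ennreal Mb" using Mb(2)[OF s] by (intro add_left_mono)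
  also have "\<dots> = ennreal (1 + Mb)" using Mb(1) by (simp add: ennreal_plus)
  finally show ?thesis .
qed

definition V_moment :: real where "V_moment = Mb + lipC * (1 + Mb)"

lemma V_moment:
  assumes s: "s \<in> {0..\<tau>}"
  shows "(\<integral>\<^sup>+x. ennreal (norm (V s x)) \<partial>\<rho> s) \<le> ennreal V_moment" and "0 \<le> V_moment"
proof -
  interpret R: prob_space "\<rho> s" by (rule \<rho>_prob[OF s])
  note [measurable_cong] = \<rho>_sets[OF s]
  have "(\<integral>\<^sup>+x. ennreal (norm (V s x)) \<partial>\<rho> s) \<le> (\<integral>\<^sup>+x. ennreal Mb + ennreal lipC * ennreal (norm x) \<partial>\<rho> s)"
    using F.V_growth Mb(1) lipC_pos
    by (intro nn_integral_mono) (simp add: ennreal_mult[symmetric] ennreal_plus[symmetric] ennreal_leI del: ennreal_plus)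
  also have "\<dots> = ennreal Mb + ennreal lipC * (\<integral>\<^sup>+x. ennreal (norm x) \<partial>\<rho> s)"
    using R.emeasure_space_1 by (simp add: nn_integral_add nn_integral_cmult)
  also have "\<dots> \<le> ennreal Mb + ennreal lipC * ennreal (1 + Mb)"
    using first_moment[OF s] by (intro add_left_mono mult_left_mono) auto
  also have "\<dots> = ennreal V_moment"
    using Mb(1) lipC_pos by (simp add: V_moment_def ennreal_mult[symmetric] ennreal_plus[symmetric] del: ennreal_plus)
  finally show "(\<integral>\<^sup>+x. ennreal (norm (V s x)) \<partial>\<rho> s) \<le> ennreal V_moment" .
  show "0 \<le> V_moment" using Mb(1) lipC_pos by (simp add: V_moment_def)
qed

text \<open>
  \<open>W\<close> is the mollified average of the field over the time interval. Its mean distance from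
  \<open>V s\<close> is at most the average over \<open>r\<close> of the mean distances between \<open>V r\<close> and \<open>V s\<close>, which
  \<open>ext_L2\<close> bounds in terms of \<open>W2 (\<rho> r) (\<rho> s)\<close>. The number \<open>\<kappa>\<close> is the weight in
  \<open>y \<le> \<kappa> + y\<^sup>2 / \<kappa>\<close>, by which the mean is bounded through the mean square.
\<close>
lemma averaged_field:
  assumes ab: "0 \<le> a" "a < b" "b \<le> \<tau>" and \<epsilon>: "0 < \<epsilon>" and \<kappa>: "0 < \<kappa>"
    and \<eta>: "\<And>r s. r \<in> {a..b} \<Longrightarrow> s \<in> {a..b} \<Longrightarrow> (W2 (\<rho> r) (\<rho> s))\<^sup>2 \<le> \<eta>"
  obtains W W' where "C1_map W W'" "\<And>x y. norm (W x - W y) \<le> lipC * norm (x - y)"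
    "\<And>y. norm ((b - a) *\<^sub>R W y - integral {a..b} (\<lambda>s. V s y)) \<le> (b - a) * (lipC * \<epsilon>)"
    "\<And>s. s \<in> {a..b} \<Longrightarrow> (\<integral>\<^sup>+x. ennreal (norm (V s x - W x)) \<partial>\<rho> s)
        \<le> ennreal (lipC * \<epsilon> + (\<kappa> + (2 * lipC\<^sup>2 + 2 * C) * \<eta> / \<kappa>))"
proof -
  define h where "h = b - a"
  have h: "0 < h" using ab by (simp add: h_def)
  have K: "0 < lipC" by (rule lipC_pos)
  have sub: "{a..b} \<subseteq> {0..\<tau>}" using ab by auto
  have \<eta>0: "0 \<le> \<eta>" using order_trans[OF zero_le_power2 \<eta>[of a a]] ab by simp
  define c where "c = 2 * lipC\<^sup>2 + 2 * C"
  have c: "0 \<le> c" using C_pos by (simp add: c_def)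
  define U where "U y = integral {a..b} (\<lambda>s. V s y) /\<^sub>R h" for y
  have Vi: "(\<lambda>s. V s y) integrable_on {a..b}" for y
    by (rule F.V_along_curve_integrable[OF continuous_on_const sub])
  have Ul: "norm (U x - U y) \<le> lipC * norm (x - y)" for x y
  proof -
    have "norm (integral {a..b} (\<lambda>s. V s x) - integral {a..b} (\<lambda>s. V s y)) \<le> lipC * norm (x - y) * (b - a)"
      by (rule has_integral_norm_le[OF has_integral_diff[OF integrable_integral[OF Vi] integrable_integral[OF Vi]]])
         (use ab V_lipschitz in auto)
    then have "norm (U x - U y) \<le> (lipC * norm (x - y) * h) / h"
      unfolding U_def using h by (simp flip: scaleR_diff_right add: h_def divide_inverse mult.commute mult_left_mono)
    then show ?thesis using h by simp
  qed
  obtain W W' where W: "C1_map W W'" "\<And>x. norm (W x - U x) \<le> lipC * \<epsilon>"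
    "\<And>x y. norm (W x - W y) \<le> lipC * norm (x - y)"
    by (rule mollify_lipschitz[OF Ul \<epsilon>]) blast
  have Wc: "continuous_on UNIV W" by (rule C1_map_continuous[OF W(1)])
  have [measurable]: "W \<in> borel_measurable borel" by (rule borel_measurable_continuous_onI[OF Wc])
  have Uc: "continuous_on UNIV U" by (rule lip_continuous[OF Ul])
  have [measurable]: "U \<in> borel_measurable borel" by (rule borel_measurable_continuous_onI[OF Uc])
  have avg: "norm ((b - a) *\<^sub>R W y - integral {a..b} (\<lambda>s. V s y)) \<le> (b - a) * (lipC * \<epsilon>)" for y
  proof -
    have "h *\<^sub>R W y - integral {a..b} (\<lambda>s. V s y) = h *\<^sub>R (W y - U y)"
      using h by (simp add: U_def scaleR_diff_right)
    then show ?thesis using W(2)[of y] h by (simp add: h_def)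
  qed
  have Q: "(\<integral>\<^sup>+x. ennreal (norm (V s x - W x)) \<partial>\<rho> s) \<le> ennreal (lipC * \<epsilon> + (\<kappa> + c * \<eta> / \<kappa>))" if s: "s \<in> {a..b}" for s
  proof -
    have s': "s \<in> {0..\<tau>}" using s sub by auto
    interpret R: prob_space "\<rho> s" by (rule \<rho>_prob[OF s'])
    interpret P: pair_sigma_finite "\<rho> s" "lborel :: real measure" ..
    note [measurable_cong] = \<rho>_sets[OF s']
    note [measurable] = V_pair_measurable
    define D where "D x r = ennreal (if r \<in> {a..b} then norm (V s x - V r x) else 0)" for x r
    have Dm[measurable]: "case_prod D \<in> borel_measurable (\<rho> s \<Otimes>\<^sub>M lborel)"
      unfolding D_def[abs_def] by measurable
    have 1: "ennreal (norm (V s x - U x)) \<le> ennreal (1/h) * (\<integral>\<^sup>+r. D x r \<partial>lborel)" for x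
    proof -
      let ?g = "\<lambda>r. norm (V s x - V r x)"
      have gb: "?g r \<le> 2 * (Mb + lipC * norm x)" for r
        using order_trans[OF norm_triangle_ineq4[of "V s x" "V r x"] add_mono[OF F.V_growth[of s x] F.V_growth[of r x]]]
        by (simp only: mult_2)
      have gm: "?g \<in> borel_measurable borel" by measurable
      have gi: "?g integrable_on {a..b}"
      proof (rule measurable_bounded_by_integrable_imp_integrable)
        show "?g \<in> borel_measurable (lebesgue_on {a..b})"
          by (intro measurable_restrict_space1 measurable_completion) (use gm in simp)
        show "(\<lambda>r. 2 * (Mb + lipC * norm x)) integrable_on {a..b}" by (rule integrable_const_ivl)
      qed (use gb in auto)
      have "V s x - U x = integral {a..b} (\<lambda>r. V s x - V r x) /\<^sub>R h"
        using h ab Vi by (simp add: U_def integral_diff[OF integrable_const_ivl Vi] scaleR_diff_right h_def)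
      then have "norm (V s x - U x) = norm (integral {a..b} (\<lambda>r. V s x - V r x)) / h"
        using h by (simp add: divide_inverse mult.commute)
      also have "\<dots> \<le> integral {a..b} ?g / h"
        using h by (intro divide_right_mono Henstock_Kurzweil_Integration.integral_norm_bound_integral gi integrable_diff Vi integrable_const_ivl) auto
      finally have "ennreal (norm (V s x - U x)) \<le> ennreal (1/h * integral {a..b} ?g)" by (intro ennreal_leI) simp
      also have "\<dots> = ennreal (1/h) * ennreal (integral {a..b} ?g)"
        using h by (intro ennreal_mult integral_nonneg gi) auto
      also have "ennreal (integral {a..b} ?g) = (\<integral>\<^sup>+r. D x r \<partial>lborel)"
        unfolding D_def
      proof (rule nn_integral_has_integral_lborel[symmetric])
        show "(\<lambda>r. if r \<in> {a..b} then ?g r else 0) \<in> borel_measurable borel" by measurable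
        show "((\<lambda>r. if r \<in> {a..b} then ?g r else 0) has_integral integral {a..b} ?g) UNIV"
          unfolding has_integral_restrict_UNIV using gi by (rule integrable_integral)
      qed auto
      finally show ?thesis .
    qed
    have 2: "(\<integral>\<^sup>+x. D x r \<partial>\<rho> s) \<le> ennreal (\<kappa> + c * \<eta> / \<kappa>) * indicator {a..b} r" for r
    proof (cases "r \<in> {a..b}")
      case True
      then have r': "r \<in> {0..\<tau>}" using sub by auto
      have "(\<integral>\<^sup>+x. D x r \<partial>\<rho> s) \<le> (\<integral>\<^sup>+x. ennreal \<kappa> + ennreal (1/\<kappa>) * ennreal ((norm (V s x - V r x))\<^sup>2) \<partial>\<rho> s)"
      proof (intro nn_integral_mono)
        fix x
        let ?y = "norm (V s x - V r x)"
        have "2 * ?y * \<kappa> \<le> ?y\<^sup>2 + \<kappa>\<^sup>2" by (rule sum_squares_bound)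
        moreover have "0 \<le> ?y * \<kappa>" using \<kappa> by simp
        ultimately have "?y * \<kappa> \<le> \<kappa>\<^sup>2 + ?y\<^sup>2" by linarith
        then have "?y \<le> \<kappa> + (1/\<kappa>) * ?y\<^sup>2" using \<kappa> by (simp add: field_simps power2_eq_square)
        then have "ennreal ?y \<le> ennreal (\<kappa> + (1/\<kappa>) * ?y\<^sup>2)" by (rule ennreal_leI)
        then show "D x r \<le> ennreal \<kappa> + ennreal (1/\<kappa>) * ennreal (?y\<^sup>2)"
          using True \<kappa> by (simp add: D_def ennreal_plus ennreal_mult[symmetric])
      qed
      also have "\<dots> = ennreal \<kappa> + ennreal (1/\<kappa>) * (\<integral>\<^sup>+x. ennreal ((norm (V s x - V r x))\<^sup>2) \<partial>\<rho> s)"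
        using R.emeasure_space_1 by (simp add: nn_integral_add nn_integral_cmult)
      also have "(\<integral>\<^sup>+x. ennreal ((norm (V s x - V r x))\<^sup>2) \<partial>\<rho> s) = (\<integral>\<^sup>+x. ennreal ((norm (ext (\<rho> r) x - v (\<rho> s) x))\<^sup>2) \<partial>\<rho> s)"
        by (rule nn_integral_cong_AE)
           (use V_AE[OF s'] in \<open>eventually_elim, simp add: norm_minus_commute V_def clamp_time_id[OF r']\<close>)
      also have "\<dots> \<le> ennreal (c * (W2 (\<rho> r) (\<rho> s))\<^sup>2)"
        unfolding c_def by (rule ext_L2[OF \<rho>_P[OF r'] \<rho>_P[OF s']])
      also have "\<dots> \<le> ennreal (c * \<eta>)" using \<eta>[OF True s] c by (intro ennreal_leI mult_left_mono) auto
      finally have "(\<integral>\<^sup>+x. D x r \<partial>\<rho> s) \<le> ennreal \<kappa> + ennreal (1/\<kappa>) * ennreal (c * \<eta>)"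
        by (meson add_left_mono mult_left_mono zero_le order_trans)
      also have "\<dots> = ennreal (\<kappa> + c * \<eta> / \<kappa>)"
        using \<kappa> c \<eta>0 by (simp add: ennreal_mult[symmetric] ennreal_plus[symmetric] del: ennreal_plus)
      finally show ?thesis using True by simp
    next
      case False
      then have "D x r = 0" for x by (simp only: D_def if_False ennreal_0)
      then show ?thesis by simp
    qed
    have "(\<integral>\<^sup>+x. ennreal (norm (V s x - U x)) \<partial>\<rho> s) \<le> (\<integral>\<^sup>+x. ennreal (1/h) * (\<integral>\<^sup>+r. D x r \<partial>lborel) \<partial>\<rho> s)"
      by (intro nn_integral_mono 1)
    also have "\<dots> = ennreal (1/h) * (\<integral>\<^sup>+x. \<integral>\<^sup>+r. D x r \<partial>lborel \<partial>\<rho> s)"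
      by (rule nn_integral_cmult) measurable
    also have "(\<integral>\<^sup>+x. \<integral>\<^sup>+r. D x r \<partial>lborel \<partial>\<rho> s) = (\<integral>\<^sup>+r. \<integral>\<^sup>+x. D x r \<partial>\<rho> s \<partial>lborel)"
      by (rule P.Fubini'[OF Dm, symmetric])
    also have "\<dots> \<le> (\<integral>\<^sup>+r. ennreal (\<kappa> + c * \<eta> / \<kappa>) * indicator {a..b} r \<partial>lborel)"
      by (intro nn_integral_mono 2)
    also have "\<dots> = ennreal (\<kappa> + c * \<eta> / \<kappa>) * ennreal h"
      using ab by (simp add: nn_integral_cmult h_def)
    finally have "(\<integral>\<^sup>+x. ennreal (norm (V s x - U x)) \<partial>\<rho> s) \<le> ennreal (1/h) * (ennreal (\<kappa> + c * \<eta> / \<kappa>) * ennreal h)"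
      by (meson mult_left_mono zero_le order_trans)
    also have "\<dots> = ennreal (\<kappa> + c * \<eta> / \<kappa>)"
    proof -
      have "ennreal (1/h) * (z * ennreal h) = z * (ennreal (1/h) * ennreal h)" for z by (simp only: ac_simps)
      moreover have "ennreal (1/h) * ennreal h = 1" using h by (simp add: ennreal_mult[symmetric])
      ultimately show ?thesis by simp
    qed
    finally have VU: "(\<integral>\<^sup>+x. ennreal (norm (V s x - U x)) \<partial>\<rho> s) \<le> ennreal (\<kappa> + c * \<eta> / \<kappa>)" .
    have "(\<integral>\<^sup>+x. ennreal (norm (V s x - W x)) \<partial>\<rho> s) \<le> (\<integral>\<^sup>+x. ennreal (lipC * \<epsilon>) + ennreal (norm (V s x - U x)) \<partial>\<rho> s)"
    proof (intro nn_integral_mono)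
      fix x
      have "norm (V s x - W x) \<le> lipC * \<epsilon> + norm (V s x - U x)"
        using norm_triangle_ineq4[of "V s x - U x" "W x - U x"] W(2)[of x] by simp
      then have "ennreal (norm (V s x - W x)) \<le> ennreal (lipC * \<epsilon> + norm (V s x - U x))" by (rule ennreal_leI)
      then show "ennreal (norm (V s x - W x)) \<le> ennreal (lipC * \<epsilon>) + ennreal (norm (V s x - U x))"
        using K \<epsilon> by (simp add: ennreal_plus)
    qed
    also have "\<dots> = ennreal (lipC * \<epsilon>) + (\<integral>\<^sup>+x. ennreal (norm (V s x - U x)) \<partial>\<rho> s)"
      using R.emeasure_space_1 by (simp add: nn_integral_add)
    also have "\<dots> \<le> ennreal (lipC * \<epsilon>) + ennreal (\<kappa> + c * \<eta> / \<kappa>)" using VU by (intro add_left_mono)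
    also have "\<dots> = ennreal (lipC * \<epsilon> + (\<kappa> + c * \<eta> / \<kappa>))"
      using K \<epsilon> \<kappa> c \<eta>0 by (intro ennreal_plus[symmetric]) auto
    finally show ?thesis .
  qed
  show ?thesis by (rule that[OF W(1,3) avg Q[unfolded c_def]])
qed

text \<open>
  Divide the time interval into \<open>N\<close> Euler steps with averaged fields. For the measures,
  \<open>transport_one_step\<close> shows that the integral of \<open>f\<close> against \<open>\<rho> T\<close> is close to that of
  \<open>f \<circ> Y N\<close> against \<open>\<rho> 0\<close>; for the trajectories, \<open>euler_step_error\<close> shows that \<open>Y N\<close> is
  close to the flow. All smallness parameters are tied to one number \<open>\<zeta>\<close>, to which both errors
  are proportional.
\<close>
lemma flow_pushforward_test:
  assumes T: "T \<in> {0..\<tau>}" and f: "test_map B f f'" and B: "0 \<le> B"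
  shows "(\<integral>x. f x \<partial>\<rho> T) = (\<integral>x. f (F.flow T x) \<partial>\<rho> 0)"
proof (cases "T = 0")
  case True
  have "F.flow 0 x = x" for x using F.flow_equation[of 0 x] \<tau> by simp
  then show ?thesis using True by simp
next
  case False
  then have T0: "0 < T" "T \<le> \<tau>" using T by auto
  have z: "0 \<in> {0..\<tau>}" using \<tau> by simp
  interpret R: prob_space "\<rho> 0" by (rule \<rho>_prob[OF z])
  note [measurable_cong] = \<rho>_sets[OF z]
  let ?K = lipC
  have K: "0 < ?K" by (rule lipC_pos)
  obtain R0 where R0: "0 \<le> R0" "\<And>t x. t \<in> {0..\<tau>} \<Longrightarrow> norm (F.flow t x) \<le> R0 + exp (?K * \<tau>) * norm x"
    by (rule F.flow_bound) blast
  define Rx where "Rx x = R0 + exp (?K * \<tau>) * norm x" for x :: "real^'d"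
  define c where "c = 2 * ?K\<^sup>2 + 2 * C"
  have c: "0 \<le> c" using C_pos by (simp add: c_def)
  \<comment> \<open>The factor of \<open>\<zeta>\<close> in the error of one step per unit of time: mollification, time average
    with Young weight \<open>\<zeta>\<close>, and the drift during the step.\<close>
  define e0 where "e0 = ?K + (1 + c) + ?K * V_moment"
  have e0: "0 \<le> e0" using K c V_moment(2)[OF z] by (simp add: e0_def)
  define TE where "TE = T * exp (?K * T)"
  have TE: "0 \<le> TE" using T0 by (simp add: TE_def)
  define Err where "Err x = ?K + ?K * (Mb + ?K * Rx x)" for x
  have Err0: "0 \<le> Err x" for x
    using K Mb(1) R0(1) by (simp add: Err_def Rx_def)
  have norm_int: "integrable (\<rho> 0) (\<lambda>x. norm x)"
    by (rule integrableI_bounded) (use first_moment[OF z] in \<open>auto intro: le_less_trans\<close>)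
  have Err_int: "integrable (\<rho> 0) Err" unfolding Err_def Rx_def using norm_int by auto
  define D where "D = TE * (B * e0) + B * (TE * (\<integral>x. Err x \<partial>\<rho> 0))"
  have fC: "C1_map f f'" and fB: "\<And>x h. \<bar>f' x h\<bar> \<le> B * norm h" and fs: "bounded {x. f x \<noteq> 0}"
    using f by (auto simp: test_map_def)
  have fl: "\<bar>f x - f y\<bar> \<le> B * norm (x - y)" for x y
  proof -
    have "norm (f x - f y) \<le> B * norm (x - y)"
    proof (rule differentiable_bound[of UNIV f f'])
      show "(f has_derivative f' z) (at z within UNIV)" for z using fC by (simp add: C1_map_def)
      show "onorm (f' z) \<le> B" for z by (rule onorm_bound[OF B]) (use fB in simp)
    qed auto
    then show ?thesis by simp
  qed
  have fc: "continuous_on UNIV f" by (rule C1_map_continuous[OF fC])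
  have fm[measurable]: "f \<in> borel_measurable borel" by (rule borel_measurable_continuous_onI[OF fc])
  obtain Bf where Bf: "\<And>x. \<bar>f x\<bar> \<le> Bf" using compact_support_bounded[OF fc fs] by blast
  have main: "\<bar>(\<integral>x. f x \<partial>\<rho> T) - (\<integral>x. f (F.flow T x) \<partial>\<rho> 0)\<bar> \<le> \<zeta> * D" if \<zeta>: "0 < \<zeta>" for \<zeta>
  proof -
    have "0 < \<zeta>\<^sup>2" using \<zeta> by simp
    then obtain \<delta> where \<delta>: "0 < \<delta>" "\<And>r s. r \<in> {0..\<tau>} \<Longrightarrow> s \<in> {0..\<tau>} \<Longrightarrow> \<bar>r - s\<bar> < \<delta> \<Longrightarrow> (W2 (\<rho> r) (\<rho> s))\<^sup>2 < \<zeta>\<^sup>2"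
      by (rule W2_uniformly_continuous) blast
    define h0 where "h0 = min (min \<delta> \<zeta>) (1 / (2 * ?K))"
    have h0: "0 < h0" using \<delta> \<zeta> K by (simp add: h0_def)
    obtain N :: nat where N: "T / h0 < real N" using reals_Archimedean2 by blast
    have N0: "0 < real N" using N T0 h0 by (meson divide_pos_pos less_trans)
    define h where "h = T / real N"
    have h: "0 < h" "real N * h = T" using T0 N0 by (auto simp: h_def)
    have "h < h0"
    proof -
      have "T < real N * h0" using N h0 by (simp add: divide_less_eq)
      then show ?thesis using N0 by (simp add: h_def divide_less_eq mult.commute)
    qed
    then have hs: "h < \<delta>" "h \<le> \<zeta>" "h * ?K \<le> 1/2"
      using K by (auto simp: h0_def field_simps)
    define t where "t k = real k * h" for k :: nat
    have tS: "t (Suc k) - t k = h" for k by (simp add: t_def algebra_simps)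
    have t0: "0 \<le> t k" for k using h by (simp add: t_def)
    have tle: "t k \<le> T" if "k \<le> N" for k
      using mult_right_mono[of "real k" "real N" h] that h by (simp add: t_def)
    define Good where "Good k W W' \<longleftrightarrow> C1_map W W' \<and> (\<forall>x y. norm (W x - W y) \<le> ?K * norm (x - y)) \<and>
      (\<forall>y. norm (h *\<^sub>R W y - integral {t k..t (Suc k)} (\<lambda>s. V s y)) \<le> h * (?K * \<zeta>)) \<and>
      (\<forall>s\<in>{t k..t (Suc k)}. (\<integral>\<^sup>+x. ennreal (norm (V s x - W x)) \<partial>\<rho> s) \<le> ennreal (?K * \<zeta> + (\<zeta> + c * \<zeta>)))"
      for k W W'
    have "\<exists>W W'. Good k W W'" if "k < N" for k
    proof -
      have lt: "t k < t (Suc k)" "t (Suc k) \<le> \<tau>" using tS[of k] h tle[of "Suc k"] that T0 by auto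
      have \<eta>: "(W2 (\<rho> r) (\<rho> s))\<^sup>2 \<le> \<zeta>\<^sup>2" if "r \<in> {t k..t (Suc k)}" "s \<in> {t k..t (Suc k)}" for r s
      proof -
        have "\<bar>r - s\<bar> < \<delta>" "r \<in> {0..\<tau>}" "s \<in> {0..\<tau>}" using that tS[of k] hs lt t0[of k] by auto
        then show ?thesis using \<delta>(2)[of r s] by simp
      qed
      obtain W W' where W: "C1_map W W'" "\<And>x y. norm (W x - W y) \<le> ?K * norm (x - y)"
        "\<And>y. norm ((t (Suc k) - t k) *\<^sub>R W y - integral {t k..t (Suc k)} (\<lambda>s. V s y)) \<le> (t (Suc k) - t k) * (?K * \<zeta>)"
        "\<And>s. s \<in> {t k..t (Suc k)} \<Longrightarrow> (\<integral>\<^sup>+x. ennreal (norm (V s x - W x)) \<partial>\<rho> s)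
           \<le> ennreal (?K * \<zeta> + (\<zeta> + (2 * ?K\<^sup>2 + 2 * C) * \<zeta>\<^sup>2 / \<zeta>))"
        by (rule averaged_field[OF t0 lt \<zeta> \<zeta> \<eta>]) blast+
      have c\<zeta>: "(2 * ?K\<^sup>2 + 2 * C) * \<zeta>\<^sup>2 / \<zeta> = c * \<zeta>" using \<zeta> by (simp add: c_def power2_eq_square)
      have "Good k W W'"
        unfolding Good_def by (intro conjI allI ballI W(1,2) W(3)[unfolded tS] W(4)[unfolded c\<zeta>])
      then show ?thesis by blast
    qed
    then have "\<exists>W W'. \<forall>k<N. Good k (W k) (W' k)" by metis
    then obtain W W' where "\<forall>k<N. Good k (W k) (W' k)" by blast
    then have W: "\<And>k. k < N \<Longrightarrow> C1_map (W k) (W' k)"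
      "\<And>k x y. k < N \<Longrightarrow> norm (W k x - W k y) \<le> ?K * norm (x - y)"
      "\<And>k y. k < N \<Longrightarrow> norm (h *\<^sub>R W k y - integral {t k..t (Suc k)} (\<lambda>s. V s y)) \<le> h * (?K * \<zeta>)"
      "\<And>k s. k < N \<Longrightarrow> s \<in> {t k..t (Suc k)} \<Longrightarrow> (\<integral>\<^sup>+x. ennreal (norm (V s x - W k x)) \<partial>\<rho> s) \<le> ennreal (?K * \<zeta> + (\<zeta> + c * \<zeta>))"
      unfolding Good_def by blast+
    define Y where "Y = rec_nat (\<lambda>x. x) (\<lambda>k y x. y x + h *\<^sub>R W k (y x))"
    have Y0: "Y 0 x = x" and YS: "Y (Suc k) x = Y k x + h *\<^sub>R W k (Y k x)" for k x by (simp_all add: Y_def)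
    have Yc: "continuous_on UNIV (Y k)" if "k \<le> N" for k
      using that
    proof (induction k)
      case 0 then show ?case by (simp add: Y0[abs_def] continuous_on_id)
    next
      case (Suc k)
      have Wc: "continuous_on UNIV (W k)" by (rule C1_map_continuous[OF W(1)]) (use Suc in auto)
      show ?case
        unfolding YS[abs_def] using Suc by (intro continuous_intros continuous_on_compose2[OF Wc]) auto
    qed
    \<comment> \<open>The last step is split off and absorbed into the test function, whose derivative bound grows
      by the factor \<open>1 + ?K * h\<close>.\<close>
    have P: "\<bar>(\<integral>x. g x \<partial>\<rho> (t k)) - (\<integral>x. g (Y k x) \<partial>\<rho> 0)\<bar> \<le> real k * h * exp (?K * (real k * h)) * (B' * (\<zeta> * e0))"
      if "k \<le> N" "test_map B' g g'" "0 \<le> B'" for k B' g g'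
      using that
    proof (induction k arbitrary: B' g g')
      case 0 then show ?case by (simp add: t_def Y0)
    next
      case (Suc k)
      then have k: "k < N" by simp
      let ?g = "\<lambda>x. g (x + h *\<^sub>R W k x)"
      have tm: "test_map (B' * (1 + ?K * h)) ?g (\<lambda>x i. g' (x + h *\<^sub>R W k x) (i + h *\<^sub>R W' k x i))"
        by (rule test_map_step[OF Suc.prems(2) W(1)[OF k] W(2)[OF k]]) (use h hs K Suc.prems in auto)
      have 1: "\<bar>(\<integral>x. g x \<partial>\<rho> (t (Suc k))) - (\<integral>x. g (x + (t (Suc k) - t k) *\<^sub>R W k x) \<partial>\<rho> (t k))\<bar>
        \<le> (t (Suc k) - t k) * (B' * ((?K * \<zeta> + (\<zeta> + c * \<zeta>)) + (t (Suc k) - t k) * ?K * V_moment))"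
      proof (rule transport_one_step[OF t0 _ _ Suc.prems(2,3) W(1)[OF k] W(2)[OF k]])
        show "t k < t (Suc k)" "t (Suc k) \<le> \<tau>" using tS[of k] h tle[of "Suc k"] k T0 by auto
        then have "{t k..t (Suc k)} \<subseteq> {0..\<tau>}" using t0[of k] by auto
        then show "(\<integral>\<^sup>+x. ennreal (norm (V s x)) \<partial>\<rho> s) \<le> ennreal V_moment" if "s \<in> {t k..t (Suc k)}" for s
          using V_moment(1) that by blast
        show "(\<integral>\<^sup>+x. ennreal (norm (V s x - W k x)) \<partial>\<rho> s) \<le> ennreal (?K * \<zeta> + (\<zeta> + c * \<zeta>))" if "s \<in> {t k..t (Suc k)}" for s
          by (rule W(4)[OF k that])
        show "(t (Suc k) - t k) * ?K \<le> 1/2" using hs tS by simp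
        show "0 \<le> V_moment" by (rule V_moment(2)[OF z])
        show "0 \<le> ?K * \<zeta> + (\<zeta> + c * \<zeta>)" using K \<zeta> c by simp
      qed
      have "(?K * \<zeta> + (\<zeta> + c * \<zeta>)) + h * ?K * V_moment \<le> \<zeta> * e0"
      proof -
        have "h * (?K * V_moment) \<le> \<zeta> * (?K * V_moment)"
          using hs K V_moment(2)[OF z] by (intro mult_right_mono) auto
        then show ?thesis by (simp add: e0_def algebra_simps)
      qed
      then have "h * (B' * ((?K * \<zeta> + (\<zeta> + c * \<zeta>)) + h * ?K * V_moment)) \<le> h * (B' * (\<zeta> * e0))"
        using h Suc.prems by (intro mult_left_mono) auto
      with 1 have 1: "\<bar>(\<integral>x. g x \<partial>\<rho> (t (Suc k))) - (\<integral>x. ?g x \<partial>\<rho> (t k))\<bar> \<le> h * (B' * (\<zeta> * e0))"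
        unfolding tS by linarith
      have 2: "\<bar>(\<integral>x. ?g x \<partial>\<rho> (t k)) - (\<integral>x. ?g (Y k x) \<partial>\<rho> 0)\<bar>
          \<le> real k * h * exp (?K * (real k * h)) * (B' * (1 + ?K * h) * (\<zeta> * e0))"
        by (rule Suc.IH[OF _ tm]) (use k K h Suc.prems in auto)
      let ?x = "B' * (\<zeta> * e0)" and ?e = "\<lambda>k. exp (?K * (real k * h))"
      have x0: "0 \<le> ?x" using Suc.prems \<zeta> e0 by simp
      have e: "(1 + ?K * h) * ?e k \<le> ?e (Suc k)"
      proof -
        have "(1 + ?K * h) * ?e k \<le> exp (?K * h) * ?e k"
          by (intro mult_right_mono) (simp_all add: exp_ge_add_one_self)
        also have "\<dots> = ?e (Suc k)" by (simp add: exp_add[symmetric] algebra_simps)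
        finally show ?thesis .
      qed
      have e1: "1 \<le> ?e (Suc k)" using K h by simp
      have "\<bar>(\<integral>x. g x \<partial>\<rho> (t (Suc k))) - (\<integral>x. g (Y (Suc k) x) \<partial>\<rho> 0)\<bar>
          \<le> h * ?x + real k * h * ?e k * (B' * (1 + ?K * h) * (\<zeta> * e0))"
        using 1 2 unfolding YS by linarith
      also have "\<dots> = h * ?x * 1 + real k * h * ?x * ((1 + ?K * h) * ?e k)" by (simp add: algebra_simps)
      also have "\<dots> \<le> h * ?x * ?e (Suc k) + real k * h * ?x * ?e (Suc k)"
        using e e1 x0 h by (intro add_mono mult_left_mono) auto
      also have "\<dots> = real (Suc k) * h * ?e (Suc k) * ?x" by (simp add: algebra_simps)
      finally show ?case .
    qed
    have tN: "t N = T" using h by (simp add: t_def)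
    have A: "\<bar>(\<integral>x. f x \<partial>\<rho> T) - (\<integral>x. f (Y N x) \<partial>\<rho> 0)\<bar> \<le> TE * (B * (\<zeta> * e0))"
      using P[OF order_refl f B] tN h by (simp add: TE_def)
    have Yerr: "norm (Y N x - F.flow T x) \<le> TE * (\<zeta> * Err x)" for x
    proof -
      have Rb: "norm (F.flow s x) \<le> Rx x" if "s \<in> {0..\<tau>}" for s using R0(2)[OF that] by (simp add: Rx_def)
      let ?c = "?K * \<zeta> + ?K * (h * (Mb + ?K * Rx x))"
      have Rx0: "0 \<le> Rx x" using R0(1) by (simp add: Rx_def)
      have cb: "?c \<le> \<zeta> * Err x"
      proof -
        have "h * (?K * (Mb + ?K * Rx x)) \<le> \<zeta> * (?K * (Mb + ?K * Rx x))"
          using hs K Mb(1) Rx0 by (intro mult_right_mono) auto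
        then show ?thesis by (simp add: Err_def algebra_simps)
      qed
      have "norm (Y N x - F.flow (t N) x) \<le> real N * h * exp (?K * (real N * h)) * ?c"
      proof (rule discrete_gronwall[where \<delta>="\<lambda>k. norm (Y k x - F.flow (t k) x)" and N=N])
        show "norm (Y 0 x - F.flow (t 0) x) \<le> 0"
          using F.flow_equation[of 0 x] \<tau> by (simp add: Y0 t_def)
        show "0 \<le> ?c" using K \<zeta> h Mb(1) Rx0 by simp
      next
        fix k assume k: "k < N"
        have "norm (Y k x + h *\<^sub>R W k (Y k x) - F.flow (t (Suc k)) x)
          \<le> (1 + ?K * (t (Suc k) - t k)) * norm (Y k x - F.flow (t k) x)
            + (t (Suc k) - t k) * (?K * \<zeta> + ?K * ((t (Suc k) - t k) * (Mb + ?K * Rx x)))"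
        proof (rule F.euler_step_error[OF t0 _ _ _ Rb])
          show "t k \<le> t (Suc k)" "t (Suc k) \<le> \<tau>" using tS[of k] h tle[of "Suc k"] k T0 by auto
          show "norm (h *\<^sub>R W k (Y k x) - integral {t k..t (Suc k)} (\<lambda>s. V s (Y k x))) \<le> (t (Suc k) - t k) * (?K * \<zeta>)"
            unfolding tS by (rule W(3)[OF k])
        qed
        then show "norm (Y (Suc k) x - F.flow (t (Suc k)) x) \<le> (1 + ?K * h) * norm (Y k x - F.flow (t k) x) + h * ?c"
          unfolding YS tS .
      qed (use K h in auto)
      also have "\<dots> = TE * ?c" using h by (simp add: TE_def)
      also have "\<dots> \<le> TE * (\<zeta> * Err x)" using cb TE by (intro mult_left_mono)
      finally show ?thesis by (simp add: tN)
    qed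
    note [measurable] = flow_measurable_at[OF T]
    have Ym[measurable]: "Y N \<in> borel_measurable borel" by (rule borel_measurable_continuous_onI[OF Yc]) simp
    have i1: "integrable (\<rho> 0) (\<lambda>x. f (Y N x))" "integrable (\<rho> 0) (\<lambda>x. f (F.flow T x))"
      by (rule R.integrable_const_bound[where B=Bf]; use Bf in auto)+
    have "\<bar>(\<integral>x. f (Y N x) \<partial>\<rho> 0) - (\<integral>x. f (F.flow T x) \<partial>\<rho> 0)\<bar> = norm (\<integral>x. f (Y N x) - f (F.flow T x) \<partial>\<rho> 0)"
      using i1 by simp
    also have "\<dots> \<le> (\<integral>x. B * (TE * (\<zeta> * Err x)) \<partial>\<rho> 0)"
    proof (rule bochner_norm_bound)
      show "integrable (\<rho> 0) (\<lambda>x. f (Y N x) - f (F.flow T x))" using i1 by auto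
      show "integrable (\<rho> 0) (\<lambda>x. B * (TE * (\<zeta> * Err x)))" using Err_int by auto
      fix x
      have "norm (f (Y N x) - f (F.flow T x)) \<le> B * norm (Y N x - F.flow T x)" using fl by simp
      also have "\<dots> \<le> B * (TE * (\<zeta> * Err x))" using Yerr B by (intro mult_left_mono)
      finally show "norm (f (Y N x) - f (F.flow T x)) \<le> B * (TE * (\<zeta> * Err x))" .
    qed
    also have "\<dots> = \<zeta> * (B * (TE * (\<integral>x. Err x \<partial>\<rho> 0)))" by simp
    finally show ?thesis using A by (simp add: D_def algebra_simps)
  qed
  have "\<bar>(\<integral>x. f x \<partial>\<rho> T) - (\<integral>x. f (F.flow T x) \<partial>\<rho> 0)\<bar> \<le> 0"
  proof (rule field_le_epsilon)
    fix e :: real assume e: "0 < e"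
    have "\<bar>(\<integral>x. f x \<partial>\<rho> T) - (\<integral>x. f (F.flow T x) \<partial>\<rho> 0)\<bar> \<le> e / (\<bar>D\<bar> + 1) * D"
      using e by (intro main) (simp add: add_nonneg_pos)
    also have "\<dots> \<le> e / (\<bar>D\<bar> + 1) * (\<bar>D\<bar> + 1)" using e by (intro mult_left_mono) auto
    also have "\<dots> = e" by (simp add: add_nonneg_eq_0_iff)
    finally show "\<bar>(\<integral>x. f x \<partial>\<rho> T) - (\<integral>x. f (F.flow T x) \<partial>\<rho> 0)\<bar> \<le> 0 + e" by simp
  qed
  then show ?thesis by simp
qed

end

section \<open>A Gronwall inequality in the mean square\<close>

lemma has_integral_Cauchy_Schwarz:
  fixes D :: "real \<Rightarrow> 'b::euclidean_space"
  assumes I: "(D has_integral I) {a..b}" and D[measurable]: "D \<in> borel_measurable borel" and ab: "a \<le> b"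
  shows "ennreal ((norm I)\<^sup>2) \<le> ennreal (b - a) * (\<integral>\<^sup>+s. ennreal ((norm (D s))\<^sup>2) * indicator {a..b} s \<partial>lborel)"
proof (cases "a = b")
  case True
  then have "(D has_integral I) {a..a}" using I by simp
  then have "I = 0" by (simp add: has_integral_iff)
  then show ?thesis by simp
next
  case False
  then have ab: "a < b" using ab by simp
  let ?Q = "\<integral>\<^sup>+s. ennreal ((norm (D s))\<^sup>2) * indicator {a..b} s \<partial>lborel"
  show ?thesis
  proof (cases "?Q = \<infinity>")
    case True
    then show ?thesis using ab by (simp add: ennreal_mult_top)
  next
    case False
    then have fin: "?Q < \<infinity>" by (simp add: less_top)
    have i2: "integrable lborel (\<lambda>s. indicator {a..b} s *\<^sub>R (norm (D s))\<^sup>2)"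
    proof (rule integrableI_bounded)
      have "(\<integral>\<^sup>+s. ennreal (norm (indicator {a..b} s *\<^sub>R (norm (D s))\<^sup>2)) \<partial>lborel) = ?Q"
        by (intro nn_integral_cong) (auto split: split_indicator)
      then show "(\<integral>\<^sup>+s. ennreal (norm (indicator {a..b} s *\<^sub>R (norm (D s))\<^sup>2)) \<partial>lborel) < \<infinity>" using fin by simp
    qed measurable
    have i0: "integrable lborel (indicator {a..b} :: real \<Rightarrow> real)"
      using ab by (intro integrable_real_indicator) (auto simp: less_imp_le)
    have i1: "integrable lborel (\<lambda>s. indicator {a..b} s *\<^sub>R norm (D s))"
    proof (rule Bochner_Integration.integrable_bound)
      show "integrable lborel (\<lambda>s. indicator {a..b} s + indicator {a..b} s *\<^sub>R (norm (D s))\<^sup>2)" using i0 i2 by auto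
      show "AE s in lborel. norm (indicator {a..b} s *\<^sub>R norm (D s)) \<le> norm (indicator {a..b} s + indicator {a..b} s *\<^sub>R (norm (D s))\<^sup>2)"
      proof (intro AE_I2)
        fix s
        have "2 * norm (D s) \<le> (norm (D s))\<^sup>2 + 1" using sum_squares_bound[of "norm (D s)" 1] by simp
        then have "norm (D s) \<le> 1 + (norm (D s))\<^sup>2" using norm_ge_zero[of "D s"] by linarith
        then show "norm (indicator {a..b} s *\<^sub>R norm (D s)) \<le> norm (indicator {a..b} s + indicator {a..b} s *\<^sub>R (norm (D s))\<^sup>2)"
          by (auto split: split_indicator)
      qed
    qed measurable
    have si: "set_integrable lborel {a..b} D"
      unfolding set_integrable_def
      by (rule Bochner_Integration.integrable_bound[OF i1]) (auto split: split_indicator)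
    have "I = (LINT s:{a..b}|lborel. D s)"
      using set_borel_integral_eq_integral(2)[OF si] I by (simp add: integral_unique)
    then have le: "norm I \<le> (\<integral>s. indicator {a..b} s *\<^sub>R norm (D s) \<partial>lborel)"
      using integral_norm_bound[of lborel "\<lambda>s. indicator {a..b} s *\<^sub>R D s"] by (simp add: set_lebesgue_integral_def)
    define A where "A = (\<integral>s. indicator {a..b} s *\<^sub>R norm (D s) \<partial>lborel)"
    define Q where "Q = (\<integral>s. indicator {a..b} s *\<^sub>R (norm (D s))\<^sup>2 \<partial>lborel)"
    have Q: "?Q = ennreal Q"
    proof -
      have "?Q = (\<integral>\<^sup>+s. ennreal (indicator {a..b} s *\<^sub>R (norm (D s))\<^sup>2) \<partial>lborel)"
        by (intro nn_integral_cong) (auto split: split_indicator)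
      also have "\<dots> = ennreal Q"
        unfolding Q_def by (rule nn_integral_eq_integral[OF i2]) auto
      finally show ?thesis .
    qed
    have A0: "0 \<le> A" unfolding A_def by (rule integral_nonneg_AE) auto
    \<comment> \<open>Expand the square of \<open>norm (D s) - k\<close>, where \<open>k\<close> is the mean value of \<open>norm (D s)\<close>.\<close>
    define k where "k = A / (b - a)"
    have "2 * k * A \<le> Q + k\<^sup>2 * (b - a)"
    proof -
      have "(\<integral>s. 2 * k * (indicator {a..b} s *\<^sub>R norm (D s)) \<partial>lborel)
          \<le> (\<integral>s. indicator {a..b} s *\<^sub>R (norm (D s))\<^sup>2 + k\<^sup>2 * indicator {a..b} s \<partial>lborel)"
      proof (rule integral_mono)
        fix s
        have "2 * norm (D s) * k \<le> (norm (D s))\<^sup>2 + k\<^sup>2" by (rule sum_squares_bound)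
        then show "2 * k * (indicator {a..b} s *\<^sub>R norm (D s)) \<le> indicator {a..b} s *\<^sub>R (norm (D s))\<^sup>2 + k\<^sup>2 * indicator {a..b} s"
          by (auto split: split_indicator simp: algebra_simps)
      qed (use i0 i1 i2 in auto)
      then show ?thesis using i0 i1 i2 ab by (simp add: A_def Q_def)
    qed
    moreover have "k * A = A\<^sup>2 / (b - a)" "k\<^sup>2 * (b - a) = A\<^sup>2 / (b - a)"
      using ab by (simp_all add: k_def power2_eq_square)
    ultimately have "A\<^sup>2 / (b - a) \<le> Q" by simp
    then have "A\<^sup>2 \<le> (b - a) * Q" using ab by (simp add: divide_le_eq mult.commute)
    moreover have "(norm I)\<^sup>2 \<le> A\<^sup>2" using le by (intro power_mono) (auto simp: A_def)
    ultimately have "ennreal ((norm I)\<^sup>2) \<le> ennreal ((b - a) * Q)" by (intro ennreal_leI) linarith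
    also have "\<dots> = ennreal (b - a) * ennreal Q"
      using ab by (intro ennreal_mult) (auto simp: Q_def intro!: integral_nonneg_AE)
    finally show ?thesis unfolding Q .
  qed
qed

text \<open>
  For each point \<open>z\<close> the curve \<open>\<lambda>s. f s z\<close> has the derivative \<open>D s z\<close> in the integrated
  sense, and the mean square of \<open>D\<close> is bounded by that of \<open>f\<close> at the same time. The latter is only
  assumed finite at each time, and bounding it on the time interval is part of the task.
\<close>
locale square_integrable_curve =
  fixes M :: "'a measure" and f D :: "real \<Rightarrow> 'a \<Rightarrow> 'b::euclidean_space" and C \<delta> \<tau> :: real
  assumes M: "sigma_finite_measure M"
    and C: "0 < C" and \<delta>: "0 \<le> \<delta>" and \<tau>: "0 \<le> \<tau>"
    and f_meas: "\<And>s. s \<in> {0..\<tau>} \<Longrightarrow> f s \<in> borel_measurable M"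
    and D_meas: "(\<lambda>p. D (fst p) (snd p)) \<in> borel_measurable (lborel \<Otimes>\<^sub>M M)"
    and D_int: "\<And>a b z. z \<in> space M \<Longrightarrow> 0 \<le> a \<Longrightarrow> a \<le> b \<Longrightarrow> b \<le> \<tau> \<Longrightarrow> ((\<lambda>s. D s z) has_integral (f b z - f a z)) {a..b}"
    and f_L2: "\<And>s. s \<in> {0..\<tau>} \<Longrightarrow> (\<integral>\<^sup>+z. ennreal ((norm (f s z))\<^sup>2) \<partial>M) < \<infinity>"
    and D_L2: "\<And>s. s \<in> {0..\<tau>} \<Longrightarrow> (\<integral>\<^sup>+z. ennreal ((norm (D s z))\<^sup>2) \<partial>M)
        \<le> ennreal (2 * C) * (\<integral>\<^sup>+z. ennreal ((norm (f s z))\<^sup>2) \<partial>M) + ennreal (2 * \<delta>)"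
begin

definition e :: "real \<Rightarrow> real" where "e s = enn2real (\<integral>\<^sup>+z. ennreal ((norm (f s z))\<^sup>2) \<partial>M)"

lemma e_eq: "s \<in> {0..\<tau>} \<Longrightarrow> (\<integral>\<^sup>+z. ennreal ((norm (f s z))\<^sup>2) \<partial>M) = ennreal (e s)"
  unfolding e_def using f_L2[of s] by (simp add: less_top)

lemma e_nonneg: "0 \<le> e s" by (simp add: e_def)

lemma increment_L2:
  assumes ab: "0 \<le> a" "a \<le> b" "b \<le> \<tau>" and E: "\<And>s. s \<in> {a..b} \<Longrightarrow> e s \<le> E"
  shows "(\<integral>\<^sup>+z. ennreal ((norm (f b z - f a z))\<^sup>2) \<partial>M) \<le> ennreal ((b - a)\<^sup>2 * (2 * C * E + 2 * \<delta>))"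
proof -
  interpret P: pair_sigma_finite "lborel :: real measure" M
    unfolding pair_sigma_finite_def using M by (auto intro: sigma_finite_lborel)
  note Dm[measurable] = D_meas
  have E0: "0 \<le> E" using E[of a] ab e_nonneg[of a] by (auto intro: order_trans)
  define G where "G s z = ennreal ((norm (D s z))\<^sup>2) * indicator {a..b} s" for s z
  have Gm[measurable]: "(\<lambda>(s, z). G s z) \<in> borel_measurable (lborel \<Otimes>\<^sub>M M)"
    unfolding G_def case_prod_beta by measurable
  have "(\<integral>\<^sup>+z. ennreal ((norm (f b z - f a z))\<^sup>2) \<partial>M) \<le> (\<integral>\<^sup>+z. ennreal (b - a) * (\<integral>\<^sup>+s. G s z \<partial>lborel) \<partial>M)"
  proof (intro nn_integral_mono)
    fix z assume z: "z \<in> space M"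
    have "(\<lambda>s. (s, z)) \<in> lborel \<rightarrow>\<^sub>M lborel \<Otimes>\<^sub>M M" using z by measurable
    from measurable_compose[OF this Dm] have "(\<lambda>s. D s z) \<in> borel_measurable borel" by simp
    then show "ennreal ((norm (f b z - f a z))\<^sup>2) \<le> ennreal (b - a) * (\<integral>\<^sup>+s. G s z \<partial>lborel)"
      unfolding G_def by (intro has_integral_Cauchy_Schwarz D_int z ab)
  qed
  also have "\<dots> = ennreal (b - a) * (\<integral>\<^sup>+z. \<integral>\<^sup>+s. G s z \<partial>lborel \<partial>M)"
    by (rule nn_integral_cmult) measurable
  also have "(\<integral>\<^sup>+z. \<integral>\<^sup>+s. G s z \<partial>lborel \<partial>M) = (\<integral>\<^sup>+s. \<integral>\<^sup>+z. G s z \<partial>M \<partial>lborel)"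
    by (rule P.Fubini') (use Gm in simp)
  also have "\<dots> \<le> (\<integral>\<^sup>+s. ennreal (2 * C * E + 2 * \<delta>) * indicator {a..b} s \<partial>lborel)"
  proof (intro nn_integral_mono)
    fix s
    show "(\<integral>\<^sup>+z. G s z \<partial>M) \<le> ennreal (2 * C * E + 2 * \<delta>) * indicator {a..b} s"
    proof (cases "s \<in> {a..b}")
      case True
      then have s: "s \<in> {0..\<tau>}" using ab by auto
      have "(\<integral>\<^sup>+z. G s z \<partial>M) = (\<integral>\<^sup>+z. ennreal ((norm (D s z))\<^sup>2) \<partial>M)" using True by (simp add: G_def)
      also have "\<dots> \<le> ennreal (2 * C) * ennreal (e s) + ennreal (2 * \<delta>)" using D_L2[OF s] by (simp add: e_eq[OF s])
      also have "\<dots> = ennreal (2 * C * e s + 2 * \<delta>)"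
        using C \<delta> e_nonneg by (simp add: ennreal_mult[symmetric] ennreal_plus[symmetric] del: ennreal_plus)
      also have "\<dots> \<le> ennreal (2 * C * E + 2 * \<delta>)" using E[OF True] C by (intro ennreal_leI) simp
      finally show ?thesis using True by simp
    qed (simp add: G_def)
  qed
  also have "\<dots> = ennreal (2 * C * E + 2 * \<delta>) * ennreal (b - a)"
    using ab by (simp add: nn_integral_cmult)
  finally have "(\<integral>\<^sup>+z. ennreal ((norm (f b z - f a z))\<^sup>2) \<partial>M)
      \<le> ennreal (b - a) * (ennreal (2 * C * E + 2 * \<delta>) * ennreal (b - a))"
    by (meson mult_left_mono zero_le order_trans)
  also have "\<dots> = ennreal ((b - a)\<^sup>2 * (2 * C * E + 2 * \<delta>))"
  proof -
    have "ennreal (b - a) * (ennreal Z * ennreal (b - a)) = ennreal ((b - a)\<^sup>2 * Z)" if "0 \<le> Z" for Z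
      using ab that by (simp add: ennreal_mult[symmetric] power2_eq_square ac_simps)
    moreover have "0 \<le> 2 * C * E + 2 * \<delta>" using C E0 \<delta> by simp
    ultimately show ?thesis by blast
  qed
  finally show ?thesis .
qed

lemma growth_aux:
  assumes x: "x \<in> {0..\<tau>}" and y: "y \<in> {0..\<tau>}" and h: "0 < h" and q: "0 \<le> q"
    and d: "(\<integral>\<^sup>+z. ennreal ((norm (f x z - f y z))\<^sup>2) \<partial>M) \<le> ennreal (h\<^sup>2 * q)"
  shows "e x \<le> (1 + h) * (e y + h * q)"
proof -
  note [measurable] = f_meas[OF x] f_meas[OF y]
  have "ennreal (e x) = (\<integral>\<^sup>+z. ennreal ((norm (f x z))\<^sup>2) \<partial>M)" by (rule e_eq[OF x, symmetric])
  also have "\<dots> \<le> (\<integral>\<^sup>+z. ennreal (1 + h) * ennreal ((norm (f y z))\<^sup>2) + ennreal (1 + 1/h) * ennreal ((norm (f x z - f y z))\<^sup>2) \<partial>M)"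
  proof (intro nn_integral_mono)
    fix z
    have "norm (f x z) \<le> norm (f y z) + norm (f x z - f y z)"
      using norm_triangle_ineq[of "f y z" "f x z - f y z"] by simp
    then have "(norm (f x z))\<^sup>2 \<le> (norm (f y z) + norm (f x z - f y z))\<^sup>2" by (intro power_mono) auto
    also have "\<dots> \<le> (1 + h) * (norm (f y z))\<^sup>2 + (1 + 1/h) * (norm (f x z - f y z))\<^sup>2" by (rule young_sq[OF h])
    finally have "ennreal ((norm (f x z))\<^sup>2) \<le> ennreal ((1 + h) * (norm (f y z))\<^sup>2 + (1 + 1/h) * (norm (f x z - f y z))\<^sup>2)"
      by (rule ennreal_leI)
    then show "ennreal ((norm (f x z))\<^sup>2) \<le> ennreal (1 + h) * ennreal ((norm (f y z))\<^sup>2) + ennreal (1 + 1/h) * ennreal ((norm (f x z - f y z))\<^sup>2)"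
      using h by (simp add: ennreal_plus[symmetric] ennreal_mult[symmetric] del: ennreal_plus)
  qed
  also have "\<dots> = ennreal (1 + h) * ennreal (e y) + ennreal (1 + 1/h) * (\<integral>\<^sup>+z. ennreal ((norm (f x z - f y z))\<^sup>2) \<partial>M)"
    using e_eq[OF y] by (simp add: nn_integral_add nn_integral_cmult)
  also have "\<dots> \<le> ennreal (1 + h) * ennreal (e y) + ennreal (1 + 1/h) * ennreal (h\<^sup>2 * q)"
    using d by (intro add_left_mono mult_left_mono) auto
  also have "\<dots> = ennreal ((1 + h) * e y + (1 + 1/h) * (h\<^sup>2 * q))"
    using h q e_nonneg by (simp add: ennreal_mult[symmetric] ennreal_plus[symmetric] del: ennreal_plus)
  finally have "e x \<le> (1 + h) * e y + (1 + 1/h) * (h\<^sup>2 * q)"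
    using h q e_nonneg[of y] by (subst (asm) ennreal_le_iff) auto
  also have "(1 + 1/h) * (h\<^sup>2 * q) = (1 + h) * (h * q)" using h by (simp add: power2_eq_square field_simps)
  finally show ?thesis by (simp add: algebra_simps)
qed

lemma growth:
  assumes ab: "0 \<le> a" "a < b" "b \<le> \<tau>" and E: "\<And>s. s \<in> {a..b} \<Longrightarrow> e s \<le> E"
  shows "e b \<le> (1 + (b - a)) * (e a + (b - a) * (2 * C * E + 2 * \<delta>))"
    and "e a \<le> (1 + (b - a)) * (e b + (b - a) * (2 * C * E + 2 * \<delta>))"
proof -
  have E0: "0 \<le> E" using E[of a] ab e_nonneg[of a] by (auto intro: order_trans)
  have q: "0 \<le> 2 * C * E + 2 * \<delta>" using C E0 \<delta> by simp
  have i: "(\<integral>\<^sup>+z. ennreal ((norm (f b z - f a z))\<^sup>2) \<partial>M) \<le> ennreal ((b - a)\<^sup>2 * (2 * C * E + 2 * \<delta>))"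
    by (rule increment_L2) (use ab E in auto)
  show "e b \<le> (1 + (b - a)) * (e a + (b - a) * (2 * C * E + 2 * \<delta>))"
    by (rule growth_aux[OF _ _ _ q i]) (use ab in auto)
  show "e a \<le> (1 + (b - a)) * (e b + (b - a) * (2 * C * E + 2 * \<delta>))"
    by (rule growth_aux[OF _ _ _ q]) (use ab i in \<open>auto simp: norm_minus_commute\<close>)
qed

text \<open>
  On intervals of this length the supremum of \<open>e\<close> enters its own bound with a factor of at most
  \<open>1/2\<close>.
\<close>
definition \<sigma> :: real where "\<sigma> = min 1 (1 / (8 * C))"

lemma \<sigma>: "0 < \<sigma>" "\<sigma> \<le> 1" "4 * C * \<sigma> \<le> 1/2"
proof -
  show "0 < \<sigma>" "\<sigma> \<le> 1" using C by (auto simp: \<sigma>_def)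
  have "\<sigma> \<le> 1 / (8 * C)" by (simp add: \<sigma>_def)
  then show "4 * C * \<sigma> \<le> 1/2" using C by (simp add: field_simps)
qed

text \<open>
  The estimate \<open>growth\<close> from \<open>y\<close> bounds the supremum of \<open>e\<close> by \<open>2 * e y + 4 * \<delta>\<close> plus half
  of the supremum itself, which can be absorbed when it is finite.
\<close>
lemma short_interval_comparison:
  assumes rs: "0 \<le> r" "s \<le> \<tau>" "s - r \<le> \<sigma>" and bd: "\<exists>B. \<forall>x\<in>{r..s}. e x \<le> B"
    and x: "x \<in> {r..s}" and y: "y \<in> {r..s}"
  shows "e x \<le> 4 * e y + 8 * \<delta>"
proof -
  define E where "E = (SUP x\<in>{r..s}. e x)"
  have bdd: "bdd_above (e ` {r..s})" using bd by (auto simp: bdd_above_def)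
  have E: "e u \<le> E" if "u \<in> {r..s}" for u unfolding E_def by (rule cSUP_upper[OF that bdd])
  have E0: "0 \<le> E" using E[OF x] e_nonneg[of x] by linarith
  have key: "e u \<le> 2 * e y + E/2 + 4 * \<delta>" if u: "u \<in> {r..s}" for u
  proof (cases "u = y")
    case True then show ?thesis using E0 \<delta> e_nonneg[of y] by simp
  next
    case False
    define h where "h = \<bar>u - y\<bar>"
    have h: "0 < h" "h \<le> \<sigma>" "h \<le> 1" using False u y rs \<sigma> by (auto simp: h_def)
    have q: "0 \<le> 2 * C * E + 2 * \<delta>" using C E0 \<delta> by simp
    have "e u \<le> (1 + h) * (e y + h * (2 * C * E + 2 * \<delta>))"
    proof (cases "u < y")
      case True
      then have "e u \<le> (1 + (y - u)) * (e y + (y - u) * (2 * C * E + 2 * \<delta>))"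
        by (intro growth(2)) (use u y rs E in auto)
      then show ?thesis using True by (simp add: h_def)
    next
      case f: False
      then have "e u \<le> (1 + (u - y)) * (e y + (u - y) * (2 * C * E + 2 * \<delta>))"
        by (intro growth(1)) (use False u y rs E in auto)
      then show ?thesis using f by (simp add: h_def)
    qed
    also have "\<dots> \<le> 2 * (e y + \<sigma> * (2 * C * E + 2 * \<delta>))"
      using h q e_nonneg[of y] \<sigma> by (intro mult_mono add_mono order_refl) auto
    also have "\<dots> = 2 * e y + (4 * C * \<sigma>) * E + \<sigma> * (4 * \<delta>)" by (simp add: algebra_simps)
    also have "\<dots> \<le> 2 * e y + (1/2) * E + 1 * (4 * \<delta>)"
      using \<sigma> E0 \<delta> by (intro add_mono mult_right_mono order_refl) auto
    finally show ?thesis by simp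
  qed
  have "E \<le> 2 * e y + E/2 + 4 * \<delta>"
    unfolding E_def by (rule cSUP_least) (use x key in \<open>auto simp: E_def\<close>)
  then show ?thesis using E[OF x] by simp
qed

lemma f_continuous: "z \<in> space M \<Longrightarrow> continuous_on {0..\<tau>} (\<lambda>s. f s z)"
proof -
  assume z: "z \<in> space M"
  have "(\<lambda>s. D s z) integrable_on {0..\<tau>}" using D_int[OF z, of 0 \<tau>] \<tau> by (auto intro: has_integral_integrable)
  then have "continuous_on {0..\<tau>} (\<lambda>s. f 0 z + integral {0..s} (\<lambda>s. D s z))"
    by (intro continuous_intros indefinite_integral_continuous_1)
  then show ?thesis
  proof (rule continuous_on_eq)
    fix x assume "x \<in> {0..\<tau>}"
    then have "((\<lambda>s. D s z) has_integral f x z - f 0 z) {0..x}" by (intro D_int z) auto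
    then show "f 0 z + integral {0..x} (\<lambda>s. D s z) = f x z" by (simp add: integral_unique)
  qed
qed

text \<open>
  Fatou's lemma: \<open>e\<close> is lower semicontinuous.
\<close>
lemma sublevel_closed: "closed {s \<in> {0..\<tau>}. e s \<le> B}"
  unfolding closed_sequential_limits
proof (intro allI impI, elim conjE)
  fix x l assume x: "\<forall>n. x n \<in> {s \<in> {0..\<tau>}. e s \<le> B}" and l: "x \<longlonglongrightarrow> l"
  have xI: "x n \<in> {0..\<tau>}" and xB: "e (x n) \<le> B" for n using x by auto
  have lI: "l \<in> {0..\<tau>}" using closed_sequentially[of "{0..\<tau>}" x l] xI l by auto
  have B: "0 \<le> B" using xB[of 0] e_nonneg[of "x 0"] by linarith
  have "ennreal (e l) = (\<integral>\<^sup>+z. ennreal ((norm (f l z))\<^sup>2) \<partial>M)" by (rule e_eq[OF lI, symmetric])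
  also have "\<dots> = (\<integral>\<^sup>+z. liminf (\<lambda>n. ennreal ((norm (f (x n) z))\<^sup>2)) \<partial>M)"
  proof (rule nn_integral_cong)
    fix z assume z: "z \<in> space M"
    have "(\<lambda>n. f (x n) z) \<longlonglongrightarrow> f l z"
      using continuous_on_tendsto_compose[OF f_continuous[OF z] l lI] xI by simp
    then have "(\<lambda>n. ennreal ((norm (f (x n) z))\<^sup>2)) \<longlonglongrightarrow> ennreal ((norm (f l z))\<^sup>2)"
      by (intro tendsto_intros tendsto_ennrealI)
    then show "ennreal ((norm (f l z))\<^sup>2) = liminf (\<lambda>n. ennreal ((norm (f (x n) z))\<^sup>2))"
      by (rule lim_imp_Liminf[OF sequentially_bot, symmetric])
  qed
  also have "\<dots> \<le> liminf (\<lambda>n. \<integral>\<^sup>+z. ennreal ((norm (f (x n) z))\<^sup>2) \<partial>M)"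
    by (rule nn_integral_liminf) (use f_meas[OF xI] in measurable)
  also have "\<dots> \<le> liminf (\<lambda>n. ennreal B)"
    by (intro Liminf_mono always_eventually allI) (simp add: e_eq[OF xI] ennreal_leI xB)
  also have "\<dots> = ennreal B" by (rule Liminf_const) simp
  finally show "l \<in> {s \<in> {0..\<tau>}. e s \<le> B}" using lI B by (simp add: ennreal_le_iff)
qed

definition bounded_times :: "real set" where
  "bounded_times = {t \<in> {0..\<tau>}. \<exists>d>0. \<exists>B. \<forall>s\<in>{0..\<tau>}. dist s t < d \<longrightarrow> e s \<le> B}"

lemma bounded_on_compact:
  assumes "compact S" "S \<subseteq> bounded_times"
  shows "\<exists>B. \<forall>s\<in>S. e s \<le> B"
proof (rule locally_bounded_imp_bounded[OF assms(1)])
  fix t assume "t \<in> S"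
  then obtain d B where "0 < d" "\<forall>s\<in>{0..\<tau>}. dist s t < d \<longrightarrow> e s \<le> B" using assms(2) by (auto simp: bounded_times_def)
  moreover have "S \<subseteq> {0..\<tau>}" using assms(2) by (auto simp: bounded_times_def)
  ultimately show "\<exists>d>0. \<exists>B. \<forall>s\<in>S. dist s t < d \<longrightarrow> e s \<le> B" by blast
qed

text \<open>
  The constants in \<open>short_interval_comparison\<close> do not depend on the bound assumed there. Hence
  \<open>e\<close> stays bounded as \<open>c\<close> is approached, and the comparison extends to \<open>c\<close>.
\<close>
lemma bound_up_to_endpoint:
  assumes c: "c \<in> {0..\<tau>}" and s: "s \<in> {0..\<tau>}" and cs: "c \<noteq> s" "\<bar>c - s\<bar> \<le> \<sigma>"
    and g: "closed_segment c s - {c} \<subseteq> bounded_times"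
  shows "e s \<le> 4 * e c + 8 * \<delta>"
proof -
  have bd: "e x \<le> 4 * e s + 8 * \<delta>" if x: "x \<in> closed_segment c s" "x \<noteq> c" for x
  proof -
    let ?r = "min x s" and ?q = "max x s"
    have sub: "{?r..?q} \<subseteq> closed_segment c s - {c}"
      using x cs by (auto simp: closed_segment_eq_real_ivl split: if_splits)
    have "\<exists>B. \<forall>u\<in>{?r..?q}. e u \<le> B" by (rule bounded_on_compact) (use sub g in auto)
    then show ?thesis
      by (intro short_interval_comparison[of ?r ?q])
         (use x c s cs in \<open>auto simp: closed_segment_eq_real_ivl split: if_splits\<close>)
  qed
  let ?r = "min c s" and ?q = "max c s"
  have "\<exists>B. \<forall>u\<in>{?r..?q}. e u \<le> B"
  proof (intro exI[of _ "max (e c) (4 * e s + 8 * \<delta>)"] ballI)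
    fix u assume "u \<in> {?r..?q}"
    then have "u \<in> closed_segment c s" by (auto simp: closed_segment_eq_real_ivl)
    then show "e u \<le> max (e c) (4 * e s + 8 * \<delta>)" using bd[of u] by (cases "u = c") auto
  qed
  then show ?thesis
    by (intro short_interval_comparison[of ?r ?q]) (use c s cs in auto)
qed

text \<open>
  Otherwise the set \<open>K\<close> of the remaining times is closed and nonempty. It is the union of the closed
  sets on which \<open>e \<le> n\<close>, so by Baire's theorem \<open>e\<close> is bounded on the part of \<open>K\<close> near some
  \<open>p\<close> in \<open>K\<close>. A time \<open>s\<close> near \<open>p\<close> outside \<open>K\<close> is separated from the point \<open>c\<close> of \<open>K\<close>
  nearest to it on the way to \<open>p\<close> only by times outside \<open>K\<close>, so \<open>e s\<close> is bounded in terms of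
  \<open>e c\<close>. Thus \<open>e\<close> is bounded near \<open>p\<close>, a contradiction.
\<close>
lemma locally_bounded_everywhere: "bounded_times = {0..\<tau>}"
proof (rule ccontr)
  assume ne: "bounded_times \<noteq> {0..\<tau>}"
  define K where "K = {0..\<tau>} - bounded_times"
  have sub: "bounded_times \<subseteq> {0..\<tau>}" by (auto simp: bounded_times_def)
  have Kne: "K \<noteq> {}" using ne sub by (auto simp: K_def)
  have Kc: "closed K"
  proof -
    define Op where "Op = (\<Union>t\<in>bounded_times. {ball t d | d. 0 < d \<and> (\<exists>B. \<forall>s\<in>{0..\<tau>}. dist s t < d \<longrightarrow> e s \<le> B)})"
    have "K = {0..\<tau>} - \<Union>Op"
    proof (intro set_eqI iffI)
      fix x assume x: "x \<in> K"
      have "x \<notin> \<Union>Op"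
      proof
        assume "x \<in> \<Union>Op"
        then obtain t d B where td: "0 < d" "\<forall>s\<in>{0..\<tau>}. dist s t < d \<longrightarrow> e s \<le> B" "dist t x < d" by (auto simp: Op_def)
        have "\<forall>s\<in>{0..\<tau>}. dist s x < d - dist t x \<longrightarrow> e s \<le> B"
          using td(2) dist_triangle[of _ t x] by (smt (verit) dist_commute)
        moreover have "0 < d - dist t x" using td(3) by simp
        ultimately have "\<exists>d>0. \<exists>B. \<forall>s\<in>{0..\<tau>}. dist s x < d \<longrightarrow> e s \<le> B" by blast
        then have "x \<in> bounded_times" using x by (simp add: bounded_times_def K_def)
        then show False using x by (simp add: K_def)
      qed
      then show "x \<in> {0..\<tau>} - \<Union>Op" using x by (simp add: K_def)
    next
      fix x assume x: "x \<in> {0..\<tau>} - \<Union>Op"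
      have "x \<notin> bounded_times"
      proof
        assume "x \<in> bounded_times"
        then obtain d B where "0 < d" "\<forall>s\<in>{0..\<tau>}. dist s x < d \<longrightarrow> e s \<le> B" by (auto simp: bounded_times_def)
        then have "ball x d \<in> Op" using \<open>x \<in> bounded_times\<close> by (auto simp: Op_def)
        then show False using x \<open>0 < d\<close> by force
      qed
      then show "x \<in> K" using x by (simp add: K_def)
    qed
    moreover have "open (\<Union>Op)" by (rule open_Union) (auto simp: Op_def)
    ultimately show ?thesis by (simp add: closed_Diff)
  qed
  define A where "A n = {s \<in> {0..\<tau>}. e s \<le> real n}" for n :: nat
  have "\<exists>n. \<not> K \<subseteq> closure (K - A n)"
  proof (rule ccontr)
    assume "\<nexists>n. \<not> K \<subseteq> closure (K - A n)"
    then have d: "K \<subseteq> closure (K - A n)" for n by blast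
    have "K \<subseteq> closure (\<Inter>(range (\<lambda>n. K - A n)))"
    proof (rule Baire[OF Kc])
      fix T assume "T \<in> range (\<lambda>n. K - A n)"
      then obtain n where T: "T = K - A n" by blast
      have "openin (top_of_set K) (K - A n)"
        using sublevel_closed[of "real n"] unfolding A_def
        by (metis Diff_Int_distrib Int_Diff Int_absorb openin_open open_Compl Diff_eq)
      then show "openin (top_of_set K) T \<and> K \<subseteq> closure T" using d T by simp
    qed simp
    also have "\<Inter>(range (\<lambda>n. K - A n)) = {}"
    proof -
      have "\<exists>n. x \<in> A n" if "x \<in> K" for x
        using that real_arch_simple[of "e x"] by (auto simp: A_def K_def)
      then show ?thesis by auto
    qed
    finally show False using Kne by simp
  qed
  then obtain n p where p: "p \<in> K" "p \<notin> closure (K - A n)" by blast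
  then obtain d where d: "0 < d" "\<And>y. y \<in> K - A n \<Longrightarrow> d \<le> dist y p"
    unfolding closure_approachable by (auto simp: not_less)
  have KA: "e y \<le> real n" if "y \<in> K" "dist y p < d" for y using d(2)[of y] that by (force simp: A_def)
  define d' where "d' = min d \<sigma>"
  have d': "0 < d'" using d \<sigma> by (simp add: d'_def)
  have pI: "p \<in> {0..\<tau>}" using p by (simp add: K_def)
  have "e s \<le> 4 * real n + 8 * \<delta>" if s: "s \<in> {0..\<tau>}" "dist s p < d'" for s
  proof (cases "s \<in> K")
    case True
    then have "e s \<le> real n" using s by (intro KA) (auto simp: d'_def)
    then show ?thesis using \<delta> e_nonneg[of s] by linarith
  next
    case False
    have "closed (K \<inter> closed_segment p s)" using Kc by (intro closed_Int closed_segment)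
    moreover have "K \<inter> closed_segment p s \<noteq> {}" using p by auto
    ultimately obtain c where c': "c \<in> K \<inter> closed_segment p s"
      and near': "\<And>y. y \<in> K \<inter> closed_segment p s \<Longrightarrow> dist s c \<le> dist s y"
      by (rule distance_attains_inf[of "K \<inter> closed_segment p s" s]) blast
    have c: "c \<in> K" "c \<in> closed_segment p s" using c' by auto
    have near: "dist s c \<le> dist s y" if "y \<in> K" "y \<in> closed_segment p s" for y using near' that by blast
    have cI: "c \<in> {0..\<tau>}" using c by (simp add: K_def)
    have cs: "c \<noteq> s" using c False by auto
    have dc: "\<bar>c - s\<bar> \<le> \<bar>s - p\<bar>" "\<bar>c - p\<bar> \<le> \<bar>s - p\<bar>"
      using c(2) by (auto simp: closed_segment_eq_real_ivl split: if_splits)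
    have "closed_segment c s - {c} \<subseteq> bounded_times"
    proof
      fix x assume x: "x \<in> closed_segment c s - {c}"
      then have xp: "x \<in> closed_segment p s" and "dist s x < dist s c"
        using c(2) by (auto simp: closed_segment_eq_real_ivl dist_real_def split: if_splits)
      then have "x \<notin> K" using near[of x] by force
      moreover have "x \<in> {0..\<tau>}" using xp pI s(1) by (auto simp: closed_segment_eq_real_ivl split: if_splits)
      ultimately show "x \<in> bounded_times" by (simp add: K_def)
    qed
    then have "e s \<le> 4 * e c + 8 * \<delta>"
      by (intro bound_up_to_endpoint[OF cI s(1) cs]) (use dc s in \<open>auto simp: d'_def dist_real_def\<close>)
    moreover have "e c \<le> real n" using dc s c by (intro KA) (auto simp: d'_def dist_real_def)
    ultimately show ?thesis by linarith
  qed
  then have "p \<in> bounded_times" using pI d' unfolding bounded_times_def by blast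
  then show False using p by (simp add: K_def)
qed

text \<open>
  Over a step of length \<open>h\<close> the mean square grows by the factor \<open>(1 + h) * (1 + 2 * C * h)\<close>,
  at most \<open>exp ((1 + 2 * C) * h)\<close>, after a shift that tends
  to \<open>2 * \<delta> / (1 + 2 * C)\<close> as \<open>h\<close> tends to 0.
\<close>
theorem gronwall:
  assumes T: "T \<in> {0..\<tau>}"
  shows "e T \<le> exp ((1 + 2 * C) * T) * e 0 + 2 * \<delta> / (1 + 2 * C) * (exp ((1 + 2 * C) * T) - 1)"
proof -
  define c where "c = 1 + 2 * C"
  have c: "0 < c" "c \<noteq> 0" using C by (simp_all add: c_def)
  obtain E where E: "\<And>s. s \<in> {0..\<tau>} \<Longrightarrow> e s \<le> E"
  proof -
    have "\<exists>B. \<forall>s\<in>{0..\<tau>}. e s \<le> B" by (rule bounded_on_compact) (simp_all add: locally_bounded_everywhere)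
    then show ?thesis using that by blast
  qed
  have E0: "0 \<le> E" using E[OF T] e_nonneg[of T] by linarith
  \<comment> \<open>\<open>h * \<kappa>\<close> bounds the growth of \<open>e\<close> within one step.\<close>
  define \<kappa> where "\<kappa> = E + 2 * (2 * C * E + 2 * \<delta>)"
  have \<kappa>: "0 \<le> \<kappa>" using E0 C \<delta> by (simp add: \<kappa>_def)
  define q where "q h = 2 * (\<delta> + C * (h * \<kappa>)) / c" for h
  have q0: "0 \<le> q h" if "0 \<le> h" for h using that \<kappa> C \<delta> c by (simp add: q_def)
  define R where "R h = exp (c * T) * (e 0 + q h * (1 + h)) - q h * (1 + h)" for h
  have bound: "e T \<le> R (T / real N)" if N: "real N > T" for N
  proof -
    define h where "h = T / real N"
    have N0: "0 < real N" using N T by auto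
    have h0: "0 \<le> h" "h \<le> 1" "real N * h = T" using N T N0 by (auto simp: h_def)
    show ?thesis
    proof (cases "T = 0")
      case True then show ?thesis by (simp add: R_def)
    next
      case False
      then have h: "0 < h" using T N0 by (simp add: h_def)
      define A where "A = (1 + h) * (1 + 2 * C * h)"
      have Ae: "A \<le> exp (c * h)"
      proof -
        have "A \<le> exp h * exp (2 * C * h)"
          unfolding A_def using h C exp_ge_add_one_self[of h] exp_ge_add_one_self[of "2 * C * h"]
          by (intro mult_mono) auto
        then show ?thesis by (simp add: exp_add[symmetric] c_def algebra_simps)
      qed
      have A0: "0 \<le> A" using h C by (simp add: A_def)
      let ?q = "q h * (1 + h)"
      have step: "e (real (Suc k) * h) + ?q \<le> A * (e (real k * h) + ?q)" if k: "k < N" for k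
      proof -
        let ?a = "real k * h" and ?b = "real (Suc k) * h"
        have hb: "?b - ?a = h" by (simp add: algebra_simps)
        have ab: "0 \<le> ?a" "?a < ?b" "?b \<le> \<tau>"
        proof -
          have "?b \<le> real N * h" using k h by (intro mult_right_mono) auto
          then show "?b \<le> \<tau>" using h0 T by simp
        qed (use h hb in auto)
        have loc: "e u \<le> e ?a + h * \<kappa>" if u: "u \<in> {?a..?b}" for u
        proof (cases "u = ?a")
          case True then show ?thesis using h \<kappa> by simp
        next
          case False
          then have au: "?a < u" "u \<le> \<tau>" "u - ?a \<le> h" using u ab hb by auto
          define g where "g = u - ?a"
          have g: "0 < g" "g \<le> h" "g \<le> 1" using au h0 by (auto simp: g_def)
          have Q: "0 \<le> 2 * C * E + 2 * \<delta>" using C E0 \<delta> by simp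
          have "e u \<le> (1 + g) * (e ?a + g * (2 * C * E + 2 * \<delta>))"
            unfolding g_def
          proof (rule growth(1)[OF ab(1) au(1,2)])
            fix s assume "s \<in> {?a..u}"
            then have "0 \<le> s" "s \<le> \<tau>" using ab(1) au(2) unfolding atLeastAtMost_iff by linarith+
            then show "e s \<le> E" by (intro E) simp
          qed
          also have "\<dots> = e ?a + g * e ?a + g * ((1 + g) * (2 * C * E + 2 * \<delta>))" by (simp add: algebra_simps)
          also have "\<dots> \<le> e ?a + h * E + h * (2 * (2 * C * E + 2 * \<delta>))"
            using g Q E[of ?a] ab e_nonneg[of ?a] by (intro add_mono mult_mono order_refl mult_right_mono) auto
          also have "\<dots> = e ?a + h * \<kappa>" by (simp add: \<kappa>_def algebra_simps)
          finally show ?thesis .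
        qed
        have "e ?b \<le> (1 + h) * (e ?a + h * (2 * C * (e ?a + h * \<kappa>) + 2 * \<delta>))"
          by (rule growth(1)[OF ab loc, unfolded hb])
        also have "\<dots> = A * e ?a + (1 + h) * (h * c * q h)"
        proof -
          have cq: "c * q h = 2 * (\<delta> + C * (h * \<kappa>))" using c(2) by (simp add: q_def)
          show ?thesis unfolding mult.assoc[of h c] cq by (simp add: A_def algebra_simps)
        qed
        finally have "e ?b + ?q \<le> A * e ?a + (1 + h * c) * ?q" by (simp add: algebra_simps)
        moreover have "(1 + h * c) * ?q \<le> A * ?q"
        proof (rule mult_right_mono)
          show "1 + h * c \<le> A" using h C by (simp add: A_def c_def algebra_simps)
          show "0 \<le> ?q" using q0[of h] h by simp
        qed
        ultimately show ?thesis by (simp add: distrib_left)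
      qed
      have iter: "e (real k * h) + ?q \<le> A ^ k * (e 0 + ?q)" if "k \<le> N" for k
        using that
      proof (induction k)
        case (Suc k)
        have "e (real (Suc k) * h) + ?q \<le> A * (e (real k * h) + ?q)" by (rule step) (use Suc in auto)
        also have "\<dots> \<le> A * (A ^ k * (e 0 + ?q))" using Suc A0 by (intro mult_left_mono) auto
        finally show ?case by (simp add: mult.assoc)
      qed simp
      have "A ^ N \<le> exp (c * h) ^ N" using Ae A0 by (rule power_mono)
      also have "\<dots> = exp (c * T)" using h0(3) by (simp add: exp_of_nat_mult[symmetric] mult.left_commute)
      finally have "A ^ N * (e 0 + ?q) \<le> exp (c * T) * (e 0 + ?q)"
        using q0[of h] h e_nonneg[of 0] by (intro mult_right_mono) auto
      then show ?thesis using iter[of N] h0(3) by (simp add: R_def h_def[symmetric])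
    qed
  qed
  have h0: "(\<lambda>N. T / real N) \<longlonglongrightarrow> 0" by (rule lim_const_over_n)
  have "(\<lambda>N. R (T / real N)) \<longlonglongrightarrow> exp (c * T) * (e 0 + (2 * (\<delta> + C * (0 * \<kappa>)) / c) * (1 + 0)) - (2 * (\<delta> + C * (0 * \<kappa>)) / c) * (1 + 0)"
    unfolding R_def q_def by (intro tendsto_intros h0 c)
  moreover have "\<forall>\<^sub>F N in sequentially. e T \<le> R (T / real N)"
    using filterlim_real_sequentially[unfolded filterlim_at_top_dense, rule_format, of T]
    by eventually_elim (rule bound)
  ultimately have "e T \<le> exp (c * T) * (e 0 + (2 * (\<delta> + C * (0 * \<kappa>)) / c) * (1 + 0)) - (2 * (\<delta> + C * (0 * \<kappa>)) / c) * (1 + 0)"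
    by (rule tendsto_lowerbound[OF _ _ sequentially_bot])
  then have "e T \<le> exp (c * T) * (e 0 + 2 * \<delta> / c) - 2 * \<delta> / c" by simp
  moreover have "X * (a + q) - q = X * a + q * (X - 1)" for X a q :: real by (simp add: algebra_simps)
  ultimately show ?thesis by (simp only: c_def)
qed

end

section \<open>Lagrangian representation of the gradient flow\<close>

text \<open>
  The indicator of an open box is a limit of mollified truncations of the distance to its
  complement.
\<close>
lemma measures_eq_of_test_maps:
  fixes \<mu> \<nu> :: "(real^'d) measure"
  assumes \<mu>: "prob_space \<mu>" "sets \<mu> = sets borel" and \<nu>: "prob_space \<nu>" "sets \<nu> = sets borel"
    and eq: "\<And>B f f'. 0 \<le> B \<Longrightarrow> test_map B f f' \<Longrightarrow> (\<integral>x. f x \<partial>\<mu>) = (\<integral>x. f x \<partial>\<nu>)"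
  shows "\<mu> = \<nu>"
proof -
  have box: "emeasure \<mu> (box l u) = emeasure \<nu> (box l u)" for l u :: "real^'d"
  proof -
    let ?S = "box l u"
    have ne: "- ?S \<noteq> {}"
    proof
      assume "- ?S = {}"
      then have "?S = UNIV" by blast
      then show False using bounded_box[of l u] not_bounded_UNIV by metis
    qed
    define f where "f n x = min 1 (real n * infdist x (- ?S))" for n x
    have fl: "norm (f n x - f n y) \<le> real n * norm (x - y)" for n x y
    proof -
      have "\<bar>infdist x (- ?S) - infdist y (- ?S)\<bar> \<le> norm (x - y)"
        using infdist_triangle[of x "- ?S" y] infdist_triangle[of y "- ?S" x]
        by (simp add: dist_norm norm_minus_commute abs_le_iff)
      then have "real n * \<bar>infdist x (- ?S) - infdist y (- ?S)\<bar> \<le> real n * norm (x - y)" by (intro mult_left_mono) auto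
      moreover have "\<bar>f n x - f n y\<bar> \<le> \<bar>real n * infdist x (- ?S) - real n * infdist y (- ?S)\<bar>"
        by (simp add: f_def min_def)
      moreover have "\<bar>real n * infdist x (- ?S) - real n * infdist y (- ?S)\<bar> = real n * \<bar>infdist x (- ?S) - infdist y (- ?S)\<bar>"
        by (simp add: right_diff_distrib[symmetric] abs_mult)
      ultimately show ?thesis by simp
    qed
    have f01: "0 \<le> f n x" "f n x \<le> 1" for n x by (auto simp: f_def infdist_nonneg)
    have f0: "f n x = 0" if "x \<notin> ?S" for n x using that by (simp add: f_def)
    have flim: "(\<lambda>n. f n x) \<longlonglongrightarrow> indicator ?S x" for x
    proof (cases "x \<in> ?S")
      case True
      have "closed (- ?S)" by (simp add: closed_Compl open_box)
      then have "infdist x (- ?S) \<noteq> 0" using True ne in_closed_iff_infdist_zero by blast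
      then have pos: "0 < infdist x (- ?S)" using infdist_nonneg[of x "- ?S"] by linarith
      then obtain N :: nat where N: "1 / infdist x (- ?S) < real N" using reals_Archimedean2 by blast
      have "f n x = 1" if "n \<ge> N" for n
      proof -
        have "1 / infdist x (- ?S) \<le> real n" using N that by linarith
        then have "1 \<le> real n * infdist x (- ?S)" using pos by (simp add: divide_le_eq)
        then show ?thesis by (simp add: f_def)
      qed
      then have "\<forall>\<^sub>F n in sequentially. f n x = indicator ?S x"
        using True by (auto simp: eventually_sequentially)
      then show ?thesis by (rule tendsto_eventually)
    qed (simp add: f0)
    \<comment> \<open>A radius of this order compensates for the Lipschitz constant \<open>real n\<close> of \<open>f n\<close>.\<close>
    have "\<exists>g g'. C1_map g g' \<and> (\<forall>x. norm (g x - f n x) \<le> real n * (1 / (real n + 1)\<^sup>2)) \<and>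
        (\<forall>x y. norm (g x - g y) \<le> real n * norm (x - y)) \<and>
        (\<forall>x. (\<forall>y. norm (y - x) \<le> 1 / (real n + 1)\<^sup>2 \<longrightarrow> f n y = 0) \<longrightarrow> g x = 0)" for n
    proof -
      have e: "0 < 1 / (real n + 1)\<^sup>2" by (simp add: add_nonneg_pos)
      show ?thesis by (rule mollify_lipschitz[OF fl e]) blast
    qed
    then obtain g g' where g: "\<And>n. C1_map (g n) (g' n)" "\<And>n x. norm (g n x - f n x) \<le> real n * (1 / (real n + 1)\<^sup>2)"
      "\<And>n x y. norm (g n x - g n y) \<le> real n * norm (x - y)"
      "\<And>n x. (\<And>y. norm (y - x) \<le> 1 / (real n + 1)\<^sup>2 \<Longrightarrow> f n y = 0) \<Longrightarrow> g n x = 0" by metis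
    have err: "real n * (1 / (real n + 1)\<^sup>2) \<le> 1 / (real n + 1)" for n
    proof -
      have "real n * (1 / (real n + 1)\<^sup>2) \<le> (real n + 1) * (1 / (real n + 1)\<^sup>2)" by (intro mult_right_mono) auto
      also have "\<dots> = 1 / (real n + 1)" by (simp add: power2_eq_square)
      finally show ?thesis .
    qed
    have gt: "test_map (real n) (g n) (g' n)" for n
      unfolding test_map_def
    proof (intro conjI allI g)
      show "\<bar>g' n x h\<bar> \<le> real n * norm h" for x h
        using lipschitz_derivative_bound[of "g n" "g' n x" x "real n" h] g(1)[of n] g(3)[of n] by (simp add: C1_map_def)
      obtain R where R: "\<And>x. x \<in> ?S \<Longrightarrow> norm x \<le> R" using bounded_box[of l u] by (auto simp: bounded_iff)
      show "bounded {x. g n x \<noteq> 0}"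
        unfolding bounded_iff
      proof (intro exI ballI)
        fix x assume "x \<in> {x. g n x \<noteq> 0}"
        then obtain y where y: "norm (y - x) \<le> 1 / (real n + 1)\<^sup>2" "f n y \<noteq> 0" using g(4)[of x n] by blast
        then have "norm y \<le> R" using f0 R by blast
        then show "norm x \<le> R + 1 / (real n + 1)\<^sup>2"
          using y(1) norm_triangle_ineq2[of x y] by (simp add: norm_minus_commute)
      qed
    qed
    have gm[measurable]: "g n \<in> borel_measurable borel" for n
      by (rule borel_measurable_continuous_onI[OF C1_map_continuous[OF g(1)]])
    have gb: "norm (g n x) \<le> 2" for n x
    proof -
      have "1 / (real n + 1) \<le> 1" by (simp add: divide_le_eq)
      then have "norm (g n x - f n x) \<le> 1" using g(2)[of n x] err[of n] by linarith
      then show ?thesis using f01[of n x] by (simp add: abs_le_iff)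
    qed
    have glim: "(\<lambda>n. g n x) \<longlonglongrightarrow> indicator ?S x" for x
    proof -
      have "(\<lambda>n. g n x - f n x) \<longlonglongrightarrow> 0"
      proof (rule Lim_null_comparison[OF _ LIMSEQ_inverse_real_of_nat])
        show "\<forall>\<^sub>F n in sequentially. norm (g n x - f n x) \<le> inverse (real (Suc n))"
          using order_trans[OF g(2) err] by (simp add: divide_inverse add.commute)
      qed
      from tendsto_add[OF this flim[of x]] show ?thesis by simp
    qed
    have lim: "(\<lambda>n. \<integral>x. g n x \<partial>M) \<longlonglongrightarrow> measure M ?S" if M: "prob_space M" "sets M = sets borel" for M :: "(real^'d) measure"
    proof -
      interpret M: prob_space M by (rule M)
      note [measurable_cong] = M(2)
      have "(\<lambda>n. \<integral>x. g n x \<partial>M) \<longlonglongrightarrow> (\<integral>x. indicator ?S x \<partial>M)"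
      proof (rule integral_dominated_convergence[where w="\<lambda>_. 2"])
        show "(indicator ?S :: _ \<Rightarrow> real) \<in> borel_measurable M"
          by (intro borel_measurable_indicator) (simp add: M(2))
        show "g n \<in> borel_measurable M" for n by measurable
      qed (use glim gb in auto)
      then show ?thesis by (simp add: M.emeasure_eq_measure M(2))
    qed
    have "measure \<mu> ?S = measure \<nu> ?S"
      using lim[OF \<mu>] lim[OF \<nu>] eq[OF _ gt] LIMSEQ_unique by auto
    then show ?thesis
      using \<mu>(1) \<nu>(1) by (simp add: prob_space.finite_measure finite_measure.emeasure_eq_measure)
  qed
  let ?A = "\<lambda>n::nat. box (- (real n *\<^sub>R One)) (real n *\<^sub>R One) :: (real^'d) set"
  show ?thesis
  proof (rule measure_eqI_generator_eq[where E="range (\<lambda>(a, b). box a b)" and \<Omega>=UNIV and A="?A"])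
    show "Int_stable (range (\<lambda>(a, b). box a b :: (real^'d) set))"
      by (fastforce intro!: Int_stableI simp: box_Int_box)
    show "sets \<mu> = sigma_sets UNIV (range (\<lambda>(a, b). box a b :: (real^'d) set))"
      "sets \<nu> = sigma_sets UNIV (range (\<lambda>(a, b). box a b :: (real^'d) set))"
      using \<mu>(2) \<nu>(2) by (simp_all add: borel_eq_box)
    show "range ?A \<subseteq> range (\<lambda>(a, b). box a b)" by auto
    show "(\<Union>n. ?A n) = UNIV" by (rule UN_box_eq_UNIV)
    show "emeasure \<mu> (?A n) \<noteq> \<infinity>" for n
      using \<mu>(1) by (simp add: prob_space.finite_measure finite_measure.emeasure_finite)
  qed (use box in auto)
qed

lemma measurable_matrix_vector:
  fixes A :: "'a \<Rightarrow> real^'n^'m" and x :: "'a \<Rightarrow> real^'n"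
  assumes [measurable]: "A \<in> borel_measurable M" "x \<in> borel_measurable M"
  shows "(\<lambda>z. A z *v x z) \<in> borel_measurable M"
proof (rule measurable_vecI)
  fix i
  have 1: "(\<lambda>z. x z $ j) \<in> borel_measurable M" for j
    by (rule borel_measurable_continuous_on[OF _ assms(2)]) (intro continuous_intros)
  have 2: "(\<lambda>z. A z $ i $ j) \<in> borel_measurable M" for j
    by (rule borel_measurable_continuous_on[OF _ assms(1)]) (intro continuous_intros)
  show "(\<lambda>z. (A z *v x z) $ i) \<in> borel_measurable M"
    unfolding matrix_vector_mult_def vec_lambda_beta using 1 2 by measurable
qed

context continuity_equation
begin

theorem lagrangian_representation:
  assumes t: "t \<in> {0..\<tau>}"
  shows "distr (\<rho> 0) borel (F.flow t) = \<rho> t"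
proof (rule measures_eq_of_test_maps)
  have z: "0 \<in> {0..\<tau>}" using \<tau> by simp
  interpret R: prob_space "\<rho> 0" by (rule \<rho>_prob[OF z])
  note [measurable_cong] = \<rho>_sets[OF z]
  note [measurable] = flow_measurable_at[OF t]
  show "prob_space (distr (\<rho> 0) borel (F.flow t))" by (rule R.prob_space_distr) measurable
  show "prob_space (\<rho> t)" "sets (\<rho> t) = sets borel" using \<rho>_prob[OF t] \<rho>_sets[OF t] by auto
  fix B :: real and f :: "real^'d \<Rightarrow> real" and f' assume B: "0 \<le> B" and f: "test_map B f f'"
  have "f \<in> borel_measurable borel"
    using f by (intro borel_measurable_continuous_onI C1_map_continuous[of f f']) (simp add: test_map_def)
  then have "(\<integral>x. f x \<partial>distr (\<rho> 0) borel (F.flow t)) = (\<integral>x. f (F.flow t x) \<partial>\<rho> 0)"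
    by (intro integral_distr) auto
  then show "(\<integral>x. f x \<partial>distr (\<rho> 0) borel (F.flow t)) = (\<integral>x. f x \<partial>\<rho> t)"
    using flow_pushforward_test[OF t f B] by simp
qed simp

end

section \<open>The parameterized flow\<close>

text \<open>
  A limit of forward difference quotients; the right end point, which has none, is a single
  time.
\<close>
lemma measurable_derivative_on_interval:
  fixes \<theta> d :: "real \<Rightarrow> 'b::euclidean_space"
  assumes \<tau>: "0 \<le> \<tau>" and \<theta>: "\<And>t. t \<in> {0..\<tau>} \<Longrightarrow> (\<theta> has_vector_derivative d t) (at t within {0..\<tau>})"
  shows "(\<lambda>t. if t \<in> {0..\<tau>} then d t else 0) \<in> borel_measurable borel"
proof -
  define \<theta>c where "\<theta>c s = \<theta> (max 0 (min \<tau> s))" for s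
  have c: "continuous_on {0..\<tau>} \<theta>"
    using \<theta> has_vector_derivative_continuous continuous_on_eq_continuous_within by blast
  have cc: "continuous_on UNIV \<theta>c"
    unfolding \<theta>c_def using \<tau> by (intro continuous_on_compose2[OF c] continuous_intros) auto
  have [measurable]: "\<theta>c \<in> borel_measurable borel" by (rule borel_measurable_continuous_onI[OF cc])
  define g where "g n s = (if s \<in> {0..<\<tau>} then (real n + 1) *\<^sub>R (\<theta>c (s + 1 / (real n + 1)) - \<theta>c s) else 0)" for n :: nat and s
  have gm[measurable]: "g n \<in> borel_measurable borel" for n unfolding g_def[abs_def] by measurable
  have lim: "(\<lambda>n. g n s) \<longlonglongrightarrow> (if s \<in> {0..<\<tau>} then d s else 0)" for s
  proof (cases "s \<in> {0..<\<tau>}")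
    case True
    then have s: "s \<in> {0..\<tau>}" by auto
    define u where "u n = s + 1 / (real n + 1)" for n :: nat
    have h: "(\<lambda>n. 1 / (real n + 1)) \<longlonglongrightarrow> 0"
      using LIMSEQ_inverse_real_of_nat by (simp add: divide_inverse add.commute)
    have ul: "u \<longlonglongrightarrow> s" using tendsto_add[OF tendsto_const[of s] h] by (simp add: u_def[abs_def])
    have ev: "\<forall>\<^sub>F n in sequentially. u n < \<tau>" by (rule order_tendstoD(2)[OF ul]) (use True in auto)
    have pos: "0 < 1 / (real n + 1)" for n by (simp add: add_nonneg_pos)
    have "filterlim u (at s within {0..\<tau>}) sequentially"
      unfolding filterlim_at
    proof (intro conjI ul)
      show "\<forall>\<^sub>F n in sequentially. u n \<in> {0..\<tau>} \<and> u n \<noteq> s"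
        using ev
      proof eventually_elim
        case (elim n)
        then show ?case using pos[of n] True by (auto simp: u_def)
      qed
    qed
    moreover have "((\<lambda>y. (1 / norm (y - s)) *\<^sub>R (\<theta> y - (\<theta> s + (y - s) *\<^sub>R d s))) \<longlongrightarrow> 0) (at s within {0..\<tau>})"
      using \<theta>[OF s] unfolding has_vector_derivative_def has_derivative_within by simp
    ultimately have "((\<lambda>n. (1 / norm (u n - s)) *\<^sub>R (\<theta> (u n) - (\<theta> s + (u n - s) *\<^sub>R d s))) \<longlonglongrightarrow> 0)"
      by (rule filterlim_compose[rotated])
    then have L: "(\<lambda>n. (1 / norm (u n - s)) *\<^sub>R (\<theta> (u n) - (\<theta> s + (u n - s) *\<^sub>R d s)) + d s) \<longlonglongrightarrow> 0 + d s"
      by (intro tendsto_intros)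
    have "(\<lambda>n. g n s) \<longlonglongrightarrow> 0 + d s"
    proof (rule Lim_transform_eventually[OF L])
      show "\<forall>\<^sub>F n in sequentially. (1 / norm (u n - s)) *\<^sub>R (\<theta> (u n) - (\<theta> s + (u n - s) *\<^sub>R d s)) + d s = g n s"
        using ev
      proof eventually_elim
        case (elim n)
        have n1: "0 < real n + 1" by simp
        have us: "u n - s = 1 / (real n + 1)" by (simp add: u_def)
        have "norm (u n - s) = 1 / (real n + 1)" unfolding us using pos[of n] by simp
        then have i: "1 / norm (u n - s) = real n + 1" by simp
        have "\<theta>c (s + 1 / (real n + 1)) = \<theta> (u n)" "\<theta>c s = \<theta> s"
          using elim True less_imp_le[OF pos[of n]] \<tau> s by (simp_all add: \<theta>c_def u_def)
        then have "g n s = (real n + 1) *\<^sub>R (\<theta> (u n) - \<theta> s)" using True by (simp add: g_def)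
        moreover have "(real n + 1) *\<^sub>R ((u n - s) *\<^sub>R d s) = d s" unfolding us using n1 by simp
        ultimately show ?case unfolding i by (simp add: scaleR_diff_right scaleR_add_right)
      qed
    qed
    then show ?thesis using True by simp
  next
    case False
    then have "g n s = 0" for n by (auto simp: g_def)
    then show ?thesis using False by auto
  qed
  have [measurable]: "(\<lambda>s. if s \<in> {0..<\<tau>} then d s else 0) \<in> borel_measurable borel"
    by (rule borel_measurable_LIMSEQ_metric[OF gm lim])
  have "(\<lambda>t. if t \<in> {0..\<tau>} then d t else 0) = (\<lambda>t. if t = \<tau> then d \<tau> else (if t \<in> {0..<\<tau>} then d t else 0))"
    using \<tau> by (auto simp: fun_eq_iff)
  then show ?thesis by simp
qed

text \<open>
  By least squares the pseudoinverse direction attains the infimum over \<open>\<xi>\<close> at the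
  parameter \<open>\<eta>\<close>, and the projection error is the supremum over all parameters.
\<close>
lemma parameterized_velocity_residual:
  fixes lam :: "(real^'d) measure" and J :: "real^'n \<Rightarrow> real^'d \<Rightarrow> real^'n^'d"
  assumes \<eta>: "\<eta> \<in> Theta" and J: "J \<eta> \<in> borel_measurable lam"
    and w: "(\<lambda>z. nabla (U (distr lam borel (T \<eta>))) (T \<eta> z)) \<in> borel_measurable lam"
    and G: "integrable lam (\<lambda>z. transpose (J \<eta> z) ** J \<eta> z)"
    and b: "b = (\<integral>z. transpose (J \<eta> z) *v nabla (U (distr lam borel (T \<eta>))) (T \<eta> z) \<partial>lam)"
    and fin: "projection_error lam U Theta T J < \<infinity>"
  shows "(\<integral>\<^sup>+z. ennreal ((norm (nabla (U (distr lam borel (T \<eta>))) (T \<eta> z)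
      - J \<eta> z *v (pseudoinverse (Ghat lam J \<eta>) *v b)))\<^sup>2) \<partial>lam) \<le> projection_error lam U Theta T J"
proof -
  let ?w = "\<lambda>z. nabla (U (distr lam borel (T \<eta>))) (T \<eta> z)"
  let ?I = "INF \<xi>. \<integral>\<^sup>+z. ennreal ((norm (?w z - J \<eta> z *v \<xi>))\<^sup>2) \<partial>lam"
  have le: "?I \<le> projection_error lam U Theta T J"
    unfolding projection_error_def by (rule SUP_upper[OF \<eta>])
  then have "?I < \<infinity>" using fin by (rule le_less_trans)
  then obtain \<xi>0 where \<xi>0: "(\<integral>\<^sup>+z. ennreal ((norm (?w z - J \<eta> z *v \<xi>0))\<^sup>2) \<partial>lam) < \<infinity>"
    by (auto simp: INF_less_iff)
  have "(\<integral>\<^sup>+z. ennreal ((norm (?w z - J \<eta> z *v (pseudoinverse (Ghat lam J \<eta>) *v b)))\<^sup>2) \<partial>lam) \<le> ?I"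
    unfolding Ghat_def b by (rule INF_greatest) (rule least_squares_residual[OF J w G \<xi>0])
  then show ?thesis using le by (rule order_trans)
qed

lemma parameter_curve_derivative:
  fixes \<theta> :: "real \<Rightarrow> real^'n" and T :: "real^'n \<Rightarrow> real^'d \<Rightarrow> real^'d" and J :: "real^'n \<Rightarrow> real^'d \<Rightarrow> real^'n^'d"
  assumes C1: "C1_family Theta T J" and \<theta>: "(\<theta> has_vector_derivative d) (at s within I)" and s: "s \<in> I"
    and I: "\<And>r. r \<in> I \<Longrightarrow> \<theta> r \<in> Theta"
  shows "((\<lambda>r. T (\<theta> r) z) has_vector_derivative J (\<theta> s) z *v d) (at s within I)"
proof -
  obtain K :: "real^'n \<Rightarrow> real^'d \<Rightarrow> real^'d^'d" where
    K: "\<And>\<eta> z. \<eta> \<in> Theta \<Longrightarrow> ((\<lambda>(\<eta>, y). T \<eta> y) has_derivative (\<lambda>(h, k). J \<eta> z *v h + K \<eta> z *v k)) (at (\<eta>, z) within Theta \<times> UNIV)"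
    using C1 unfolding C1_family_def by blast
  have 1: "((\<lambda>r. (\<theta> r, z)) has_derivative (\<lambda>t. (t *\<^sub>R d, 0))) (at s within I)"
    using \<theta> unfolding has_vector_derivative_def by (intro has_derivative_Pair has_derivative_const)
  have 2: "((\<lambda>(\<eta>, y). T \<eta> y) has_derivative (\<lambda>(h, k). J (\<theta> s) z *v h + K (\<theta> s) z *v k)) (at (\<theta> s, z) within (\<lambda>r. (\<theta> r, z)) ` I)"
    by (rule has_derivative_subset[OF K[OF I[OF s]]]) (use I in auto)
  have "((\<lambda>r. (\<lambda>(\<eta>, y). T \<eta> y) (\<theta> r, z)) has_derivative (\<lambda>t. (\<lambda>(h, k). J (\<theta> s) z *v h + K (\<theta> s) z *v k) (t *\<^sub>R d, 0))) (at s within I)"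
    by (rule has_derivative_in_compose[OF 1 2])
  moreover have "(\<lambda>t. (\<lambda>(h, k). J (\<theta> s) z *v h + K (\<theta> s) z *v k) (t *\<^sub>R d, 0)) = (\<lambda>t. t *\<^sub>R (J (\<theta> s) z *v d))"
    by (auto simp: matrix_vector_mult_scaleR)
  ultimately show ?thesis unfolding has_vector_derivative_def by simp
qed

theorem theorem3p7:
  fixes lam :: "(real^'d) measure" and varrho :: "real^'d \<Rightarrow> real"
    and F :: "(real^'d) measure \<Rightarrow> real"
    and U :: "(real^'d) measure \<Rightarrow> real^'d \<Rightarrow> real"
    and C :: real
    and Theta :: "(real^'n) set"
    and T :: "real^'n \<Rightarrow> real^'d \<Rightarrow> real^'d"
    and J :: "real^'n \<Rightarrow> real^'d \<Rightarrow> real^'n^'d"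
    and gradF :: "real^'n \<Rightarrow> real^'n"
    and \<tau> :: real
    and \<theta> :: "real \<Rightarrow> real^'n"
    and \<rho>0 :: "(real^'d) measure" and \<rho> :: "real \<Rightarrow> (real^'d) measure"
  assumes varrho: "varrho \<in> borel_measurable borel" "\<And>x. 0 \<le> varrho x"
    and lam: "lam = density lborel (\<lambda>x. ennreal (varrho x))" "prob_space lam"
    and U_variation: "first_variation F U"
    and U_smooth: "\<And>\<mu>. \<mu> \<in> prob_densities \<Longrightarrow> C1 (U \<mu>)"
    and C_pos: "C > 0"
    and lipschitz: "\<And>S S'. push_forward_map lam S \<Longrightarrow> push_forward_map lam S' \<Longrightarrow>
        (\<integral>\<^sup>+z. ennreal ((norm (nabla (U (distr lam borel S)) (S z)
                             - nabla (U (distr lam borel S')) (S' z)))\<^sup>2) \<partial>lam)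
        \<le> ennreal C * (\<integral>\<^sup>+z. ennreal ((norm (S z - S' z))\<^sup>2) \<partial>lam)"
    and T_push: "\<And>\<eta>. \<eta> \<in> Theta \<Longrightarrow> push_forward_map lam (T \<eta>)"
    and T_C1: "C1_family Theta T J"
    and G_integrable: "\<And>\<eta>. \<eta> \<in> Theta \<Longrightarrow> integrable lam (\<lambda>z. transpose (J \<eta> z) ** J \<eta> z)"
    and gradF: "\<And>\<eta>. \<eta> \<in> Theta \<Longrightarrow>
        ((\<lambda>\<eta>'. F (distr lam borel (T \<eta>'))) has_derivative (\<lambda>h. gradF \<eta> \<bullet> h)) (at \<eta> within Theta)"
    and gradF_eq: "\<And>\<eta>. \<eta> \<in> Theta \<Longrightarrow>
        gradF \<eta> = (\<integral>z. transpose (J \<eta> z) *v nabla (U (distr lam borel (T \<eta>))) (T \<eta> z) \<partial>lam)"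
    and \<theta>_in: "\<And>t. t \<in> {0..\<tau>} \<Longrightarrow> \<theta> t \<in> Theta"
    and \<theta>_flow: "\<And>t. t \<in> {0..\<tau>} \<Longrightarrow>
        (\<theta> has_vector_derivative - (pseudoinverse (Ghat lam J (\<theta> t)) *v gradF (\<theta> t)))
          (at t within {0..\<tau>})"
    and \<rho>_flow: "wasserstein_gradient_flow U \<tau> \<rho>0 \<rho>"
    and t: "t \<in> {0..\<tau>}"
  shows "ennreal ((W2 (distr lam borel (T (\<theta> t))) (\<rho> t))\<^sup>2)
      \<le> ennreal (exp ((1 + 2 * C) * t)) * ennreal ((W2 (distr lam borel (T (\<theta> 0))) \<rho>0)\<^sup>2)
        + 2 * projection_error lam U Theta T J / ennreal (1 + 2 * C)
          * ennreal (exp ((1 + 2 * C) * t) - 1)"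
proof -
  define v where "v \<mu> x = - nabla (U \<mu>) x" for \<mu> x
  have \<tau>: "0 \<le> \<tau>" using t by simp
  have z0: "0 \<in> {0..\<tau>}" using \<tau> by simp
  have sl: "sets lam = sets borel" by (simp add: lam)
  have \<rho>0: "\<rho> 0 = \<rho>0" using \<rho>_flow by (simp add: wasserstein_gradient_flow_def)
  have pfm: "push_forward_map lam S \<longleftrightarrow> S \<in> borel \<rightarrow>\<^sub>M borel \<and> distr lam borel S \<in> prob_densities" for S
    unfolding push_forward_map_def by (simp add: measurable_cong_sets[OF sl refl])
  interpret L: prob_space lam by (rule lam)
  interpret CE: continuity_equation lam v C \<tau> \<rho>
  proof
    show "sets lam = sets borel" by (rule sl)
    show "absolutely_continuous lborel lam"
      unfolding lam(1) by (intro absolutely_continuousI_density) (use varrho in simp)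
    show "continuous_on UNIV (v \<mu>)" if "\<mu> \<in> prob_densities" for \<mu>
      unfolding v_def using U_smooth[OF that] by (intro continuous_intros) (simp add: C1_def)
    show "0 < C" by (rule C_pos)
    show "(\<integral>\<^sup>+z. ennreal ((norm (v (distr lam borel S) (S z) - v (distr lam borel S') (S' z)))\<^sup>2) \<partial>lam)
        \<le> ennreal C * (\<integral>\<^sup>+z. ennreal ((norm (S z - S' z))\<^sup>2) \<partial>lam)"
      if "S \<in> borel \<rightarrow>\<^sub>M borel" "S' \<in> borel \<rightarrow>\<^sub>M borel" "distr lam borel S \<in> prob_densities" "distr lam borel S' \<in> prob_densities" for S S'
      using lipschitz[of S S'] that by (simp add: pfm v_def norm_minus_commute)
    show "0 \<le> \<tau>" by (rule \<tau>)
    show "\<rho> s \<in> prob_densities" if "s \<in> {0..\<tau>}" for s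
      using \<rho>_flow that by (simp add: wasserstein_gradient_flow_def)
    show "((\<lambda>s. W2 (\<rho> s) (\<rho> r)) \<longlongrightarrow> 0) (at r within {0..\<tau>})" if "r \<in> {0..\<tau>}" for r
      using \<rho>_flow that by (simp add: wasserstein_gradient_flow_def)
    show "((\<lambda>s. \<integral>x. \<phi> x \<partial>\<rho> s) has_real_derivative (\<integral>x. nabla \<phi> x \<bullet> v (\<rho> r) x \<partial>\<rho> r)) (at r within {0..\<tau>})"
      if "C1 \<phi>" "bounded {x. \<phi> x \<noteq> 0}" "r \<in> {0..\<tau>}" for \<phi> r
    proof -
      have "((\<lambda>s. \<integral>x. \<phi> x \<partial>\<rho> s) has_real_derivative - (\<integral>x. nabla \<phi> x \<bullet> nabla (U (\<rho> r)) x \<partial>\<rho> r)) (at r within {0..\<tau>})"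
        using \<rho>_flow that unfolding wasserstein_gradient_flow_def by blast
      then show ?thesis by (simp add: v_def)
    qed
  qed
  let ?\<delta> = "projection_error lam U Theta T J"
  let ?c = "1 + 2 * C"
  have Tm: "T (\<theta> s) \<in> borel \<rightarrow>\<^sub>M borel" and TP: "distr lam borel (T (\<theta> s)) \<in> prob_densities" if "s \<in> {0..\<tau>}" for s
    using T_push[OF \<theta>_in[OF that]] by (auto simp: pfm)
  note \<rho>P = CE.\<rho>_P
  \<comment> \<open>An infinite projection error makes the right-hand side infinite at every positive time.\<close>
  consider "t = 0" | "0 < t" "?\<delta> = \<infinity>" | "0 < t" "?\<delta> < \<infinity>"
    using t by (cases "t = 0"; cases "?\<delta> = \<infinity>") (auto simp: less_top)
  then show ?thesis
  proof cases
    case 1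
    then show ?thesis by (simp add: \<rho>0)
  next
    case 2
    have "0 < exp (?c * t) - 1" using 2 C_pos by simp
    then have "2 * ?\<delta> / ennreal ?c * ennreal (exp (?c * t) - 1) = \<infinity>"
      using 2 C_pos by (simp add: ennreal_top_divide ennreal_mult_eq_top_iff divide_ennreal_def ennreal_top_mult)
    then show ?thesis by simp
  next
    case 3
    define \<delta> where "\<delta> = enn2real ?\<delta>"
    have \<delta>: "?\<delta> = ennreal \<delta>" "0 \<le> \<delta>" using 3 by (simp_all add: \<delta>_def less_top)
    have bound: "(W2 (distr lam borel (T (\<theta> t))) (\<rho> t))\<^sup>2
        \<le> exp (?c * t) * ((W2 (distr lam borel (T (\<theta> 0))) \<rho>0)\<^sup>2 + \<epsilon>) + 2 * \<delta> / ?c * (exp (?c * t) - 1)"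
      if \<epsilon>: "0 < \<epsilon>" for \<epsilon>
    proof -
      \<comment> \<open>Both curves are represented on the reference space, by maps that are almost optimally coupled
        at the initial time.\<close>
      obtain S where S[measurable]: "S \<in> borel \<rightarrow>\<^sub>M borel" and dS: "distr lam borel S = \<rho> 0"
        and cost: "(\<integral>\<^sup>+z. ennreal ((norm (T (\<theta> 0) z - S z))\<^sup>2) \<partial>lam) \<le> ennreal ((W2 (distr lam borel (T (\<theta> 0))) (\<rho> 0))\<^sup>2 + \<epsilon>)"
        by (rule CE.near_optimal_map[OF Tm[OF z0] refl TP[OF z0] \<rho>P[OF z0] \<epsilon>])
      define cl where "cl s = max 0 (min \<tau> s)" for s :: real
      have cl: "cl s \<in> {0..\<tau>}" "s \<in> {0..\<tau>} \<Longrightarrow> cl s = s" for s using \<tau> by (auto simp: cl_def)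
      define X where "X s z = CE.F.flow (cl s) (S z)" for s z
      define d\<theta> where "d\<theta> s = (if s \<in> {0..\<tau>} then - (pseudoinverse (Ghat lam J (\<theta> s)) *v gradF (\<theta> s)) else 0)" for s
      define f where "f s z = T (\<theta> (cl s)) z - X s z" for s z
      define D where "D s z = J (\<theta> (cl s)) z *v d\<theta> s - CE.V s (X s z)" for s z
      have Xm: "X s \<in> borel \<rightarrow>\<^sub>M borel" for s
        unfolding X_def by (rule measurable_compose[OF S CE.flow_measurable_at[OF cl(1)]])
      have dX: "distr lam borel (X s) = \<rho> s" if s: "s \<in> {0..\<tau>}" for s
      proof -
        have "X s = CE.F.flow s \<circ> S" by (simp add: fun_eq_iff X_def cl(2)[OF s])
        then have "distr lam borel (X s) = distr (distr lam borel S) borel (CE.F.flow s)"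
          using CE.flow_measurable_at[OF s] by (subst distr_distr) (auto simp: measurable_cong_sets[OF sl refl])
        then show ?thesis using CE.lagrangian_representation[OF s] by (simp add: dS)
      qed
      have JK: "continuous_on (Theta \<times> UNIV) (\<lambda>(\<eta>, z). J \<eta> z)" using T_C1 by (auto simp: C1_family_def)
      have "continuous_on {0..\<tau>} \<theta>"
        using \<theta>_flow has_vector_derivative_continuous continuous_on_eq_continuous_within by blast
      then have \<theta>c: "continuous_on UNIV (\<lambda>s. \<theta> (cl s))"
        unfolding cl_def by (rule continuous_on_compose2) (use \<tau> in \<open>auto intro!: continuous_intros\<close>)
      have Jm2: "(\<lambda>p. J (\<theta> (cl (fst p))) (snd p)) \<in> borel_measurable borel"
      proof (rule borel_measurable_continuous_onI)
        have "continuous_on UNIV (\<lambda>p. (\<lambda>(\<eta>, z). J \<eta> z) (\<theta> (cl (fst p)), snd p))"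
          by (rule continuous_on_compose2[OF JK])
             (use \<theta>_in cl in \<open>auto intro!: continuous_intros continuous_on_compose2[OF \<theta>c]\<close>)
        then show "continuous_on UNIV (\<lambda>p. J (\<theta> (cl (fst p))) (snd p))" by simp
      qed
      have Jm: "J \<eta> \<in> borel_measurable lam" if "\<eta> \<in> Theta" for \<eta>
      proof -
        have "continuous_on UNIV (\<lambda>z. (\<lambda>(\<eta>, z). J \<eta> z) (\<eta>, z))"
          by (rule continuous_on_compose2[OF JK]) (use that in \<open>auto intro!: continuous_intros\<close>)
        then show ?thesis
          unfolding measurable_cong_sets[OF sl refl] by (intro borel_measurable_continuous_onI) simp
      qed
      have nablam: "nabla (U \<mu>) \<in> borel_measurable borel" if "\<mu> \<in> prob_densities" for \<mu>
        using U_smooth[OF that] by (intro borel_measurable_continuous_onI) (simp add: C1_def)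
      have fst_m: "(fst :: real \<times> (real^'d) \<Rightarrow> real) \<in> borel \<rightarrow>\<^sub>M borel"
        and snd_m: "(snd :: real \<times> (real^'d) \<Rightarrow> real^'d) \<in> borel \<rightarrow>\<^sub>M borel"
        by (intro borel_measurable_continuous_onI continuous_intros)+
      have d\<theta>m: "d\<theta> \<in> borel_measurable borel"
        unfolding d\<theta>_def[abs_def] by (rule measurable_derivative_on_interval[OF \<tau> \<theta>_flow])
      have X2m: "(\<lambda>p. X (fst p) (snd p)) \<in> borel \<rightarrow>\<^sub>M borel"
      proof -
        have "(\<lambda>p :: real \<times> (real^'d). (fst p, S (snd p))) \<in> borel \<rightarrow>\<^sub>M (borel \<Otimes>\<^sub>M borel)"
          by (intro measurable_Pair fst_m measurable_compose[OF snd_m S])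
        then have "(\<lambda>p :: real \<times> (real^'d). (fst p, S (snd p))) \<in> borel \<rightarrow>\<^sub>M borel" by (simp add: borel_prod)
        from measurable_compose[OF this CE.F.flow_measurable] show ?thesis by (simp add: X_def cl_def)
      qed
      have Dm: "(\<lambda>p. D (fst p) (snd p)) \<in> borel_measurable borel"
        unfolding D_def
        by (intro borel_measurable_diff measurable_matrix_vector[OF Jm2 measurable_compose[OF fst_m d\<theta>m]]
            CE.V_pair_measurable[OF fst_m X2m])
      have sp: "sets (lborel \<Otimes>\<^sub>M lam) = sets (borel :: (real \<times> (real^'d)) measure)"
        unfolding borel_prod[symmetric] by (rule sets_pair_measure_cong) (simp_all add: sl)
      interpret SC: square_integrable_curve lam f D C \<delta> \<tau>
      proof
        show "0 < C" by (rule C_pos)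
        show "0 \<le> \<delta>" by (rule \<delta>(2))
        show "0 \<le> \<tau>" by (rule \<tau>)
        show "f s \<in> borel_measurable lam" if "s \<in> {0..\<tau>}" for s
          unfolding f_def measurable_cong_sets[OF sl refl] using Xm Tm[OF cl(1)] by (intro borel_measurable_diff)
        show "(\<lambda>p. D (fst p) (snd p)) \<in> borel_measurable (lborel \<Otimes>\<^sub>M lam)"
          unfolding measurable_cong_sets[OF sp refl] by (rule Dm)
        show "((\<lambda>s. D s z) has_integral (f b z - f a z)) {a..b}" if ab: "0 \<le> a" "a \<le> b" "b \<le> \<tau>" for a b z
        proof -
          have sub: "{a..b} \<subseteq> {0..\<tau>}" using ab by auto
          have "((\<lambda>r. T (\<theta> r) z) has_vector_derivative J (\<theta> s) z *v d\<theta> s) (at s within {a..b})" if "s \<in> {a..b}" for s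
          proof -
            have s: "s \<in> {0..\<tau>}" using sub that by blast
            have "(\<theta> has_vector_derivative d\<theta> s) (at s within {0..\<tau>})" using \<theta>_flow[OF s] s by (simp add: d\<theta>_def)
            from parameter_curve_derivative[OF T_C1 this s \<theta>_in] show ?thesis
              by (rule has_vector_derivative_within_subset[OF _ sub])
          qed
          then have "((\<lambda>s. J (\<theta> s) z *v d\<theta> s) has_integral (T (\<theta> b) z - T (\<theta> a) z)) {a..b}"
            by (rule fundamental_theorem_of_calculus[OF ab(2)])
          from has_integral_diff[OF this CE.F.flow_increment[OF ab, of "S z"]]
          have I: "((\<lambda>s. J (\<theta> s) z *v d\<theta> s - CE.V s (CE.F.flow s (S z))) has_integral
              (T (\<theta> b) z - T (\<theta> a) z - (CE.F.flow b (S z) - CE.F.flow a (S z)))) {a..b}" .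
          have "((\<lambda>s. D s z) has_integral
              (T (\<theta> b) z - T (\<theta> a) z - (CE.F.flow b (S z) - CE.F.flow a (S z)))) {a..b}"
            by (rule has_integral_eq[OF _ I]) (use sub cl(2) in \<open>auto simp: D_def X_def\<close>)
          moreover have "T (\<theta> b) z - T (\<theta> a) z - (CE.F.flow b (S z) - CE.F.flow a (S z)) = f b z - f a z"
            using ab cl(2)[of a] cl(2)[of b] by (simp add: f_def X_def algebra_simps)
          ultimately show ?thesis by simp
        qed
        fix s assume s: "s \<in> {0..\<tau>}"
        note \<eta> = \<theta>_in[OF s]
        have Xs: "distr lam borel (X s) \<in> prob_densities" using \<rho>P[OF s] by (simp add: dX[OF s])
        show "(\<integral>\<^sup>+z. ennreal ((norm (f s z))\<^sup>2) \<partial>lam) < \<infinity>"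
          unfolding f_def cl(2)[OF s] by (rule CE.maps_sq_finite[OF Tm[OF s] Xm TP[OF s] Xs])
        define w1 where "w1 z = nabla (U (distr lam borel (T (\<theta> s)))) (T (\<theta> s) z)" for z
        define w2 where "w2 z = nabla (U (\<rho> s)) (X s z)" for z
        define p where "p = pseudoinverse (Ghat lam J (\<theta> s)) *v gradF (\<theta> s)"
        define res where "res z = w1 z - J (\<theta> s) z *v p" for z
        have w1m: "w1 \<in> borel_measurable lam"
          unfolding w1_def[abs_def] measurable_cong_sets[OF sl refl]
          by (rule measurable_compose[OF Tm[OF s] nablam[OF TP[OF s]]])
        have w2m: "w2 \<in> borel_measurable lam"
          unfolding w2_def[abs_def] measurable_cong_sets[OF sl refl]
          by (rule measurable_compose[OF Xm nablam[OF \<rho>P[OF s]]])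
        have resm: "res \<in> borel_measurable lam"
          unfolding res_def[abs_def] by (intro borel_measurable_diff w1m measurable_matrix_vector Jm[OF \<eta>]) simp
        have res: "(\<integral>\<^sup>+z. ennreal ((norm (res z))\<^sup>2) \<partial>lam) \<le> ennreal \<delta>"
          using parameterized_velocity_residual[OF \<eta> Jm[OF \<eta>] w1m[unfolded w1_def[abs_def]] G_integrable[OF \<eta>] gradF_eq[OF \<eta>] 3(2)]
          by (simp add: \<delta>(1) res_def w1_def p_def)
        have lip: "(\<integral>\<^sup>+z. ennreal ((norm (w2 z - w1 z))\<^sup>2) \<partial>lam) \<le> ennreal C * (\<integral>\<^sup>+z. ennreal ((norm (f s z))\<^sup>2) \<partial>lam)"
          using lipschitz[of "T (\<theta> s)" "X s"] Tm[OF s] TP[OF s] Xm[of s] Xs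
          by (simp add: pfm f_def cl(2)[OF s] w1_def w2_def dX[OF s] norm_minus_commute)
        have "AE x in distr lam borel (X s). CE.V s x = v (\<rho> s) x"
          unfolding dX[OF s] by (rule CE.V_AE[OF s])
        then have "AE z in lam. CE.V s (X s z) = v (\<rho> s) (X s z)"
          by (rule AE_distrD[rotated]) (simp add: measurable_cong_sets[OF sl refl] Xm)
        \<comment> \<open>Subtract and add the gradient along \<open>T (\<theta> s)\<close>: what remains is the least-squares residual
          and the difference of the gradients along the two maps.\<close>
        then have "AE z in lam. ennreal ((norm (D s z))\<^sup>2) \<le> 2 * ennreal ((norm (res z))\<^sup>2) + 2 * ennreal ((norm (w2 z - w1 z))\<^sup>2)"
        proof eventually_elim
          case (elim z)
          have "J (\<theta> s) z *v (- p) = - (J (\<theta> s) z *v p)"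
            by (rule linear_neg[OF matrix_vector_mul_linear])
          moreover have "d\<theta> s = - p" using s by (simp add: d\<theta>_def p_def)
          ultimately have "D s z = res z + (w2 z - w1 z)"
            using elim by (simp add: D_def cl(2)[OF s] res_def w2_def v_def)
          then have "(norm (D s z))\<^sup>2 \<le> 2 * (norm (res z))\<^sup>2 + 2 * (norm (w2 z - w1 z))\<^sup>2"
            using norm_add_sq_le[of "res z" "w2 z - w1 z"] by simp
          then have "ennreal ((norm (D s z))\<^sup>2) \<le> ennreal (2 * (norm (res z))\<^sup>2 + 2 * (norm (w2 z - w1 z))\<^sup>2)" by (rule ennreal_leI)
          then show ?case by (simp add: ennreal_plus ennreal_mult)
        qed
        then have "(\<integral>\<^sup>+z. ennreal ((norm (D s z))\<^sup>2) \<partial>lam)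
            \<le> (\<integral>\<^sup>+z. 2 * ennreal ((norm (res z))\<^sup>2) + 2 * ennreal ((norm (w2 z - w1 z))\<^sup>2) \<partial>lam)"
          by (rule nn_integral_mono_AE)
        also have "\<dots> = 2 * (\<integral>\<^sup>+z. ennreal ((norm (res z))\<^sup>2) \<partial>lam) + 2 * (\<integral>\<^sup>+z. ennreal ((norm (w2 z - w1 z))\<^sup>2) \<partial>lam)"
          using resm w1m w2m by (simp add: nn_integral_add nn_integral_cmult)
        also have "\<dots> \<le> 2 * ennreal \<delta> + 2 * (ennreal C * (\<integral>\<^sup>+z. ennreal ((norm (f s z))\<^sup>2) \<partial>lam))"
          using res lip by (intro add_mono mult_left_mono) auto
        also have "\<dots> = ennreal (2 * C) * (\<integral>\<^sup>+z. ennreal ((norm (f s z))\<^sup>2) \<partial>lam) + ennreal (2 * \<delta>)"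
          using C_pos \<delta>(2) by (simp add: ennreal_mult mult.assoc add.commute)
        finally show "(\<integral>\<^sup>+z. ennreal ((norm (D s z))\<^sup>2) \<partial>lam)
            \<le> ennreal (2 * C) * (\<integral>\<^sup>+z. ennreal ((norm (f s z))\<^sup>2) \<partial>lam) + ennreal (2 * \<delta>)" .
      qed
      have "X 0 z = S z" for z
        using CE.F.flow_equation[OF z0, of "S z"] cl(2)[OF z0] by (simp add: X_def)
      then have "ennreal (SC.e 0) \<le> ennreal ((W2 (distr lam borel (T (\<theta> 0))) \<rho>0)\<^sup>2 + \<epsilon>)"
        using cost by (simp add: SC.e_eq[OF z0, symmetric] f_def cl(2)[OF z0] \<rho>0)
      then have e0: "SC.e 0 \<le> (W2 (distr lam borel (T (\<theta> 0))) \<rho>0)\<^sup>2 + \<epsilon>"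
        using \<epsilon> by (subst (asm) ennreal_le_iff) (auto simp: add_nonneg_pos less_imp_le)
      have "ennreal ((W2 (distr lam borel (T (\<theta> t))) (\<rho> t))\<^sup>2) \<le> ennreal (SC.e t)"
        using CE.W2_le_maps[OF Tm[OF t] Xm[of t] refl dX[OF t] TP[OF t] \<rho>P[OF t]]
        by (simp add: SC.e_eq[OF t, symmetric] f_def cl(2)[OF t])
      then have "(W2 (distr lam borel (T (\<theta> t))) (\<rho> t))\<^sup>2 \<le> SC.e t"
        using SC.e_nonneg by (subst (asm) ennreal_le_iff) auto
      also have "\<dots> \<le> exp (?c * t) * SC.e 0 + 2 * \<delta> / ?c * (exp (?c * t) - 1)" by (rule SC.gronwall[OF t])
      also have "\<dots> \<le> exp (?c * t) * ((W2 (distr lam borel (T (\<theta> 0))) \<rho>0)\<^sup>2 + \<epsilon>) + 2 * \<delta> / ?c * (exp (?c * t) - 1)"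
        using e0 by (intro add_right_mono mult_left_mono) auto
      finally show ?thesis .
    qed
    let ?b = "exp (?c * t) * (W2 (distr lam borel (T (\<theta> 0))) \<rho>0)\<^sup>2 + 2 * \<delta> / ?c * (exp (?c * t) - 1)"
    have "(W2 (distr lam borel (T (\<theta> t))) (\<rho> t))\<^sup>2 \<le> ?b"
    proof (rule field_le_epsilon)
      fix \<epsilon> :: real assume "0 < \<epsilon>"
      then have "0 < \<epsilon> / exp (?c * t)" by simp
      from bound[OF this] show "(W2 (distr lam borel (T (\<theta> t))) (\<rho> t))\<^sup>2 \<le> ?b + \<epsilon>"
        by (simp add: distrib_left)
    qed
    then have "ennreal ((W2 (distr lam borel (T (\<theta> t))) (\<rho> t))\<^sup>2) \<le> ennreal ?b" by (rule ennreal_leI)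
    also have "\<dots> = ennreal (exp (?c * t)) * ennreal ((W2 (distr lam borel (T (\<theta> 0))) \<rho>0)\<^sup>2)
        + 2 * ?\<delta> / ennreal ?c * ennreal (exp (?c * t) - 1)"
    proof -
      have g: "0 \<le> exp (?c * t) - 1" using 3 C_pos by simp
      have "2 * ?\<delta> / ennreal ?c = ennreal (2 * \<delta> / ?c)"
        using \<delta> C_pos by (simp add: divide_ennreal[symmetric] ennreal_mult)
      then show ?thesis
        using g \<delta>(2) C_pos by (simp add: ennreal_mult[symmetric] ennreal_plus[symmetric] del: ennreal_plus)
    qed
    finally show ?thesis .
  qed
qed

end
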